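(* Let $\Omega\subseteq\mathbb{R}^n$ be open, let $w\in A_1^*$, and let $f\in BV(\Omega;w)$. (i) If $f$ is $w$-approximable, then there exists a sequence $\{f_k\}_{k=1}^\infty\subseteq C^\infty(\Omega)\cap BV(\Omega;w)$ such that $f_k\to f$ in $L^1(\Omega;w)$ and $$\lim_{k\to\infty}\lVert Df_k\rVert_w(\Omega)=\lVert Df\rVert_w(\Omega).$$ (ii) If $f$ is not $w$-approximable, then there exists a sequence $\{f_k\}_{k=1}^\infty\subseteq C^\infty(\Omega)\cap BV(\Omega;w)$ such that $f_k\to f$ in $L^1(\Omega;w)$ and $$\lVert Df\rVert_w(\Omega)\le\lim_{k\to\infty}\lVert Df_k\rVert_w(\Omega)\le[w]_{A_1}\lVert Df\rVert_w(\Omega).$$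
   Context: $A_1^*$ weights (everywhere version): $w:\mathbb{R}^n\to[0,\infty]$ belongs to $A_1$ if $w\in L^1_{\mathrm{loc}}(\Omega)$ and there is $C>0$ with $\frac{1}{|B|}\int_B w\,dx\le C\inf_{x\in B}w(x)$ (a true infimum, not an essential one) for all balls $B\subseteq\mathbb{R}^n$; $[w]_{A_1}$ is the smallest such $C$. $w\in A_1^*$ means $w\in A_1$ and $w$ is lower semicontinuous. The case $w\equiv0$ is excluded, so $w>0$ everywhere. $\mathrm{Lip}_c(\Omega;\mathbb{R}^n)$ is the space of compactly supported Lipschitz maps. $L^1(\Omega;w)$ is the space of measurable $f$ with $\int_\Omega|f|\,w\,dx<\infty$. $BV(\Omega;w)$ is the space of $f\in L^1(\Omega;w)$ (identified a.e.) such that $$\lVert Df\rVert_w(\Omega):=\sup\left\{\int_\Omega f\operatorname{div}\varphi\,dx:\varphi\in\mathrm{Lip}_c(\Omega;\mathbb{R}^n),\ |\varphi|\le w\right\}<\infty.$$ Every $f\in BV(\Omega;w)$ lies in the classical space $BV_{\mathrm{loc}}(\Omega)$, and $\lVert Df\rVert$ denotes its classical (unweighted) total variation Radon measure on $\Omega$. The function $f$ is called $w$-approximable if $$\lim_{\varepsilon\to0}\frac{1}{|B(x,\varepsilon)|}\int_{B(x,\varepsilon)}|w(y)-w(x)|\,dy=0\quad\text{for }\lVert Df\rVert\text{-a.e. }x.$$ *)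

theory Defs
  imports "HOL-Analysis.Analysis"
begin

section \<open>Weights\<close>

definition lower_semicontinuous :: "('a::topological_space \<Rightarrow> 'b::linorder) \<Rightarrow> bool" where
  "lower_semicontinuous w \<longleftrightarrow> (\<forall>t. open {x. t < w x})"

definition L1_loc_weight :: "'a::euclidean_space set \<Rightarrow> ('a \<Rightarrow> ennreal) \<Rightarrow> bool" where
  "L1_loc_weight \<Omega> w \<longleftrightarrow>
     w \<in> borel_measurable lebesgue \<and>
     (\<forall>K. compact K \<and> K \<subseteq> \<Omega> \<longrightarrow> (\<integral>\<^sup>+x\<in>K. w x \<partial>lebesgue) < \<infinity>)"

definition ball_average :: "'a::euclidean_space \<Rightarrow> real \<Rightarrow> ('a \<Rightarrow> ennreal) \<Rightarrow> ennreal" where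
  "ball_average x r g = (\<integral>\<^sup>+y\<in>ball x r. g y \<partial>lebesgue) / emeasure lebesgue (ball x r)"

definition A1_bound :: "('a::euclidean_space \<Rightarrow> ennreal) \<Rightarrow> real \<Rightarrow> bool" where
  "A1_bound w C \<longleftrightarrow>
     C > 0 \<and> (\<forall>x r. r > 0 \<longrightarrow> ball_average x r w \<le> ennreal C * (INF y\<in>ball x r. w y))"

definition A1 :: "'a::euclidean_space set \<Rightarrow> ('a \<Rightarrow> ennreal) \<Rightarrow> bool" where
  "A1 \<Omega> w \<longleftrightarrow> L1_loc_weight \<Omega> w \<and> (\<exists>C. A1_bound w C)"

definition A1_const :: "('a::euclidean_space \<Rightarrow> ennreal) \<Rightarrow> real" where
  "A1_const w = Inf {C. A1_bound w C}"

definition A1_star :: "'a::euclidean_space set \<Rightarrow> ('a \<Rightarrow> ennreal) \<Rightarrow> bool" where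
  "A1_star \<Omega> w \<longleftrightarrow> A1 \<Omega> w \<and> lower_semicontinuous w \<and> (\<exists>x. w x \<noteq> 0)"


section \<open>Test fields and smooth functions\<close>

text \<open>Functions on an open set are total functions whose values outside that set
  are irrelevant; in particular supports are taken relative to the set.\<close>

definition compactly_supported_in ::
    "'a::topological_space set \<Rightarrow> ('a \<Rightarrow> 'b::zero) \<Rightarrow> bool" where
  "compactly_supported_in \<Omega> \<phi> \<longleftrightarrow>
     compact (closure {x\<in>\<Omega>. \<phi> x \<noteq> 0}) \<and> closure {x\<in>\<Omega>. \<phi> x \<noteq> 0} \<subseteq> \<Omega>"

definition Lip_c :: "'a::euclidean_space set \<Rightarrow> ('a \<Rightarrow> 'a) set" where
  "Lip_c \<Omega> = {\<phi>. (\<exists>L. L-lipschitz_on \<Omega> \<phi>) \<and> compactly_supported_in \<Omega> \<phi>}"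

text \<open>The class \<open>C\<^sup>k\<close> on an open set, by recursion over directional derivatives.\<close>

primrec Ck_on ::
    "nat \<Rightarrow> 'a::euclidean_space set \<Rightarrow> ('a \<Rightarrow> 'b::real_normed_vector) \<Rightarrow> bool" where
  "Ck_on 0 \<Omega> f \<longleftrightarrow> continuous_on \<Omega> f"
| "Ck_on (Suc k) \<Omega> f \<longleftrightarrow>
     (\<forall>x\<in>\<Omega>. f differentiable (at x)) \<and>
     (\<forall>v. Ck_on k \<Omega> (\<lambda>x. frechet_derivative f (at x) v))"

definition Cinf_on :: "'a::euclidean_space set \<Rightarrow> ('a \<Rightarrow> 'b::real_normed_vector) \<Rightarrow> bool" where
  "Cinf_on \<Omega> f \<longleftrightarrow> (\<forall>k. Ck_on k \<Omega> f)"

definition C1_c :: "'a::euclidean_space set \<Rightarrow> ('a \<Rightarrow> 'a) set" where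
  "C1_c \<Omega> = {\<phi>. Ck_on 1 \<Omega> \<phi> \<and> compactly_supported_in \<Omega> \<phi>}"

text \<open>A Lipschitz field is differentiable almost everywhere (Rademacher), so the
  arbitrary value of \<open>frechet_derivative\<close> at the remaining points does not
  affect the integrals below.\<close>

definition divergence :: "('a::euclidean_space \<Rightarrow> 'a) \<Rightarrow> 'a \<Rightarrow> real" where
  "divergence \<phi> x = (\<Sum>b\<in>Basis. frechet_derivative \<phi> (at x) b \<bullet> b)"


section \<open>Weighted \<open>L\<^sup>1\<close> and \<open>BV\<close>\<close>

definition L1_norm :: "'a::euclidean_space set \<Rightarrow> ('a \<Rightarrow> ennreal) \<Rightarrow> ('a \<Rightarrow> real) \<Rightarrow> ennreal" where
  "L1_norm \<Omega> w f = (\<integral>\<^sup>+x\<in>\<Omega>. ennreal \<bar>f x\<bar> * w x \<partial>lebesgue)"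

definition L1_weighted :: "'a::euclidean_space set \<Rightarrow> ('a \<Rightarrow> ennreal) \<Rightarrow> ('a \<Rightarrow> real) set" where
  "L1_weighted \<Omega> w = {f. f \<in> borel_measurable (lebesgue_on \<Omega>) \<and> L1_norm \<Omega> w f < \<infinity>}"

text \<open>In both suprema below the zero field is admissible, so the
  supremum is nonnegative and \<open>ennreal\<close>, which sends negative numbers to \<open>0\<close>,
  does not change it.\<close>

definition weighted_variation ::
    "'a::euclidean_space set \<Rightarrow> ('a \<Rightarrow> ennreal) \<Rightarrow> ('a \<Rightarrow> real) \<Rightarrow> ennreal" where
  "weighted_variation \<Omega> w f =
     (SUP \<phi>\<in>{\<phi>\<in>Lip_c \<Omega>. \<forall>x\<in>\<Omega>. ennreal (norm (\<phi> x)) \<le> w x}.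
        ennreal (LINT x:\<Omega>|lebesgue. f x * divergence \<phi> x))"

definition BV_weighted :: "'a::euclidean_space set \<Rightarrow> ('a \<Rightarrow> ennreal) \<Rightarrow> ('a \<Rightarrow> real) set" where
  "BV_weighted \<Omega> w = {f \<in> L1_weighted \<Omega> w. weighted_variation \<Omega> w f < \<infinity>}"


section \<open>The classical total variation measure and approximability\<close>

definition total_variation :: "'a::euclidean_space set \<Rightarrow> ('a \<Rightarrow> real) \<Rightarrow> ennreal" where
  "total_variation U f =
     (SUP \<phi>\<in>{\<phi>\<in>C1_c U. \<forall>x\<in>U. norm (\<phi> x) \<le> 1}.
        ennreal (LINT x:U|lebesgue. f x * divergence \<phi> x))"

text \<open>For \<open>f\<close> locally of bounded variation on the open set \<open>\<Omega>\<close>, the outer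
  regular extension of \<open>total_variation\<close> from open sets to Borel sets is countably
  additive, so it is the value of \<open>emeasure\<close> here. For other \<open>f\<close>, \<open>measure_of\<close>
  may return the zero measure.\<close>

definition variation_measure :: "'a::euclidean_space set \<Rightarrow> ('a \<Rightarrow> real) \<Rightarrow> 'a measure" where
  "variation_measure \<Omega> f =
     measure_of \<Omega> (sets (restrict_space borel \<Omega>))
       (\<lambda>A. INF U\<in>{U. open U \<and> A \<subseteq> U \<and> U \<subseteq> \<Omega>}. total_variation U f)"

text \<open>Subtraction on \<open>ennreal\<close> is truncated; \<open>ennreal_absdiff a b\<close> is the absolute
  difference of \<open>a\<close> and \<open>b\<close>, infinite if either of them is.\<close>

definition ennreal_absdiff :: "ennreal \<Rightarrow> ennreal \<Rightarrow> ennreal" where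
  "ennreal_absdiff a b = (a - b) + (b - a)"

definition approximable ::
    "'a::euclidean_space set \<Rightarrow> ('a \<Rightarrow> ennreal) \<Rightarrow> ('a \<Rightarrow> real) \<Rightarrow> bool" where
  "approximable \<Omega> w f \<longleftrightarrow>
     (AE x in variation_measure \<Omega> f.
        ((\<lambda>\<epsilon>. ball_average x \<epsilon> (\<lambda>y. ennreal_absdiff (w y) (w x))) \<longlongrightarrow> 0) (at_right 0))"

end

theory Submission
  imports Defs
begin

text \<open>The approximants are of Meyers--Serrin type: \<open>f\<close> is split by a partition of unity \<open>\<zeta>\<^sub>i\<close> into pieces that
live in shells of \<open>\<Omega>\<close>, the \<open>i\<close>-th piece is mollified with a small radius \<open>r\<^sub>i\<close>, and the results are
added (\<open>smoothing\<close>). What is particular to the weighted setting is the interplay of mollification and weight.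

The mollifier \<open>\<rho>\<^sub>r\<close> decreases with the distance from the centre and is therefore a superposition of indicators of
concentric balls. The \<open>A\<^sub>1\<close> condition bounds the averages of \<open>w\<close> over balls by \<open>[w]\<close> times the value at the centre,
everywhere and not only almost everywhere, so that \<open>\<rho>\<^sub>r * w \<le> [w] w\<close> at every point (\<open>wmol_le\<close>). This
makes mollification bounded, and hence convergent, in weighted \<open>L\<^sup>1\<close> (\<open>mollify_L1\<close>), and it shows that the
mollification of a test field \<open>\<phi>\<close> with \<open>|\<phi>| \<le> w\<close> is bounded by \<open>[w] w\<close>.

The variation of the approximant is estimated by duality. Since the mollifier is even, mollifications and cutoffs can be moved to the
test field: testing the approximant with \<open>\<phi>\<close> is the same as testing \<open>f\<close> with
\<open>\<psi> = \<Sum>\<^sub>i \<zeta>\<^sub>i (\<rho>\<^sub>i * \<phi>)\<close>, where \<open>\<rho>\<^sub>i\<close> has radius \<open>r\<^sub>i\<close>, up to an arbitrarily small error, the derivatives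
of the partition functions cancelling before mollification (\<open>smoothing_test_field\<close>). The field satisfies
\<open>|\<psi>| \<le> \<Sum>\<^sub>i \<zeta>\<^sub>i (\<rho>\<^sub>i * w)\<close>, and this bound is exploited twice.

\<^item> It is at most \<open>[w] w\<close>, so the variation of the approximant is at most \<open>[w]\<close> times that of \<open>f\<close>, up to a small
error (\<open>Var_smoothing_le_C\<close>). This gives the second part of the theorem.

\<^item> Testing \<open>f\<close> with \<open>\<psi>\<close> gives at most \<open>\<integral> |\<psi>| d|Df|\<close> (\<open>pairing_le_integral_norm\<close>), hence at most
\<open>\<Sum>\<^sub>i \<integral> \<zeta>\<^sub>i (\<rho>\<^sub>i * w) d|Df|\<close>. If \<open>f\<close> is \<open>w\<close>-approximable, the upper limit of \<open>\<rho>\<^sub>r * w\<close> as \<open>r\<close> tends to \<open>0\<close>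
is at most \<open>w\<close> almost everywhere for \<open>|Df|\<close>. The functions are dominated by \<open>[w] w\<close>, which is
integrable because \<open>\<integral> w d|Df| \<le> \<parallel>Df\<parallel>\<^sub>w\<close> (\<open>integral_weight_le_Var\<close>). The reverse Fatou lemma allows to choose
the radii such that the sum exceeds \<open>\<integral> w d|Df|\<close>, and hence \<open>\<parallel>Df\<parallel>\<^sub>w\<close>, by arbitrarily little
(\<open>Var_smoothing_le_approximable\<close>). This gives the upper bound in the first part.

In both parts the lower bound is the lower semicontinuity of the variation (\<open>Var_lower_semicontinuous\<close>), and
in the second part the limit is obtained by passing to a subsequence.

The inequality for \<open>\<integral> w d|Df|\<close> rests on lower semicontinuity of \<open>w\<close>: the superlevel sets of \<open>w\<close> are open, and near optimal
fields for the classical variation on these sets can be added up to a field bounded by \<open>w\<close>. Both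
inequalities that relate fields to the measure \<open>|Df|\<close> are proved by cutting into layers, and \<open>|Df|\<close> itself
comes from Caratheodory's construction.

Test fields are Lipschitz, and their divergence is defined through Frechet derivatives that exist only almost everywhere. Rademacher's
theorem (\<open>Rademacher\<close>) identifies it with a Borel function that has good algebraic properties (\<open>borel_div\<close>). Its proof
reduces to the line by Fubini's theorem and to linearity of derivatives of mollified functions.\<close>

section \<open>Smooth kernels and convolution\<close>

text \<open>For \<open>k = 0\<close> this is the classical smooth function that is flat at the origin and zero to the left of it;
the powers \<open>t ^ k\<close> in the denominator make the family closed under differentiation.\<close>

definition flat_exp :: "nat \<Rightarrow> real \<Rightarrow> real" where
  "flat_exp k t = (if t > 0 then exp (- 1 / t) / t ^ k else 0)"

lemma flat_exp_nonneg: "0 \<le> flat_exp k t"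
  by (simp add: flat_exp_def)

lemma exp_ge_power_div_fact: "0 \<le> u \<Longrightarrow> u ^ n / fact n \<le> exp (u::real)"
proof -
  assume u: "0 \<le> u"
  have "sum (\<lambda>i. inverse (fact i) * u ^ i) {n} \<le> (\<Sum>i. inverse (fact i) * u ^ i)"
    by (rule sum_le_suminf[OF summable_exp]) (use u in auto)
  then show ?thesis
    by (simp add: exp_def scaleR_conv_of_real field_simps)
qed

text \<open>The quadratic bound at the origin, uniform over the family, is what makes every member differentiable at \<open>0\<close>.
It compares the exponential series with a single one of its terms.\<close>

lemma flat_exp_bound:
  assumes "t > 0" shows "flat_exp k t \<le> fact (k + 2) * t ^ 2"
proof -
  have "(1/t) ^ (k+2) / fact (k+2) \<le> exp (1/t)"
    using assms by (intro exp_ge_power_div_fact) auto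
  then have "inverse (exp (1/t)) \<le> inverse ((1/t) ^ (k+2) / fact (k+2))"
    using assms by (intro le_imp_inverse_le) auto
  also have "\<dots> = fact (k+2) * t ^ (k+2)"
    using assms by (simp add: field_simps power_divide)
  finally have *: "exp (- (1/t)) \<le> fact (k+2) * t ^ (k+2)"
    by (simp add: exp_minus)
  have "flat_exp k t = exp (- (1/t)) / t ^ k" using assms by (simp add: flat_exp_def)
  also have "\<dots> \<le> (fact (k+2) * t ^ (k+2)) / t ^ k"
    using * assms by (intro divide_right_mono) auto
  also have "\<dots> = fact (k+2) * t^2" using assms by (simp add: power_add power2_eq_square)
  finally show ?thesis .
qed

lemma flat_exp_has_derivative:
  "(flat_exp k has_real_derivative (flat_exp (k+2) t - real k * flat_exp (k+1) t)) (at t)"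
proof -
  consider "t > 0" | "t < 0" | "t = 0" by linarith
  then show ?thesis
  proof cases
    case 1
    have "((\<lambda>t. exp (- 1 / t) / t ^ k) has_real_derivative (flat_exp (k+2) t - real k * flat_exp (k+1) t)) (at t)"
    proof (rule DERIV_cong)
      show "((\<lambda>t. exp (- 1 / t) / t ^ k) has_real_derivative
          ((exp (- 1 / t) * (1 / t\<^sup>2)) * t ^ k - exp (- 1 / t) * (real k * t ^ (k - 1))) / (t ^ k * t ^ k)) (at t)"
        using 1 by (auto intro!: derivative_eq_intros simp: power2_eq_square)
      \<comment> \<open>For \<open>k = 0\<close> both sides vanish, whatever \<open>t ^ (0 - 1)\<close> is.\<close>
      have *: "real k * t ^ (k - 1) = real k * t ^ k / t" using 1 by (cases k) auto
      show "((exp (- 1 / t) * (1 / t\<^sup>2)) * t ^ k - exp (- 1 / t) * (real k * t ^ (k - 1))) / (t ^ k * t ^ k)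
          = flat_exp (k+2) t - real k * flat_exp (k+1) t"
        unfolding * using 1 by (simp add: flat_exp_def field_simps power2_eq_square)
    qed
    then show ?thesis
      by (rule DERIV_cong_ev[OF refl _ refl, THEN iffD2, rotated])
         (use 1 in \<open>auto simp: flat_exp_def eventually_nhds intro!: exI[of _ "{0<..}"]\<close>)
  next
    case 2
    have "((\<lambda>t. 0) has_real_derivative (flat_exp (k+2) t - real k * flat_exp (k+1) t)) (at t)"
      using 2 by (auto simp: flat_exp_def)
    then show ?thesis
      by (rule DERIV_cong_ev[OF refl _ refl, THEN iffD2, rotated])
         (use 2 in \<open>auto simp: flat_exp_def eventually_nhds intro!: exI[of _ "{..<0}"]\<close>)
  next
    case 3
    have "((\<lambda>y. (flat_exp k y - flat_exp k 0) / (y - 0)) \<longlongrightarrow> 0) (at 0)"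
    proof (rule Lim_null_comparison)
      show "\<forall>\<^sub>F y in at 0. norm ((flat_exp k y - flat_exp k 0) / (y - 0)) \<le> fact (k+2) * \<bar>y\<bar>"
      proof (rule always_eventually, rule allI)
        fix y :: real
        show "norm ((flat_exp k y - flat_exp k 0) / (y - 0)) \<le> fact (k+2) * \<bar>y\<bar>"
        proof (cases "y > 0")
          case True
          then show ?thesis using flat_exp_bound[OF True, of k] flat_exp_nonneg[of k y]
            by (simp add: flat_exp_def[of _ 0] abs_mult divide_le_eq mult.assoc power2_eq_square)
        next
          case False
          then have z: "flat_exp k y = 0" "flat_exp k 0 = 0" by (simp_all add: flat_exp_def)
          have "0 \<le> fact (k+2) * \<bar>y\<bar>" by (rule mult_nonneg_nonneg) auto
          then show ?thesis unfolding z by (simp only: diff_self div_0 norm_zero)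
        qed
      qed
      show "((\<lambda>y. fact (k+2) * \<bar>y\<bar>) \<longlongrightarrow> 0) (at (0::real))"
        by (auto intro!: tendsto_eq_intros)
    qed
    then show ?thesis using 3 by (simp add: has_field_derivative_iff flat_exp_def[of _ 0])
  qed
qed

text \<open>This set contains the mollifier and is closed under directional derivatives,
so that every statement about arbitrarily many derivatives of a convolution follows by induction from a statement
about one derivative.\<close>

inductive_set kernels :: "real \<Rightarrow> ('a::euclidean_space \<Rightarrow> real) set" for r where
  base: "(\<lambda>z. flat_exp k (1 - (z \<bullet> z) / r\<^sup>2)) \<in> kernels r"
| add: "a \<in> kernels r \<Longrightarrow> b \<in> kernels r \<Longrightarrow> (\<lambda>z. a z + b z) \<in> kernels r"
| scale: "a \<in> kernels r \<Longrightarrow> (\<lambda>z. c * a z) \<in> kernels r"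
| lin: "a \<in> kernels r \<Longrightarrow> (\<lambda>z. (z \<bullet> v) * a z) \<in> kernels r"

lemma kernel_derivative:
  assumes "a \<in> kernels r"
  shows "\<exists>D. (\<forall>x. (a has_derivative D x) (at x)) \<and> (\<forall>v. (\<lambda>x. D x v) \<in> kernels r)"
  using assms
proof induction
  case (base k)
  let ?h = "\<lambda>t. flat_exp (k+2) t - real k * flat_exp (k+1) t"
  let ?u = "\<lambda>z::'a. 1 - (z \<bullet> z) / r\<^sup>2"
  let ?D = "\<lambda>x v. ?h (?u x) * (- (2 * (x \<bullet> v)) / r\<^sup>2)"
  have "((\<lambda>z::'a. 1 - inverse (r\<^sup>2) * (z \<bullet> z)) has_derivative (\<lambda>v. - (2 * (x \<bullet> v)) / r\<^sup>2)) (at x)" for x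
    by (auto intro!: derivative_eq_intros simp: inner_commute divide_inverse)
  then have "(?u has_derivative (\<lambda>v. - (2 * (x \<bullet> v)) / r\<^sup>2)) (at x)" for x
    by (simp add: divide_inverse mult.commute)
  then have "((\<lambda>z. flat_exp k (?u z)) has_derivative ?D x) (at x)" for x
    by (rule has_derivative_compose[OF _ flat_exp_has_derivative[THEN has_field_derivative_imp_has_derivative]])
  moreover have "(\<lambda>x. ?D x v) \<in> kernels r" for v
  proof -
    have "(\<lambda>x. (- 2 / r\<^sup>2) * ((x \<bullet> v) * (flat_exp (k+2) (?u x) + (- real k) * flat_exp (k+1) (?u x)))) \<in> kernels r"
      by (intro kernels.intros)
    moreover have "(\<lambda>x. ?D x v) = (\<lambda>x. (- 2 / r\<^sup>2) * ((x \<bullet> v) * (flat_exp (k+2) (?u x) + (- real k) * flat_exp (k+1) (?u x))))"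
      by (auto simp: fun_eq_iff algebra_simps)
    ultimately show ?thesis by (simp only:)
  qed
  ultimately show ?case by (intro exI[of _ ?D] conjI allI)
next
  case (add a b)
  then obtain D E where D: "\<And>x. (a has_derivative D x) (at x)" "\<And>v. (\<lambda>x. D x v) \<in> kernels r"
    and E: "\<And>x. (b has_derivative E x) (at x)" "\<And>v. (\<lambda>x. E x v) \<in> kernels r" by blast
  show ?case
    by (rule exI[of _ "\<lambda>x v. D x v + E x v"])
       (auto intro!: derivative_eq_intros kernels.intros D E)
next
  case (scale a c)
  then obtain D where D: "\<And>x. (a has_derivative D x) (at x)" "\<And>v. (\<lambda>x. D x v) \<in> kernels r" by blast
  show ?case
    by (rule exI[of _ "\<lambda>x v. c * D x v"]) (auto intro!: derivative_eq_intros kernels.intros D)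
next
  case (lin a u)
  then obtain D where D: "\<And>x. (a has_derivative D x) (at x)" "\<And>v. (\<lambda>x. D x v) \<in> kernels r" by blast
  show ?case
    by (rule exI[of _ "\<lambda>x v. (v \<bullet> u) * a x + (x \<bullet> u) * D x v"])
       (auto intro!: derivative_eq_intros kernels.intros D lin)
qed

lemma kernel_support:
  assumes "a \<in> kernels r" "r > 0" "norm z \<ge> r" shows "a z = 0"
  using assms(1)
proof induction
  case (base k)
  have "r\<^sup>2 \<le> (norm z)\<^sup>2" using assms by (intro power_mono) auto
  then have "1 - (z \<bullet> z) / r\<^sup>2 \<le> 0" using assms by (simp add: dot_square_norm)
  then show ?case by (simp add: flat_exp_def)
qed auto

lemma kernel_continuous:
  assumes "a \<in> kernels r" shows "continuous_on S a"
  using kernel_derivative[OF assms] by (blast intro: continuous_at_imp_continuous_on has_derivative_continuous)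

lemma kernel_bounded:
  fixes a :: "'a::euclidean_space \<Rightarrow> real"
  assumes "a \<in> kernels r" "r > 0"
  obtains B where "B > 0" "\<And>x. \<bar>a x\<bar> \<le> B"
proof -
  have "compact (a ` cball 0 r)"
    by (intro compact_continuous_image kernel_continuous[OF assms(1)]) auto
  then obtain B where B: "\<forall>x\<in>cball 0 r. norm (a x) \<le> B" "B > 0"
    by (auto dest!: compact_imp_bounded simp: bounded_pos)
  show ?thesis
  proof (rule that[OF B(2)])
    fix x show "\<bar>a x\<bar> \<le> B"
      using B kernel_support[OF assms, of x] by (cases "x \<in> cball 0 r") auto
  qed
qed

lemma bounded_linear_norm_le_Basis:
  fixes D :: "'a::euclidean_space \<Rightarrow> 'b::real_normed_vector"
  assumes "bounded_linear D" "\<And>b. norm (D b) \<le> B b"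
  shows "norm (D v) \<le> (\<Sum>b\<in>Basis. B b) * norm v"
proof -
  interpret bounded_linear D by (rule assms(1))
  have "D v = D (\<Sum>b\<in>Basis. (v \<bullet> b) *\<^sub>R b)" by (simp add: euclidean_representation)
  also have "\<dots> = (\<Sum>b\<in>Basis. (v \<bullet> b) *\<^sub>R D b)" by (simp add: sum scaleR)
  also have "norm \<dots> \<le> (\<Sum>b\<in>Basis. norm ((v \<bullet> b) *\<^sub>R D b))" by (rule norm_sum)
  also have "\<dots> \<le> (\<Sum>b\<in>Basis. norm v * B b)"
    unfolding norm_scaleR using assms(2) Basis_le_norm by (intro sum_mono mult_mono) auto
  finally show ?thesis by (simp add: sum_distrib_left mult.commute)
qed

lemma kernel_derivative_bounded:
  fixes a :: "'a::euclidean_space \<Rightarrow> real"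
  assumes "a \<in> kernels r" "r > 0"
  obtains D B where "\<And>x. (a has_derivative D x) (at x)" "\<And>v. (\<lambda>x. D x v) \<in> kernels r"
    "\<And>x v. \<bar>D x v\<bar> \<le> B * norm v"
proof -
  obtain D where D: "\<And>x. (a has_derivative D x) (at x)" "\<And>v. (\<lambda>x. D x v) \<in> kernels r"
    using kernel_derivative[OF assms(1)] by blast
  have "\<exists>B. \<forall>x. \<bar>D x b\<bar> \<le> B" for b
    using kernel_bounded[OF D(2) assms(2), of b] by blast
  then obtain B where B: "\<And>b x. \<bar>D x b\<bar> \<le> B b" by metis
  have "\<bar>D x v\<bar> \<le> (\<Sum>b\<in>Basis. B b) * norm v" for x v
    using bounded_linear_norm_le_Basis[OF has_derivative_bounded_linear[OF D(1)[of x]], of B v] B by simp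
  with D show ?thesis by (rule that)
qed

text \<open>The kernel is scalar and the convolved function may be vector valued: scalar functions, vector fields
and gradients are all mollified by this one operation.\<close>

definition conv :: "('a::euclidean_space \<Rightarrow> real) \<Rightarrow> ('a \<Rightarrow> 'b::euclidean_space) \<Rightarrow> 'a \<Rightarrow> 'b" where
  "conv a g x = (\<integral>y. a (x - y) *\<^sub>R g y \<partial>lborel)"

lemma integrable_bounded_scaleR:
  fixes g :: "'a \<Rightarrow> 'b::euclidean_space"
  assumes "integrable M g" "q \<in> borel_measurable M" "\<And>x. \<bar>q x\<bar> \<le> B"
  shows "integrable M (\<lambda>x. q x *\<^sub>R g x)"
proof (rule Bochner_Integration.integrable_bound)
  show "integrable M (\<lambda>x. B * norm (g x))" using assms by auto
  show "AE x in M. norm (q x *\<^sub>R g x) \<le> norm (B * norm (g x))"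
  proof (rule AE_I2)
    fix x
    have "\<bar>q x\<bar> * norm (g x) \<le> B * norm (g x)" by (intro mult_right_mono assms(3)) auto
    then show "norm (q x *\<^sub>R g x) \<le> norm (B * norm (g x))" by simp
  qed
qed (use assms in auto)

text \<open>Differentiation under the integral sign by dominated convergence: the difference quotients of a kernel with bounded
derivative are dominated by a multiple of \<open>norm (g y)\<close>.\<close>

lemma conv_has_derivative:
  fixes g :: "'a::euclidean_space \<Rightarrow> 'b::euclidean_space"
  assumes D: "\<And>x. (a has_derivative D x) (at x)" and B: "\<And>x v. \<bar>D x v\<bar> \<le> B * norm v"
    and m: "\<And>v. (\<lambda>x. D x v) \<in> borel_measurable borel"
    and g: "integrable lborel g" and bd: "\<And>x. \<bar>a x\<bar> \<le> C"
  shows "(conv a g has_derivative (\<lambda>v. conv (\<lambda>z. D z v) g x)) (at x)"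
proof -
  have am[measurable]: "a \<in> borel_measurable borel"
    using D by (intro borel_measurable_continuous_onI continuous_at_imp_continuous_on) (blast intro: has_derivative_continuous)
  have [measurable]: "g \<in> borel_measurable borel" using g by auto
  have mD[measurable]: "(\<lambda>y. D (x - y) v) \<in> borel_measurable borel" for x v
    using m[of v] by (rule measurable_compose[rotated]) measurable
  have onorm_le_B: "onorm (D z) \<le> B" for z
    by (rule onorm_le) (use B in auto)
  have lip: "\<bar>a x - a y\<bar> \<le> B * norm (x - y)" for x y
  proof -
    have "norm (a x - a y) \<le> B * norm (x - y)"
      by (rule differentiable_bound[OF convex_UNIV, where f'=D])
         (use D B in \<open>auto intro!: onorm_le_B intro: has_derivative_at_withinI\<close>)
    then show ?thesis by simp
  qed
  have ia: "integrable lborel (\<lambda>y. a (x - y) *\<^sub>R g y)" for x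
    by (rule integrable_bounded_scaleR[OF g _ bd]) measurable
  have iD: "integrable lborel (\<lambda>y. D (x - y) v *\<^sub>R g y)" for x v
    by (rule integrable_bounded_scaleR[OF g _ B]) measurable
  have lin: "bounded_linear (D z)" for z using D by (rule has_derivative_bounded_linear)
  have bl: "bounded_linear (\<lambda>v. conv (\<lambda>z. D z v) g x)"
  proof (rule bounded_linear_intro[where K="B * (\<integral>y. norm (g y) \<partial>lborel)"])
    fix u v :: 'a and c :: real
    show "conv (\<lambda>z. D z (u + v)) g x = conv (\<lambda>z. D z u) g x + conv (\<lambda>z. D z v) g x"
      unfolding conv_def using iD
      by (subst Bochner_Integration.integral_add[symmetric]) (auto simp: linear_add[OF bounded_linear.linear[OF lin]] scaleR_add_left)
    show "conv (\<lambda>z. D z (c *\<^sub>R v)) g x = c *\<^sub>R conv (\<lambda>z. D z v) g x"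
      unfolding conv_def using iD
      by (subst Bochner_Integration.integral_scaleR_right[symmetric]) (auto simp: linear_scale[OF bounded_linear.linear[OF lin]])
    have "norm (conv (\<lambda>z. D z v) g x) \<le> (\<integral>y. norm (D (x - y) v *\<^sub>R g y) \<partial>lborel)"
      unfolding conv_def by (rule integral_norm_bound)
    also have "\<dots> \<le> (\<integral>y. (B * norm v) * norm (g y) \<partial>lborel)"
      using g integrable_norm[OF iD[of x v]] B by (intro integral_mono) (auto intro!: mult_right_mono)
    finally show "norm (conv (\<lambda>z. D z v) g x) \<le> norm v * (B * (\<integral>y. norm (g y) \<partial>lborel))"
      by (simp add: mult_ac)
  qed
  have "((\<lambda>y. norm (conv a g y - conv a g x - conv (\<lambda>z. D z (y - x)) g x) / norm (y - x)) \<longlongrightarrow> 0) (at x)"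
  proof (subst tendsto_at_iff_sequentially, safe)
    fix X :: "nat \<Rightarrow> 'a" assume X: "\<forall>i. X i \<in> UNIV - {x}" "X \<longlonglongrightarrow> x"
    \<comment> \<open>The Taylor remainder of the kernel divided by the step; bounded by twice the bound of the derivative.\<close>
    define q where "q = (\<lambda>i y. (a (X i - y) - a (x - y) - D (x - y) (X i - x)) / norm (X i - x))"
    have qm[measurable]: "q i \<in> borel_measurable borel" for i unfolding q_def by measurable
    have qb: "\<bar>q i y\<bar> \<le> 2 * B" for i y
    proof -
      have "\<bar>a (X i - y) - a (x - y) - D (x - y) (X i - x)\<bar> \<le> 2 * B * norm (X i - x)"
        using lip[of "X i - y" "x - y"] B[of "x - y" "X i - x"] by (simp add: algebra_simps)
      then show ?thesis using X(1) by (simp add: q_def field_simps abs_divide)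
    qed
    have "(\<lambda>i. \<integral>y. q i y *\<^sub>R g y \<partial>lborel) \<longlonglongrightarrow> (\<integral>y. 0 \<partial>(lborel :: 'a measure))"
    proof (rule integral_dominated_convergence[where w="\<lambda>y. 2 * B * norm (g y)"])
      show "AE y in lborel. (\<lambda>i. q i y *\<^sub>R g y) \<longlonglongrightarrow> 0"
      proof (rule AE_I2)
        fix y
        have "((\<lambda>z. norm (a z - a (x - y) - D (x - y) (z - (x - y))) / norm (z - (x - y))) \<longlongrightarrow> 0) (at (x - y))"
          using D[of "x - y"] by (simp add: has_derivative_iff_norm)
        moreover have "filterlim (\<lambda>i. X i - y) (at (x - y)) sequentially"
          unfolding filterlim_at using X by (auto intro!: tendsto_intros)
        ultimately have "(\<lambda>i. norm (a (X i - y) - a (x - y) - D (x - y) ((X i - y) - (x - y))) / norm ((X i - y) - (x - y))) \<longlonglongrightarrow> 0"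
          by (rule filterlim_compose)
        then have "(\<lambda>i. norm (q i y)) \<longlonglongrightarrow> 0" by (simp add: q_def abs_divide)
        then have "(\<lambda>i. q i y) \<longlonglongrightarrow> 0" by (rule tendsto_norm_zero_cancel)
        then show "(\<lambda>i. q i y *\<^sub>R g y) \<longlonglongrightarrow> 0" by (auto intro: tendsto_eq_intros)
      qed
      show "AE y in lborel. norm (q i y *\<^sub>R g y) \<le> 2 * B * norm (g y)" for i
        using qb by (auto intro!: mult_right_mono)
    qed (use g in auto)
    moreover have "(\<integral>y. q i y *\<^sub>R g y \<partial>lborel) = (conv a g (X i) - conv a g x - conv (\<lambda>z. D z (X i - x)) g x) /\<^sub>R norm (X i - x)" for i
      unfolding conv_def using ia iD
      by (subst Bochner_Integration.integral_diff[symmetric], simp, simp)+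
         (subst integral_scaleR_right[symmetric], rule Bochner_Integration.integral_cong,
          auto simp: q_def divide_inverse algebra_simps)
    ultimately have "(\<lambda>i. (conv a g (X i) - conv a g x - conv (\<lambda>z. D z (X i - x)) g x) /\<^sub>R norm (X i - x)) \<longlonglongrightarrow> 0"
      by simp
    from tendsto_norm_zero[OF this] show "((\<lambda>y. norm (conv a g y - conv a g x - conv (\<lambda>z. D z (y - x)) g x) / norm (y - x)) \<circ> X) \<longlonglongrightarrow> 0"
      by (simp add: o_def divide_inverse mult_ac)
  qed
  then show ?thesis using bl by (simp add: has_derivative_iff_norm)
qed

lemma kernel_measurable: "a \<in> kernels r \<Longrightarrow> a \<in> borel_measurable borel"
  by (rule borel_measurable_continuous_onI) (rule kernel_continuous)

lemma conv_kernel_has_derivative: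
  fixes g :: "'a::euclidean_space \<Rightarrow> 'b::euclidean_space"
  assumes "a \<in> kernels r" "r > 0" "integrable lborel g"
  obtains D where "\<And>x. (conv a g has_derivative (\<lambda>v. conv (\<lambda>z. D z v) g x)) (at x)" "\<And>v. (\<lambda>x. D x v) \<in> kernels r"
proof -
  obtain D B where D: "\<And>x. (a has_derivative D x) (at x)" "\<And>v. (\<lambda>x. D x v) \<in> kernels r"
    "\<And>x v. \<bar>D x v\<bar> \<le> B * norm v" using kernel_derivative_bounded[OF assms(1,2)] by blast
  obtain C where "\<And>x. \<bar>a x\<bar> \<le> C" using kernel_bounded[OF assms(1,2)] by blast
  then have "\<And>x. (conv a g has_derivative (\<lambda>v. conv (\<lambda>z. D z v) g x)) (at x)"
    by (intro conv_has_derivative[OF D(1,3) kernel_measurable[OF D(2)] assms(3)])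
  then show ?thesis using D(2) by (rule that)
qed

lemma conv_differentiable:
  fixes g :: "'a::euclidean_space \<Rightarrow> 'b::euclidean_space"
  assumes "a \<in> kernels r" "r > 0" "integrable lborel g"
  shows "conv a g differentiable (at x)"
proof -
  obtain D where "\<And>x. (conv a g has_derivative (\<lambda>v. conv (\<lambda>z. D z v) g x)) (at x)"
    using conv_kernel_has_derivative[OF assms] by metis
  then show ?thesis unfolding differentiable_def by (intro exI)
qed

text \<open>The derivative of a convolution with a kernel is again a convolution with a kernel.\<close>

lemma conv_Ck:
  fixes g :: "'a::euclidean_space \<Rightarrow> 'b::euclidean_space"
  assumes "a \<in> kernels r" "r > 0" "integrable lborel g"
  shows "Ck_on k S (conv a g)"
  using assms(1)
proof (induction k arbitrary: a)
  case 0
  then show ?case using conv_differentiable[OF _ assms(2,3)]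
    by (auto intro!: continuous_at_imp_continuous_on differentiable_imp_continuous_within)
next
  case (Suc k)
  obtain D where D: "\<And>x. (conv a g has_derivative (\<lambda>v. conv (\<lambda>z. D z v) g x)) (at x)" "\<And>v. (\<lambda>x. D x v) \<in> kernels r"
    using conv_kernel_has_derivative[OF Suc.prems assms(2,3)] by blast
  have "frechet_derivative (conv a g) (at x) = (\<lambda>v. conv (\<lambda>z. D z v) g x)" for x
    by (rule frechet_derivative_at[OF D(1), symmetric])
  then show ?case using Suc.IH[OF D(2)] D(1) by (auto simp: differentiable_def)
qed

section \<open>A radially decreasing mollifier\<close>

text \<open>Lebesgue measure is invariant under \<open>y \<mapsto> x - y\<close>, which moves the translation from the kernel to the function.\<close>

lemma distr_lborel_reflect: "distr lborel borel (\<lambda>y::'a::euclidean_space. x - y) = lborel"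
proof -
  have "lborel = density (distr lborel borel (\<lambda>y::'a. x + (-1) *\<^sub>R y)) (\<lambda>_. \<bar>-1::real\<bar> ^ DIM('a))"
    by (rule lborel_affine) simp
  then show ?thesis by (simp add: density_1)
qed

lemma integral_lborel_reflect:
  fixes h :: "'a::euclidean_space \<Rightarrow> 'b::{banach, second_countable_topology}"
  assumes [measurable]: "h \<in> borel_measurable borel"
  shows "(\<integral>y. h (x - y) \<partial>lborel) = integral\<^sup>L lborel h"
  by (subst (2) distr_lborel_reflect[of x, symmetric]) (simp add: integral_distr)

lemma integrable_lborel_reflect:
  fixes h :: "'a::euclidean_space \<Rightarrow> 'b::{banach, second_countable_topology}"
  assumes [measurable]: "h \<in> borel_measurable borel"
  shows "integrable lborel (\<lambda>y. h (x - y)) = integrable lborel h"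
  by (subst (2) distr_lborel_reflect[of x, symmetric]) (simp add: integrable_distr_eq)

lemma nn_integral_lborel_reflect:
  fixes h :: "'a::euclidean_space \<Rightarrow> ennreal"
  assumes [measurable]: "h \<in> borel_measurable borel"
  shows "(\<integral>\<^sup>+y. h (x - y) \<partial>lborel) = integral\<^sup>N lborel h"
  by (subst (2) distr_lborel_reflect[of x, symmetric]) (simp add: nn_integral_distr)

lemma kernel_integrable:
  fixes a :: "'a::euclidean_space \<Rightarrow> real"
  assumes "a \<in> kernels r" "r > 0" shows "integrable lborel a"
proof -
  obtain B where B: "B > 0" "\<And>x. \<bar>a x\<bar> \<le> B" using kernel_bounded[OF assms] by blast
  show ?thesis
  proof (rule Bochner_Integration.integrable_bound)
    show "integrable lborel (\<lambda>x. B * indicator (cball (0::'a) r) x)"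
      using emeasure_bounded_finite[OF bounded_cball[of "0::'a" r]] by (intro integrable_mult_right integrable_real_indicator) auto
    show "AE x in lborel. norm (a x) \<le> norm (B * indicator (cball 0 r) x)"
      using B kernel_support[OF assms] by (intro AE_I2) (auto simp: indicator_def)
    show "a \<in> borel_measurable lborel" using kernel_measurable[OF assms(1)] by simp
  qed
qed

definition bump :: "real \<Rightarrow> 'a::euclidean_space \<Rightarrow> real" where
  "bump r z = flat_exp 0 (1 - (z \<bullet> z) / r\<^sup>2)"

text \<open>The normalised bump. Two features beyond smoothness are used: it is even, which makes mollification symmetric under the
integral, and it decreases with the distance from the centre, which makes its superlevel sets balls.\<close>

definition mol :: "real \<Rightarrow> 'a::euclidean_space \<Rightarrow> real" where
  "mol r z = bump r z / (\<integral>y. bump r (y::'a) \<partial>lborel)"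

lemma bump_kernel: "bump r \<in> kernels r"
  unfolding bump_def[abs_def] by (rule kernels.base)

lemma flat_exp0_mono: "u \<le> v \<Longrightarrow> flat_exp 0 u \<le> flat_exp 0 v"
  by (auto simp: flat_exp_def field_simps)

text \<open>On the ball of half the radius the bump is at least its value at distance \<open>r / 2\<close>, where the argument
of \<open>flat_exp\<close> is \<open>3 / 4\<close>. This is the lower bound for the normalising constant that gives
the correct order of magnitude of the mollifier.\<close>

lemma integral_bump_ge:
  assumes "r > 0"
  shows "(\<integral>y. bump r (y::'a::euclidean_space) \<partial>lborel) \<ge> flat_exp 0 (3/4) * measure lborel (ball (0::'a) (r/2))"
proof -
  have "flat_exp 0 (3/4) * measure lborel (ball (0::'a) (r/2)) = (\<integral>y. flat_exp 0 (3/4) * indicator (ball (0::'a) (r/2)) y \<partial>lborel)"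
    by simp
  also have "\<dots> \<le> (\<integral>y. bump r (y::'a) \<partial>lborel)"
  proof (rule integral_mono)
    show "integrable lborel (\<lambda>y. flat_exp 0 (3/4) * indicator (ball (0::'a) (r/2)) y)"
      using emeasure_bounded_finite[OF bounded_ball[of "0::'a" "r/2"]] by (intro integrable_mult_right integrable_real_indicator) auto
    show "integrable lborel (bump r :: 'a \<Rightarrow> real)" by (rule kernel_integrable[OF bump_kernel assms])
    fix y :: 'a
    show "flat_exp 0 (3/4) * indicator (ball 0 (r/2)) y \<le> bump r y"
    proof (cases "y \<in> ball 0 (r/2)")
      case True
      then have "(norm y)\<^sup>2 \<le> (r/2)\<^sup>2" by (intro power_mono) auto
      then have "3/4 \<le> 1 - (y \<bullet> y) / r\<^sup>2" using assms by (simp add: dot_square_norm field_simps)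
      then show ?thesis using True flat_exp0_mono by (simp add: bump_def)
    qed (simp add: bump_def flat_exp_nonneg)
  qed
  finally show ?thesis .
qed

lemma measure_ball_pos: "r > 0 \<Longrightarrow> measure lborel (ball (x::'a::euclidean_space) r) > 0"
  using content_ball_pos[of r x] by simp

lemma integral_bump_pos: "r > 0 \<Longrightarrow> (\<integral>y. bump r (y::'a::euclidean_space) \<partial>lborel) > 0"
proof -
  assume r: "r > 0"
  have "flat_exp 0 (3/4) * measure lborel (ball (0::'a) (r/2)) > 0"
    using measure_ball_pos[of "r/2" "0::'a"] r by (intro mult_pos_pos) (auto simp: flat_exp_def)
  then show ?thesis using integral_bump_ge[OF r, where 'a='a] by linarith
qed

lemma mol_kernel: "mol r \<in> kernels r"
proof -
  have "mol r = (\<lambda>z::'a. inverse (\<integral>y. bump r (y::'a) \<partial>lborel) * bump r z)"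
    by (auto simp: mol_def fun_eq_iff divide_inverse mult.commute)
  then show ?thesis using kernels.scale[OF bump_kernel] by simp
qed

lemma mol_nonneg: "0 \<le> mol r z"
  unfolding mol_def bump_def by (intro divide_nonneg_nonneg integral_nonneg_AE) (auto simp: flat_exp_nonneg)

lemma mol_measurable[measurable]: "mol r \<in> borel_measurable borel"
  by (rule kernel_measurable[OF mol_kernel])

lemma mol_support: "r > 0 \<Longrightarrow> norm z \<ge> r \<Longrightarrow> mol r z = 0"
  by (rule kernel_support[OF mol_kernel])

lemma mol_minus: "mol r (x - y) = mol r (y - x)"
  by (simp add: mol_def bump_def dot_square_norm norm_minus_commute)

lemma mol_integrable: "r > 0 \<Longrightarrow> integrable lborel (mol r)"
  by (rule kernel_integrable[OF mol_kernel])

lemma integral_mol: "r > 0 \<Longrightarrow> (\<integral>y. mol r (y::'a::euclidean_space) \<partial>lborel) = 1"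
  using integral_bump_pos[where 'a='a, of r] by (simp add: mol_def[abs_def])

lemma nn_integral_mol: "r > 0 \<Longrightarrow> (\<integral>\<^sup>+y. ennreal (mol r (y::'a::euclidean_space)) \<partial>lborel) = 1"
  by (subst nn_integral_eq_integral[OF mol_integrable]) (auto simp: integral_mol mol_nonneg)

lemma mol_integrable': "r > 0 \<Longrightarrow> integrable lborel (\<lambda>y. mol r (x - y))"
  using integrable_lborel_reflect[of "mol r" x] mol_integrable by auto

lemma integral_mol': "r > 0 \<Longrightarrow> (\<integral>y. mol r (x - y) \<partial>lborel) = 1"
  using integral_lborel_reflect[of "mol r" x] integral_mol by auto

lemma nn_integral_mol': "r > 0 \<Longrightarrow> (\<integral>\<^sup>+y. ennreal (mol r (x - y)) \<partial>lborel) = 1"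
  using nn_integral_lborel_reflect[of "\<lambda>z. ennreal (mol r z)" x] nn_integral_mol by auto

text \<open>The mollifier is dominated by a constant, independent of the radius, times the normalised indicator of its ball.
Thus smallness of ball averages implies smallness of mollifications.\<close>

lemma mol_upper:
  assumes "r > 0"
  shows "mol r (z::'a::euclidean_space) \<le> (flat_exp 0 1 * 2 ^ DIM('a) / flat_exp 0 (3/4)) / measure lborel (ball (0::'a) r)"
proof -
  have b: "measure lborel (ball (0::'a) (r/2)) = measure lborel (ball (0::'a) r) / 2 ^ DIM('a)"
    using content_ball_conv_unit_ball[of r "0::'a"] content_ball_conv_unit_ball[of "r/2" "0::'a"] assms
    by (simp add: power_divide)
  have h: "flat_exp 0 (3/4) > 0" by (simp add: flat_exp_def)
  have p: "measure lborel (ball (0::'a) r) > 0" using measure_ball_pos assms by blast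
  have "mol r z \<le> flat_exp 0 1 / (flat_exp 0 (3/4) * measure lborel (ball (0::'a) (r/2)))"
    unfolding mol_def
  proof (rule frac_le)
    show "bump r z \<le> flat_exp 0 1" unfolding bump_def by (rule flat_exp0_mono) (auto simp: divide_nonneg_nonneg)
    show "flat_exp 0 (3/4) * measure lborel (ball (0::'a) (r/2)) \<le> (\<integral>y. bump r (y::'a) \<partial>lborel)"
      by (rule integral_bump_ge[OF assms])
    show "0 < flat_exp 0 (3/4) * measure lborel (ball (0::'a) (r/2))"
      using h measure_ball_pos[of "r/2" "0::'a"] assms by simp
  qed (rule flat_exp_nonneg)
  then show ?thesis using b h p by (simp add: field_simps)
qed

lemma flat_exp0_superlevel:
  assumes "0 \<le> T"
  shows "(\<forall>u. \<not> T < flat_exp 0 u) \<or> (\<exists>c. \<forall>u. T < flat_exp 0 u \<longleftrightarrow> c < u)"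
proof -
  consider "T = 0" | "T \<ge> 1" | "0 < T" "T < 1" using assms by linarith
  then show ?thesis
  proof cases
    case 1 then show ?thesis by (intro disjI2 exI[of _ 0]) (auto simp: flat_exp_def)
  next
    case 2 
    have "flat_exp 0 u \<le> 1" for u by (auto simp: flat_exp_def)
    with 2 show ?thesis by (meson dual_order.trans not_le)
  next
    case 3
    then have l: "ln T < 0" by simp
    have "T < flat_exp 0 u \<longleftrightarrow> - 1 / ln T < u" for u
    proof (cases "u > 0")
      case True
      have "T < flat_exp 0 u \<longleftrightarrow> ln T < - 1 / u" using True 3 exp_less_cancel_iff[of "ln T" "- 1 / u"] by (simp add: flat_exp_def)
      also have "\<dots> \<longleftrightarrow> - 1 / ln T < u" using True l by (simp add: field_simps)
      finally show ?thesis .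
    next
      case False
      moreover have "- 1 / ln T > 0" using l by (simp add: divide_neg_neg)
      ultimately have "\<not> - 1 / ln T < u" using False by linarith
      then show ?thesis using 3 False by (simp add: flat_exp_def)
    qed
    then show ?thesis by blast
  qed
qed

text \<open>Radial monotonicity in the form in which it enters the layer cake formula.\<close>

lemma mol_superlevel:
  assumes "r > 0" "0 \<le> t"
  shows "\<exists>s. {y. t < mol r (x - y)} = ball (x::'a::euclidean_space) s"
proof -
  define N where "N = (\<integral>y. bump r (y::'a) \<partial>lborel)"
  have N: "N > 0" unfolding N_def by (rule integral_bump_pos[OF assms(1)])
  have *: "t < mol r z \<longleftrightarrow> t * N < flat_exp 0 (1 - (z \<bullet> z) / r\<^sup>2)" for z :: 'a
    using N unfolding mol_def N_def[symmetric] bump_def by (simp add: field_simps)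
  have "0 \<le> t * N" using N assms(2) by simp
  from flat_exp0_superlevel[OF this] show ?thesis
  proof (elim disjE exE)
    assume "\<forall>u. \<not> t * N < flat_exp 0 u"
    then show ?thesis by (intro exI[of _ 0]) (auto simp: * )
  next
    fix c assume c: "\<forall>u. (t * N < flat_exp 0 u) = (c < u)"
    have "t < mol r (x - y) \<longleftrightarrow> dist x y < sqrt (r\<^sup>2 * (1 - c))" for y
    proof -
      have "t < mol r (x - y) \<longleftrightarrow> (norm (x - y))\<^sup>2 < r\<^sup>2 * (1 - c)"
        unfolding * c[rule_format] using assms(1) by (simp add: dot_square_norm field_simps)
      also have "\<dots> \<longleftrightarrow> dist x y < sqrt (r\<^sup>2 * (1 - c))"
        using real_sqrt_less_iff[of "(norm (x - y))\<^sup>2" "r\<^sup>2 * (1 - c)"] by (simp add: dist_norm)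
      finally show ?thesis .
    qed
    then show ?thesis
      by (intro exI[of _ "sqrt (r\<^sup>2 * (1 - c))"] set_eqI) (simp only: mem_Collect_eq mem_ball)
  qed
qed

section \<open>Mollification of weights\<close>

text \<open>Mollification of a weight, in extended nonnegative numbers, so that no integrability has to be assumed.\<close>

definition wmol :: "real \<Rightarrow> ('a::euclidean_space \<Rightarrow> ennreal) \<Rightarrow> 'a \<Rightarrow> ennreal" where
  "wmol r w x = (\<integral>\<^sup>+y. ennreal (mol r (x - y)) * w y \<partial>lborel)"

lemma wmol_measurable[measurable]:
  assumes [measurable]: "w \<in> borel_measurable borel"
  shows "wmol r w \<in> borel_measurable borel"
  unfolding wmol_def[abs_def] by measurable

text \<open>By the layer cake formula the mollifier is a superposition of indicators of balls with a common centre, of total mass one.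
A bound for all ball averages around a point therefore passes to the mollification with the same constant. For a weight in
\<open>A\<^sub>1\<close> this yields \<open>wmol r w x \<le> [w] * w x\<close> at every point, with exactly the constant
of the theorem.\<close>

lemma wmol_le:
  fixes w :: "'a::euclidean_space \<Rightarrow> ennreal"
  assumes [measurable]: "w \<in> borel_measurable borel" and "r > 0"
    and H: "\<And>s. s > 0 \<Longrightarrow> (\<integral>\<^sup>+y\<in>ball x s. w y \<partial>lborel) \<le> W * emeasure lborel (ball x s)"
  shows "wmol r w x \<le> W"
proof -
  \<comment> \<open>The height of the mollifier as the length of an interval of levels, which Fubini then integrates last.\<close>
  have layer: "ennreal (mol r z) = (\<integral>\<^sup>+t. indicator {0..<mol r z} t \<partial>lborel)" for z :: 'a
    by (simp add: mol_nonneg)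
  have "wmol r w x = (\<integral>\<^sup>+y. \<integral>\<^sup>+t. (if 0 \<le> t \<and> t < mol r (x - y) then w y else 0) \<partial>lborel \<partial>lborel)"
    unfolding wmol_def layer
    by (intro nn_integral_cong, subst nn_integral_multc[symmetric])
       (auto intro!: nn_integral_cong simp: indicator_def)
  also have "\<dots> = (\<integral>\<^sup>+t. \<integral>\<^sup>+y. (if 0 \<le> t \<and> t < mol r (x - y) then w y else 0) \<partial>lborel \<partial>lborel)"
    by (rule lborel_pair.Fubini') measurable
  also have "\<dots> \<le> (\<integral>\<^sup>+t. \<integral>\<^sup>+y. (if 0 \<le> t \<and> t < mol r (x - y) then W else 0) \<partial>lborel \<partial>lborel)"
  proof (rule nn_integral_mono)
    fix t :: real
    show "(\<integral>\<^sup>+y. (if 0 \<le> t \<and> t < mol r (x - y) then w y else 0) \<partial>lborel)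
       \<le> (\<integral>\<^sup>+y. (if 0 \<le> t \<and> t < mol r (x - y) then W else 0) \<partial>lborel)"
    proof (cases "0 \<le> t")
      case True
      obtain s where s: "{y. t < mol r (x - y)} = ball x s" using mol_superlevel[OF assms(2) True] by blast
      have s': "t < mol r (x - y) \<longleftrightarrow> y \<in> ball x s" for y using s by blast
      \<comment> \<open>The radius is not positive for levels that are not attained.\<close>
      have sn: "ball x s = {}" if "\<not> s > 0" using that by simp
      have "(\<integral>\<^sup>+y. (if 0 \<le> t \<and> t < mol r (x - y) then w y else 0) \<partial>lborel) = (\<integral>\<^sup>+y\<in>ball x s. w y \<partial>lborel)"
        using True by (intro nn_integral_cong) (simp add: s' indicator_def)
      also have "\<dots> \<le> W * emeasure lborel (ball x s)"
      proof (cases "s > 0")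
        case False
        show ?thesis unfolding sn[OF False] by simp
      qed (rule H)
      also have "\<dots> = (\<integral>\<^sup>+y. (if 0 \<le> t \<and> t < mol r (x - y) then W else 0) \<partial>lborel)"
        using True by (subst nn_integral_cmult_indicator[symmetric]) (auto intro!: nn_integral_cong simp: s' indicator_def)
      finally show ?thesis .
    qed simp
  qed
  also have "\<dots> = (\<integral>\<^sup>+y. \<integral>\<^sup>+t. (if 0 \<le> t \<and> t < mol r (x - y) then W else 0) \<partial>lborel \<partial>lborel)"
    by (rule lborel_pair.Fubini'[symmetric]) measurable
  also have "\<dots> = (\<integral>\<^sup>+y. ennreal (mol r (x - y)) * W \<partial>lborel)"
    unfolding layer
    by (intro nn_integral_cong, subst nn_integral_multc[symmetric])
       (auto intro!: nn_integral_cong simp: indicator_def)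
  also have "\<dots> = W"
    using nn_integral_mol'[OF assms(2), of x] by (simp add: nn_integral_multc)
  finally show ?thesis .
qed

lemma norm_conv_le:
  fixes g :: "'a::euclidean_space \<Rightarrow> 'b::euclidean_space"
  assumes [measurable]: "g \<in> borel_measurable borel"
  shows "ennreal (norm (conv (mol r) g x)) \<le> (\<integral>\<^sup>+y. ennreal (mol r (x - y)) * ennreal (norm (g y)) \<partial>lborel)"
proof (cases "integrable lborel (\<lambda>y. mol r (x - y) *\<^sub>R g y)")
  case True
  have "ennreal (norm (conv (mol r) g x)) \<le> (\<integral>\<^sup>+y. norm (mol r (x - y) *\<^sub>R g y) \<partial>lborel)"
    unfolding conv_def using integral_norm_bound_ennreal[OF True] .
  also have "\<dots> = (\<integral>\<^sup>+y. ennreal (mol r (x - y)) * ennreal (norm (g y)) \<partial>lborel)"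
    by (intro nn_integral_cong) (simp add: mol_nonneg ennreal_mult)
  finally show ?thesis .
qed (simp add: conv_def not_integrable_integral_eq)

lemma norm_conv_le_wmol:
  fixes g :: "'a::euclidean_space \<Rightarrow> 'b::euclidean_space"
  assumes [measurable]: "g \<in> borel_measurable borel" and "\<And>y. ennreal (norm (g y)) \<le> w y"
  shows "ennreal (norm (conv (mol r) g x)) \<le> wmol r w x"
  unfolding wmol_def
  by (rule order_trans[OF norm_conv_le]) (auto intro!: nn_integral_mono mult_left_mono assms)

lemma conv_measurable[measurable]:
  fixes g :: "'a::euclidean_space \<Rightarrow> 'b::euclidean_space"
  assumes [measurable]: "g \<in> borel_measurable borel"
  shows "conv (mol r) g \<in> borel_measurable borel"
  unfolding conv_def[abs_def] by measurable

text \<open>Because the kernel is even, the mollification can be shifted from the function to the weight. Together with the previous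
bound this makes mollification bounded on weighted \<open>L\<^sup>1\<close>.\<close>

lemma nn_integral_conv_le:
  fixes g :: "'a::euclidean_space \<Rightarrow> 'b::euclidean_space" and w :: "'a \<Rightarrow> ennreal"
  assumes [measurable]: "g \<in> borel_measurable borel" "w \<in> borel_measurable borel"
  shows "(\<integral>\<^sup>+x. ennreal (norm (conv (mol r) g x)) * w x \<partial>lborel) \<le> (\<integral>\<^sup>+y. ennreal (norm (g y)) * wmol r w y \<partial>lborel)"
proof -
  have "(\<integral>\<^sup>+x. ennreal (norm (conv (mol r) g x)) * w x \<partial>lborel)
     \<le> (\<integral>\<^sup>+x. (\<integral>\<^sup>+y. ennreal (mol r (x - y)) * ennreal (norm (g y)) \<partial>lborel) * w x \<partial>lborel)"
    by (intro nn_integral_mono mult_right_mono norm_conv_le) auto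
  also have "\<dots> = (\<integral>\<^sup>+x. (\<integral>\<^sup>+y. ennreal (mol r (x - y)) * ennreal (norm (g y)) * w x \<partial>lborel) \<partial>lborel)"
    by (intro nn_integral_cong nn_integral_multc[symmetric]) measurable
  also have "\<dots> = (\<integral>\<^sup>+y. (\<integral>\<^sup>+x. ennreal (mol r (x - y)) * ennreal (norm (g y)) * w x \<partial>lborel) \<partial>lborel)"
    by (rule lborel_pair.Fubini') measurable
  also have "\<dots> = (\<integral>\<^sup>+y. (\<integral>\<^sup>+x. ennreal (norm (g y)) * (ennreal (mol r (y - x)) * w x) \<partial>lborel) \<partial>lborel)"
    by (intro nn_integral_cong) (simp add: mol_minus[of r] mult_ac)
  also have "\<dots> = (\<integral>\<^sup>+y. ennreal (norm (g y)) * wmol r w y \<partial>lborel)"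
    unfolding wmol_def by (intro nn_integral_cong nn_integral_cmult) measurable
  finally show ?thesis .
qed

section \<open>Weights in the class \<open>A\<^sub>1\<^sup>*\<close>\<close>

lemma AE_lborel_negligible:
  assumes "AE x in lborel. x \<notin> S"
  shows "negligible S"
proof -
  have "AE x in lebesgue. x \<notin> S" using AE_completion[OF assms] by simp
  then show ?thesis by (simp add: negligible_iff_null_sets AE_iff_null_sets[symmetric] completion.AE_iff_null_sets)
qed

lemma AE_lborel_not_in_negligible:
  assumes "negligible N"
  shows "AE x in lborel. x \<notin> N"
proof -
  have "AE x in lebesgue. x \<notin> N" using assms by (auto simp: negligible_iff_null_sets intro!: AE_not_in)
  then show ?thesis by (simp add: AE_completion_iff)
qed

lemma weight_indicator_measurable:
  fixes w :: "'a::topological_space \<Rightarrow> ennreal"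
  assumes [measurable]: "w \<in> borel_measurable borel" "S \<in> sets borel"
  shows "(\<lambda>x. w x * indicator S x) \<in> borel_measurable borel"
  by measurable

text \<open>What the proof uses of an \<open>A\<^sub>1\<close> weight. Local integrability and the lower bounds are claimed on all compact
sets, although integrability is assumed only inside \<open>\<Omega>\<close>: a single point of finite weight
bounds the integral over every ball that contains it, and a single ball of zero integral would force the weight to vanish
everywhere. The inequality over balls holds for the infimum of all admissible constants because that infimum is attained.\<close>

lemma A1_star_facts:
  fixes w :: "'a::euclidean_space \<Rightarrow> ennreal"
  assumes "A1_star \<Omega> w" "open \<Omega>" "\<Omega> \<noteq> {}"
  shows "w \<in> borel_measurable borel"
    and "A1_const w > 0"
    and "\<And>x s. s > 0 \<Longrightarrow> (\<integral>\<^sup>+y\<in>ball x s. w y \<partial>lborel) \<le> (ennreal (A1_const w) * w x) * emeasure lborel (ball x s)"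
    and "\<And>K. compact K \<Longrightarrow> (\<integral>\<^sup>+y\<in>K. w y \<partial>lborel) < \<infinity>"
    and "\<And>K. compact K \<Longrightarrow> \<exists>c>0. \<forall>x\<in>K. ennreal c \<le> w x"
proof -
  have lsc: "lower_semicontinuous w" and nz: "\<exists>x. w x \<noteq> 0" and A: "A1 \<Omega> w"
    using assms(1) by (auto simp: A1_star_def)
  have op: "open {x. t < w x}" for t using lsc by (simp add: lower_semicontinuous_def)
  show wm: "w \<in> borel_measurable borel"
    by (rule borel_measurableI_greater) (use op in auto)
  note [measurable] = wm
  have e0: "emeasure lborel (ball x r) \<noteq> 0" if "r > 0" for x :: 'a and r
    using measure_ball_pos[OF that, of x] by (auto simp: measure_def)
  have ef: "emeasure lborel (ball x r) \<noteq> \<infinity>" for x :: 'a and r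
    using emeasure_bounded_finite[of "ball x r"] by simp
  have lb: "(\<integral>\<^sup>+y\<in>B. w y \<partial>lebesgue) = (\<integral>\<^sup>+y\<in>B. w y \<partial>lborel)" for B
    by (rule nn_integral_completion)
  define I where "I x r = (\<integral>\<^sup>+y\<in>ball x r. w y \<partial>lborel)" for x r
  have avg: "ball_average x r w = I x r / emeasure lborel (ball x r)" for x r
    unfolding ball_average_def lb I_def by simp
  have bnd: "I x r \<le> ennreal C * (INF y\<in>ball x r. w y) * emeasure lborel (ball x r)" if "A1_bound w C" "r > 0" for C x r
  proof -
    have "I x r / emeasure lborel (ball x r) \<le> ennreal C * (INF y\<in>ball x r. w y)"
      using that unfolding A1_bound_def avg by blast
    then have "I x r / emeasure lborel (ball x r) * emeasure lborel (ball x r) \<le> ennreal C * (INF y\<in>ball x r. w y) * emeasure lborel (ball x r)"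
      by (rule mult_right_mono) simp
    then show ?thesis using e0[OF that(2), of x] ef[of x r] by (simp add: ennreal_divide_times ennreal_divide_self less_top)
  qed
  obtain C1 where C1: "A1_bound w C1" using A by (auto simp: A1_def)
  then have C1p: "C1 > 0" by (simp add: A1_bound_def)
  have bnd': "I x r \<le> ennreal C * w z * emeasure lborel (ball x r)" if "A1_bound w C" "r > 0" "z \<in> ball x r" for C x r z
    by (rule order_trans[OF bnd[OF that(1,2)]]) (auto intro!: mult_right_mono mult_left_mono INF_lower that)
  \<comment> \<open>The part of a ball where \<open>w\<close> is positive is open; if the integral over the ball vanishes, this part is a null set, hence empty. The \<open>A\<^sub>1\<close> condition at the centre spreads this to all concentric balls.\<close>
  have Ipos: "I x r > 0" if "r > 0" for x r
  proof (rule ccontr)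
    obtain z where z: "w z \<noteq> 0" using nz by blast
    have iz: "w z' = 0" if "I x r = 0" "z' \<in> ball x r" for x r z'
    proof (rule ccontr)
      assume "w z' \<noteq> 0"
      have "AE y in lborel. w y * indicator (ball x r) y = 0"
        using that(1) unfolding I_def by (subst (asm) nn_integral_0_iff_AE) (auto intro!: weight_indicator_measurable wm)
      then have "AE y in lborel. y \<notin> ball x r \<inter> {y. 0 < w y}"
        by eventually_elim (auto simp: indicator_def)
      moreover have "open (ball x r \<inter> {y. 0 < w y})" by (intro open_Int op open_ball)
      ultimately have "ball x r \<inter> {y. 0 < w y} = {}"
        using open_not_negligible AE_lborel_negligible by blast
      then show False using that(2) \<open>w z' \<noteq> 0\<close> by (auto simp: zero_less_iff_neq_zero)
    qed
    assume "\<not> 0 < I x r"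
    then have I0: "I x r = 0" by (simp add: zero_less_iff_neq_zero)
    have "w x = 0" using iz[OF I0, of x] that by simp
    moreover define R where "R = dist x z + 1"
    moreover have "I x R \<le> ennreal C1 * w x * emeasure lborel (ball x R)"
      by (rule bnd'[OF C1]) (auto simp: R_def add_nonneg_pos)
    ultimately have "I x R = 0" by simp
    from iz[OF this, of z] z show False by (auto simp: R_def)
  qed
  \<comment> \<open>Local integrability in \<open>\<Omega>\<close> yields a point of finite weight.\<close>
  obtain z0 where z0: "w z0 < \<infinity>"
  proof -
    obtain p e where pe: "p \<in> \<Omega>" "e > 0" "cball p e \<subseteq> \<Omega>"
      using assms(2,3) by (metis all_not_in_conv open_contains_cball)
    then have fin: "(\<integral>\<^sup>+x\<in>cball p e. w x \<partial>lebesgue) < \<infinity>"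
      using A by (auto simp: A1_def L1_loc_weight_def)
    have "\<exists>z. w z < \<infinity>"
    proof (rule ccontr)
      assume "\<nexists>z. w z < \<infinity>"
      then have "\<And>z. w z = \<infinity>" using top.not_eq_extremum by auto
      then have "(\<integral>\<^sup>+x\<in>cball p e. w x \<partial>lebesgue) = \<infinity> * emeasure lborel (cball p e)"
        by (simp add: nn_integral_cmult_indicator)
      moreover have "emeasure lborel (cball p e) > 0"
        using e0[OF pe(2), of p] emeasure_mono[OF ball_subset_cball[of p e], of lborel]
        by (simp add: zero_less_iff_neq_zero) (metis le_zero_eq)
      ultimately show False using fin by (simp add: ennreal_top_mult split: if_splits)
    qed
    then show ?thesis using that by blast
  qed
  have Ifin: "I x r < \<infinity>" for x r
  proof -
    define R where "R = \<bar>r\<bar> + dist x z0 + 1"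
    have "ball x r \<subseteq> ball z0 R"
    proof
      fix y assume "y \<in> ball x r"
      then show "y \<in> ball z0 R"
        using dist_triangle[of z0 y x] dist_commute[of z0 x] unfolding R_def mem_ball by linarith
    qed
    then have "I x r \<le> I z0 R" unfolding I_def by (intro nn_integral_mono) (auto simp: indicator_def)
    also have "\<dots> \<le> ennreal C1 * w z0 * emeasure lborel (ball z0 R)"
      by (rule bnd'[OF C1]) (auto simp: R_def add_nonneg_pos)
    also have "\<dots> < \<infinity>" using z0 ef[of z0 R] by (simp add: ennreal_mult_less_top less_top)
    finally show ?thesis .
  qed
  have Kb: "\<exists>R>0. K \<subseteq> ball z0 R" if "compact K" for K
  proof -
    obtain R where "K \<subseteq> ball z0 R" using bounded_subset_ballD[OF compact_imp_bounded[OF \<open>compact K\<close>], of z0] by auto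
    then have "K \<subseteq> ball z0 (max R 1)" by auto
    then show ?thesis by (intro exI[of _ "max R 1"]) auto
  qed
  show "(\<integral>\<^sup>+y\<in>K. w y \<partial>lborel) < \<infinity>" if "compact K" for K
  proof -
    obtain R where R: "K \<subseteq> ball z0 R" using Kb[OF \<open>compact K\<close>] by blast
    then have "(\<integral>\<^sup>+y\<in>K. w y \<partial>lborel) \<le> I z0 R" unfolding I_def by (intro nn_integral_mono) (auto simp: indicator_def)
    also have "\<dots> < \<infinity>" by (rule Ifin)
    finally show ?thesis .
  qed
  show "\<exists>c>0. \<forall>x\<in>K. ennreal c \<le> w x" if "compact K" for K
  proof -
    obtain R where R: "R > 0" "K \<subseteq> ball z0 R" using Kb[OF \<open>compact K\<close>] by blast
    define m where "m = measure lborel (ball z0 R)"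
    have m: "m > 0" "emeasure lborel (ball z0 R) = ennreal m"
      unfolding m_def using measure_ball_pos[OF R(1)] ef by (auto simp: emeasure_eq_ennreal_measure)
    obtain i where i: "I z0 R = ennreal i" "i > 0"
      using Ipos[OF R(1), of z0] Ifin[of z0 R] by (cases "I z0 R") auto
    have "ennreal (i / (C1 * m)) \<le> w x" if "x \<in> K" for x
    proof (cases "w x")
      case (real v)
      have "I z0 R \<le> ennreal C1 * w x * emeasure lborel (ball z0 R)" using R that by (intro bnd'[OF C1]) auto
      then have "i \<le> C1 * v * m" using real i m C1p by (simp add: ennreal_mult[symmetric] ennreal_le_iff)
      then show ?thesis using m C1p real by (simp add: ennreal_le_iff divide_le_eq mult_ac)
    qed simp
    moreover have "i / (C1 * m) > 0" using i m C1p by simp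
    ultimately show ?thesis by blast
  qed
  \<comment> \<open>The average over a ball is at least the infimum, so no admissible constant is below \<open>1\<close>; in particular their infimum is positive.\<close>
  have ge1: "C \<ge> 1" if "A1_bound w C" for C
  proof -
    have Cp: "C > 0" using that by (simp add: A1_bound_def)
    have "(INF y\<in>ball z0 1. w y) * emeasure lborel (ball z0 1) = (\<integral>\<^sup>+y\<in>ball z0 1. (INF y\<in>ball z0 1. w y) \<partial>lborel)"
      by (simp add: nn_integral_cmult_indicator)
    also have "\<dots> \<le> I z0 1" unfolding I_def
      by (intro nn_integral_mono) (auto simp: indicator_def intro!: INF_lower)
    finally have 1: "(INF y\<in>ball z0 1. w y) * emeasure lborel (ball z0 1) \<le> I z0 1" .
    have "I z0 1 \<le> ennreal C * ((INF y\<in>ball z0 1. w y) * emeasure lborel (ball z0 1))"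
      using bnd[OF that, of 1 z0] by (simp add: mult.assoc)
    also have "\<dots> \<le> ennreal C * I z0 1" by (intro mult_left_mono 1) simp
    finally have "I z0 1 \<le> ennreal C * I z0 1" .
    moreover obtain i where "I z0 1 = ennreal i" "i > 0"
      using Ipos[of 1 z0] Ifin[of z0 1] by (cases "I z0 1") auto
    ultimately have "i \<le> C * i" using Cp by (simp add: ennreal_mult[symmetric] ennreal_le_iff)
    then show ?thesis using \<open>i > 0\<close> by simp
  qed
  have c1: "A1_const w \<ge> 1" unfolding A1_const_def
    by (rule cInf_greatest) (use C1 ge1 in auto)
  then show cp: "A1_const w > 0" by simp
  show "(\<integral>\<^sup>+y\<in>ball x s. w y \<partial>lborel) \<le> (ennreal (A1_const w) * w x) * emeasure lborel (ball x s)" if "s > 0" for x s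
  proof (cases "w x")
    case (real v)
    define m where "m = measure lborel (ball x s)"
    have m: "m > 0" "emeasure lborel (ball x s) = ennreal m"
      unfolding m_def using measure_ball_pos[OF that] ef by (auto simp: emeasure_eq_ennreal_measure)
    obtain i where i: "I x s = ennreal i" "i > 0"
      using Ipos[OF \<open>s > 0\<close>, of x] Ifin[of x s] by (cases "I x s") auto
    have le: "i \<le> C * v * m" if C: "A1_bound w C" for C
    proof -
      have "I x s \<le> ennreal C * w x * emeasure lborel (ball x s)" using \<open>s > 0\<close> by (intro bnd'[OF C]) auto
      moreover have "C > 0" using C by (simp add: A1_bound_def)
      ultimately show ?thesis using real i m by (simp add: ennreal_mult[symmetric] ennreal_le_iff)
    qed
    have v: "v > 0" using le[OF C1] i real m C1p by (cases "v = 0") auto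
    have "i / (v * m) \<le> A1_const w" unfolding A1_const_def
      by (rule cInf_greatest) (use C1 le v m in \<open>auto simp: divide_le_eq mult_ac\<close>)
    then have "i \<le> A1_const w * v * m" using v m by (simp add: divide_le_eq mult_ac)
    then show ?thesis using real i m cp v unfolding I_def[symmetric]
      by (simp add: ennreal_mult[symmetric] ennreal_le_iff)
  next
    case top
    then show ?thesis using cp e0[OF that, of x] by (simp add: ennreal_mult_top ennreal_top_mult)
  qed
qed

section \<open>Convergence of mollifications in weighted \<open>L\<^sup>1\<close>\<close>

lemma clamp_to_ball:
  fixes v :: "'b::euclidean_space"
  assumes "M \<ge> 0"
  shows "norm (closest_point (cball 0 M) v) \<le> M" "norm (closest_point (cball 0 M) v - v) \<le> norm v"
    "norm v \<le> M \<Longrightarrow> closest_point (cball 0 M) v = v"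
proof -
  have ne: "closed (cball (0::'b) M)" "cball (0::'b) M \<noteq> {}" using assms by auto
  show "norm (closest_point (cball 0 M) v) \<le> M"
    using closest_point_in_set[OF ne, of v] by simp
  show "norm (closest_point (cball 0 M) v - v) \<le> norm v"
    using closest_point_le[OF ne(1), of 0 v] assms by (simp add: dist_norm norm_minus_commute)
  show "norm v \<le> M \<Longrightarrow> closest_point (cball 0 M) v = v"
    by (rule closest_point_self) simp
qed

lemma continuous_clamp: "M \<ge> 0 \<Longrightarrow> continuous_on UNIV (closest_point (cball (0::'b::euclidean_space) M))"
  by (rule continuous_on_closest_point) auto

lemma continuous_cutoff:
  fixes K :: "'a::euclidean_space set"
  assumes "compact K"
  obtains \<eta> :: "'a \<Rightarrow> real" and R where "continuous_on UNIV \<eta>" "\<And>x. 0 \<le> \<eta> x \<and> \<eta> x \<le> 1" "\<And>x. x \<in> K \<Longrightarrow> \<eta> x = 1"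
    "R > 0" "\<And>x. x \<notin> cball 0 R \<Longrightarrow> \<eta> x = 0"
proof -
  obtain R where R: "R > 0" "\<And>x. x \<in> K \<Longrightarrow> norm x \<le> R"
    using compact_imp_bounded[OF assms] by (auto simp: bounded_pos)
  show ?thesis
  proof (rule that[of "\<lambda>x. max 0 (min 1 (R + 1 - norm x))" "R + 1"])
    show "continuous_on UNIV (\<lambda>x. max 0 (min 1 (R + 1 - norm x)))" by (intro continuous_intros)
  qed (use R in force)+
qed

text \<open>Density of continuous functions in weighted \<open>L\<^sup>1\<close>. The function is first truncated to a large ball of
values; the truncation is an almost everywhere limit of continuous functions, and after clamping their values and
cutting off their supports dominated convergence applies.\<close>

lemma continuous_dense_L1:
  fixes g :: "'a::euclidean_space \<Rightarrow> 'b::euclidean_space" and w :: "'a \<Rightarrow> ennreal"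
  assumes [measurable]: "w \<in> borel_measurable borel" "g \<in> borel_measurable borel"
    and loc: "\<And>K. compact K \<Longrightarrow> (\<integral>\<^sup>+y\<in>K. w y \<partial>lborel) < \<infinity>"
    and fin: "(\<integral>\<^sup>+y. ennreal (norm (g y)) * w y \<partial>lborel) < \<infinity>"
    and K: "compact K" "\<And>x. x \<notin> K \<Longrightarrow> g x = 0" and e: "e > 0"
  obtains G R where "continuous_on UNIV G" "\<And>x. x \<notin> cball 0 R \<Longrightarrow> G x = 0"
    "(\<integral>\<^sup>+y. ennreal (norm (g y - G y)) * w y \<partial>lborel) < e"
proof -
  define e' where "e' = min 1 e / 2"
  have e': "e' > 0" "e' + e' \<le> e"
  proof -
    show "e' > 0" using e by (simp add: e'_def min_def ennreal_zero_less_divide)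
    have "e' + e' = min 1 e * 2 / 2"
      unfolding e'_def by (simp add: mult_2_right ennreal_times_divide flip: add_divide_distrib_ennreal)
    also have "\<dots> = min 1 e" by (rule mult_divide_eq_ennreal) auto
    finally have "e' + e' = min 1 e" .
    then show "e' + e' \<le> e" by simp
  qed
  let ?c = "\<lambda>n. closest_point (cball (0::'b) (real n))"
  have cm[measurable]: "?c n \<in> borel_measurable borel" for n
    by (rule borel_measurable_continuous_onI[OF continuous_clamp]) simp
  have c0: "?c n 0 = 0" for n by (rule clamp_to_ball(3)) auto
  have "(\<lambda>n. \<integral>\<^sup>+y. ennreal (norm (g y - ?c n (g y))) * w y \<partial>lborel) \<longlonglongrightarrow> (\<integral>\<^sup>+y. 0 \<partial>(lborel::'a measure))"
  proof (rule nn_integral_dominated_convergence[where w="\<lambda>y. ennreal (norm (g y)) * w y"])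
    show "AE x in lborel. ennreal (norm (g x - ?c j (g x))) * w x \<le> ennreal (norm (g x)) * w x" for j
    proof (intro AE_I2 mult_right_mono ennreal_leI)
      show "norm (g x - ?c j (g x)) \<le> norm (g x)" for x
        using clamp_to_ball(2)[of "real j" "g x"] by (simp add: norm_minus_commute)
    qed simp
    show "AE x in lborel. (\<lambda>i. ennreal (norm (g x - ?c i (g x))) * w x) \<longlonglongrightarrow> 0"
    proof (rule AE_I2)
      fix x
      obtain N where N: "norm (g x) \<le> real N" using real_arch_simple by blast
      have "\<forall>\<^sub>F i in sequentially. ennreal (norm (g x - ?c i (g x))) * w x = 0"
        using eventually_ge_at_top[of N]
        by eventually_elim (use N in \<open>simp add: clamp_to_ball(3)\<close>)
      then show "(\<lambda>i. ennreal (norm (g x - ?c i (g x))) * w x) \<longlonglongrightarrow> 0"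
        by (rule tendsto_eventually)
    qed
  qed (use fin in \<open>simp_all add: less_top\<close>)
  then have "\<forall>\<^sub>F n in sequentially. (\<integral>\<^sup>+y. ennreal (norm (g y - ?c n (g y))) * w y \<partial>lborel) < e'"
    using e'(1) by (simp add: order_tendsto_iff)
  then obtain n where n: "(\<integral>\<^sup>+y. ennreal (norm (g y - ?c n (g y))) * w y \<partial>lborel) < e'"
    by (auto simp: eventually_sequentially)
  \<comment> \<open>The bounded truncation; a measurable function is an almost everywhere limit of continuous ones.\<close>
  define g1 where "g1 y = ?c n (g y)" for y
  have g1m[measurable]: "g1 \<in> borel_measurable borel" unfolding g1_def[abs_def] by measurable
  have g1K: "g1 x = 0" if "x \<notin> K" for x using K(2)[OF that] by (simp add: g1_def c0)
  have "g1 \<in> borel_measurable lebesgue" by (rule measurable_completion) simp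
  then have "g1 measurable_on UNIV" by (rule lebesgue_measurable_imp_measurable_on) auto
  then obtain N h where N: "negligible N" and h: "\<And>m. continuous_on UNIV (h m)"
    and hl: "\<And>x. x \<notin> N \<Longrightarrow> (\<lambda>m. h m x) \<longlonglongrightarrow> g1 x"
    by (auto simp: measurable_on_def)
  obtain \<eta> :: "'a \<Rightarrow> real" and R where chi: "continuous_on UNIV \<eta>" "\<And>x. 0 \<le> \<eta> x \<and> \<eta> x \<le> 1" "\<And>x. x \<in> K \<Longrightarrow> \<eta> x = 1"
    "R > 0" "\<And>x. x \<notin> cball 0 R \<Longrightarrow> \<eta> x = 0" using continuous_cutoff[OF K(1)] by metis
  define G where "G m x = \<eta> x *\<^sub>R ?c n (h m x)" for m x
  have Gc: "continuous_on UNIV (G m)" for m unfolding G_def[abs_def]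
    by (intro continuous_intros chi(1) continuous_on_compose2[OF continuous_clamp h]) auto
  have [measurable]: "G m \<in> borel_measurable borel" for m by (rule borel_measurable_continuous_onI[OF Gc])
  have GR: "G m x = 0" if "x \<notin> cball 0 R" for m x using chi(5)[OF that] by (simp add: G_def)
  have KR: "K \<subseteq> cball 0 R" using chi(3,5) by force
  have aeN: "AE x in lborel. x \<notin> N" by (rule AE_lborel_not_in_negligible[OF N])
  have wR[measurable]: "(\<lambda>y. w y * indicator (cball 0 R) y) \<in> borel_measurable lborel" by (simp add: weight_indicator_measurable)
  have "(\<lambda>m. \<integral>\<^sup>+y. ennreal (norm (g1 y - G m y)) * w y \<partial>lborel) \<longlonglongrightarrow> (\<integral>\<^sup>+y. 0 \<partial>(lborel::'a measure))"
  proof (rule nn_integral_dominated_convergence[where w="\<lambda>y. ennreal (2 * real n) * (w y * indicator (cball 0 R) y)"])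
    show "AE x in lborel. ennreal (norm (g1 x - G j x)) * w x \<le> ennreal (2 * real n) * (w x * indicator (cball 0 R) x)" for j
    proof (rule AE_I2)
      fix x
      have "norm (G j x) \<le> 1 * real n" unfolding G_def norm_scaleR
        by (intro mult_mono) (use chi(2)[of x] clamp_to_ball(1)[of "real n" "h j x"] in auto)
      moreover have "norm (g1 x) \<le> real n" unfolding g1_def by (rule clamp_to_ball) simp
      ultimately have "norm (g1 x - G j x) \<le> 2 * real n" using norm_triangle_ineq4[of "g1 x" "G j x"] by linarith
      then have "ennreal (norm (g1 x - G j x)) * w x \<le> ennreal (2 * real n) * w x" by (intro mult_right_mono ennreal_leI) auto
      then show "ennreal (norm (g1 x - G j x)) * w x \<le> ennreal (2 * real n) * (w x * indicator (cball 0 R) x)"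
        using GR[of x j] g1K[of x] subsetD[OF KR, of x] by (cases "x \<in> cball 0 R") auto
    qed
    show "AE x in lborel. (\<lambda>i. ennreal (norm (g1 x - G i x)) * w x) \<longlonglongrightarrow> 0"
    proof -
      have "AE x in lborel. w x * indicator (cball 0 R) x \<noteq> \<infinity>"
        by (rule nn_integral_PInf_AE[OF wR]) (use loc[of "cball 0 R"] in auto)
      with aeN show ?thesis
      proof eventually_elim
        fix x assume x: "x \<notin> N" "w x * indicator (cball 0 R) x \<noteq> \<infinity>"
        show "(\<lambda>i. ennreal (norm (g1 x - G i x)) * w x) \<longlonglongrightarrow> 0"
        proof (cases "x \<in> cball 0 R")
          case True
          have "(\<lambda>i. ?c n (h i x)) \<longlonglongrightarrow> ?c n (g1 x)"
            by (rule continuous_on_tendsto_compose[OF continuous_clamp hl[OF x(1)]]) auto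
          also have "?c n (g1 x) = g1 x" unfolding g1_def by (intro clamp_to_ball) (auto intro!: clamp_to_ball(1))
          finally have "(\<lambda>i. G i x) \<longlonglongrightarrow> \<eta> x *\<^sub>R g1 x" unfolding G_def by (intro tendsto_intros)
          also have "\<eta> x *\<^sub>R g1 x = g1 x" using chi(3)[of x] g1K[of x] by (cases "x \<in> K") auto
          finally have "(\<lambda>i. norm (g1 x - G i x)) \<longlonglongrightarrow> norm (g1 x - g1 x)" by (intro tendsto_intros)
          then have "(\<lambda>i. w x * ennreal (norm (g1 x - G i x))) \<longlonglongrightarrow> w x * ennreal 0"
            using x(2) True by (intro ennreal_tendsto_cmult tendsto_ennrealI) (auto simp: less_top)
          then show ?thesis by (simp add: mult.commute)
        next
          case False
          then show ?thesis using GR[of x] g1K[of x] subsetD[OF KR, of x] by (cases "x \<in> K") auto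
        qed
      qed
    qed
    show "(\<integral>\<^sup>+x. ennreal (2 * real n) * (w x * indicator (cball 0 R) x) \<partial>lborel) < \<infinity>"
      using loc[of "cball 0 R"] by (subst nn_integral_cmult[OF wR]) (auto simp: ennreal_mult_less_top)
  qed (use wR in measurable)
  then have "\<forall>\<^sub>F m in sequentially. (\<integral>\<^sup>+y. ennreal (norm (g1 y - G m y)) * w y \<partial>lborel) < e'"
    using e'(1) by (simp add: order_tendsto_iff)
  then obtain m where m: "(\<integral>\<^sup>+y. ennreal (norm (g1 y - G m y)) * w y \<partial>lborel) < e'"
    by (auto simp: eventually_sequentially)
  have "(\<integral>\<^sup>+y. ennreal (norm (g y - G m y)) * w y \<partial>lborel)
      \<le> (\<integral>\<^sup>+y. ennreal (norm (g y - g1 y)) * w y + ennreal (norm (g1 y - G m y)) * w y \<partial>lborel)"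
  proof (rule nn_integral_mono)
    fix y
    have "norm (g y - G m y) \<le> norm (g y - g1 y) + norm (g1 y - G m y)" by (rule norm_triangle_sub[of "g y - G m y" "g y - g1 y", simplified, THEN order_trans]) simp
    then show "ennreal (norm (g y - G m y)) * w y \<le> ennreal (norm (g y - g1 y)) * w y + ennreal (norm (g1 y - G m y)) * w y"
      by (simp flip: ennreal_plus distrib_right) (intro mult_right_mono ennreal_leI, auto)
  qed
  also have "\<dots> = (\<integral>\<^sup>+y. ennreal (norm (g y - g1 y)) * w y \<partial>lborel) + (\<integral>\<^sup>+y. ennreal (norm (g1 y - G m y)) * w y \<partial>lborel)"
    by (rule nn_integral_add) auto
  also have "\<dots> < e' + e'" using n m unfolding g1_def by (rule add_strict_mono)
  finally have "(\<integral>\<^sup>+y. ennreal (norm (g y - G m y)) * w y \<partial>lborel) < e" using e'(2) by simp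
  then show ?thesis using that[OF Gc GR] by blast
qed

lemma integrable_continuous_compact_support:
  fixes G :: "'a::euclidean_space \<Rightarrow> 'b::euclidean_space"
  assumes "continuous_on UNIV G" "compact K" "\<And>x. x \<notin> K \<Longrightarrow> G x = 0"
  shows "integrable lborel G"
proof -
  have "integrable lborel (\<lambda>x. indicator K x *\<^sub>R G x)"
    by (rule borel_integrable_compact[OF assms(2)]) (rule continuous_on_subset[OF assms(1)], simp)
  moreover have "(\<lambda>x. indicator K x *\<^sub>R G x) = G" using assms(3) by (auto simp: indicator_def)
  ultimately show ?thesis by simp
qed

lemma conv_mol_integrable:
  fixes g :: "'a::euclidean_space \<Rightarrow> 'b::euclidean_space"
  assumes "r > 0" "integrable lborel g"
  shows "integrable lborel (\<lambda>y. mol r (x - y) *\<^sub>R g y)"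
proof -
  obtain B where "\<And>z. \<bar>mol r (z::'a)\<bar> \<le> B" using kernel_bounded[OF mol_kernel assms(1)] by metis
  then show ?thesis by (intro integrable_bounded_scaleR[OF assms(2), where B=B]) auto
qed

lemma conv_mol_diff:
  fixes g :: "'a::euclidean_space \<Rightarrow> 'b::euclidean_space"
  assumes "r > 0" "integrable lborel g" "integrable lborel h"
  shows "conv (mol r) (\<lambda>y. g y - h y) x = conv (mol r) g x - conv (mol r) h x"
  unfolding conv_def scaleR_diff_right
  by (rule Bochner_Integration.integral_diff) (intro conv_mol_integrable assms)+

text \<open>A mollified value is an average of values nearby. With \<open>c = 0\<close> this also bounds mollifications.\<close>

lemma conv_mol_approx_pointwise:
  fixes g :: "'a::euclidean_space \<Rightarrow> 'b::euclidean_space"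
  assumes "r > 0" "integrable lborel g" "\<And>y. dist x y < r \<Longrightarrow> norm (g y - c) \<le> e"
  shows "norm (conv (mol r) g x - c) \<le> e"
proof -
  have i: "integrable lborel (\<lambda>y. mol r (x - y) *\<^sub>R g y)" "integrable lborel (\<lambda>y. mol r (x - y) *\<^sub>R c)"
    using conv_mol_integrable[OF assms(1,2)] mol_integrable'[OF assms(1), of x] by auto
  have "conv (mol r) g x - c = (\<integral>y. mol r (x - y) *\<^sub>R g y - mol r (x - y) *\<^sub>R c \<partial>lborel)"
    unfolding conv_def using i mol_integrable'[OF assms(1), of x] integral_mol'[OF assms(1), of x]
    by (subst Bochner_Integration.integral_diff) auto
  also have "norm \<dots> \<le> (\<integral>y. norm (mol r (x - y) *\<^sub>R g y - mol r (x - y) *\<^sub>R c) \<partial>lborel)"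
    by (rule integral_norm_bound)
  also have "\<dots> \<le> (\<integral>y. mol r (x - y) * e \<partial>lborel)"
  proof (rule integral_mono)
    show "integrable lborel (\<lambda>y. norm (mol r (x - y) *\<^sub>R g y - mol r (x - y) *\<^sub>R c))"
      using i by (intro integrable_norm Bochner_Integration.integrable_diff)
    show "integrable lborel (\<lambda>y. mol r (x - y) * e)" using mol_integrable'[OF assms(1), of x] by simp
    fix y
    have "norm (mol r (x - y) *\<^sub>R g y - mol r (x - y) *\<^sub>R c) = mol r (x - y) * norm (g y - c)"
      by (simp add: scaleR_diff_right[symmetric] mol_nonneg)
    also have "\<dots> \<le> mol r (x - y) * e"
      using assms(3)[of y] mol_support[OF assms(1), of "x - y"] mol_nonneg[of r "x - y"]
      by (cases "dist x y < r") (auto simp: dist_norm intro!: mult_left_mono)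
    finally show "norm (mol r (x - y) *\<^sub>R g y - mol r (x - y) *\<^sub>R c) \<le> mol r (x - y) * e" .
  qed
  also have "\<dots> = e" using integral_mol'[OF assms(1), of x] by simp
  finally show ?thesis .
qed

text \<open>Mollification is uniformly bounded on weighted \<open>L\<^sup>1\<close> and converges uniformly on continuous functions with
compact support; density transfers convergence to all functions with compact support.\<close>

lemma mollify_L1:
  fixes g :: "'a::euclidean_space \<Rightarrow> 'b::euclidean_space" and w :: "'a \<Rightarrow> ennreal"
  assumes wm[measurable]: "w \<in> borel_measurable borel"
    and loc: "\<And>K. compact K \<Longrightarrow> (\<integral>\<^sup>+y\<in>K. w y \<partial>lborel) < \<infinity>"
    and C: "C \<ge> 0" "\<And>r x. r > 0 \<Longrightarrow> wmol r w x \<le> ennreal C * w x"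
    and g: "integrable lborel g" and fin: "(\<integral>\<^sup>+y. ennreal (norm (g y)) * w y \<partial>lborel) < \<infinity>"
    and K: "compact K" "\<And>x. x \<notin> K \<Longrightarrow> g x = 0"
  shows "((\<lambda>r. \<integral>\<^sup>+x. ennreal (norm (conv (mol r) g x - g x)) * w x \<partial>lborel) \<longlongrightarrow> 0) (at_right 0)"
proof (rule order_tendstoI)
  have gm[measurable]: "g \<in> borel_measurable borel" using g by auto
  fix e :: ennreal assume e: "0 < e"
  obtain e0 where e0: "e0 > 0" "ennreal e0 \<le> e"
  proof (cases e)
    case (real x) then show ?thesis using e that[of x] by auto
  next
    case top then show ?thesis using that[of 1] by auto
  qed
  define d where "d = e0 / (2 * (C + 1))"
  have d: "d > 0" "(C + 1) * d = e0 / 2"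
  proof -
    have "C + 1 > 0" using C(1) by simp
    then show "d > 0" "(C + 1) * d = e0 / 2" using e0 by (simp_all add: d_def field_simps)
  qed
  obtain G R where G: "continuous_on UNIV G" "\<And>x. x \<notin> cball 0 R \<Longrightarrow> G x = 0"
    "(\<integral>\<^sup>+y. ennreal (norm (g y - G y)) * w y \<partial>lborel) < ennreal d"
    using continuous_dense_L1[OF wm gm loc fin K, of "ennreal d"] d(1) by auto
  have Gi: "integrable lborel G" by (rule integrable_continuous_compact_support[OF G(1) compact_cball G(2)])
  have Gm[measurable]: "G \<in> borel_measurable borel" using Gi by auto
  obtain W where W: "W \<ge> 0" "(\<integral>\<^sup>+y\<in>cball 0 (R + 1). w y \<partial>lborel) = ennreal W"
    using loc[of "cball 0 (R + 1)"] by (cases "(\<integral>\<^sup>+y\<in>cball 0 (R + 1). w y \<partial>lborel)") auto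
  define \<eta> where "\<eta> = e0 / (2 * (W + 1))"
  have eta: "\<eta> > 0" "\<eta> * W < e0 / 2"
    using e0 W(1) by (auto simp: \<eta>_def field_simps)
  have "uniformly_continuous_on (cball 0 (R + 2)) G"
    by (rule compact_uniformly_continuous[OF continuous_on_subset[OF G(1)]]) auto
  then obtain \<delta> where \<delta>: "\<delta> > 0" "\<And>x y. x \<in> cball 0 (R + 2) \<Longrightarrow> y \<in> cball 0 (R + 2) \<Longrightarrow> dist y x < \<delta> \<Longrightarrow> dist (G y) (G x) < \<eta>"
    using eta(1) unfolding uniformly_continuous_on_def by metis
  show "\<forall>\<^sub>F r in at_right 0. (\<integral>\<^sup>+x. ennreal (norm (conv (mol r) g x - g x)) * w x \<partial>lborel) < e"
    unfolding eventually_at_right_field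
  proof (intro exI[of _ "min 1 \<delta>"] conjI allI impI)
    show "0 < min 1 \<delta>" using \<delta> by simp
    fix r :: real assume r: "0 < r" "r < min 1 \<delta>"
    have GG: "ennreal (norm (conv (mol r) G x - G x)) * w x \<le> ennreal \<eta> * (w x * indicator (cball 0 (R + 1)) x)" for x
    proof (cases "x \<in> cball 0 (R + 1)")
      case True
      have "norm (conv (mol r) G x - G x) \<le> \<eta>"
      proof (rule conv_mol_approx_pointwise[OF r(1) Gi])
        fix y assume y: "dist x y < r"
        have "norm y \<le> norm x + dist x y" by (metis dist_commute dist_norm norm_triangle_sub)
        then have "y \<in> cball 0 (R + 2)" "x \<in> cball 0 (R + 2)" using True y r by auto
        then show "norm (G y - G x) \<le> \<eta>" using \<delta>(2)[of x y] y r by (auto simp: dist_commute dist_norm norm_minus_commute less_imp_le)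
      qed
      then show ?thesis using True by (auto intro!: mult_right_mono ennreal_leI)
    next
      case False
      have "norm (conv (mol r) G x - 0) \<le> 0"
      proof (rule conv_mol_approx_pointwise[OF r(1) Gi])
        fix y assume y: "dist x y < r"
        have "norm x \<le> norm y + dist x y" by (metis dist_norm norm_triangle_sub)
        then have "y \<notin> cball 0 R" using False y r by auto
        then show "norm (G y - 0) \<le> 0" using G(2) by simp
      qed
      moreover have "G x = 0" using False by (intro G(2)) auto
      ultimately show ?thesis by simp
    qed
    have "(\<integral>\<^sup>+x. ennreal (norm (conv (mol r) g x - g x)) * w x \<partial>lborel)
      \<le> (\<integral>\<^sup>+x. ennreal (norm (conv (mol r) (\<lambda>y. g y - G y) x)) * w x + (ennreal (norm (g x - G x)) * w x + ennreal (norm (conv (mol r) G x - G x)) * w x) \<partial>lborel)"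
    proof (rule nn_integral_mono)
      fix x
      have eq: "conv (mol r) g x - g x = conv (mol r) (\<lambda>y. g y - G y) x - (g x - G x) + (conv (mol r) G x - G x)"
        by (simp add: conv_mol_diff[OF r(1) g Gi])
      have "norm (conv (mol r) g x - g x) \<le> norm (conv (mol r) (\<lambda>y. g y - G y) x) + (norm (g x - G x) + norm (conv (mol r) G x - G x))"
        unfolding eq
        using norm_triangle_ineq4[of "conv (mol r) (\<lambda>y. g y - G y) x" "g x - G x"]
          norm_triangle_ineq[of "conv (mol r) (\<lambda>y. g y - G y) x - (g x - G x)" "conv (mol r) G x - G x"] by linarith
      then have "ennreal (norm (conv (mol r) g x - g x)) \<le> ennreal (norm (conv (mol r) (\<lambda>y. g y - G y) x)) + (ennreal (norm (g x - G x)) + ennreal (norm (conv (mol r) G x - G x)))"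
        by (simp flip: ennreal_plus add: ennreal_leI)
      then have "ennreal (norm (conv (mol r) g x - g x)) * w x \<le> (ennreal (norm (conv (mol r) (\<lambda>y. g y - G y) x)) + (ennreal (norm (g x - G x)) + ennreal (norm (conv (mol r) G x - G x)))) * w x"
        by (rule mult_right_mono) simp
      then show "ennreal (norm (conv (mol r) g x - g x)) * w x \<le> ennreal (norm (conv (mol r) (\<lambda>y. g y - G y) x)) * w x + (ennreal (norm (g x - G x)) * w x + ennreal (norm (conv (mol r) G x - G x)) * w x)"
        by (simp add: distrib_right)
    qed
    also have "\<dots> = (\<integral>\<^sup>+x. ennreal (norm (conv (mol r) (\<lambda>y. g y - G y) x)) * w x \<partial>lborel)
      + ((\<integral>\<^sup>+x. ennreal (norm (g x - G x)) * w x \<partial>lborel) + (\<integral>\<^sup>+x. ennreal (norm (conv (mol r) G x - G x)) * w x \<partial>lborel))"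
      by (simp add: nn_integral_add)
    also have "\<dots> \<le> ennreal C * ennreal d + (ennreal d + ennreal \<eta> * ennreal W)"
    proof (intro add_mono)
      have "(\<integral>\<^sup>+x. ennreal (norm (conv (mol r) (\<lambda>y. g y - G y) x)) * w x \<partial>lborel) \<le> (\<integral>\<^sup>+y. ennreal (norm (g y - G y)) * wmol r w y \<partial>lborel)"
        by (rule nn_integral_conv_le) auto
      also have "\<dots> \<le> (\<integral>\<^sup>+y. ennreal C * (ennreal (norm (g y - G y)) * w y) \<partial>lborel)"
        by (rule nn_integral_mono, subst mult.left_commute) (intro mult_left_mono C(2) r, simp)
      also have "\<dots> = ennreal C * (\<integral>\<^sup>+y. ennreal (norm (g y - G y)) * w y \<partial>lborel)" by (rule nn_integral_cmult) auto
      also have "\<dots> \<le> ennreal C * ennreal d" by (intro mult_left_mono less_imp_le[OF G(3)]) simp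
      finally show "(\<integral>\<^sup>+x. ennreal (norm (conv (mol r) (\<lambda>y. g y - G y) x)) * w x \<partial>lborel) \<le> ennreal C * ennreal d" .
      show "(\<integral>\<^sup>+x. ennreal (norm (g x - G x)) * w x \<partial>lborel) \<le> ennreal d" using G(3) by simp
      have "(\<integral>\<^sup>+x. ennreal (norm (conv (mol r) G x - G x)) * w x \<partial>lborel) \<le> (\<integral>\<^sup>+x. ennreal \<eta> * (w x * indicator (cball 0 (R + 1)) x) \<partial>lborel)"
        by (intro nn_integral_mono GG)
      also have "\<dots> = ennreal \<eta> * ennreal W" unfolding W(2)[symmetric] by (rule nn_integral_cmult) (simp add: weight_indicator_measurable)
      finally show "(\<integral>\<^sup>+x. ennreal (norm (conv (mol r) G x - G x)) * w x \<partial>lborel) \<le> ennreal \<eta> * ennreal W" .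
    qed
    also have "\<dots> = ennreal (C * d + (d + \<eta> * W))" using C(1) d(1) eta(1) W(1) by (simp add: ennreal_mult)
    also have "\<dots> < ennreal e0" using d eta e0 by (intro ennreal_lessI) (auto simp: algebra_simps)
    also have "\<dots> \<le> e" by (rule e0)
    finally show "(\<integral>\<^sup>+x. ennreal (norm (conv (mol r) g x - g x)) * w x \<partial>lborel) < e" .
  qed
qed simp

lemma mollify_L1_unweighted:
  fixes g :: "'a::euclidean_space \<Rightarrow> 'b::euclidean_space"
  assumes "integrable lborel g" "compact K" "\<And>x. x \<notin> K \<Longrightarrow> g x = 0"
  shows "((\<lambda>r. \<integral>\<^sup>+x. ennreal (norm (conv (mol r) g x - g x)) \<partial>lborel) \<longlongrightarrow> 0) (at_right 0)"
proof -
  have "((\<lambda>r. \<integral>\<^sup>+x. ennreal (norm (conv (mol r) g x - g x)) * 1 \<partial>lborel) \<longlongrightarrow> 0) (at_right 0)"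
  proof (rule mollify_L1[where C=1, OF _ _ _ _ assms(1) _ assms(2,3)])
    show "(\<integral>\<^sup>+ y\<in>K. 1 \<partial>lborel) < \<infinity>" if "compact K" for K :: "'a set"
      using emeasure_compact_finite[OF that] compact_imp_closed[OF that] by (simp add: borel_closed)
    show "wmol r (\<lambda>x. 1) x \<le> ennreal 1 * 1" if "r > 0" for r and x :: 'a
      unfolding wmol_def using nn_integral_mol'[OF that, of x] by simp
    show "(\<integral>\<^sup>+ y. ennreal (norm (g y)) * 1 \<partial>lborel) < \<infinity>"
      using assms(1) by (simp add: integrable_iff_bounded)
  qed auto
  then show ?thesis by simp
qed

text \<open>The uniqueness principle used for Rademacher's theorem: an identity between integrable functions
may be checked after mollification, where everything is smooth.\<close>

lemma conv_mol_zero_imp_AE_zero: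
  fixes h :: "'a::euclidean_space \<Rightarrow> 'b::euclidean_space"
  assumes "integrable lborel h" "compact K" "\<And>x. x \<notin> K \<Longrightarrow> h x = 0"
    and "\<And>r x. r > 0 \<Longrightarrow> conv (mol r) h x = 0"
  shows "AE x in lborel. h x = 0"
proof -
  have [measurable]: "h \<in> borel_measurable borel" using assms(1) by auto
  have "((\<lambda>r. \<integral>\<^sup>+x. ennreal (norm (conv (mol r) h x - h x)) \<partial>lborel) \<longlongrightarrow> 0) (at_right 0)"
    by (rule mollify_L1_unweighted[OF assms(1,2,3)])
  moreover have "\<forall>\<^sub>F r in at_right 0. (\<integral>\<^sup>+x. ennreal (norm (conv (mol r) h x - h x)) \<partial>lborel) = (\<integral>\<^sup>+x. ennreal (norm (h x)) \<partial>lborel)"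
    unfolding eventually_at_right_field by (intro exI[of _ 1]) (auto simp: assms(4))
  ultimately have "((\<lambda>r. \<integral>\<^sup>+x. ennreal (norm (h x)) \<partial>lborel) \<longlongrightarrow> 0) (at_right (0::real))"
    by (rule tendsto_cong[THEN iffD1, rotated])
  then have "(\<integral>\<^sup>+x. ennreal (norm (h x)) \<partial>lborel) = 0"
    by (simp add: tendsto_const_iff trivial_limit_at_right_real)
  then show ?thesis by (subst (asm) nn_integral_0_iff_AE) auto
qed

section \<open>Directional derivatives of Lipschitz functions\<close>

text \<open>Difference quotients are taken along the fixed sequence \<open>1 / (n + 1)\<close>, so that the derivative built from them
is Borel measurable and defined at every point.\<close>

definition diff_quot :: "'a::euclidean_space \<Rightarrow> ('a \<Rightarrow> real) \<Rightarrow> nat \<Rightarrow> 'a \<Rightarrow> real" where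
  "diff_quot v u n x = (u (x + (1 / real (Suc n)) *\<^sub>R v) - u x) * real (Suc n)"

definition dir_deriv :: "'a::euclidean_space \<Rightarrow> ('a \<Rightarrow> real) \<Rightarrow> 'a \<Rightarrow> real" where
  "dir_deriv v u x = lim (\<lambda>n. diff_quot v u n x)"

lemma inverse_Suc_at_right: "filterlim (\<lambda>n. 1 / real (Suc n)) (at_right 0) sequentially"
  unfolding filterlim_at using LIMSEQ_inverse_real_of_nat by (auto simp: inverse_eq_divide)

lemma lipschitz_continuous: "L-lipschitz_on UNIV u \<Longrightarrow> continuous_on UNIV u"
  by (rule lipschitz_on_continuous_on)

lemma lipschitz_borel: "L-lipschitz_on UNIV (u :: 'a::euclidean_space \<Rightarrow> 'b::euclidean_space) \<Longrightarrow> u \<in> borel_measurable borel"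
  by (rule borel_measurable_continuous_onI[OF lipschitz_continuous])

lemma diff_quot_measurable[measurable]:
  assumes [measurable]: "u \<in> borel_measurable borel" shows "diff_quot v u n \<in> borel_measurable borel"
  unfolding diff_quot_def[abs_def] by measurable

lemma dir_deriv_measurable[measurable]:
  assumes [measurable]: "u \<in> borel_measurable borel" shows "dir_deriv v u \<in> borel_measurable borel"
  unfolding dir_deriv_def[abs_def] by measurable

lemma lipschitz_norm: "L-lipschitz_on UNIV u \<Longrightarrow> norm (u x - u y) \<le> L * norm (x - y)"
  by (auto simp: lipschitz_on_def dist_norm)

lemma diff_quot_bound:
  assumes "L-lipschitz_on UNIV u" shows "\<bar>diff_quot v u n x\<bar> \<le> L * norm v"
proof -
  have "\<bar>u (x + (1 / real (Suc n)) *\<^sub>R v) - u x\<bar> \<le> L * norm ((1 / real (Suc n)) *\<^sub>R v)"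
    using lipschitz_norm[OF assms, of "x + (1 / real (Suc n)) *\<^sub>R v" x] by simp
  also have "\<dots> = L * norm v / real (Suc n)" by simp
  finally have "\<bar>u (x + (1 / real (Suc n)) *\<^sub>R v) - u x\<bar> * real (Suc n) \<le> L * norm v"
    by (subst (asm) pos_le_divide_eq) auto
  then show ?thesis by (simp only: diff_quot_def abs_mult abs_of_nat)
qed

lemma dir_deriv_bound:
  assumes "L-lipschitz_on UNIV u" "convergent (\<lambda>n. diff_quot v u n x)" shows "\<bar>dir_deriv v u x\<bar> \<le> L * norm v"
proof -
  have "(\<lambda>n. diff_quot v u n x) \<longlonglongrightarrow> dir_deriv v u x" using assms(2) unfolding dir_deriv_def by (simp add: convergent_LIMSEQ_iff)
  then have "(\<lambda>n. \<bar>diff_quot v u n x\<bar>) \<longlonglongrightarrow> \<bar>dir_deriv v u x\<bar>" by (rule tendsto_rabs)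
  then show ?thesis by (rule LIMSEQ_le_const2) (use diff_quot_bound[OF assms(1)] in auto)
qed

text \<open>For a Lipschitz function, convergence of the difference quotients along \<open>1 / (n + 1)\<close> already gives the full one-sided
limit: consecutive steps have ratio tending to \<open>1\<close>, so that interpolation between them costs a factor that vanishes.\<close>

lemma sequential_imp_right_derivative:
  assumes L: "L-lipschitz_on UNIV u" and c: "convergent (\<lambda>n. diff_quot v u n x)"
  shows "((\<lambda>t. (u (x + t *\<^sub>R v) - u x) / t) \<longlongrightarrow> dir_deriv v u x) (at_right 0)"
proof (rule tendstoI)
  fix e :: real assume e: "e > 0"
  have "(\<lambda>n. diff_quot v u n x) \<longlonglongrightarrow> dir_deriv v u x" using c unfolding dir_deriv_def by (simp add: convergent_LIMSEQ_iff)
  then obtain N where N: "\<And>n. n \<ge> N \<Longrightarrow> \<bar>diff_quot v u n x - dir_deriv v u x\<bar> < e / 2"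
    using e by (metis LIMSEQ_iff half_gt_zero real_norm_def)
  have L0: "L \<ge> 0" using L by (simp add: lipschitz_on_def)
  define B where "B = L * norm v"
  have B: "B \<ge> 0" using L0 by (simp add: B_def)
  \<comment> \<open>Large enough for \<open>n > M\<close> to control both the tail of the sequence and the interpolation error \<open>2 * B / (n + 1)\<close>.\<close>
  define M where "M = max (real N) (4 * B / e)"
  have M: "M \<ge> 0" "M \<ge> real N" "4 * B / e \<le> M" by (simp_all add: M_def)
  then have M': "2 * B \<le> e / 2 * M" using e by (simp add: field_simps)
  show "\<forall>\<^sub>F t in at_right 0. dist ((u (x + t *\<^sub>R v) - u x) / t) (dir_deriv v u x) < e"
    unfolding eventually_at_right_field
  proof (intro exI[of _ "1 / (M + 2)"] conjI allI impI)
    show "0 < 1 / (M + 2)" using M by simp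
    fix t :: real assume t: "0 < t" "t < 1 / (M + 2)"
    then have tM: "M + 2 < 1 / t" using M by (simp add: field_simps)
    \<comment> \<open>The step \<open>1 / (n + 1)\<close> is the smallest reciprocal of a natural number that is at least \<open>t\<close>.\<close>
    define n where "n = nat \<lfloor>1 / t\<rfloor> - 1"
    have fl: "\<lfloor>1 / t\<rfloor> \<ge> 2" using tM M by linarith
    then have "int (Suc n) = \<lfloor>1 / t\<rfloor>" unfolding n_def by linarith
    then have n1: "real (Suc n) = of_int \<lfloor>1 / t\<rfloor>" by (metis of_int_of_nat_eq)
    have nl: "real (Suc n) \<le> 1 / t" "1 / t < real (Suc n) + 1" unfolding n1 by linarith+
    have nM: "M < real n" using tM nl by simp
    define s where "s = 1 / real (Suc n)"
    have s: "s > 0" "t \<le> s" using nl t unfolding s_def by (auto simp: field_simps)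
    have q: "diff_quot v u n x = (u (x + s *\<^sub>R v) - u x) / s" by (simp add: diff_quot_def s_def)
    have st: "(s - t) / t \<le> 1 / real (Suc n)"
    proof -
      have "(s - t) / t = s * (1 / t) - 1" using t by (simp add: field_simps)
      also have "\<dots> \<le> s * (real (Suc n) + 1) - 1" using s nl by (intro diff_right_mono mult_left_mono) auto
      also have "\<dots> = 1 / real (Suc n)" by (simp add: s_def field_simps)
      finally show ?thesis .
    qed
    have a1: "\<bar>u (x + t *\<^sub>R v) - u (x + s *\<^sub>R v)\<bar> \<le> B * (s - t)"
      using lipschitz_norm[OF L, of "x + t *\<^sub>R v" "x + s *\<^sub>R v"] s
      by (simp add: B_def scaleR_diff_left[symmetric] mult_ac)
    have a2: "\<bar>u (x + s *\<^sub>R v) - u x\<bar> \<le> B * s"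
      using lipschitz_norm[OF L, of "x + s *\<^sub>R v" x] s by (simp add: B_def mult_ac)
    have "(u (x + t *\<^sub>R v) - u x) / t - diff_quot v u n x
        = (u (x + t *\<^sub>R v) - u (x + s *\<^sub>R v)) / t + (u (x + s *\<^sub>R v) - u x) * (1 / t - 1 / s)"
      unfolding q using s t by (simp add: field_simps)
    also have "\<bar>\<dots>\<bar> \<le> \<bar>(u (x + t *\<^sub>R v) - u (x + s *\<^sub>R v)) / t\<bar> + \<bar>(u (x + s *\<^sub>R v) - u x) * (1 / t - 1 / s)\<bar>"
      by (rule abs_triangle_ineq)
    also have "\<dots> \<le> B * (s - t) / t + B * s * (1 / t - 1 / s)"
    proof (rule add_mono)
      show "\<bar>(u (x + t *\<^sub>R v) - u (x + s *\<^sub>R v)) / t\<bar> \<le> B * (s - t) / t"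
        using a1 t by (simp add: abs_divide divide_right_mono)
      have p: "0 \<le> 1 / t - 1 / s" using s t by (simp add: field_simps)
      show "\<bar>(u (x + s *\<^sub>R v) - u x) * (1 / t - 1 / s)\<bar> \<le> B * s * (1 / t - 1 / s)"
        unfolding abs_mult using mult_right_mono[OF a2 p] p by simp
    qed
    also have "\<dots> = 2 * B * ((s - t) / t)" using s t by (simp add: field_simps)
    also have "\<dots> \<le> 2 * B * (1 / real (Suc n))" using st B by (intro mult_left_mono) auto
    also have "\<dots> \<le> e / 2"
    proof -
      have "2 * B \<le> e / 2 * M" by (rule M')
      also have "\<dots> \<le> e / 2 * real (Suc n)" using nM e by (intro mult_left_mono) auto
      finally show ?thesis by (simp add: field_simps)
    qed
    finally have "\<bar>(u (x + t *\<^sub>R v) - u x) / t - diff_quot v u n x\<bar> \<le> e / 2" .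
    moreover have "\<bar>diff_quot v u n x - dir_deriv v u x\<bar> < e / 2" using nM M(2) by (intro N) linarith
    ultimately show "dist ((u (x + t *\<^sub>R v) - u x) / t) (dir_deriv v u x) < e" unfolding dist_real_def by linarith
  qed
qed

text \<open>Lipschitz functions on the line are differentiable almost everywhere, here from the right. Adding a
linear function makes \<open>g\<close> a bi-Lipschitz increasing bijection \<open>F\<close>; the measure of \<open>F ` A\<close> is absolutely
continuous, its Radon--Nikodym density integrates to increments of \<open>F\<close>, and Lebesgue's differentiation theorem
applies to the density.\<close>

lemma lipschitz_real_right_derivative:
  fixes g :: "real \<Rightarrow> real"
  assumes L: "L-lipschitz_on UNIV g"
  shows "\<exists>N. negligible N \<and> (\<forall>x. x \<notin> N \<longrightarrow> (\<exists>l. ((\<lambda>h. (g (x + h) - g x) / h) \<longlongrightarrow> l) (at_right 0)))"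
proof -
  have L0: "L \<ge> 0" using L by (simp add: lipschitz_on_def)
  \<comment> \<open>The slope \<open>L + 1\<close> makes the increments of \<open>F\<close> at least those of the identity.\<close>
  define F where "F x = g x + (L + 1) * x" for x
  have gl: "\<bar>g y - g x\<bar> \<le> L * (y - x)" if "x \<le> y" for x y
    using lipschitz_norm[OF L, of y x] that by simp
  have F1: "y - x \<le> F y - F x" "F y - F x \<le> (2 * L + 1) * (y - x)" if "x \<le> y" for x y
    using gl[OF that] by (auto simp: F_def algebra_simps)
  have smono: "strict_mono F" 
  proof (rule strict_monoI)
    fix x y :: real assume "x < y" then show "F x < F y" using F1(1)[of x y] by linarith
  qed
  have inj: "inj F" by (rule strict_mono_imp_inj_on[OF smono])
  have Fc: "continuous_on UNIV F" unfolding F_def by (intro continuous_intros lipschitz_continuous[OF L])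
  have surj: "surj F"
  proof (rule surjI[of F "\<lambda>y. SOME x. F x = y"])
    fix y
    have "\<exists>x\<ge>-\<bar>y - F 0\<bar>. x \<le> \<bar>y - F 0\<bar> \<and> F x = y"
      by (rule IVT') (use F1(1)[of "- \<bar>y - F 0\<bar>" 0] F1(1)[of 0 "\<bar>y - F 0\<bar>"] in \<open>auto intro: continuous_on_subset[OF Fc]\<close>)
    then show "F (SOME x. F x = y) = y" by (metis (mono_tags, lifting) someI_ex)
  qed
  define G where "G = inv F"
  have GF: "G (F x) = x" and FG: "F (G y) = y" for x y
    unfolding G_def using inj surj by (simp_all add: surj_f_inv_f)
  have "mono G"
  proof (rule monoI)
    fix x y :: real assume "x \<le> y"
    show "G x \<le> G y"
    proof (rule ccontr)
      assume "\<not> G x \<le> G y"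
      then have "F (G y) < F (G x)" using smono by (auto simp: strict_mono_def)
      then show False using FG \<open>x \<le> y\<close> by simp
    qed
  qed
  then have Gm[measurable]: "G \<in> borel_measurable borel" by (rule borel_measurable_mono)
  \<comment> \<open>The measure of the image under \<open>F\<close>, written as a push-forward under the inverse.\<close>
  define M where "M = distr lborel borel G"
  have Mem: "emeasure M A = emeasure lborel (F ` A)" if "A \<in> sets borel" for A
  proof -
    have "G -` A = F ` A" using GF FG by (auto simp: image_iff) (metis FG)
    then show ?thesis unfolding M_def using that by (simp add: emeasure_distr)
  qed
  have FA: "F ` A \<in> sets borel" if "A \<in> sets borel" for A
  proof -
    have "G -` A = F ` A" using GF FG by (auto simp: image_iff) (metis FG)
    moreover have "G -` A \<in> sets borel" using measurable_sets[OF Gm that] by simp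
    ultimately show ?thesis by simp
  qed
  have ac: "absolutely_continuous lborel M"
    unfolding absolutely_continuous_def
  proof
    fix A :: "real set" assume A: "A \<in> null_sets lborel"
    then have "negligible A" by (auto simp: negligible_iff_null_sets intro: null_sets_completionI)
    then have "negligible (F ` A)"
    proof (rule negligible_locally_Lipschitz_image[OF _ _, rotated])
      fix x assume "x \<in> A"
      have "norm (F y - F x) \<le> (2 * L + 1) * norm (y - x)" for y
        using F1[of x y] F1[of y x] by (cases "x \<le> y") auto
      then show "\<exists>T B. open T \<and> x \<in> T \<and> (\<forall>y\<in>A \<inter> T. norm (F y - F x) \<le> B * norm (y - x))"
        by (intro exI[of _ UNIV]) auto
    qed simp
    then have "F ` A \<in> null_sets lebesgue" by (simp add: negligible_iff_null_sets)
    moreover have "F ` A \<in> sets borel" using A FA by auto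
    ultimately have "emeasure lborel (F ` A) = 0" by (simp add: null_sets_def)
    then show "A \<in> null_sets M" using A Mem[of A] by (auto simp: null_sets_def M_def)
  qed
  obtain f where f[measurable]: "f \<in> borel_measurable lborel" and fd: "density lborel f = M"
    using sigma_finite_measure.Radon_Nikodym[OF sigma_finite_lborel ac] by (auto simp: M_def)
  have nnf: "(\<integral>\<^sup>+x\<in>{a..b}. f x \<partial>lborel) = ennreal (F b - F a)" if "a \<le> b" for a b
  proof -
    have "(\<integral>\<^sup>+x\<in>{a..b}. f x \<partial>lborel) = emeasure M {a..b}" unfolding fd[symmetric] by (simp add: emeasure_density)
    also have "\<dots> = emeasure lborel (F ` {a..b})" by (rule Mem) simp
    also have "F ` {a..b} = {F a..F b}"
      using smono by (auto simp: strict_mono_less_eq image_iff intro: exI[of _ "G y" for y]) (metis FG strict_mono_less_eq atLeastAtMost_iff)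
    also have "emeasure lborel {F a..F b} = ennreal (F b - F a)" using F1(1)[OF that] that by simp
    finally show ?thesis .
  qed
  define h where "h x = enn2real (f x)" for x
  have [measurable]: "h \<in> borel_measurable borel" unfolding h_def[abs_def] by measurable
  have hi: "(h has_integral (F b - F a)) (cbox a b)" if "a \<le> b" for a b
  proof -
    have "(\<integral>\<^sup>+x. f x * indicator {a..b} x \<partial>lborel) \<noteq> \<infinity>" using nnf[OF that] by simp
    then have "AE x in lborel. f x * indicator {a..b} x \<noteq> \<infinity>" by (rule nn_integral_PInf_AE[rotated]) measurable
    then have "(\<integral>\<^sup>+x. ennreal (h x * indicator {a..b} x) \<partial>lborel) = (\<integral>\<^sup>+x\<in>{a..b}. f x \<partial>lborel)"
      by (intro nn_integral_cong_AE) (auto elim!: eventually_mono simp: h_def indicator_def less_top)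
    then have "((\<lambda>x. h x * indicator {a..b} x) has_integral (F b - F a)) UNIV"
      using nnf[OF that] F1(1)[OF that] that
      by (intro nn_integral_has_integral) (auto simp: h_def)
    moreover have "(\<lambda>x. h x * indicator {a..b} x) = (\<lambda>x. if x \<in> cbox a b then h x else 0)"
      by (auto simp: fun_eq_iff)
    ultimately show ?thesis by (simp only: has_integral_restrict_UNIV)
  qed
  have "h integrable_on cbox a b" for a b
    using hi[of a b] by (cases "a \<le> b") (auto simp: integrable_on_def intro: exI[of _ 0])
  then obtain N where N: "negligible N"
      "\<And>x e. \<lbrakk>x \<notin> N; 0 < e\<rbrakk> \<Longrightarrow> \<exists>d>0. \<forall>k. 0 < k \<and> k < d \<longrightarrow>
          norm (integral (cbox x (x + k *\<^sub>R One)) h /\<^sub>R k ^ DIM(real) - h x) < e"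
    by (rule integrable_ccontinuous_explicit[of h]) blast
  have "((\<lambda>k. (g (x + k) - g x) / k) \<longlongrightarrow> h x - (L + 1)) (at_right 0)" if xN: "x \<notin> N" for x
  proof (rule tendstoI)
    fix e :: real assume "e > 0"
    then obtain d where d: "d > 0" "\<And>k. 0 < k \<and> k < d \<longrightarrow> norm (integral (cbox x (x + k *\<^sub>R One)) h /\<^sub>R k ^ DIM(real) - h x) < e"
      using N(2)[OF xN] by metis
    show "\<forall>\<^sub>F k in at_right 0. dist ((g (x + k) - g x) / k) (h x - (L + 1)) < e"
      unfolding eventually_at_right_field
    proof (intro exI[of _ d] conjI allI impI)
      fix k assume k: "0 < k" "k < d"
      have "integral (cbox x (x + k)) h = F (x + k) - F x" using hi[of x "x + k"] k by (intro integral_unique) auto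
      then have "\<bar>(F (x + k) - F x) / k - h x\<bar> < e" using d(2)[of k] k by (simp add: divide_inverse mult.commute)
      moreover have "(F (x + k) - F x) / k = (g (x + k) - g x) / k + (L + 1)" using k by (simp add: F_def field_simps)
      ultimately show "dist ((g (x + k) - g x) / k) (h x - (L + 1)) < e" by (simp add: dist_real_def algebra_simps)
    qed (use d in auto)
  qed
  then show ?thesis using N(1) by blast
qed

section \<open>Rademacher's theorem\<close>

lemma nn_integral_lborel_translate:
  fixes h :: "'a::euclidean_space \<Rightarrow> ennreal"
  assumes [measurable]: "h \<in> borel_measurable borel"
  shows "(\<integral>\<^sup>+y. h (y + c) \<partial>lborel) = integral\<^sup>N lborel h"
proof -
  have "integral\<^sup>N lborel h = integral\<^sup>N (distr lborel borel ((+) c)) h" by (simp add: lborel_distr_plus)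
  also have "\<dots> = (\<integral>\<^sup>+y. h (c + y) \<partial>lborel)" by (rule nn_integral_distr) auto
  finally show ?thesis by (simp add: add.commute)
qed

text \<open>Fubini in an arbitrary direction: averaging a set over translates along \<open>v\<close> does not
change its measure.\<close>

lemma AE_on_lines_imp_AE:
  fixes v :: "'a::euclidean_space"
  assumes E[measurable]: "E \<in> sets borel" and ae: "\<And>x. AE t in lborel. x + t *\<^sub>R v \<notin> E"
  shows "AE x in lborel. x \<notin> E"
proof -
  have "(\<integral>\<^sup>+t. \<integral>\<^sup>+x. indicator {0..1::real} t * indicator E (x + t *\<^sub>R v) \<partial>lborel \<partial>lborel)
      = (\<integral>\<^sup>+x. \<integral>\<^sup>+t. indicator {0..1} t * indicator E (x + t *\<^sub>R v) \<partial>lborel \<partial>lborel)"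
    by (rule lborel_pair.Fubini'[symmetric]) measurable
  also have "\<dots> = (\<integral>\<^sup>+x. 0 \<partial>(lborel :: 'a measure))"
  proof (rule nn_integral_cong)
    fix x
    have "AE t in lborel. indicator {0..1::real} t * indicator E (x + t *\<^sub>R v) = (0::ennreal)"
      using ae[of x] by eventually_elim simp
    from nn_integral_cong_AE[OF this]
    show "(\<integral>\<^sup>+t. indicator {0..1::real} t * indicator E (x + t *\<^sub>R v) \<partial>lborel) = 0" by simp
  qed
  finally have 0: "(\<integral>\<^sup>+t. \<integral>\<^sup>+x. indicator {0..1::real} t * indicator E (x + t *\<^sub>R v) \<partial>lborel \<partial>lborel) = 0" by simp
  have "(\<integral>\<^sup>+x. indicator {0..1::real} t * indicator E (x + t *\<^sub>R v) \<partial>lborel) = indicator {0..1} t * emeasure lborel E" for t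
  proof -
    have "(\<integral>\<^sup>+x. indicator {0..1::real} t * indicator E (x + t *\<^sub>R v) \<partial>lborel)
        = indicator {0..1::real} t * (\<integral>\<^sup>+x. indicator E (x + t *\<^sub>R v) \<partial>lborel)"
      by (rule nn_integral_cmult) measurable
    then show ?thesis by (simp add: nn_integral_lborel_translate)
  qed
  with 0 have "(\<integral>\<^sup>+t. indicator {0..1::real} t * emeasure lborel E \<partial>lborel) = 0" by simp
  then have "emeasure lborel E = 0" by (simp add: nn_integral_multc)
  then show ?thesis by (intro AE_not_in) (auto simp: null_sets_def)
qed

lemma AE_reflect:
  fixes x :: "'a::euclidean_space"
  assumes "AE y in lborel. P y" shows "AE y in lborel. P (x - y)"
  using assms by (subst (asm) distr_lborel_reflect[of x, symmetric]) (rule AE_distrD, auto)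

lemma AE_diff_quot_convergent:
  fixes u :: "'a::euclidean_space \<Rightarrow> real"
  assumes L: "L-lipschitz_on UNIV u"
  shows "AE x in lborel. convergent (\<lambda>n. diff_quot v u n x)"
proof -
  have [measurable]: "u \<in> borel_measurable borel" by (rule lipschitz_borel[OF L])
  define E where "E = {x. \<not> Cauchy (\<lambda>n. diff_quot v u n x)}"
  have "{x \<in> space borel. Cauchy (\<lambda>n. diff_quot v u n x)} \<in> sets borel"
    by (rule sets_Collect_Cauchy) measurable
  then have "- {x. Cauchy (\<lambda>n. diff_quot v u n x)} \<in> sets borel" by (intro borel_comp) simp
  then have E: "E \<in> sets borel" by (simp add: E_def Collect_neg_eq)
  have "AE x in lborel. x \<notin> E"
  proof (rule AE_on_lines_imp_AE[OF E])
    fix x :: 'a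
    define g where "g t = u (x + t *\<^sub>R v)" for t
    have "(L * norm v)-lipschitz_on UNIV g"
    proof (rule lipschitz_onI)
      have "L \<ge> 0" using L by (simp add: lipschitz_on_def)
      then show "0 \<le> L * norm v" by simp
      show "dist (g s) (g t) \<le> L * norm v * dist s t" for s t
        using lipschitz_norm[OF L, of "x + s *\<^sub>R v" "x + t *\<^sub>R v"]
        by (simp add: g_def dist_norm scaleR_diff_left[symmetric] mult_ac)
    qed
    then obtain N where N: "negligible N" "\<And>t. t \<notin> N \<Longrightarrow> \<exists>l. ((\<lambda>h. (g (t + h) - g t) / h) \<longlongrightarrow> l) (at_right 0)"
      using lipschitz_real_right_derivative by metis
    have "x + t *\<^sub>R v \<notin> E" if tN: "t \<notin> N" for t
    proof -
      obtain l where l: "((\<lambda>h. (g (t + h) - g t) / h) \<longlongrightarrow> l) (at_right 0)" using N(2)[OF tN] by blast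
      from filterlim_compose[OF l inverse_Suc_at_right] have "(\<lambda>n. (g (t + 1 / real (Suc n)) - g t) / (1 / real (Suc n))) \<longlonglongrightarrow> l" .
      also have "(\<lambda>n. (g (t + 1 / real (Suc n)) - g t) / (1 / real (Suc n))) = (\<lambda>n. diff_quot v u n (x + t *\<^sub>R v))"
        by (simp add: fun_eq_iff g_def diff_quot_def scaleR_add_left add.assoc)
      finally have "Cauchy (\<lambda>n. diff_quot v u n (x + t *\<^sub>R v))" by (rule LIMSEQ_imp_Cauchy)
      then show ?thesis by (simp add: E_def)
    qed
    moreover have "AE t in lborel. t \<notin> N" by (rule AE_lborel_not_in_negligible[OF N(1)])
    ultimately show "AE t in lborel. x + t *\<^sub>R v \<notin> E" by (auto elim!: eventually_mono)
  qed
  then show ?thesis by (simp add: E_def Cauchy_convergent_iff)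
qed

lemma AE_diff_quot_tendsto:
  fixes u :: "'a::euclidean_space \<Rightarrow> real"
  assumes "L-lipschitz_on UNIV u"
  shows "AE x in lborel. (\<lambda>n. diff_quot v u n x) \<longlonglongrightarrow> dir_deriv v u x"
  using AE_diff_quot_convergent[OF assms, of v] by eventually_elim (simp add: dir_deriv_def convergent_LIMSEQ_iff)

lemma AE_dir_deriv_bound:
  fixes u :: "'a::euclidean_space \<Rightarrow> real"
  assumes "L-lipschitz_on UNIV u"
  shows "AE x in lborel. \<bar>dir_deriv v u x\<bar> \<le> L * norm v"
  using AE_diff_quot_convergent[OF assms, of v] by eventually_elim (rule dir_deriv_bound[OF assms])

lemma dir_deriv_zero_open:
  assumes "open S" "x \<in> S" "\<And>y. y \<in> S \<Longrightarrow> u y = 0"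
  shows "(\<lambda>n. diff_quot v u n x) \<longlonglongrightarrow> 0" "dir_deriv v u x = 0"
proof -
  have "(\<lambda>n. x + (1 / real (Suc n)) *\<^sub>R v) \<longlonglongrightarrow> x + 0 *\<^sub>R v"
    by (intro tendsto_intros) (use LIMSEQ_inverse_real_of_nat in \<open>simp add: inverse_eq_divide\<close>)
  then have "\<forall>\<^sub>F n in sequentially. x + (1 / real (Suc n)) *\<^sub>R v \<in> S"
    using assms(1,2) by (simp add: topological_tendstoD)
  then have "\<forall>\<^sub>F n in sequentially. diff_quot v u n x = 0"
    by eventually_elim (simp add: diff_quot_def assms)
  then show *: "(\<lambda>n. diff_quot v u n x) \<longlonglongrightarrow> 0" by (rule tendsto_eventually)
  show "dir_deriv v u x = 0" unfolding dir_deriv_def by (rule limI[OF *])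
qed

lemma dir_deriv_zero_outside:
  assumes "closed K" "\<And>y. y \<notin> K \<Longrightarrow> u y = 0" "x \<notin> K"
  shows "dir_deriv v u x = 0"
  by (rule dir_deriv_zero_open(2)[of "- K"]) (use assms in auto)

lemma integrable_bounded_compact_support:
  fixes g :: "'a::euclidean_space \<Rightarrow> 'b::euclidean_space"
  assumes "g \<in> borel_measurable borel" "compact K" "\<And>x. x \<notin> K \<Longrightarrow> g x = 0" "AE x in lborel. norm (g x) \<le> B"
  shows "integrable lborel g"
proof (rule Bochner_Integration.integrable_bound)
  show "integrable lborel (\<lambda>x. B * indicator K x :: real)"
    using emeasure_compact_finite[OF assms(2)] compact_imp_closed[OF assms(2)]
    by (intro integrable_mult_right integrable_real_indicator) auto
  show "AE x in lborel. norm (g x) \<le> norm (B * indicator K x :: real)"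
    using assms(4) by eventually_elim (use assms(3) in \<open>auto simp: indicator_def\<close>)
qed (use assms in simp)

lemma lipschitz_bounded:
  fixes u :: "'a::euclidean_space \<Rightarrow> 'b::euclidean_space"
  assumes "L-lipschitz_on UNIV u" "compact K" "\<And>x. x \<notin> K \<Longrightarrow> u x = 0"
  obtains B where "B > 0" "\<And>x. norm (u x) \<le> B"
proof -
  have "compact (u ` K)" by (rule compact_continuous_image[OF continuous_on_subset[OF lipschitz_continuous[OF assms(1)]] assms(2)]) simp
  then obtain B where B: "B > 0" "\<forall>x\<in>K. norm (u x) \<le> B" by (auto dest!: compact_imp_bounded simp: bounded_pos)
  show ?thesis
  proof (rule that[OF B(1)])
    show "norm (u x) \<le> B" for x using B assms(3)[of x] by (cases "x \<in> K") auto
  qed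
qed

lemma integrable_lipschitz:
  fixes u :: "'a::euclidean_space \<Rightarrow> 'b::euclidean_space"
  assumes "L-lipschitz_on UNIV u" "compact K" "\<And>x. x \<notin> K \<Longrightarrow> u x = 0"
  shows "integrable lborel u"
  by (rule integrable_continuous_compact_support[OF lipschitz_continuous[OF assms(1)] assms(2,3)])

lemma integrable_dir_deriv:
  fixes u :: "'a::euclidean_space \<Rightarrow> real"
  assumes "L-lipschitz_on UNIV u" "compact K" "\<And>x. x \<notin> K \<Longrightarrow> u x = 0"
  shows "integrable lborel (dir_deriv v u)"
proof (rule integrable_bounded_compact_support[OF _ assms(2)])
  show "dir_deriv v u \<in> borel_measurable borel" using lipschitz_borel[OF assms(1)] by simp
  show "AE x in lborel. norm (dir_deriv v u x) \<le> L * norm v" using AE_dir_deriv_bound[OF assms(1)] by simp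
  show "dir_deriv v u x = 0" if "x \<notin> K" for x by (rule dir_deriv_zero_outside[OF compact_imp_closed[OF assms(2)] assms(3) that])
qed

lemma conv_reflect:
  fixes g :: "'a::euclidean_space \<Rightarrow> 'b::euclidean_space"
  assumes [measurable]: "g \<in> borel_measurable borel" "a \<in> borel_measurable borel"
  shows "conv a g x = (\<integral>z. a z *\<^sub>R g (x - z) \<partial>lborel)"
  using integral_lborel_reflect[of "\<lambda>z. a z *\<^sub>R g (x - z)" x] by (simp add: conv_def)

text \<open>Directional derivatives commute with mollification, again by dominated convergence, the quotients being bounded
by the Lipschitz constant.\<close>

lemma conv_dir_deriv:
  fixes u :: "'a::euclidean_space \<Rightarrow> real"
  assumes L: "L-lipschitz_on UNIV u" and r: "r > 0"
  shows "(\<lambda>n. diff_quot v (conv (mol r) u) n x) \<longlonglongrightarrow> conv (mol r) (dir_deriv v u) x"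
proof -
  have um[measurable]: "u \<in> borel_measurable borel" by (rule lipschitz_borel[OF L])
  have i: "integrable lborel (\<lambda>z. mol r z *\<^sub>R u (y - z))" for y
  proof (rule Bochner_Integration.integrable_bound)
    show "integrable lborel (\<lambda>z. (\<bar>u y\<bar> + L * r) * mol r (z::'a))" by (intro integrable_mult_right mol_integrable r)
    show "AE z in lborel. norm (mol r z *\<^sub>R u (y - z)) \<le> norm ((\<bar>u y\<bar> + L * r) * mol r z)"
    proof (rule AE_I2)
      fix z :: 'a
      have L0: "L \<ge> 0" using L by (simp add: lipschitz_on_def)
      show "norm (mol r z *\<^sub>R u (y - z)) \<le> norm ((\<bar>u y\<bar> + L * r) * mol r z)"
      proof (cases "norm z < r")
        case True
        have "\<bar>u (y - z) - u y\<bar> \<le> L * norm z" using lipschitz_norm[OF L, of "y - z" y] by simp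
        also have "\<dots> \<le> L * r" using True L0 by (intro mult_left_mono) auto
        finally have "\<bar>u (y - z)\<bar> \<le> \<bar>u y\<bar> + L * r" by linarith
        then have "\<bar>u (y - z)\<bar> * mol r z \<le> (\<bar>u y\<bar> + L * r) * mol r z" by (rule mult_right_mono[OF _ mol_nonneg])
        moreover have "0 \<le> \<bar>u y\<bar> + L * r" using L0 r by simp
        ultimately show ?thesis by (simp add: abs_mult mol_nonneg mult.commute)
      next
        case False then show ?thesis using mol_support[OF r, of z] by simp
      qed
    qed
  qed simp
  have "(\<lambda>n. \<integral>z. mol r z *\<^sub>R diff_quot v u n (x - z) \<partial>lborel) \<longlonglongrightarrow> (\<integral>z. mol r z *\<^sub>R dir_deriv v u (x - z) \<partial>lborel)"
  proof (rule integral_dominated_convergence[where w="\<lambda>z. L * norm v * mol r z"])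
    show "AE z in lborel. (\<lambda>n. mol r z *\<^sub>R diff_quot v u n (x - z)) \<longlonglongrightarrow> mol r z *\<^sub>R dir_deriv v u (x - z)"
      using AE_reflect[OF AE_diff_quot_tendsto[OF L, of v], of x] by eventually_elim (intro tendsto_intros)
    show "AE z in lborel. norm (mol r z *\<^sub>R diff_quot v u n (x - z)) \<le> L * norm v * mol r z" for n
    proof (rule AE_I2)
      fix z :: 'a
      have "mol r z * \<bar>diff_quot v u n (x - z)\<bar> \<le> mol r z * (L * norm v)"
        by (intro mult_left_mono diff_quot_bound[OF L] mol_nonneg)
      then show "norm (mol r z *\<^sub>R diff_quot v u n (x - z)) \<le> L * norm v * mol r z"
        by (simp add: abs_mult mol_nonneg mult.commute)
    qed
  qed (auto intro!: integrable_mult_right mol_integrable r)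
  also have "(\<integral>z. mol r z *\<^sub>R dir_deriv v u (x - z) \<partial>lborel) = conv (mol r) (dir_deriv v u) x"
    by (rule conv_reflect[symmetric]) auto
  also have "(\<lambda>n. \<integral>z. mol r z *\<^sub>R diff_quot v u n (x - z) \<partial>lborel) = (\<lambda>n. diff_quot v (conv (mol r) u) n x)"
  proof
    fix n
    let ?h = "(1 / real (Suc n)) *\<^sub>R v"
    have "diff_quot v (conv (mol r) u) n x = ((\<integral>z. mol r z *\<^sub>R u (x + ?h - z) \<partial>lborel) - (\<integral>z. mol r z *\<^sub>R u (x - z) \<partial>lborel)) * real (Suc n)"
      by (simp add: diff_quot_def conv_reflect)
    also have "\<dots> = (\<integral>z. (mol r z *\<^sub>R u (x + ?h - z) - mol r z *\<^sub>R u (x - z)) * real (Suc n) \<partial>lborel)"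
      by (subst Bochner_Integration.integral_diff[OF i i, symmetric]) (rule integral_mult_left_zero[symmetric])
    also have "\<dots> = (\<integral>z. mol r z *\<^sub>R diff_quot v u n (x - z) \<partial>lborel)"
      by (intro Bochner_Integration.integral_cong) (auto simp: diff_quot_def algebra_simps)
    finally show "(\<integral>z. mol r z *\<^sub>R diff_quot v u n (x - z) \<partial>lborel) = diff_quot v (conv (mol r) u) n x" by simp
  qed
  finally show ?thesis .
qed

lemma diff_quot_has_derivative:
  assumes "(u has_derivative D) (at x)"
  shows "(\<lambda>n. diff_quot v u n x) \<longlonglongrightarrow> D v" "dir_deriv v u x = D v"
proof -
  have l: "((\<lambda>t. x + t *\<^sub>R v) has_derivative (\<lambda>t. t *\<^sub>R v)) (at 0)"
    by (auto intro!: derivative_eq_intros)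
  have "(u has_derivative D) (at (x + 0 *\<^sub>R v))" using assms by simp
  from has_derivative_compose[OF l this]
  have "((\<lambda>t. u (x + t *\<^sub>R v)) has_derivative (\<lambda>t. D (t *\<^sub>R v))) (at 0)" .
  moreover have "(\<lambda>t. D (t *\<^sub>R v)) = (*) (D v)"
    using linear_scale[OF bounded_linear.linear[OF has_derivative_bounded_linear[OF assms]]]
    by (simp add: fun_eq_iff mult.commute)
  ultimately have "((\<lambda>t. u (x + t *\<^sub>R v)) has_real_derivative D v) (at 0)"
    by (simp add: has_field_derivative_def)
  then have "((\<lambda>t. (u (x + t *\<^sub>R v) - u x) / t) \<longlongrightarrow> D v) (at 0)"
    by (simp add: has_field_derivative_iff)
  moreover have "filterlim (\<lambda>n. 1 / real (Suc n)) (at 0) sequentially"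
    unfolding filterlim_at using LIMSEQ_inverse_real_of_nat by (auto simp: inverse_eq_divide)
  ultimately have "(\<lambda>n. (u (x + (1 / real (Suc n)) *\<^sub>R v) - u x) / (1 / real (Suc n))) \<longlonglongrightarrow> D v"
    by (rule filterlim_compose)
  then show *: "(\<lambda>n. diff_quot v u n x) \<longlonglongrightarrow> D v" by (simp add: diff_quot_def)
  show "dir_deriv v u x = D v" unfolding dir_deriv_def by (rule limI[OF *])
qed

text \<open>Linearity of the directional derivative in the direction holds for the mollified function, which is differentiable, and
hence almost everywhere for the function itself.\<close>

lemma AE_dir_deriv_linear:
  fixes u :: "'a::euclidean_space \<Rightarrow> real"
  assumes L: "L-lipschitz_on UNIV u" and K: "compact K" "\<And>x. x \<notin> K \<Longrightarrow> u x = 0"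
  shows "AE x in lborel. dir_deriv v u x = (\<Sum>b\<in>Basis. (v \<bullet> b) * dir_deriv b u x)"
proof -
  define h where "h x = dir_deriv v u x - (\<Sum>b\<in>Basis. (v \<bullet> b) * dir_deriv b u x)" for x
  have i: "integrable lborel (dir_deriv v u)" for v by (rule integrable_dir_deriv[OF L K])
  have "AE x in lborel. h x = 0"
  proof (rule conv_mol_zero_imp_AE_zero[OF _ K(1)])
    show "integrable lborel h" unfolding h_def[abs_def] using i by (intro Bochner_Integration.integrable_diff Bochner_Integration.integrable_sum integrable_mult_right) auto
    have cl: "closed K" using K(1) by (rule compact_imp_closed)
    show "h x = 0" if "x \<notin> K" for x
      using dir_deriv_zero_outside[OF cl K(2) that] by (simp add: h_def)
    fix r :: real and x :: 'a assume r: "r > 0"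
    obtain D where D: "(conv (mol r) u has_derivative D) (at x)"
      using conv_differentiable[OF mol_kernel r integrable_lipschitz[OF L K], of x] by (auto simp: differentiable_def)
    \<comment> \<open>For the smooth mollified function the directional derivative is the Frechet derivative, which is linear.\<close>
    have Dv: "conv (mol r) (dir_deriv v u) x = D v" for v
      using LIMSEQ_unique[OF conv_dir_deriv[OF L r] diff_quot_has_derivative(1)[OF D]] .
    have im: "integrable lborel (\<lambda>y. mol r (x - y) *\<^sub>R dir_deriv v u y)" for v by (rule conv_mol_integrable[OF r i])
    have "conv (mol r) h x = conv (mol r) (dir_deriv v u) x - (\<Sum>b\<in>Basis. (v \<bullet> b) * conv (mol r) (dir_deriv b u) x)"
    proof -
      have "conv (mol r) h x = (\<integral>y. mol r (x - y) *\<^sub>R dir_deriv v u y - (\<Sum>b\<in>Basis. (v \<bullet> b) * (mol r (x - y) *\<^sub>R dir_deriv b u y)) \<partial>lborel)"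
        unfolding conv_def h_def by (intro Bochner_Integration.integral_cong) (auto simp: algebra_simps sum_distrib_left)
      also have "\<dots> = (\<integral>y. mol r (x - y) *\<^sub>R dir_deriv v u y \<partial>lborel) - (\<integral>y. (\<Sum>b\<in>Basis. (v \<bullet> b) * (mol r (x - y) *\<^sub>R dir_deriv b u y)) \<partial>lborel)"
        using im by (intro Bochner_Integration.integral_diff Bochner_Integration.integrable_sum integrable_mult_right) auto
      also have "(\<integral>y. (\<Sum>b\<in>Basis. (v \<bullet> b) * (mol r (x - y) *\<^sub>R dir_deriv b u y)) \<partial>lborel) = (\<Sum>b\<in>Basis. (v \<bullet> b) * (\<integral>y. mol r (x - y) *\<^sub>R dir_deriv b u y \<partial>lborel))"
        using im by (subst Bochner_Integration.integral_sum) (auto intro!: integrable_mult_right)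
      finally show ?thesis by (simp add: conv_def)
    qed
    also have "\<dots> = D v - (\<Sum>b\<in>Basis. (v \<bullet> b) * D b)" by (simp add: Dv)
    also have "\<dots> = 0"
    proof -
      interpret D: bounded_linear D using D by (rule has_derivative_bounded_linear)
      have "D v = D (\<Sum>b\<in>Basis. (v \<bullet> b) *\<^sub>R b)" by (simp add: euclidean_representation)
      then show ?thesis by (simp add: D.sum D.scaleR)
    qed
    finally show "conv (mol r) h x = 0" .
  qed
  then show ?thesis by (simp add: h_def)
qed

text \<open>For almost every point the directional derivatives exist and are linear along a countable dense set of directions.
A finite part of that set is a fine net on the unit sphere, on which the convergence of the quotients is
uniform; the Lipschitz condition extends the estimate from the net to all directions.\<close>

lemma Rademacher_scalar:
  fixes u :: "'a::euclidean_space \<Rightarrow> real"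
  assumes L: "L-lipschitz_on UNIV u" and K: "compact K" "\<And>x. x \<notin> K \<Longrightarrow> u x = 0"
  shows "AE x in lborel. (u has_derivative (\<lambda>v. \<Sum>b\<in>Basis. (v \<bullet> b) * dir_deriv b u x)) (at x)"
proof -
  obtain Q :: "'a set" where Q: "countable Q" "\<And>X. open X \<Longrightarrow> X \<noteq> {} \<Longrightarrow> \<exists>d\<in>Q. d \<in> X"
    using countable_dense_exists by metis
  have "AE x in lborel. \<forall>q\<in>Q. dir_deriv q u x = (\<Sum>b\<in>Basis. (q \<bullet> b) * dir_deriv b u x) \<and> convergent (\<lambda>n. diff_quot q u n x)"
    using Q(1) AE_dir_deriv_linear[OF L K] AE_diff_quot_convergent[OF L] by (subst AE_ball_countable) auto
  then show ?thesis
  proof eventually_elim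
    fix x assume x: "\<forall>q\<in>Q. dir_deriv q u x = (\<Sum>b\<in>Basis. (q \<bullet> b) * dir_deriv b u x) \<and> convergent (\<lambda>n. diff_quot q u n x)"
    define G where "G = (\<Sum>b\<in>Basis. dir_deriv b u x *\<^sub>R b)"
    have G: "(\<Sum>b\<in>Basis. (v \<bullet> b) * dir_deriv b u x) = G \<bullet> v" for v
      unfolding G_def inner_sum_left by (intro sum.cong) (simp_all add: inner_commute)
    have L0: "L \<ge> 0" using L by (simp add: lipschitz_on_def)
    show "(u has_derivative (\<lambda>v. \<Sum>b\<in>Basis. (v \<bullet> b) * dir_deriv b u x)) (at x)"
      unfolding G has_derivative_at_alt
    proof (intro conjI allI impI)
      show "bounded_linear (\<lambda>v. G \<bullet> v)" by (rule bounded_linear_inner_right)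
      fix e :: real assume e: "0 < e"
      define c where "c = L + norm G + 1"
      define \<epsilon> where "\<epsilon> = e / (2 * c)"
      have pos: "c > 0" using L0 by (simp add: c_def add_nonneg_pos)
      have ep: "\<epsilon> > 0" using e pos by (simp add: \<epsilon>_def)
      have ep2: "(L + norm G) * \<epsilon> \<le> e / 2"
      proof -
        have "(L + norm G) * \<epsilon> \<le> c * \<epsilon>" using ep by (intro mult_right_mono) (auto simp: c_def)
        also have "\<dots> = e / 2" using pos by (simp add: \<epsilon>_def)
        finally show ?thesis .
      qed
      \<comment> \<open>A finite net of the unit sphere inside the countable set of good directions.\<close>
      have sub: "sphere (0::'a) 1 \<subseteq> (\<Union>q\<in>Q. ball q \<epsilon>)"
      proof
        fix y :: 'a
        obtain q where "q \<in> Q" "q \<in> ball y \<epsilon>" using Q(2)[of "ball y \<epsilon>"] ep by auto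
        then show "y \<in> (\<Union>q\<in>Q. ball q \<epsilon>)" by (auto simp: dist_commute)
      qed
      obtain C where C: "C \<subseteq> Q" "finite C" "sphere (0::'a) 1 \<subseteq> (\<Union>q\<in>C. ball q \<epsilon>)"
        by (rule compactE_image[OF compact_sphere _ sub]) (auto intro: that)
      have "\<forall>\<^sub>F t in at_right 0. \<forall>q\<in>C. \<bar>(u (x + t *\<^sub>R q) - u x) / t - G \<bullet> q\<bar> < e / 2"
      proof (rule eventually_ball_finite[OF C(2)], rule ballI)
        fix q assume "q \<in> C"
        then have q: "dir_deriv q u x = G \<bullet> q" "convergent (\<lambda>n. diff_quot q u n x)" using x C(1) G[of q] by auto
        from tendstoD[OF sequential_imp_right_derivative[OF L q(2)], of "e / 2"] e
        show "\<forall>\<^sub>F t in at_right 0. \<bar>(u (x + t *\<^sub>R q) - u x) / t - G \<bullet> q\<bar> < e / 2"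
          by (simp add: dist_real_def q(1))
      qed
      then obtain d where d: "d > 0" "\<And>t q. 0 < t \<Longrightarrow> t < d \<Longrightarrow> q \<in> C \<Longrightarrow> \<bar>(u (x + t *\<^sub>R q) - u x) / t - G \<bullet> q\<bar> < e / 2"
        unfolding eventually_at_right_field by blast
      show "\<exists>d>0. \<forall>y. norm (y - x) < d \<longrightarrow> norm (u y - u x - G \<bullet> (y - x)) \<le> e * norm (y - x)"
      proof (intro exI[of _ d] conjI allI impI d(1))
        fix y assume y: "norm (y - x) < d"
        show "norm (u y - u x - G \<bullet> (y - x)) \<le> e * norm (y - x)"
        proof (cases "y = x")
          case False
          define t where "t = norm (y - x)"
          have t: "t > 0" "t < d" using False y by (auto simp: t_def)
          define z where "z = (y - x) /\<^sub>R t"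
          have z: "norm z = 1" "y = x + t *\<^sub>R z" using t by (auto simp: z_def t_def)
          have "z \<in> (\<Union>q\<in>C. ball q \<epsilon>)" by (rule subsetD[OF C(3)]) (simp add: z(1))
          then obtain q where q: "q \<in> C" "norm (z - q) < \<epsilon>" by (auto simp: dist_norm norm_minus_commute)
          have 1: "\<bar>u (x + t *\<^sub>R q) - u x - t * (G \<bullet> q)\<bar> \<le> e / 2 * t"
          proof -
            have "u (x + t *\<^sub>R q) - u x - t * (G \<bullet> q) = ((u (x + t *\<^sub>R q) - u x) / t - G \<bullet> q) * t"
              using t by (simp add: field_simps)
            also have "\<bar>\<dots>\<bar> = \<bar>(u (x + t *\<^sub>R q) - u x) / t - G \<bullet> q\<bar> * t" using t by (simp add: abs_mult)
            also have "\<dots> \<le> e / 2 * t" using d(2)[OF t q(1)] t by (intro mult_right_mono) auto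
            finally show ?thesis .
          qed
          have 2: "\<bar>u (x + t *\<^sub>R z) - u (x + t *\<^sub>R q)\<bar> \<le> L * \<epsilon> * t"
          proof -
            have "\<bar>u (x + t *\<^sub>R z) - u (x + t *\<^sub>R q)\<bar> \<le> L * (t * norm (z - q))"
              using lipschitz_norm[OF L, of "x + t *\<^sub>R z" "x + t *\<^sub>R q"] t by (simp add: scaleR_diff_right[symmetric])
            also have "\<dots> \<le> L * (t * \<epsilon>)" using L0 t q by (intro mult_left_mono) auto
            finally show ?thesis by (simp add: mult_ac)
          qed
          have 3: "\<bar>t * (G \<bullet> q) - t * (G \<bullet> z)\<bar> \<le> norm G * \<epsilon> * t"
          proof -
            have "\<bar>t * (G \<bullet> q) - t * (G \<bullet> z)\<bar> = t * \<bar>G \<bullet> (q - z)\<bar>"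
              using t by (simp add: inner_diff_right abs_mult flip: right_diff_distrib)
            also have "\<bar>G \<bullet> (q - z)\<bar> \<le> norm G * norm (q - z)" by (rule Cauchy_Schwarz_ineq2)
            also have "\<dots> \<le> norm G * \<epsilon>" using q by (intro mult_left_mono) (auto simp: norm_minus_commute)
            finally show ?thesis using t by (simp add: mult_ac)
          qed
          have "\<bar>u (x + t *\<^sub>R z) - u x - t * (G \<bullet> z)\<bar> \<le> e / 2 * t + L * \<epsilon> * t + norm G * \<epsilon> * t"
            using 1 2 3 by linarith
          also have "\<dots> = (e / 2 + (L + norm G) * \<epsilon>) * t" by (simp add: algebra_simps)
          also have "\<dots> \<le> e * t" using ep2 t by (intro mult_right_mono) auto
          finally show ?thesis unfolding z(2) using t z(1) by (simp add: inner_scaleR_right)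
        qed simp
      qed
    qed
  qed
qed

text \<open>A Borel function that agrees almost everywhere with the divergence of a Lipschitz field. It is built from directional
derivatives and is therefore linear, subject to the product rule and compatible with mollification, each time
almost everywhere or better.\<close>

definition borel_div :: "('a::euclidean_space \<Rightarrow> 'a) \<Rightarrow> 'a \<Rightarrow> real" where
  "borel_div \<phi> x = (\<Sum>b\<in>Basis. dir_deriv b (\<lambda>y. \<phi> y \<bullet> b) x)"

lemma borel_div_measurable[measurable]:
  assumes [measurable]: "\<phi> \<in> borel_measurable borel" shows "borel_div \<phi> \<in> borel_measurable borel"
  unfolding borel_div_def[abs_def] by measurable

lemma lipschitz_component:
  assumes "L-lipschitz_on UNIV (\<phi> :: 'a::euclidean_space \<Rightarrow> 'b::euclidean_space)" "b \<in> Basis"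
  shows "L-lipschitz_on UNIV (\<lambda>y. \<phi> y \<bullet> b)"
proof (rule lipschitz_onI)
  show "0 \<le> L" using assms(1) by (simp add: lipschitz_on_def)
  show "dist (\<phi> x \<bullet> b) (\<phi> y \<bullet> b) \<le> L * dist x y" for x y
    using lipschitz_norm[OF assms(1), of x y] Basis_le_norm[OF assms(2), of "\<phi> x - \<phi> y"]
    by (simp add: dist_norm inner_diff_left)
qed

text \<open>The scalar statement applied to the components of the field identifies the diagonal of its Frechet derivative.\<close>

lemma Rademacher:
  fixes \<phi> :: "'a::euclidean_space \<Rightarrow> 'a"
  assumes L: "L-lipschitz_on UNIV \<phi>" and K: "compact K" "\<And>x. x \<notin> K \<Longrightarrow> \<phi> x = 0"
  shows "AE x in lborel. \<phi> differentiable (at x) \<and> divergence \<phi> x = borel_div \<phi> x"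
proof -
  have "AE x in lborel. \<forall>b\<in>Basis. ((\<lambda>y. \<phi> y \<bullet> b) has_derivative (\<lambda>v. \<Sum>c\<in>Basis. (v \<bullet> c) * dir_deriv c (\<lambda>y. \<phi> y \<bullet> b) x)) (at x)"
  proof (rule AE_finite_allI[OF finite_Basis])
    fix b :: 'a assume b: "b \<in> Basis"
    show "AE x in lborel. ((\<lambda>y. \<phi> y \<bullet> b) has_derivative (\<lambda>v. \<Sum>c\<in>Basis. (v \<bullet> c) * dir_deriv c (\<lambda>y. \<phi> y \<bullet> b) x)) (at x)"
      by (rule Rademacher_scalar[OF lipschitz_component[OF L b] K(1)]) (simp add: K(2))
  qed
  then show ?thesis
  proof eventually_elim
    fix x assume *: "\<forall>b\<in>Basis. ((\<lambda>y. \<phi> y \<bullet> b) has_derivative (\<lambda>v. \<Sum>c\<in>Basis. (v \<bullet> c) * dir_deriv c (\<lambda>y. \<phi> y \<bullet> b) x)) (at x)"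
    have d: "\<phi> differentiable (at x)"
      using * by (subst differentiable_componentwise_within) (auto simp: differentiable_def)
    then have D: "(\<phi> has_derivative frechet_derivative \<phi> (at x)) (at x)" by (simp add: frechet_derivative_works)
    have "frechet_derivative \<phi> (at x) b \<bullet> b = dir_deriv b (\<lambda>y. \<phi> y \<bullet> b) x" if b: "b \<in> Basis" for b
    proof -
      have "((\<lambda>y. \<phi> y \<bullet> b) has_derivative (\<lambda>v. frechet_derivative \<phi> (at x) v \<bullet> b)) (at x)"
        by (rule has_derivative_inner_left[OF D])
      from diff_quot_has_derivative(2)[OF this, of b] show ?thesis by simp
    qed
    then show "\<phi> differentiable (at x) \<and> divergence \<phi> x = borel_div \<phi> x"
      using d by (simp add: divergence_def borel_div_def)
  qed
qed

section \<open>Lipschitz fields and their divergence\<close>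

text \<open>Fields are Lipschitz on the whole space and vanish outside an explicit compact set, so that sums, products with
cutoffs and mollifications only have to keep track of that set.\<close>

definition lipc :: "'a::euclidean_space set \<Rightarrow> ('a \<Rightarrow> 'b::euclidean_space) \<Rightarrow> bool" where
  "lipc K \<phi> \<longleftrightarrow> compact K \<and> (\<exists>L. L-lipschitz_on UNIV \<phi>) \<and> (\<forall>x. x \<notin> K \<longrightarrow> \<phi> x = 0)"

lemma lipcE:
  assumes "lipc K \<phi>"
  obtains L where "compact K" "L-lipschitz_on UNIV \<phi>" "\<And>x. x \<notin> K \<Longrightarrow> \<phi> x = 0"
  using assms by (auto simp: lipc_def)

lemma lipcI:
  "compact K \<Longrightarrow> L-lipschitz_on UNIV \<phi> \<Longrightarrow> (\<And>x. x \<notin> K \<Longrightarrow> \<phi> x = 0) \<Longrightarrow> lipc K \<phi>"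
  by (auto simp: lipc_def)

lemma lipc_mono: "lipc K \<phi> \<Longrightarrow> K \<subseteq> K' \<Longrightarrow> compact K' \<Longrightarrow> lipc K' \<phi>"
  by (auto simp: lipc_def)

lemma lipc_borel: "lipc K \<phi> \<Longrightarrow> \<phi> \<in> borel_measurable borel"
  by (auto simp: lipc_def lipschitz_borel)

lemma lipc_bounded:
  assumes "lipc K \<phi>" obtains B where "B > 0" "\<And>x. norm (\<phi> x) \<le> B"
proof -
  obtain L where L: "compact K" "L-lipschitz_on UNIV \<phi>" "\<And>x. x \<notin> K \<Longrightarrow> \<phi> x = 0" using lipcE[OF assms] by metis
  show ?thesis by (rule lipschitz_bounded[OF L(2,1,3)]) (auto intro: that)
qed

lemma lipc_zero: "compact K \<Longrightarrow> lipc K (\<lambda>x. 0)"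
  by (auto simp: lipc_def lipschitz_on_def intro: exI[of _ 0])

lemma lipc_add:
  assumes "lipc K \<phi>" "lipc K' \<psi>" shows "lipc (K \<union> K') (\<lambda>x. \<phi> x + \<psi> x)"
  using assms unfolding lipc_def by (auto intro: lipschitz_on_add compact_Un)

lemma lipc_cmult:
  assumes "lipc K \<phi>" shows "lipc K (\<lambda>x. c *\<^sub>R \<phi> x)"
  using assms unfolding lipc_def by (auto intro!: lipschitz_on_cmult)

lemma lipc_diff:
  assumes "lipc K \<phi>" "lipc K' \<psi>" shows "lipc (K \<union> K') (\<lambda>x. \<phi> x - \<psi> x)"
  using lipc_add[OF assms(1) lipc_cmult[OF assms(2), of "-1"]] by simp

lemma lipc_sum:
  assumes "finite I" "\<And>i. i \<in> I \<Longrightarrow> lipc K (\<phi> i)" "compact K" shows "lipc K (\<lambda>x. \<Sum>i\<in>I. \<phi> i x)"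
  using assms(1,2)
proof (induction I)
  case empty then show ?case using lipc_zero[OF assms(3)] by simp
next
  case (insert i I)
  then show ?case using lipc_add[of K "\<phi> i" K] by simp
qed

text \<open>The new support set \<open>K'\<close> may be smaller than \<open>K\<close>; this is how cutoffs localise a field.\<close>

lemma lipc_mult:
  fixes \<zeta> :: "'a::euclidean_space \<Rightarrow> real" and \<phi> :: "'a \<Rightarrow> 'b::euclidean_space"
  assumes z: "M-lipschitz_on UNIV \<zeta>" "\<And>x. \<bar>\<zeta> x\<bar> \<le> A" and p: "lipc K \<phi>"
    and K': "compact K'" "\<And>x. x \<in> K \<Longrightarrow> \<zeta> x \<noteq> 0 \<Longrightarrow> x \<in> K'"
  shows "lipc K' (\<lambda>x. \<zeta> x *\<^sub>R \<phi> x)"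
proof -
  obtain L where L: "compact K" "L-lipschitz_on UNIV \<phi>" "\<And>x. x \<notin> K \<Longrightarrow> \<phi> x = 0" using lipcE[OF p] by metis
  obtain B where B: "B > 0" "\<And>x. norm (\<phi> x) \<le> B" using lipc_bounded[OF p] by metis
  have A0: "A \<ge> 0" using z(2)[of 0] by linarith
  have M0: "M \<ge> 0" "L \<ge> 0" using z(1) L(2) by (auto simp: lipschitz_on_def)
  show ?thesis
  proof (rule lipcI[OF K'(1)])
    show "(A * L + M * B)-lipschitz_on UNIV (\<lambda>x. \<zeta> x *\<^sub>R \<phi> x)"
    proof (rule lipschitz_onI)
      show "0 \<le> A * L + M * B" using A0 M0 B by simp
      fix x y
      have "\<zeta> x *\<^sub>R \<phi> x - \<zeta> y *\<^sub>R \<phi> y = \<zeta> x *\<^sub>R (\<phi> x - \<phi> y) + (\<zeta> x - \<zeta> y) *\<^sub>R \<phi> y" by (simp add: algebra_simps)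
      then have "norm (\<zeta> x *\<^sub>R \<phi> x - \<zeta> y *\<^sub>R \<phi> y) \<le> \<bar>\<zeta> x\<bar> * norm (\<phi> x - \<phi> y) + \<bar>\<zeta> x - \<zeta> y\<bar> * norm (\<phi> y)"
        by (metis norm_scaleR norm_triangle_ineq)
      also have "\<dots> \<le> A * (L * norm (x - y)) + (M * norm (x - y)) * B"
        using z(2)[of x] lipschitz_norm[OF L(2), of x y] lipschitz_norm[OF z(1), of x y] B(2)[of y] A0 M0 B(1)
        by (intro add_mono mult_mono) auto
      finally show "dist (\<zeta> x *\<^sub>R \<phi> x) (\<zeta> y *\<^sub>R \<phi> y) \<le> (A * L + M * B) * dist x y"
        by (simp add: dist_norm algebra_simps)
    qed
    show "\<zeta> x *\<^sub>R \<phi> x = 0" if "x \<notin> K'" for x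
      using K'(2)[of x] L(3)[of x] that by (cases "x \<in> K") auto
  qed
qed

text \<open>The nearest point projection onto a ball is a contraction fixing the origin, so truncating a field
preserves its Lipschitz constant and its support.\<close>

lemma lipc_clamp:
  assumes p: "lipc K (\<phi> :: 'a::euclidean_space \<Rightarrow> 'b::euclidean_space)" and M: "M \<ge> 0"
  shows "lipc K (\<lambda>x. closest_point (cball 0 M) (\<phi> x))"
proof -
  obtain L where L: "compact K" "L-lipschitz_on UNIV \<phi>" "\<And>x. x \<notin> K \<Longrightarrow> \<phi> x = 0" using lipcE[OF p] by metis
  show ?thesis
  proof (rule lipcI[OF L(1)])
    show "L-lipschitz_on UNIV (\<lambda>x. closest_point (cball 0 M) (\<phi> x))"
    proof (rule lipschitz_onI)
      show "0 \<le> L" using L(2) by (simp add: lipschitz_on_def)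
      fix x y
      have "dist (closest_point (cball 0 M) (\<phi> x)) (closest_point (cball 0 M) (\<phi> y)) \<le> dist (\<phi> x) (\<phi> y)"
        by (rule closest_point_lipschitz) (use M in auto)
      also have "\<dots> \<le> L * dist x y" using lipschitz_norm[OF L(2), of x y] by (simp add: dist_norm)
      finally show "dist (closest_point (cball 0 M) (\<phi> x)) (closest_point (cball 0 M) (\<phi> y)) \<le> L * dist x y" .
    qed
    show "closest_point (cball 0 M) (\<phi> x) = 0" if "x \<notin> K" for x
      using L(3)[OF that] M by (simp add: clamp_to_ball(3))
  qed
qed

lemma conv_zero:
  fixes g :: "'a::euclidean_space \<Rightarrow> 'b::euclidean_space"
  assumes "r > 0" "\<And>y. dist x y < r \<Longrightarrow> g y = 0"
  shows "conv (mol r) g x = 0"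
proof -
  have "mol r (x - y) *\<^sub>R g y = 0" for y
    using assms(2)[of y] mol_support[OF assms(1), of "x - y"] by (cases "dist x y < r") (auto simp: dist_norm)
  then have "(\<lambda>y. mol r (x - y) *\<^sub>R g y) = (\<lambda>y. 0)" by (intro ext)
  then show ?thesis by (simp only: conv_def integral_zero)
qed

lemma lipc_conv:
  fixes \<phi> :: "'a::euclidean_space \<Rightarrow> 'b::euclidean_space"
  assumes p: "lipc K \<phi>" and r: "r > 0" and K': "compact K'" "\<And>x y. y \<in> K \<Longrightarrow> dist x y < r \<Longrightarrow> x \<in> K'"
  shows "lipc K' (conv (mol r) \<phi>)"
proof -
  obtain L where L: "compact K" "L-lipschitz_on UNIV \<phi>" "\<And>x. x \<notin> K \<Longrightarrow> \<phi> x = 0" using lipcE[OF p] by metis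
  have pm[measurable]: "\<phi> \<in> borel_measurable borel" by (rule lipc_borel[OF p])
  obtain B where B: "B > 0" "\<And>x. norm (\<phi> x) \<le> B" using lipc_bounded[OF p] by metis
  have L0: "L \<ge> 0" using L(2) by (simp add: lipschitz_on_def)
  have i: "integrable lborel (\<lambda>z. mol r z *\<^sub>R \<phi> (x - z))" for x
  proof (rule Bochner_Integration.integrable_bound)
    show "integrable lborel (\<lambda>z::'a. B * mol r z)" by (intro integrable_mult_right mol_integrable r)
    show "AE z in lborel. norm (mol r z *\<^sub>R \<phi> (x - z)) \<le> norm (B * mol r z)"
    proof (rule AE_I2)
      fix z :: 'a
      have "mol r z * norm (\<phi> (x - z)) \<le> mol r z * B" by (intro mult_left_mono B mol_nonneg)
      then show "norm (mol r z *\<^sub>R \<phi> (x - z)) \<le> norm (B * mol r z)"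
        using B(1) by (simp add: abs_mult mol_nonneg mult.commute)
    qed
  qed simp
  show ?thesis
  proof (rule lipcI[OF K'(1)])
    show "L-lipschitz_on UNIV (conv (mol r) \<phi>)"
    proof (rule lipschitz_onI[OF _ L0])
      fix x y :: 'a
      have "conv (mol r) \<phi> x - conv (mol r) \<phi> y = (\<integral>z. mol r z *\<^sub>R \<phi> (x - z) - mol r z *\<^sub>R \<phi> (y - z) \<partial>lborel)"
        by (simp add: conv_reflect i)
      also have "norm \<dots> \<le> (\<integral>z. norm (mol r z *\<^sub>R \<phi> (x - z) - mol r z *\<^sub>R \<phi> (y - z)) \<partial>lborel)" by (rule integral_norm_bound)
      also have "\<dots> \<le> (\<integral>z. (L * norm (x - y)) * mol r (z::'a) \<partial>lborel)"
      proof (rule integral_mono)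
        show "integrable lborel (\<lambda>z. norm (mol r z *\<^sub>R \<phi> (x - z) - mol r z *\<^sub>R \<phi> (y - z)))"
          by (intro integrable_norm Bochner_Integration.integrable_diff i)
        show "integrable lborel (\<lambda>z::'a. (L * norm (x - y)) * mol r z)" by (intro integrable_mult_right mol_integrable r)
        show "norm (mol r z *\<^sub>R \<phi> (x - z) - mol r z *\<^sub>R \<phi> (y - z)) \<le> (L * norm (x - y)) * mol r z" for z
          using lipschitz_norm[OF L(2), of "x - z" "y - z"] mol_nonneg[of r z]
          by (simp add: scaleR_diff_right[symmetric] mult.commute[of _ "mol r z"] mult_left_mono)
      qed
      also have "\<dots> = L * norm (x - y)" by (simp add: integral_mol[OF r])
      finally show "dist (conv (mol r) \<phi> x) (conv (mol r) \<phi> y) \<le> L * dist x y" by (simp add: dist_norm)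
    qed
    show "conv (mol r) \<phi> x = 0" if "x \<notin> K'" for x
      by (rule conv_zero[OF r]) (use K'(2) L(3) that in blast)
  qed
qed

lemma borel_div_zero_outside:
  assumes "lipc K \<phi>" "x \<notin> K" shows "borel_div \<phi> x = 0"
proof -
  obtain L where L: "compact K" "L-lipschitz_on UNIV \<phi>" "\<And>x. x \<notin> K \<Longrightarrow> \<phi> x = 0" using lipcE[OF assms(1)] by metis
  show ?thesis unfolding borel_div_def
    by (intro sum.neutral ballI dir_deriv_zero_outside[OF compact_imp_closed[OF L(1)] _ assms(2)]) (simp add: L(3))
qed

lemma borel_div_bounded:
  assumes "lipc K \<phi>"
  obtains B where "B > 0" "AE x in lborel. \<bar>borel_div \<phi> x\<bar> \<le> B"
proof -
  obtain L where L: "compact K" "L-lipschitz_on UNIV \<phi>" "\<And>x. x \<notin> K \<Longrightarrow> \<phi> x = 0" using lipcE[OF assms(1)] by metis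
  have "AE x in lborel. \<forall>b\<in>Basis. \<bar>dir_deriv b (\<lambda>y. \<phi> y \<bullet> b) x\<bar> \<le> L * norm b"
    by (rule AE_finite_allI[OF finite_Basis]) (rule AE_dir_deriv_bound[OF lipschitz_component[OF L(2)]])
  then have "AE x in lborel. \<bar>borel_div \<phi> x\<bar> \<le> (\<Sum>b\<in>(Basis::'a set). L * norm b) + 1"
  proof eventually_elim
    fix x assume "\<forall>b\<in>Basis. \<bar>dir_deriv b (\<lambda>y. \<phi> y \<bullet> b) x\<bar> \<le> L * norm b"
    then have "\<bar>borel_div \<phi> x\<bar> \<le> (\<Sum>b\<in>(Basis::'a set). L * norm b)" unfolding borel_div_def
      by (intro order_trans[OF sum_abs] sum_mono) auto
    then show "\<bar>borel_div \<phi> x\<bar> \<le> (\<Sum>b\<in>(Basis::'a set). L * norm b) + 1" by simp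
  qed
  moreover have "(\<Sum>b\<in>(Basis::'a set). L * norm b) + 1 > 0"
    using L(2) by (intro add_nonneg_pos sum_nonneg) (auto simp: lipschitz_on_def)
  ultimately show ?thesis using that by blast
qed

lemma integrable_mult_borel_div:
  assumes p: "lipc K \<phi>" and h: "integrable lborel h"
  shows "integrable lborel (\<lambda>x. h x * borel_div \<phi> x)"
proof -
  have [measurable]: "\<phi> \<in> borel_measurable borel" "h \<in> borel_measurable borel" using lipc_borel[OF p] h by auto
  obtain B where B: "B > 0" "AE x in lborel. \<bar>borel_div \<phi> x\<bar> \<le> B" using borel_div_bounded[OF p] by metis
  show ?thesis
  proof (rule Bochner_Integration.integrable_bound)
    show "integrable lborel (\<lambda>x. B * h x)" using h by simp
    show "AE x in lborel. norm (h x * borel_div \<phi> x) \<le> norm (B * h x)"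
      using B(2)
    proof eventually_elim
      fix x assume "\<bar>borel_div \<phi> x\<bar> \<le> B"
      then have "\<bar>h x\<bar> * \<bar>borel_div \<phi> x\<bar> \<le> \<bar>h x\<bar> * B" by (intro mult_left_mono) auto
      then show "norm (h x * borel_div \<phi> x) \<le> norm (B * h x)" using B(1) by (simp add: abs_mult mult.commute)
    qed
  qed measurable
qed

definition grad :: "('a::euclidean_space \<Rightarrow> real) \<Rightarrow> 'a \<Rightarrow> 'a" where
  "grad \<zeta> x = (\<Sum>b\<in>Basis. dir_deriv b \<zeta> x *\<^sub>R b)"

lemma grad_measurable[measurable]:
  assumes [measurable]: "\<zeta> \<in> borel_measurable borel" shows "grad \<zeta> \<in> borel_measurable borel"
  unfolding grad_def[abs_def] by measurable

lemma AE_diff_quot_components: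
  assumes "L-lipschitz_on UNIV (\<phi> :: 'a::euclidean_space \<Rightarrow> 'a)"
  shows "AE x in lborel. \<forall>b\<in>Basis. (\<lambda>n. diff_quot b (\<lambda>y. \<phi> y \<bullet> b) n x) \<longlonglongrightarrow> dir_deriv b (\<lambda>y. \<phi> y \<bullet> b) x"
  by (rule AE_finite_allI[OF finite_Basis]) (rule AE_diff_quot_tendsto[OF lipschitz_component[OF assms]])

lemma dir_deriv_eqI: "(\<lambda>n. diff_quot v u n x) \<longlonglongrightarrow> l \<Longrightarrow> dir_deriv v u x = l"
  unfolding dir_deriv_def by (rule limI)

lemma AE_borel_div_add:
  assumes "L-lipschitz_on UNIV \<phi>" "M-lipschitz_on UNIV \<psi>"
  shows "AE x in lborel. borel_div (\<lambda>y. \<phi> y + \<psi> y) x = borel_div \<phi> x + borel_div \<psi> x"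
  using AE_diff_quot_components[OF assms(1)] AE_diff_quot_components[OF assms(2)]
proof eventually_elim
  fix x
  assume a: "\<forall>b\<in>Basis. (\<lambda>n. diff_quot b (\<lambda>y. \<phi> y \<bullet> b) n x) \<longlonglongrightarrow> dir_deriv b (\<lambda>y. \<phi> y \<bullet> b) x"
    "\<forall>b\<in>Basis. (\<lambda>n. diff_quot b (\<lambda>y. \<psi> y \<bullet> b) n x) \<longlonglongrightarrow> dir_deriv b (\<lambda>y. \<psi> y \<bullet> b) x"
  have "dir_deriv b (\<lambda>y. (\<phi> y + \<psi> y) \<bullet> b) x = dir_deriv b (\<lambda>y. \<phi> y \<bullet> b) x + dir_deriv b (\<lambda>y. \<psi> y \<bullet> b) x" if "b \<in> Basis" for b
  proof (rule dir_deriv_eqI)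
    have "(\<lambda>n. diff_quot b (\<lambda>y. \<phi> y \<bullet> b) n x + diff_quot b (\<lambda>y. \<psi> y \<bullet> b) n x) \<longlonglongrightarrow> dir_deriv b (\<lambda>y. \<phi> y \<bullet> b) x + dir_deriv b (\<lambda>y. \<psi> y \<bullet> b) x"
      using a that by (intro tendsto_add) auto
    then show "(\<lambda>n. diff_quot b (\<lambda>y. (\<phi> y + \<psi> y) \<bullet> b) n x) \<longlonglongrightarrow> dir_deriv b (\<lambda>y. \<phi> y \<bullet> b) x + dir_deriv b (\<lambda>y. \<psi> y \<bullet> b) x"
      by (simp add: diff_quot_def inner_add_left algebra_simps)
  qed
  then show "borel_div (\<lambda>y. \<phi> y + \<psi> y) x = borel_div \<phi> x + borel_div \<psi> x" by (simp add: borel_div_def sum.distrib)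
qed

lemma AE_borel_div_mult:
  fixes \<zeta> :: "'a::euclidean_space \<Rightarrow> real"
  assumes z: "M-lipschitz_on UNIV \<zeta>" and p: "L-lipschitz_on UNIV \<phi>"
  shows "AE x in lborel. borel_div (\<lambda>y. \<zeta> y *\<^sub>R \<phi> y) x = \<zeta> x * borel_div \<phi> x + grad \<zeta> x \<bullet> \<phi> x"
proof -
  have "AE x in lborel. \<forall>b\<in>(Basis::'a set). (\<lambda>n. diff_quot b \<zeta> n x) \<longlonglongrightarrow> dir_deriv b \<zeta> x"
    by (rule AE_finite_allI[OF finite_Basis]) (rule AE_diff_quot_tendsto[OF z])
  with AE_diff_quot_components[OF p] show ?thesis
  proof eventually_elim
    fix x
    assume a: "\<forall>b\<in>Basis. (\<lambda>n. diff_quot b (\<lambda>y. \<phi> y \<bullet> b) n x) \<longlonglongrightarrow> dir_deriv b (\<lambda>y. \<phi> y \<bullet> b) x"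
      "\<forall>b\<in>Basis. (\<lambda>n. diff_quot b \<zeta> n x) \<longlonglongrightarrow> dir_deriv b \<zeta> x"
    have "dir_deriv b (\<lambda>y. (\<zeta> y *\<^sub>R \<phi> y) \<bullet> b) x = \<zeta> x * dir_deriv b (\<lambda>y. \<phi> y \<bullet> b) x + dir_deriv b \<zeta> x * (\<phi> x \<bullet> b)" if b: "b \<in> Basis" for b
    proof (rule dir_deriv_eqI)
      have "(\<lambda>n. x + (1 / real (Suc n)) *\<^sub>R b) \<longlonglongrightarrow> x + 0 *\<^sub>R b"
        by (intro tendsto_intros) (use LIMSEQ_inverse_real_of_nat in \<open>simp add: inverse_eq_divide\<close>)
      then have lim: "(\<lambda>n. \<phi> (x + (1 / real (Suc n)) *\<^sub>R b)) \<longlonglongrightarrow> \<phi> x"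
        using continuous_on_tendsto_compose[OF lipschitz_continuous[OF p], of "\<lambda>n. x + (1 / real (Suc n)) *\<^sub>R b" x] by simp
      have "(\<lambda>n. \<zeta> x * diff_quot b (\<lambda>y. \<phi> y \<bullet> b) n x + diff_quot b \<zeta> n x * (\<phi> (x + (1 / real (Suc n)) *\<^sub>R b) \<bullet> b))
        \<longlonglongrightarrow> \<zeta> x * dir_deriv b (\<lambda>y. \<phi> y \<bullet> b) x + dir_deriv b \<zeta> x * (\<phi> x \<bullet> b)"
        using a b lim by (intro tendsto_intros) auto
      then show "(\<lambda>n. diff_quot b (\<lambda>y. (\<zeta> y *\<^sub>R \<phi> y) \<bullet> b) n x) \<longlonglongrightarrow> \<zeta> x * dir_deriv b (\<lambda>y. \<phi> y \<bullet> b) x + dir_deriv b \<zeta> x * (\<phi> x \<bullet> b)"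
        by (simp add: diff_quot_def algebra_simps)
    qed
    then have "borel_div (\<lambda>y. \<zeta> y *\<^sub>R \<phi> y) x = \<zeta> x * borel_div \<phi> x + (\<Sum>b\<in>Basis. dir_deriv b \<zeta> x * (\<phi> x \<bullet> b))"
      unfolding borel_div_def sum_distrib_left sum.distrib[symmetric] by (intro sum.cong) auto
    moreover have "grad \<zeta> x \<bullet> \<phi> x = (\<Sum>b\<in>Basis. dir_deriv b \<zeta> x * (\<phi> x \<bullet> b))"
      unfolding grad_def inner_sum_left by (intro sum.cong) (simp_all add: inner_commute)
    ultimately show "borel_div (\<lambda>y. \<zeta> y *\<^sub>R \<phi> y) x = \<zeta> x * borel_div \<phi> x + grad \<zeta> x \<bullet> \<phi> x" by simp
  qed
qed

lemma dir_deriv_cmult: 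
  assumes "(\<lambda>n. diff_quot v u n x) \<longlonglongrightarrow> dir_deriv v u x"
  shows "dir_deriv v (\<lambda>y. c * u y) x = c * dir_deriv v u x"
proof (rule dir_deriv_eqI)
  have "(\<lambda>n. c * diff_quot v u n x) \<longlonglongrightarrow> c * dir_deriv v u x" by (intro tendsto_intros assms)
  then show "(\<lambda>n. diff_quot v (\<lambda>y. c * u y) n x) \<longlonglongrightarrow> c * dir_deriv v u x" by (simp add: diff_quot_def algebra_simps)
qed

lemma AE_borel_div_cmult:
  assumes "L-lipschitz_on UNIV \<phi>"
  shows "AE x in lborel. borel_div (\<lambda>y. c *\<^sub>R \<phi> y) x = c * borel_div \<phi> x"
  using AE_diff_quot_components[OF assms]
  by eventually_elim (simp add: borel_div_def dir_deriv_cmult sum_distrib_left)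

text \<open>This identity holds at every point, since for a mollified function the difference quotients converge everywhere.\<close>

lemma borel_div_conv:
  assumes p: "lipc K \<phi>" and r: "r > 0"
  shows "borel_div (conv (mol r) \<phi>) x = conv (mol r) (borel_div \<phi>) x"
proof -
  obtain L where L: "compact K" "L-lipschitz_on UNIV \<phi>" "\<And>x. x \<notin> K \<Longrightarrow> \<phi> x = 0" using lipcE[OF p] by metis
  have ip: "integrable lborel \<phi>" by (rule integrable_lipschitz[OF L(2,1,3)])
  have comp: "conv (mol r) \<phi> y \<bullet> b = conv (mol r) (\<lambda>y. \<phi> y \<bullet> b) y" for y b
    unfolding conv_def using conv_mol_integrable[OF r ip, of y] by (simp flip: integral_inner_left)
  have "borel_div (conv (mol r) \<phi>) x = (\<Sum>b\<in>Basis. conv (mol r) (dir_deriv b (\<lambda>y. \<phi> y \<bullet> b)) x)"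
    unfolding borel_div_def comp
    by (intro sum.cong refl dir_deriv_eqI conv_dir_deriv[OF lipschitz_component[OF L(2)] r])
  also have "\<dots> = conv (mol r) (borel_div \<phi>) x"
  proof -
    have "integrable lborel (dir_deriv b (\<lambda>y. \<phi> y \<bullet> b))" if "b \<in> Basis" for b
      by (rule integrable_dir_deriv[OF lipschitz_component[OF L(2) that] L(1)]) (simp add: L(3))
    then have "integrable lborel (\<lambda>y. mol r (x - y) *\<^sub>R dir_deriv b (\<lambda>y. \<phi> y \<bullet> b) y)" if "b \<in> Basis" for b
      using that by (intro conv_mol_integrable[OF r])
    then show ?thesis unfolding conv_def borel_div_def
      by (subst Bochner_Integration.integral_sum[symmetric]) (auto simp: sum_distrib_left)
  qed
  finally show ?thesis .
qed

section \<open>Pairing functions with fields\<close>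

text \<open>All variations are suprema of this pairing, in which the function is Borel and the divergence
is the Borel one.\<close>

definition pairing :: "('a::euclidean_space \<Rightarrow> real) \<Rightarrow> ('a \<Rightarrow> 'a) \<Rightarrow> real" where
  "pairing f \<phi> = (\<integral>x. f x * borel_div \<phi> x \<partial>lborel)"

text \<open>Functions on \<open>\<Omega>\<close> are represented by Borel functions on the whole space that vanish outside \<open>\<Omega>\<close>.\<close>

definition locally_integrable :: "'a::euclidean_space set \<Rightarrow> ('a \<Rightarrow> real) \<Rightarrow> bool" where
  "locally_integrable \<Omega> f \<longleftrightarrow> f \<in> borel_measurable borel \<and> (\<forall>K. compact K \<and> K \<subseteq> \<Omega> \<longrightarrow> integrable lborel (\<lambda>x. indicator K x * f x))
    \<and> (\<forall>x. x \<notin> \<Omega> \<longrightarrow> f x = 0)"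

lemma locally_integrable_borel: "locally_integrable \<Omega> f \<Longrightarrow> f \<in> borel_measurable borel"
  by (simp add: locally_integrable_def)

lemma integrable_locally_integrable_bounded:
  assumes f: "locally_integrable \<Omega> f" and K: "compact K" "K \<subseteq> \<Omega>" and h: "h \<in> borel_measurable borel" "AE x in lborel. norm (h x) \<le> B"
    "\<And>x. x \<notin> K \<Longrightarrow> h x = (0::'b::euclidean_space)"
  shows "integrable lborel (\<lambda>x. f x *\<^sub>R h x)"
proof (rule Bochner_Integration.integrable_bound)
  have [measurable]: "f \<in> borel_measurable borel" "h \<in> borel_measurable borel" using locally_integrable_borel[OF f] h by auto
  show "integrable lborel (\<lambda>x. B * (indicator K x * f x))" using f K by (intro integrable_mult_right) (auto simp: locally_integrable_def)
  show "AE x in lborel. norm (f x *\<^sub>R h x) \<le> norm (B * (indicator K x * f x))"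
    using h(2)
  proof eventually_elim
    fix x assume b: "norm (h x) \<le> B"
    then have "\<bar>f x\<bar> * norm (h x) \<le> \<bar>f x\<bar> * \<bar>B\<bar>" by (intro mult_left_mono) auto
    then show "norm (f x *\<^sub>R h x) \<le> norm (B * (indicator K x * f x))" using h(3)[of x]
      by (cases "x \<in> K") (auto simp: abs_mult mult.commute)
  qed
  show "(\<lambda>x. f x *\<^sub>R h x) \<in> borel_measurable lborel" by simp
qed

lemma integrable_pairing:
  assumes f: "locally_integrable \<Omega> f" and p: "lipc K \<phi>" and K: "K \<subseteq> \<Omega>"
  shows "integrable lborel (\<lambda>x. f x * borel_div \<phi> x)"
proof -
  obtain B where B: "AE x in lborel. \<bar>borel_div \<phi> x\<bar> \<le> B" using borel_div_bounded[OF p] by metis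
  have "compact K" using p by (simp add: lipc_def)
  have "integrable lborel (\<lambda>x. f x *\<^sub>R borel_div \<phi> x)"
    by (rule integrable_locally_integrable_bounded[OF f \<open>compact K\<close> K _ _ borel_div_zero_outside[OF p]])
       (use B lipc_borel[OF p] in auto)
  then show ?thesis by simp
qed

lemma pairing_add:
  assumes f: "locally_integrable \<Omega> f" and p: "lipc K \<phi>" "K \<subseteq> \<Omega>" "lipc K' \<psi>" "K' \<subseteq> \<Omega>"
  shows "pairing f (\<lambda>x. \<phi> x + \<psi> x) = pairing f \<phi> + pairing f \<psi>"
proof -
  have [measurable]: "f \<in> borel_measurable borel" "\<phi> \<in> borel_measurable borel" "\<psi> \<in> borel_measurable borel"
    using locally_integrable_borel[OF f] lipc_borel p by auto
  have "AE x in lborel. borel_div (\<lambda>y. \<phi> y + \<psi> y) x = borel_div \<phi> x + borel_div \<psi> x"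
    using p AE_borel_div_add by (auto simp: lipc_def)
  then have "pairing f (\<lambda>x. \<phi> x + \<psi> x) = (\<integral>x. f x * borel_div \<phi> x + f x * borel_div \<psi> x \<partial>lborel)"
    unfolding pairing_def by (intro integral_cong_AE) (auto elim!: eventually_mono simp: algebra_simps)
  also have "\<dots> = pairing f \<phi> + pairing f \<psi>" unfolding pairing_def
    by (rule Bochner_Integration.integral_add[OF integrable_pairing[OF f p(1,2)] integrable_pairing[OF f p(3,4)]])
  finally show ?thesis .
qed

lemma pairing_cmult:
  assumes f: "locally_integrable \<Omega> f" and p: "lipc K \<phi>"
  shows "pairing f (\<lambda>x. c *\<^sub>R \<phi> x) = c * pairing f \<phi>"
proof -
  have [measurable]: "f \<in> borel_measurable borel" "\<phi> \<in> borel_measurable borel"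
    using locally_integrable_borel[OF f] lipc_borel p by auto
  have "AE x in lborel. borel_div (\<lambda>y. c *\<^sub>R \<phi> y) x = c * borel_div \<phi> x"
    using p AE_borel_div_cmult by (auto simp: lipc_def)
  then have "pairing f (\<lambda>x. c *\<^sub>R \<phi> x) = (\<integral>x. c * (f x * borel_div \<phi> x) \<partial>lborel)"
    unfolding pairing_def by (intro integral_cong_AE) (auto elim!: eventually_mono simp: algebra_simps)
  then show ?thesis by (simp add: pairing_def)
qed

lemma pairing_zero: "pairing f (\<lambda>x. 0) = 0"
proof -
  have "borel_div (\<lambda>x. 0) x = 0" for x :: 'a
    unfolding borel_div_def using dir_deriv_zero_open(2)[of UNIV x "\<lambda>x. 0"] by simp
  then show ?thesis by (simp add: pairing_def)
qed

lemma pairing_sum: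
  assumes f: "locally_integrable \<Omega> f" and "finite I" "\<And>i. i \<in> I \<Longrightarrow> lipc K (\<phi> i)" "compact K" "K \<subseteq> \<Omega>"
  shows "pairing f (\<lambda>x. \<Sum>i\<in>I. \<phi> i x) = (\<Sum>i\<in>I. pairing f (\<phi> i))"
  using assms(2,3)
proof (induction I)
  case empty then show ?case by (simp add: pairing_zero)
next
  case (insert i I)
  have "pairing f (\<lambda>x. \<phi> i x + (\<Sum>i\<in>I. \<phi> i x)) = pairing f (\<phi> i) + pairing f (\<lambda>x. \<Sum>i\<in>I. \<phi> i x)"
    by (rule pairing_add[OF f _ assms(5) _ assms(5)]) (use insert lipc_sum[OF _ _ assms(4)] in auto)
  then show ?case using insert by simp
qed

text \<open>Mollification is symmetric with respect to the integral, because the mollifier is even.\<close>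

lemma conv_duality:
  fixes g h :: "'a::euclidean_space \<Rightarrow> real"
  assumes g: "integrable lborel g" and h: "h \<in> borel_measurable borel" "AE x in lborel. \<bar>h x\<bar> \<le> B" and r: "r > 0"
  shows "(\<integral>x. g x * conv (mol r) h x \<partial>lborel) = (\<integral>x. conv (mol r) g x * h x \<partial>lborel)"
proof -
  have [measurable]: "g \<in> borel_measurable borel" "h \<in> borel_measurable borel" using g h by auto
  have int: "integrable (lborel \<Otimes>\<^sub>M lborel) (\<lambda>(x, y). g x * (mol r (x - y) * h y))"
  proof (rule integrableI_bounded)
    show "(\<lambda>(x, y). g x * (mol r (x - y) * h y)) \<in> borel_measurable (lborel \<Otimes>\<^sub>M lborel)" by measurable
    have "(\<integral>\<^sup>+p. ennreal (norm (case p of (x, y) \<Rightarrow> g x * (mol r (x - y) * h y))) \<partial>(lborel \<Otimes>\<^sub>M lborel))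
      = (\<integral>\<^sup>+x. \<integral>\<^sup>+y. ennreal \<bar>g x\<bar> * (ennreal (mol r (x - y)) * ennreal \<bar>h y\<bar>) \<partial>lborel \<partial>lborel)"
      by (subst lborel.nn_integral_fst[symmetric]) (auto simp: abs_mult ennreal_mult mol_nonneg split_beta intro!: nn_integral_cong)
    also have "\<dots> \<le> (\<integral>\<^sup>+x. \<integral>\<^sup>+y. ennreal \<bar>g x\<bar> * (ennreal (mol r (x - y)) * ennreal B) \<partial>lborel \<partial>lborel)"
      using h(2) by (intro nn_integral_mono nn_integral_mono_AE) (auto elim!: eventually_mono intro!: mult_left_mono ennreal_leI)
    also have "\<dots> = (\<integral>\<^sup>+x. ennreal \<bar>g x\<bar> * ennreal B \<partial>lborel)"
      by (intro nn_integral_cong) (simp add: nn_integral_cmult nn_integral_multc nn_integral_mol'[OF r])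
    also have "\<dots> = (\<integral>\<^sup>+x. ennreal \<bar>g x\<bar> \<partial>lborel) * ennreal B" by (simp add: nn_integral_multc)
    also have "\<dots> < \<infinity>" using g by (simp add: integrable_iff_bounded ennreal_mult_less_top)
    finally show "(\<integral>\<^sup>+p. ennreal (norm (case p of (x, y) \<Rightarrow> g x * (mol r (x - y) * h y))) \<partial>(lborel \<Otimes>\<^sub>M lborel)) < \<infinity>" .
  qed
  have "(\<integral>x. g x * conv (mol r) h x \<partial>lborel) = (\<integral>x. \<integral>y. g x * (mol r (x - y) * h y) \<partial>lborel \<partial>lborel)"
    unfolding conv_def by simp
  also have "\<dots> = (\<integral>y. \<integral>x. g x * (mol r (x - y) * h y) \<partial>lborel \<partial>lborel)"
    using lborel_pair.Fubini_integral[OF int] by simp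
  also have "\<dots> = (\<integral>y. conv (mol r) g y * h y \<partial>lborel)"
  proof (rule Bochner_Integration.integral_cong[OF refl])
    fix y
    have "(\<integral>x. g x * (mol r (x - y) * h y) \<partial>lborel) = (\<integral>x. (mol r (y - x) * g x) * h y \<partial>lborel)"
      by (intro Bochner_Integration.integral_cong) (simp_all add: mol_minus[of r] mult_ac)
    then show "(\<integral>x. g x * (mol r (x - y) * h y) \<partial>lborel) = conv (mol r) g y * h y"
      by (simp add: conv_def)
  qed
  finally show ?thesis .
qed

lemma pairing_conv:
  assumes g: "integrable lborel g" and p: "lipc K \<phi>" and r: "r > 0"
  shows "pairing g (conv (mol r) \<phi>) = (\<integral>x. conv (mol r) g x * borel_div \<phi> x \<partial>lborel)"
proof -
  obtain B where B: "AE x in lborel. \<bar>borel_div \<phi> x\<bar> \<le> B" using borel_div_bounded[OF p] by metis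
  show ?thesis unfolding pairing_def borel_div_conv[OF p r]
    by (rule conv_duality[OF g _ B r]) (use lipc_borel[OF p] in simp)
qed

section \<open>Variation as a supremum over Lipschitz fields\<close>

text \<open>The variation of \<open>f\<close> on \<open>U\<close> against fields dominated by \<open>g\<close>. It covers the weighted variation
(\<open>g = w\<close>) and the classical one (\<open>g = 1\<close>).\<close>

definition Var :: "('a::euclidean_space \<Rightarrow> real) \<Rightarrow> 'a set \<Rightarrow> ('a \<Rightarrow> ennreal) \<Rightarrow> ennreal" where
  "Var f U g = (SUP \<phi>\<in>{\<phi>. \<exists>K. K \<subseteq> U \<and> lipc K \<phi> \<and> (\<forall>x\<in>U. ennreal (norm (\<phi> x)) \<le> g x)}. ennreal (pairing f \<phi>))"

lemma Var_upper:
  assumes "lipc K \<phi>" "K \<subseteq> U" "\<And>x. x \<in> U \<Longrightarrow> ennreal (norm (\<phi> x)) \<le> g x"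
  shows "ennreal (pairing f \<phi>) \<le> Var f U g"
  unfolding Var_def by (rule SUP_upper) (use assms in auto)

lemma Var_least:
  assumes "\<And>\<phi> K. lipc K \<phi> \<Longrightarrow> K \<subseteq> U \<Longrightarrow> (\<And>x. x \<in> U \<Longrightarrow> ennreal (norm (\<phi> x)) \<le> g x) \<Longrightarrow> ennreal (pairing f \<phi>) \<le> c"
  shows "Var f U g \<le> c"
  unfolding Var_def by (rule SUP_least) (use assms in auto)

lemma compact_neighbourhood:
  fixes K :: "'a::euclidean_space set"
  assumes "compact K" "open U" "K \<subseteq> U"
  obtains K' r where "r > 0" "compact K'" "K \<subseteq> K'" "K' \<subseteq> U" "\<And>x y. y \<in> K \<Longrightarrow> dist x y < r \<Longrightarrow> x \<in> K'"
proof (cases "K = {}")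
  case True
  show ?thesis by (rule that[of 1 "{}"]) (use True in auto)
next
  case False
  obtain e where e: "e > 0" "{x. infdist x K \<le> e} \<subseteq> U"
    using compact_in_open_separated[OF False assms] by blast
  show ?thesis
  proof (rule that[OF e(1) compact_infdist_le[OF False assms(1) e(1)] _ e(2)])
    show "K \<subseteq> {x. infdist x K \<le> e}" using e(1) by auto
    fix x y assume "y \<in> K" "dist x y < e"
    then show "x \<in> {x. infdist x K \<le> e}" using infdist_le[of y K x] by simp
  qed
qed

lemma compactly_supported_inD:
  assumes "compactly_supported_in U \<phi>" "K = closure {x\<in>U. \<phi> x \<noteq> 0}"
  shows "compact K" "K \<subseteq> U" "\<And>x. x \<in> U \<Longrightarrow> x \<notin> K \<Longrightarrow> \<phi> x = 0"
  using assms closure_subset[of "{x\<in>U. \<phi> x \<noteq> 0}"] by (auto simp: compactly_supported_in_def)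

lemma compactly_supported_inI:
  fixes \<phi> :: "'a::euclidean_space \<Rightarrow> 'b::zero"
  assumes "compact K" "K \<subseteq> U" "\<And>x. x \<notin> K \<Longrightarrow> \<phi> x = 0"
  shows "compactly_supported_in U \<phi>"
proof -
  have s: "{x\<in>U. \<phi> x \<noteq> 0} \<subseteq> K" using assms(3) by auto
  then have "closure {x\<in>U. \<phi> x \<noteq> 0} \<subseteq> K" by (rule closure_minimal) (rule compact_imp_closed[OF assms(1)])
  moreover have "bounded {x\<in>U. \<phi> x \<noteq> 0}" by (rule bounded_subset[OF compact_imp_bounded[OF assms(1)] s])
  ultimately show ?thesis using assms(2) by (auto simp: compactly_supported_in_def compact_closure)
qed

text \<open>A field that is Lipschitz on \<open>U\<close> and compactly supported there stays Lipschitz after extension by zero: points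
outside \<open>U\<close> have a positive distance from the support.\<close>

lemma lipc_zero_extension:
  fixes \<phi> :: "'a::euclidean_space \<Rightarrow> 'b::euclidean_space"
  assumes U: "open U" and L: "L-lipschitz_on U \<phi>" and s: "compactly_supported_in U \<phi>"
  shows "\<exists>K\<subseteq>U. lipc K (\<lambda>x. if x \<in> U then \<phi> x else 0)"
proof -
  define K where "K = closure {x\<in>U. \<phi> x \<noteq> 0}"
  note K = compactly_supported_inD[OF s K_def]
  obtain K' r where r: "r > 0" "K' \<subseteq> U" "\<And>x y. y \<in> K \<Longrightarrow> dist x y < r \<Longrightarrow> x \<in> K'"
    using compact_neighbourhood[OF K(1) U K(2)] by metis
  have "compact (\<phi> ` K)"
    by (rule compact_continuous_image[OF continuous_on_subset[OF lipschitz_on_continuous_on[OF L] K(2)] K(1)])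
  then obtain B where B: "B > 0" "\<forall>x\<in>K. norm (\<phi> x) \<le> B" by (auto dest!: compact_imp_bounded simp: bounded_pos)
  have L0: "L \<ge> 0" using L by (simp add: lipschitz_on_def)
  let ?\<psi> = "\<lambda>x. if x \<in> U then \<phi> x else 0"
  \<comment> \<open>A point of the support and a point outside \<open>U\<close> have distance at least \<open>r\<close>, so the bound \<open>B\<close> of the field is worth \<open>B / r\<close> times the distance.\<close>
  have cross: "dist (\<phi> x) 0 \<le> (L + B / r) * dist x y" if "x \<in> U" "y \<notin> U" for x y
  proof (cases "x \<in> K")
    case True
    have "r \<le> dist x y" using r(2) r(3)[of x y] True that by (force simp: dist_commute)
    then have "B \<le> B / r * dist x y" using r(1) B(1) by (simp add: field_simps)
    moreover have "norm (\<phi> x) \<le> B" using B True by blast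
    moreover have "0 \<le> L * dist x y" using L0 by simp
    ultimately show ?thesis by (simp add: algebra_simps)
  next
    case False
    then show ?thesis using K(3)[OF that(1)] L0 B r by simp
  qed
  have "lipc K ?\<psi>"
  proof (rule lipcI[OF K(1)])
    show "(L + B / r)-lipschitz_on UNIV ?\<psi>"
    proof (rule lipschitz_onI)
      show nn: "0 \<le> L + B / r" using L0 B r by simp
      fix x y
      show "dist (?\<psi> x) (?\<psi> y) \<le> (L + B / r) * dist x y"
      proof (cases "x \<in> U"; cases "y \<in> U")
        assume xy: "x \<in> U" "y \<in> U"
        have "dist (\<phi> x) (\<phi> y) \<le> L * dist x y" using L xy by (simp add: lipschitz_on_def)
        also have "\<dots> \<le> (L + B / r) * dist x y" using B r by (intro mult_right_mono) auto
        finally show ?thesis using xy by simp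
      next
        assume "x \<in> U" "y \<notin> U" then show ?thesis using cross[of x y] by simp
      next
        assume "x \<notin> U" "y \<in> U" then show ?thesis using cross[of y x] by (simp add: dist_commute)
      next
        assume "x \<notin> U" "y \<notin> U" then show ?thesis using nn by simp
      qed
    qed
    show "?\<psi> x = 0" if "x \<notin> K" for x using K(3)[of x] that by auto
  qed
  then show ?thesis using K(2) by blast
qed

lemma frechet_derivative_local:
  assumes "open U" "x \<in> U" "\<And>y. y \<in> U \<Longrightarrow> \<phi> y = \<psi> y"
  shows "frechet_derivative \<phi> (at x) = frechet_derivative \<psi> (at x)"
proof -
  have "(\<phi> has_derivative D) (at x) \<longleftrightarrow> (\<psi> has_derivative D) (at x)" for D
    using has_derivative_transform_within_open[of \<phi> D x UNIV U \<psi>] has_derivative_transform_within_open[of \<psi> D x UNIV U \<phi>] assms by auto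
  then show ?thesis by (simp add: frechet_derivative_def)
qed

text \<open>Rademacher's theorem enters here. The Frechet derivative of a Lipschitz field agrees almost everywhere with the
directional derivatives, whatever value it has elsewhere, and the Lebesgue measurable \<open>f\<close> may be replaced by
a Borel representative.\<close>

lemma field_integral_eq_pairing:
  fixes \<phi> \<psi> :: "'a::euclidean_space \<Rightarrow> 'a"
  assumes U: "open U" and p: "lipc K \<psi>" "K \<subseteq> U" "\<And>x. x \<in> U \<Longrightarrow> \<phi> x = \<psi> x"
    and g: "g \<in> borel_measurable borel" and fg: "AE x in lebesgue. x \<in> U \<longrightarrow> f x = g x"
  shows "(LINT x:U|lebesgue. f x * divergence \<phi> x) = pairing g \<psi>"
proof -
  have [measurable]: "\<psi> \<in> borel_measurable borel" "g \<in> borel_measurable borel" using lipc_borel[OF p(1)] g by auto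
  have "AE x in lborel. \<psi> differentiable (at x) \<and> divergence \<psi> x = borel_div \<psi> x"
  proof -
    obtain L where L: "compact K" "L-lipschitz_on UNIV \<psi>" "\<And>x. x \<notin> K \<Longrightarrow> \<psi> x = 0" using lipcE[OF p(1)] by metis
    show ?thesis by (rule Rademacher[OF L(2,1,3)])
  qed
  then have "AE x in lebesgue. \<psi> differentiable (at x) \<and> divergence \<psi> x = borel_div \<psi> x" by (rule AE_completion)
  with fg have ae: "AE x in lebesgue. g x * borel_div \<psi> x = indicator U x *\<^sub>R (f x * divergence \<phi> x)"
  proof eventually_elim
    fix x assume a: "x \<in> U \<longrightarrow> f x = g x" "\<psi> differentiable (at x) \<and> divergence \<psi> x = borel_div \<psi> x"
    show "g x * borel_div \<psi> x = indicator U x *\<^sub>R (f x * divergence \<phi> x)"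
    proof (cases "x \<in> U")
      case True
      have "divergence \<phi> x = divergence \<psi> x"
        unfolding divergence_def using frechet_derivative_local[OF U True p(3)] by simp
      then show ?thesis using a True by simp
    next
      case False
      then have "borel_div \<psi> x = 0" using borel_div_zero_outside[OF p(1)] p(2) by blast
      then show ?thesis using False by simp
    qed
  qed
  have m: "(\<lambda>x. g x * borel_div \<psi> x) \<in> borel_measurable lborel" by simp
  have "(LINT x:U|lebesgue. f x * divergence \<phi> x) = (\<integral>x. g x * borel_div \<psi> x \<partial>lebesgue)"
    unfolding set_lebesgue_integral_def
  proof (rule integral_cong_AE[symmetric])
    show 1: "(\<lambda>x. g x * borel_div \<psi> x) \<in> borel_measurable lebesgue" by (rule measurable_completion[OF m])
    show "(\<lambda>x. indicator U x *\<^sub>R (f x * divergence \<phi> x)) \<in> borel_measurable lebesgue" by (rule borel_measurable_AE[OF 1 ae])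
  qed (rule ae)
  also have "\<dots> = pairing g \<psi>" unfolding pairing_def by (rule integral_completion[OF m])
  finally show ?thesis .
qed

lemma weighted_variation_eq_Var:
  fixes f g :: "'a::euclidean_space \<Rightarrow> real"
  assumes U: "open \<Omega>" and g: "g \<in> borel_measurable borel" and fg: "AE x in lebesgue. x \<in> \<Omega> \<longrightarrow> f x = g x"
  shows "weighted_variation \<Omega> w f = Var g \<Omega> w"
proof (rule antisym)
  show "weighted_variation \<Omega> w f \<le> Var g \<Omega> w"
    unfolding weighted_variation_def
  proof (rule SUP_least)
    fix \<phi> assume "\<phi> \<in> {\<phi> \<in> Lip_c \<Omega>. \<forall>x\<in>\<Omega>. ennreal (norm (\<phi> x)) \<le> w x}"
    then obtain L where L: "L-lipschitz_on \<Omega> \<phi>" "compactly_supported_in \<Omega> \<phi>" "\<And>x. x \<in> \<Omega> \<Longrightarrow> ennreal (norm (\<phi> x)) \<le> w x"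
      by (auto simp: Lip_c_def)
    obtain K where K: "K \<subseteq> \<Omega>" "lipc K (\<lambda>x. if x \<in> \<Omega> then \<phi> x else 0)" using lipc_zero_extension[OF U L(1,2)] by blast
    have "(LINT x:\<Omega>|lebesgue. f x * divergence \<phi> x) = pairing g (\<lambda>x. if x \<in> \<Omega> then \<phi> x else 0)"
      by (rule field_integral_eq_pairing[OF U K(2,1) _ g fg]) simp
    then show "ennreal (LINT x:\<Omega>|lebesgue. f x * divergence \<phi> x) \<le> Var g \<Omega> w"
      using Var_upper[OF K(2,1), of w g] L(3) by simp
  qed
  show "Var g \<Omega> w \<le> weighted_variation \<Omega> w f"
  proof (rule Var_least)
    fix \<phi> :: "'a \<Rightarrow> 'a" and K assume p: "lipc K \<phi>" "K \<subseteq> \<Omega>" "\<And>x. x \<in> \<Omega> \<Longrightarrow> ennreal (norm (\<phi> x)) \<le> w x"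
    obtain L where L: "compact K" "L-lipschitz_on UNIV \<phi>" "\<And>x. x \<notin> K \<Longrightarrow> \<phi> x = 0" using lipcE[OF p(1)] by metis
    have "\<phi> \<in> Lip_c \<Omega>" unfolding Lip_c_def
      using compactly_supported_inI[OF L(1) p(2) L(3)]
      by (intro CollectI conjI exI[of _ L] lipschitz_on_subset[OF L(2)]) auto
    moreover have "(LINT x:\<Omega>|lebesgue. f x * divergence \<phi> x) = pairing g \<phi>"
      by (rule field_integral_eq_pairing[OF U p(1,2) _ g fg]) simp
    ultimately show "ennreal (pairing g \<phi>) \<le> weighted_variation \<Omega> w f"
      unfolding weighted_variation_def using p(3) by (intro SUP_upper2[of \<phi>]) auto
  qed
qed

text \<open>The derivative of such a field is bounded on the support, which is compact, and vanishes off it; the extension by zero is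
differentiable everywhere, so the mean value inequality on the whole space applies, however \<open>U\<close> is shaped.\<close>

lemma C1_c_imp_Lip_c:
  fixes \<phi> :: "'a::euclidean_space \<Rightarrow> 'a"
  assumes U: "open U" and p: "\<phi> \<in> C1_c U"
  shows "\<exists>K\<subseteq>U. lipc K (\<lambda>x. if x \<in> U then \<phi> x else 0)"
proof -
  define K where "K = closure {x\<in>U. \<phi> x \<noteq> 0}"
  have s: "compactly_supported_in U \<phi>" and c: "Ck_on 1 U \<phi>" using p by (auto simp: C1_c_def)
  note K = compactly_supported_inD[OF s K_def]
  have d: "\<And>x. x \<in> U \<Longrightarrow> \<phi> differentiable (at x)" and dc: "\<And>v. continuous_on U (\<lambda>x. frechet_derivative \<phi> (at x) v)"
    using c by auto
  let ?\<psi> = "\<lambda>x. if x \<in> U then \<phi> x else 0"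
  define D where "D x = (if x \<in> K then frechet_derivative \<phi> (at x) else (\<lambda>_. 0))" for x
  have D: "(?\<psi> has_derivative D x) (at x)" for x
  proof (cases "x \<in> K")
    case True
    then have xU: "x \<in> U" using K by auto
    then have "(\<phi> has_derivative D x) (at x)" using d True by (simp add: D_def frechet_derivative_works)
    then show ?thesis by (rule has_derivative_transform_within_open[OF _ U xU]) simp
  next
    case False
    have "((\<lambda>x. 0) has_derivative D x) (at x)" using False by (simp add: D_def)
    then show ?thesis
      by (rule has_derivative_transform_within_open[of _ _ _ _ "- K"]) (use False K compact_imp_closed[OF K(1)] in auto)
  qed
  have "\<exists>B. \<forall>x. norm (D x b) \<le> B" for b
  proof -
    have "compact ((\<lambda>x. frechet_derivative \<phi> (at x) b) ` K)"
      by (rule compact_continuous_image[OF continuous_on_subset[OF dc K(2)] K(1)])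
    then obtain B where B: "B > 0" "\<forall>x\<in>K. norm (frechet_derivative \<phi> (at x) b) \<le> B"
      by (auto dest!: compact_imp_bounded simp: bounded_pos)
    then show ?thesis by (intro exI[of _ B]) (auto simp: D_def)
  qed
  then obtain B where B: "\<And>b x. norm (D x b) \<le> B b" by metis
  have bd: "norm (D x v) \<le> (\<Sum>b\<in>Basis. B b) * norm v" for x v
    by (rule bounded_linear_norm_le_Basis[OF has_derivative_bounded_linear[OF D] B])
  have "lipc K ?\<psi>"
  proof (rule lipcI[OF K(1)])
    show "(\<Sum>b\<in>(Basis::'a set). B b)-lipschitz_on UNIV ?\<psi>"
    proof (rule lipschitz_onI)
      show "0 \<le> (\<Sum>b\<in>(Basis::'a set). B b)"
        using B by (intro sum_nonneg) (meson norm_ge_zero order_trans)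
      fix x y
      have "norm (?\<psi> x - ?\<psi> y) \<le> (\<Sum>b\<in>(Basis::'a set). B b) * norm (x - y)"
        by (rule differentiable_bound[OF convex_UNIV, where f'=D])
           (use D bd in \<open>auto intro: has_derivative_at_withinI onorm_le\<close>)
      then show "dist (?\<psi> x) (?\<psi> y) \<le> (\<Sum>b\<in>(Basis::'a set). B b) * dist x y" by (simp add: dist_norm)
    qed
    show "?\<psi> x = 0" if "x \<notin> K" for x using K(3)[of x] that by auto
  qed
  then show ?thesis using K(2) by blast
qed

lemma pairing_localize:
  assumes "lipc K \<phi>" "K \<subseteq> K'" shows "pairing (\<lambda>x. indicator K' x * f x) \<phi> = pairing f \<phi>"
  unfolding pairing_def
proof (rule Bochner_Integration.integral_cong[OF refl])
  fix x show "indicator K' x * f x * borel_div \<phi> x = f x * borel_div \<phi> x"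
    using borel_div_zero_outside[OF assms(1), of x] assms(2) by (cases "x \<in> K'") auto
qed

text \<open>Mollified fields are smooth, so this is the reason why smooth and Lipschitz test fields give the same classical variation.\<close>

lemma pairing_conv_tendsto:
  fixes \<phi> :: "'a::euclidean_space \<Rightarrow> 'a"
  assumes f: "locally_integrable \<Omega> f" and U: "open \<Omega>" and p: "lipc K \<phi>" "K \<subseteq> \<Omega>"
  shows "((\<lambda>r. pairing f (conv (mol r) \<phi>)) \<longlongrightarrow> pairing f \<phi>) (at_right 0)"
proof -
  have cK: "compact K" using p(1) by (simp add: lipc_def)
  obtain K' r0 where K': "r0 > 0" "compact K'" "K \<subseteq> K'" "K' \<subseteq> \<Omega>" "\<And>x y. y \<in> K \<Longrightarrow> dist x y < r0 \<Longrightarrow> x \<in> K'"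
    using compact_neighbourhood[OF cK U p(2)] by metis
  \<comment> \<open>All fields involved live in \<open>K'\<close>, so \<open>f\<close> may be cut off to an integrable function.\<close>
  define f1 where "f1 x = indicator K' x * f x" for x
  have f1: "integrable lborel f1" using f K' unfolding f1_def[abs_def] locally_integrable_def by blast
  have [measurable]: "f1 \<in> borel_measurable borel" "\<phi> \<in> borel_measurable borel" using f1 lipc_borel[OF p(1)] by auto
  obtain B where B: "B > 0" "AE x in lborel. \<bar>borel_div \<phi> x\<bar> \<le> B" using borel_div_bounded[OF p(1)] by metis
  have lim: "((\<lambda>r. \<integral>\<^sup>+x. ennreal (norm (conv (mol r) f1 x - f1 x)) \<partial>lborel) \<longlongrightarrow> 0) (at_right 0)"
    by (rule mollify_L1_unweighted[OF f1 K'(2)]) (simp add: f1_def)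
  show ?thesis
  proof (rule tendstoI)
    fix e :: real assume e: "e > 0"
    have "\<forall>\<^sub>F r in at_right 0. (\<integral>\<^sup>+x. ennreal (norm (conv (mol r) f1 x - f1 x)) \<partial>lborel) < ennreal (e / B)"
      using order_tendstoD(2)[OF lim] e B by simp
    moreover have "\<forall>\<^sub>F r in at_right 0. 0 < r \<and> r < r0"
      using K'(1) unfolding eventually_at_right_field by (intro exI[of _ r0]) auto
    ultimately show "\<forall>\<^sub>F r in at_right 0. dist (pairing f (conv (mol r) \<phi>)) (pairing f \<phi>) < e"
    proof eventually_elim
      fix r assume a: "(\<integral>\<^sup>+x. ennreal (norm (conv (mol r) f1 x - f1 x)) \<partial>lborel) < ennreal (e / B)" and r: "0 < r \<and> r < r0"
      have lc: "lipc K' (conv (mol r) \<phi>)"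
        by (rule lipc_conv[OF p(1) _ K'(2)]) (use r K'(5) in auto)
      have ci: "integrable lborel (\<lambda>x. conv (mol r) f1 x - f1 x)"
      proof (rule integrableI_bounded)
        show "(\<integral>\<^sup>+ x. ennreal (norm (conv (mol r) f1 x - f1 x)) \<partial>lborel) < \<infinity>"
          using a by (rule less_le_trans) simp
      qed simp
      then have ci': "integrable lborel (conv (mol r) f1)"
        using Bochner_Integration.integrable_add[OF ci f1] by simp
      note ib = integrable_mult_borel_div[OF p(1)]
      have "pairing f (conv (mol r) \<phi>) - pairing f \<phi> = pairing f1 (conv (mol r) \<phi>) - pairing f1 \<phi>"
        using pairing_localize[OF lc order_refl, of f] pairing_localize[OF p(1) K'(3), of f] by (simp add: f1_def[abs_def])
      also have "\<dots> = (\<integral>x. conv (mol r) f1 x * borel_div \<phi> x \<partial>lborel) - (\<integral>x. f1 x * borel_div \<phi> x \<partial>lborel)"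
        using pairing_conv[OF f1 p(1)] r by (simp add: pairing_def)
      also have "\<dots> = (\<integral>x. (conv (mol r) f1 x - f1 x) * borel_div \<phi> x \<partial>lborel)"
        using ib[OF ci'] ib[OF f1] by (simp add: left_diff_distrib)
      finally have eq: "pairing f (conv (mol r) \<phi>) - pairing f \<phi> = (\<integral>x. (conv (mol r) f1 x - f1 x) * borel_div \<phi> x \<partial>lborel)" .
      have "ennreal \<bar>pairing f (conv (mol r) \<phi>) - pairing f \<phi>\<bar> \<le> (\<integral>\<^sup>+x. ennreal (norm ((conv (mol r) f1 x - f1 x) * borel_div \<phi> x)) \<partial>lborel)"
        unfolding eq using integral_norm_bound_ennreal[OF ib[OF ci]] by simp
      also have "\<dots> \<le> (\<integral>\<^sup>+x. ennreal B * ennreal (norm (conv (mol r) f1 x - f1 x)) \<partial>lborel)"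
      proof (rule nn_integral_mono_AE)
        show "AE x in lborel. ennreal (norm ((conv (mol r) f1 x - f1 x) * borel_div \<phi> x)) \<le> ennreal B * ennreal (norm (conv (mol r) f1 x - f1 x))"
          using B(2)
        proof eventually_elim
          fix x assume "\<bar>borel_div \<phi> x\<bar> \<le> B"
          then have "\<bar>conv (mol r) f1 x - f1 x\<bar> * \<bar>borel_div \<phi> x\<bar> \<le> \<bar>conv (mol r) f1 x - f1 x\<bar> * B" by (intro mult_left_mono) auto
          then show "ennreal (norm ((conv (mol r) f1 x - f1 x) * borel_div \<phi> x)) \<le> ennreal B * ennreal (norm (conv (mol r) f1 x - f1 x))"
            using B(1) by (simp add: abs_mult mult.commute ennreal_mult[symmetric] ennreal_leI)
        qed
      qed
      also have "\<dots> = ennreal B * (\<integral>\<^sup>+x. ennreal (norm (conv (mol r) f1 x - f1 x)) \<partial>lborel)" by (rule nn_integral_cmult) simp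
      also have "\<dots> < ennreal B * ennreal (e / B)" using a B(1) by (intro ennreal_mult_strict_left_mono) auto
      also have "\<dots> = ennreal e" using B(1) e by (simp add: ennreal_mult[symmetric])
      finally show "dist (pairing f (conv (mol r) \<phi>)) (pairing f \<phi>) < e" using e by (simp add: dist_real_def ennreal_less_iff)
    qed
  qed
qed

text \<open>The classical variation, defined by continuously differentiable fields, can be computed with Lipschitz fields, which
are stable under the cutoffs and truncations used below.\<close>

lemma total_variation_eq_Var:
  fixes f g :: "'a::euclidean_space \<Rightarrow> real"
  assumes U: "open U" "U \<subseteq> \<Omega>" "open \<Omega>" and g: "locally_integrable \<Omega> g" and fg: "AE x in lebesgue. x \<in> \<Omega> \<longrightarrow> f x = g x"
  shows "total_variation U f = Var g U (\<lambda>_. 1)"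
proof (rule antisym)
  have fg': "AE x in lebesgue. x \<in> U \<longrightarrow> f x = g x" using fg by eventually_elim (use U in auto)
  have gm: "g \<in> borel_measurable borel" by (rule locally_integrable_borel[OF g])
  show "total_variation U f \<le> Var g U (\<lambda>_. 1)"
    unfolding total_variation_def
  proof (rule SUP_least)
    fix \<phi> assume "\<phi> \<in> {\<phi> \<in> C1_c U. \<forall>x\<in>U. norm (\<phi> x) \<le> 1}"
    then have p: "\<phi> \<in> C1_c U" "\<And>x. x \<in> U \<Longrightarrow> norm (\<phi> x) \<le> 1" by auto
    obtain K where K: "K \<subseteq> U" "lipc K (\<lambda>x. if x \<in> U then \<phi> x else 0)" using C1_c_imp_Lip_c[OF U(1) p(1)] by blast
    have "(LINT x:U|lebesgue. f x * divergence \<phi> x) = pairing g (\<lambda>x. if x \<in> U then \<phi> x else 0)"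
      by (rule field_integral_eq_pairing[OF U(1) K(2,1) _ gm fg']) simp
    then show "ennreal (LINT x:U|lebesgue. f x * divergence \<phi> x) \<le> Var g U (\<lambda>_. 1)"
      using Var_upper[OF K(2,1), of "\<lambda>_. 1" g] p(2) by (simp add: ennreal_le_1)
  qed
  show "Var g U (\<lambda>_. 1) \<le> total_variation U f"
  proof (rule Var_least)
    fix \<phi> :: "'a \<Rightarrow> 'a" and K assume p: "lipc K \<phi>" "K \<subseteq> U" "\<And>x. x \<in> U \<Longrightarrow> ennreal (norm (\<phi> x)) \<le> 1"
    obtain L where L: "compact K" "L-lipschitz_on UNIV \<phi>" "\<And>x. x \<notin> K \<Longrightarrow> \<phi> x = 0" using lipcE[OF p(1)] by metis
    have ip: "integrable lborel \<phi>" by (rule integrable_lipschitz[OF L(2,1,3)])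
    have n1: "norm (\<phi> x) \<le> 1" for x using subsetD[OF p(2), of x] p(3)[of x] L(3)[of x] by (cases "x \<in> K") (simp_all add: ennreal_le_1)
    obtain K' r0 where K': "r0 > 0" "compact K'" "K \<subseteq> K'" "K' \<subseteq> U" "\<And>x y. y \<in> K \<Longrightarrow> dist x y < r0 \<Longrightarrow> x \<in> K'"
      using compact_neighbourhood[OF L(1) U(1) p(2)] by metis
    have ev: "\<forall>\<^sub>F r in at_right 0. ennreal (pairing g (conv (mol r) \<phi>)) \<le> total_variation U f"
      unfolding eventually_at_right_field
    proof (intro exI[of _ r0] conjI allI impI K'(1))
      fix r assume r: "0 < r" "r < r0"
      have lc: "lipc K' (conv (mol r) \<phi>)"
        by (rule lipc_conv[OF p(1) r(1) K'(2)]) (use r K'(5) in auto)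
      have z: "conv (mol r) \<phi> x = 0" if "x \<notin> K'" for x using lc that by (simp add: lipc_def)
      have "conv (mol r) \<phi> \<in> C1_c U" unfolding C1_c_def
        using compactly_supported_inI[OF K'(2,4) z] by (intro CollectI conjI conv_Ck[OF mol_kernel r(1) ip])
      moreover have "norm (conv (mol r) \<phi> x) \<le> 1" for x
        using conv_mol_approx_pointwise[OF r(1) ip, of x 0 1] n1 by simp
      moreover have "(LINT x:U|lebesgue. f x * divergence (conv (mol r) \<phi>) x) = pairing g (conv (mol r) \<phi>)"
        by (rule field_integral_eq_pairing[OF U(1) lc K'(4) _ gm fg']) simp
      ultimately show "ennreal (pairing g (conv (mol r) \<phi>)) \<le> total_variation U f"
        unfolding total_variation_def by (intro SUP_upper2[of "conv (mol r) \<phi>"]) auto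
    qed
    have "((\<lambda>r. ennreal (pairing g (conv (mol r) \<phi>))) \<longlongrightarrow> ennreal (pairing g \<phi>)) (at_right 0)"
      using pairing_conv_tendsto[OF g U(3) p(1)] p(2) U(2) by (intro tendsto_ennrealI) auto
    then show "ennreal (pairing g \<phi>) \<le> total_variation U f"
      by (rule tendsto_upperbound[OF _ ev]) simp
  qed
qed

section \<open>The total variation measure\<close>

abbreviation TV :: "('a::euclidean_space \<Rightarrow> real) \<Rightarrow> 'a set \<Rightarrow> ennreal" where
  "TV f U \<equiv> Var f U (\<lambda>_. 1)"

lemma TV_upper:
  assumes "lipc K \<phi>" "K \<subseteq> U" "\<And>x. norm (\<phi> x) \<le> 1"
  shows "ennreal (pairing f \<phi>) \<le> TV f U"
  by (rule Var_upper[OF assms(1,2)]) (simp add: ennreal_le_1 assms(3))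

lemma TV_least:
  fixes f :: "'a::euclidean_space \<Rightarrow> real"
  assumes "\<And>\<phi> K. lipc K \<phi> \<Longrightarrow> K \<subseteq> U \<Longrightarrow> (\<And>x. norm (\<phi> x) \<le> 1) \<Longrightarrow> ennreal (pairing f \<phi>) \<le> c"
  shows "TV f U \<le> c"
proof (rule Var_least)
  fix \<phi> :: "'a \<Rightarrow> 'a" and K assume p: "lipc K \<phi>" "K \<subseteq> U" "\<And>x. x \<in> U \<Longrightarrow> ennreal (norm (\<phi> x)) \<le> 1"
  have "norm (\<phi> x) \<le> 1" for x
    using p by (cases "x \<in> U") (auto simp: ennreal_le_1 lipc_def)
  then show "ennreal (pairing f \<phi>) \<le> c" by (rule assms[OF p(1,2)])
qed

lemma TV_mono: "U \<subseteq> V \<Longrightarrow> TV f U \<le> TV f V"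
  by (rule TV_least) (auto intro: TV_upper)

lemma TV_empty: "TV (f :: 'a::euclidean_space \<Rightarrow> real) {} = 0"
proof -
  have "TV f {} \<le> 0"
  proof (rule TV_least)
    fix \<phi> :: "'a \<Rightarrow> 'a" and K assume "lipc K \<phi>" "K \<subseteq> {}"
    then have "\<phi> = (\<lambda>x. 0)" by (auto simp: lipc_def)
    then show "ennreal (pairing f \<phi>) \<le> 0" using pairing_zero[of f] by simp
  qed
  then show ?thesis by simp
qed

lemma ennreal_add_le: "ennreal (a + b) \<le> ennreal a + ennreal b"
proof -
  have "ennreal (a + b) \<le> ennreal (max 0 a + max 0 b)" by (intro ennreal_leI) auto
  also have "\<dots> = ennreal (max 0 a) + ennreal (max 0 b)" by simp
  finally show ?thesis by (simp add: max_def ennreal_neg split: if_splits)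
qed

lemma clamp01_lipschitz:
  assumes "L-lipschitz_on UNIV u"
  shows "L-lipschitz_on UNIV (\<lambda>x. max 0 (min 1 (u x :: real)))"
proof (rule lipschitz_onI)
  show "0 \<le> L" using assms by (simp add: lipschitz_on_def)
  fix x y
  have "dist (max 0 (min 1 (u x))) (max 0 (min 1 (u y))) \<le> dist (u x) (u y)"
    by (auto simp: dist_real_def max_def min_def)
  also have "\<dots> \<le> L * dist x y" using assms by (simp add: lipschitz_on_def)
  finally show "dist (max 0 (min 1 (u x))) (max 0 (min 1 (u y))) \<le> L * dist x y" .
qed

lemma lipschitz_cutoff:
  fixes K :: "'a::euclidean_space set"
  assumes "compact K" "open U" "K \<subseteq> U"
  obtains \<eta> :: "'a \<Rightarrow> real" and M V K' where "M-lipschitz_on UNIV \<eta>" "\<And>x. 0 \<le> \<eta> x \<and> \<eta> x \<le> 1" "open V" "K \<subseteq> V"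
    "\<And>x. x \<in> V \<Longrightarrow> \<eta> x = 1" "compact K'" "K' \<subseteq> U" "\<And>x. x \<notin> K' \<Longrightarrow> \<eta> x = 0"
proof (cases "K = {}")
  case True
  show ?thesis
    by (rule that[of 0 "\<lambda>_. 0" "{}" "{}"]) (use True in \<open>auto simp: lipschitz_on_def\<close>)
next
  case False
  obtain e where e: "e > 0" "{x. infdist x K \<le> e} \<subseteq> U"
    using compact_in_open_separated[OF False assms] by blast
  define u where "u x = 2 - (2 / e) * infdist x K" for x
  have ul: "(2 / e)-lipschitz_on UNIV u"
  proof (rule lipschitz_onI)
    fix x y
    have eq: "u x - u y = (2 / e) * (infdist y K - infdist x K)" by (simp add: u_def algebra_simps)
    have "2 / e > 0" using e by simp
    then have "dist (u x) (u y) = (2 / e) * \<bar>infdist x K - infdist y K\<bar>"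
      by (simp only: dist_real_def eq abs_mult abs_of_pos abs_minus_commute[of "infdist y K"])
    also have "\<dots> \<le> (2 / e) * dist x y" using e by (intro mult_left_mono infdist_triangle_abs) auto
    finally show "dist (u x) (u y) \<le> (2 / e) * dist x y" .
  qed (use e in simp)
  show ?thesis
  proof (rule that[OF clamp01_lipschitz[OF ul], of "{x. infdist x K < e / 2}" "{x. infdist x K \<le> e}"])
    show "open {x. infdist x K < e / 2}" by (intro open_Collect_less continuous_intros)
    show "K \<subseteq> {x. infdist x K < e / 2}" using e by auto
    show "max 0 (min 1 (u x)) = 1" if "x \<in> {x. infdist x K < e / 2}" for x
    proof -
      have "(2 / e) * infdist x K \<le> (2 / e) * (e / 2)" using that e by (intro mult_left_mono) auto
      then show ?thesis using e by (simp add: u_def)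
    qed
    show "max 0 (min 1 (u x)) = 0" if "x \<notin> {x. infdist x K \<le> e}" for x
    proof -
      have "(2 / e) * e \<le> (2 / e) * infdist x K" using that e by (intro mult_left_mono) auto
      then show ?thesis using e by (simp add: u_def)
    qed
  qed (use compact_infdist_le[OF False assms(1) e(1)] e in auto)
qed

text \<open>Subadditivity: a cutoff splits a field supported in \<open>U \<union> V\<close> into one supported in \<open>U\<close> and one supported in
\<open>V\<close>, both still bounded by \<open>1\<close>.\<close>

lemma TV_Un:
  fixes f :: "'a::euclidean_space \<Rightarrow> real"
  assumes f: "locally_integrable \<Omega> f" and U: "open U" "open V" "U \<subseteq> \<Omega>" "V \<subseteq> \<Omega>"
  shows "TV f (U \<union> V) \<le> TV f U + TV f V"
proof (rule TV_least)
  fix \<phi> :: "'a \<Rightarrow> 'a" and K assume p: "lipc K \<phi>" "K \<subseteq> U \<union> V" "\<And>x. norm (\<phi> x) \<le> 1"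
  have cK: "compact K" using p(1) by (simp add: lipc_def)
  have "compact (K - V)" by (rule compact_diff[OF cK U(2)])
  moreover have "K - V \<subseteq> U" using p(2) by auto
  ultimately obtain \<eta> :: "'a \<Rightarrow> real" and M W K' where x: "M-lipschitz_on UNIV \<eta>" "\<And>x. 0 \<le> \<eta> x \<and> \<eta> x \<le> 1" "open W" "K - V \<subseteq> W"
    "\<And>x. x \<in> W \<Longrightarrow> \<eta> x = 1" "compact K'" "K' \<subseteq> U" "\<And>x. x \<notin> K' \<Longrightarrow> \<eta> x = 0"
    using lipschitz_cutoff[OF _ U(1), of "K - V"] by metis
  have k: "x \<in> K'" if "\<eta> x \<noteq> 0" for x using x(8)[of x] that by blast
  have ab: "\<bar>\<eta> x\<bar> \<le> 1" "\<bar>1 - \<eta> x\<bar> \<le> 1" for x using x(2)[of x] by auto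
  have l1: "lipc (K \<inter> K') (\<lambda>x. \<eta> x *\<^sub>R \<phi> x)"
    by (rule lipc_mult[OF x(1) _ p(1), where A=1]) (use x(6) k ab cK in auto)
  have x1: "M-lipschitz_on UNIV (\<lambda>x. 1 - \<eta> x)"
    using x(1) by (simp add: lipschitz_on_def dist_real_def abs_minus_commute)
  have l2: "lipc (K - W) (\<lambda>x. (1 - \<eta> x) *\<^sub>R \<phi> x)"
    by (rule lipc_mult[OF x1 _ p(1), where A=1]) (use x(3,5) ab cK in \<open>auto intro: compact_diff\<close>)
  have s1: "K \<inter> K' \<subseteq> U" "K - W \<subseteq> V" using x by auto
  have "pairing f \<phi> = pairing f (\<lambda>x. \<eta> x *\<^sub>R \<phi> x + (1 - \<eta> x) *\<^sub>R \<phi> x)" by (simp add: scaleR_left_diff_distrib)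
  also have "\<dots> = pairing f (\<lambda>x. \<eta> x *\<^sub>R \<phi> x) + pairing f (\<lambda>x. (1 - \<eta> x) *\<^sub>R \<phi> x)"
    by (rule pairing_add[OF f l1 _ l2]) (use s1 U in auto)
  finally have "ennreal (pairing f \<phi>) \<le> ennreal (pairing f (\<lambda>x. \<eta> x *\<^sub>R \<phi> x)) + ennreal (pairing f (\<lambda>x. (1 - \<eta> x) *\<^sub>R \<phi> x))"
    using ennreal_add_le by simp
  also have "\<dots> \<le> TV f U + TV f V"
  proof (rule add_mono)
    have "norm (\<eta> x *\<^sub>R \<phi> x) \<le> 1" "norm ((1 - \<eta> x) *\<^sub>R \<phi> x) \<le> 1" for x
      using x(2)[of x] p(3)[of x] by (auto simp: mult_le_one)
    then show "ennreal (pairing f (\<lambda>x. \<eta> x *\<^sub>R \<phi> x)) \<le> TV f U" "ennreal (pairing f (\<lambda>x. (1 - \<eta> x) *\<^sub>R \<phi> x)) \<le> TV f V"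
      using TV_upper[OF l1 s1(1)] TV_upper[OF l2 s1(2)] by auto
  qed
  finally show "ennreal (pairing f \<phi>) \<le> TV f U + TV f V" .
qed

lemma TV_UN_finite:
  fixes f :: "'a::euclidean_space \<Rightarrow> real"
  assumes f: "locally_integrable \<Omega> f" and U: "\<And>i::nat. open (U i)" "\<And>i. U i \<subseteq> \<Omega>"
  shows "TV f (\<Union>i<n. U i) \<le> (\<Sum>i<n. TV f (U i))"
proof (induction n)
  case 0 then show ?case by (simp add: TV_empty)
next
  case (Suc n)
  have "(\<Union>i<Suc n. U i) = (\<Union>i<n. U i) \<union> U n" by (auto simp: less_Suc_eq)
  moreover have "TV f ((\<Union>i<n. U i) \<union> U n) \<le> TV f (\<Union>i<n. U i) + TV f (U n)"
    by (rule TV_Un[OF f]) (use U in auto)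
  ultimately show ?case using Suc by (auto intro: order_trans add_mono)
qed

text \<open>A compact support is covered by finitely many of the sets, so finite subadditivity suffices.\<close>

lemma TV_UN:
  fixes f :: "'a::euclidean_space \<Rightarrow> real"
  assumes f: "locally_integrable \<Omega> f" and U: "\<And>i::nat. open (U i)" "\<And>i. U i \<subseteq> \<Omega>"
  shows "TV f (\<Union>i. U i) \<le> (\<Sum>i. TV f (U i))"
proof (rule TV_least)
  fix \<phi> :: "'a \<Rightarrow> 'a" and K assume p: "lipc K \<phi>" "K \<subseteq> (\<Union>i. U i)" "\<And>x. norm (\<phi> x) \<le> 1"
  have cK: "compact K" using p(1) by (simp add: lipc_def)
  obtain C where C: "finite C" "K \<subseteq> (\<Union>i\<in>C. U i)"
    by (rule compactE_image[OF cK U(1) p(2)]) (auto intro: that)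
  obtain n where n: "C \<subseteq> {..<n}" using finite_nat_bounded[OF C(1)] by blast
  have "ennreal (pairing f \<phi>) \<le> TV f (\<Union>i<n. U i)" by (rule TV_upper[OF p(1) _ p(3)]) (use C n in blast)
  also have "\<dots> \<le> (\<Sum>i<n. TV f (U i))" by (rule TV_UN_finite[OF f U])
  also have "\<dots> \<le> (\<Sum>i. TV f (U i))" by (rule sum_le_suminf) auto
  finally show "ennreal (pairing f \<phi>) \<le> (\<Sum>i. TV f (U i))" .
qed

text \<open>Superadditivity on disjoint sets: fields with disjoint supports can be added without violating the
bound \<open>1\<close>.\<close>

lemma TV_superadd_compact:
  assumes f: "locally_integrable \<Omega> f" and U: "open U" "U \<subseteq> \<Omega>" and p: "lipc K \<phi>" "K \<subseteq> U" "\<And>x. norm (\<phi> x) \<le> 1"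
  shows "ennreal (pairing f \<phi>) + TV f (U - K) \<le> TV f U"
proof -
  have "TV f (U - K) + ennreal (pairing f \<phi>) = (SUP \<psi>\<in>{\<psi>. \<exists>K'. K' \<subseteq> U - K \<and> lipc K' \<psi> \<and> (\<forall>x\<in>U - K. ennreal (norm (\<psi> x)) \<le> 1)}. ennreal (pairing f \<psi>) + ennreal (pairing f \<phi>))"
    unfolding Var_def
    by (rule ennreal_SUP_add_left[symmetric]) (auto intro!: exI[of _ "\<lambda>x. 0"] exI[of _ "{}"] lipc_zero)
  also have "\<dots> \<le> TV f U"
  proof (rule SUP_least)
    fix \<psi> :: "'a \<Rightarrow> 'a"
    assume "\<psi> \<in> {\<psi>. \<exists>K'. K' \<subseteq> U - K \<and> lipc K' \<psi> \<and> (\<forall>x\<in>U - K. ennreal (norm (\<psi> x)) \<le> 1)}"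
    then obtain K' where q: "K' \<subseteq> U - K" "lipc K' \<psi>" "\<And>x. x \<in> U - K \<Longrightarrow> norm (\<psi> x) \<le> 1" by (auto simp: ennreal_le_1)
    have z: "\<psi> x = 0" if "x \<notin> K'" for x using q(2) that by (simp add: lipc_def)
    have z': "\<phi> x = 0" if "x \<notin> K" for x using p(1) that by (simp add: lipc_def)
    have n: "norm (\<psi> x) \<le> 1" for x using q(1) q(3)[of x] z[of x] by (cases "x \<in> K'") auto
    have l: "lipc (K' \<union> K) (\<lambda>x. \<psi> x + \<phi> x)" by (rule lipc_add[OF q(2) p(1)])
    have n2: "norm (\<psi> x + \<phi> x) \<le> 1" for x
      using z[of x] z'[of x] n[of x] p(3)[of x] q(1) by (cases "x \<in> K"; cases "x \<in> K'") auto
    have add: "pairing f (\<lambda>x. \<psi> x + \<phi> x) = pairing f \<psi> + pairing f \<phi>"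
      by (rule pairing_add[OF f q(2) _ p(1)]) (use q p U in auto)
    have 1: "ennreal (pairing f \<psi>) \<le> TV f U" by (rule TV_upper[OF q(2) _ n]) (use q in auto)
    have 2: "ennreal (pairing f \<phi>) \<le> TV f U" by (rule TV_upper[OF p])
    have KU: "K' \<union> K \<subseteq> U" using q(1) p(2) by auto
    have 3: "ennreal (pairing f \<psi> + pairing f \<phi>) \<le> TV f U"
      using TV_upper[OF l KU n2, of f] by (simp add: add)
    \<comment> \<open>If one of the two pairings is negative, its extended value is \<open>0\<close> and the other field alone suffices.\<close>
    show "ennreal (pairing f \<psi>) + ennreal (pairing f \<phi>) \<le> TV f U"
      using 1 2 3 by (cases "pairing f \<psi> \<ge> 0"; cases "pairing f \<phi> \<ge> 0") (auto simp: ennreal_neg)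
  qed
  finally show ?thesis by (simp add: add.commute)
qed

text \<open>The outer regular extension of the variation to arbitrary subsets of \<open>\<Omega>\<close>.\<close>

definition TV_outer :: "'a::euclidean_space set \<Rightarrow> ('a \<Rightarrow> real) \<Rightarrow> 'a set \<Rightarrow> ennreal" where
  "TV_outer \<Omega> f A = (INF U\<in>{U. open U \<and> A \<subseteq> U \<and> U \<subseteq> \<Omega>}. TV f U)"

lemma TV_outer_open: "open U \<Longrightarrow> U \<subseteq> \<Omega> \<Longrightarrow> TV_outer \<Omega> f U = TV f U"
  unfolding TV_outer_def by (intro antisym INF_lower INF_greatest TV_mono) auto

lemma TV_outer_mono: "A \<subseteq> B \<Longrightarrow> TV_outer \<Omega> f A \<le> TV_outer \<Omega> f B"
  unfolding TV_outer_def by (rule INF_superset_mono) auto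

lemma TV_outer_le: "open U \<Longrightarrow> A \<subseteq> U \<Longrightarrow> U \<subseteq> \<Omega> \<Longrightarrow> TV_outer \<Omega> f A \<le> TV f U"
  unfolding TV_outer_def by (rule INF_lower) auto

lemma suminf_geometric_ennreal: "e > 0 \<Longrightarrow> (\<Sum>i. ennreal (e * (1/2) ^ Suc i)) = ennreal e"
proof -
  assume e: "e > 0"
  have "(\<lambda>i. e * (1/2) ^ Suc i) sums (e * 1)" by (intro sums_mult power_half_series)
  then show ?thesis using e by (intro suminf_ennreal_eq) auto
qed

lemma TV_outer_countably_subadditive:
  assumes f: "locally_integrable \<Omega> f" and O: "open \<Omega>" and A: "\<And>i::nat. A i \<subseteq> \<Omega>"
  shows "TV_outer \<Omega> f (\<Union>i. A i) \<le> (\<Sum>i. TV_outer \<Omega> f (A i))"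
proof (cases "(\<Sum>i. TV_outer \<Omega> f (A i)) = \<infinity>")
  case False
  have fin: "TV_outer \<Omega> f (A i) < \<infinity>" for i
  proof -
    have "TV_outer \<Omega> f (A i) \<le> (\<Sum>i. TV_outer \<Omega> f (A i))" using sum_le_suminf[of "\<lambda>i. TV_outer \<Omega> f (A i)" "{i}"] by simp
    then show ?thesis using False by (simp add: less_top[symmetric]) (metis top.extremum_uniqueI)
  qed
  show ?thesis
  proof (rule ennreal_le_epsilon)
    fix e :: real assume e: "e > 0"
    have "\<exists>U. open U \<and> A i \<subseteq> U \<and> U \<subseteq> \<Omega> \<and> TV f U \<le> TV_outer \<Omega> f (A i) + ennreal (e * (1/2) ^ Suc i)" for i
    proof -
      have "TV_outer \<Omega> f (A i) < TV_outer \<Omega> f (A i) + ennreal (e * (1/2) ^ Suc i)"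
        using fin[of i] e by (cases "TV_outer \<Omega> f (A i)") (auto simp: ennreal_less_iff simp flip: ennreal_plus)
      then have "(INF U\<in>{U. open U \<and> A i \<subseteq> U \<and> U \<subseteq> \<Omega>}. TV f U) < TV_outer \<Omega> f (A i) + ennreal (e * (1/2) ^ Suc i)"
        by (simp add: TV_outer_def)
      then show ?thesis unfolding INF_less_iff using less_imp_le by blast
    qed
    then obtain U where U: "\<And>i. open (U i)" "\<And>i. A i \<subseteq> U i" "\<And>i. U i \<subseteq> \<Omega>"
      "\<And>i. TV f (U i) \<le> TV_outer \<Omega> f (A i) + ennreal (e * (1/2) ^ Suc i)" by metis
    have "TV_outer \<Omega> f (\<Union>i. A i) \<le> TV f (\<Union>i. U i)" 
    proof (rule TV_outer_le)
      show "open (\<Union>i. U i)" using U(1) by blast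
      show "(\<Union>i. A i) \<subseteq> (\<Union>i. U i)" using U(2) by blast
      show "(\<Union>i. U i) \<subseteq> \<Omega>" using U(3) by blast
    qed
    also have "\<dots> \<le> (\<Sum>i. TV f (U i))" by (rule TV_UN[OF f U(1,3)])
    also have "\<dots> \<le> (\<Sum>i. TV_outer \<Omega> f (A i) + ennreal (e * (1/2) ^ Suc i))" by (intro suminf_le U(4)) auto
    also have "\<dots> = (\<Sum>i. TV_outer \<Omega> f (A i)) + (\<Sum>i. ennreal (e * (1/2) ^ Suc i))" by (rule suminf_add[symmetric]) auto
    also have "(\<Sum>i. ennreal (e * (1/2) ^ Suc i)) = ennreal e" by (rule suminf_geometric_ennreal[OF e])
    finally show "TV_outer \<Omega> f (\<Union>i. A i) \<le> (\<Sum>i. TV_outer \<Omega> f (A i)) + ennreal e" .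
  qed
qed simp

lemma TV_outer_empty: "TV_outer \<Omega> f {} = 0"
  using TV_outer_open[of "{}" \<Omega> f] by (simp add: TV_empty)

lemma TV_outer_subadditive:
  assumes f: "locally_integrable \<Omega> f" and O: "open \<Omega>" and A: "A \<subseteq> \<Omega>" "B \<subseteq> \<Omega>"
  shows "TV_outer \<Omega> f (A \<union> B) \<le> TV_outer \<Omega> f A + TV_outer \<Omega> f B"
proof -
  have "TV_outer \<Omega> f (\<Union>i. binaryset A B i) \<le> (\<Sum>i. TV_outer \<Omega> f (binaryset A B i))"
    by (rule TV_outer_countably_subadditive[OF f O]) (use A in \<open>auto simp: binaryset_def\<close>)
  then show ?thesis by (simp add: UN_binaryset_eq suminf_binaryset_eq TV_outer_empty)
qed

text \<open>The Caratheodory condition for open sets, reduced to the superadditivity above by exhausting \<open>U \<inter> G\<close>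
with the supports of the fields that compute its variation.\<close>

lemma TV_outer_open_split:
  assumes f: "locally_integrable \<Omega> f" and U: "open U" "U \<subseteq> \<Omega>" and G: "open G"
  shows "TV_outer \<Omega> f (U \<inter> G) + TV_outer \<Omega> f (U - G) \<le> TV f U"
proof -
  have "TV_outer \<Omega> f (U \<inter> G) = TV f (U \<inter> G)" by (rule TV_outer_open) (use U G in auto)
  then have "TV_outer \<Omega> f (U \<inter> G) + TV_outer \<Omega> f (U - G) = (SUP \<psi>\<in>{\<psi>. \<exists>K. K \<subseteq> U \<inter> G \<and> lipc K \<psi> \<and> (\<forall>x\<in>U \<inter> G. ennreal (norm (\<psi> x)) \<le> 1)}. ennreal (pairing f \<psi>) + TV_outer \<Omega> f (U - G))"
    unfolding Var_def
    by (simp only:, intro ennreal_SUP_add_left[symmetric]) (auto intro!: exI[of _ "\<lambda>x. 0"] exI[of _ "{}"] lipc_zero)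
  also have "\<dots> \<le> TV f U"
  proof (rule SUP_least)
    fix \<psi> :: "'a \<Rightarrow> 'a"
    assume "\<psi> \<in> {\<psi>. \<exists>K. K \<subseteq> U \<inter> G \<and> lipc K \<psi> \<and> (\<forall>x\<in>U \<inter> G. ennreal (norm (\<psi> x)) \<le> 1)}"
    then obtain K where q: "K \<subseteq> U \<inter> G" "lipc K \<psi>" "\<And>x. x \<in> U \<inter> G \<Longrightarrow> norm (\<psi> x) \<le> 1" by (auto simp: ennreal_le_1)
    have cl: "closed K" using q(2) by (auto simp: lipc_def intro: compact_imp_closed)
    have n: "norm (\<psi> x) \<le> 1" for x using q by (cases "x \<in> K") (auto simp: lipc_def)
    have "TV_outer \<Omega> f (U - G) \<le> TV f (U - K)" by (rule TV_outer_le) (use U q cl in \<open>auto intro: open_Diff\<close>)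
    then have "ennreal (pairing f \<psi>) + TV_outer \<Omega> f (U - G) \<le> ennreal (pairing f \<psi>) + TV f (U - K)" by (intro add_left_mono)
    also have "\<dots> \<le> TV f U" by (rule TV_superadd_compact[OF f U q(2) _ n]) (use q in auto)
    finally show "ennreal (pairing f \<psi>) + TV_outer \<Omega> f (U - G) \<le> TV f U" .
  qed
  finally show ?thesis .
qed

text \<open>Caratheodory's extension theorem: the sets that split the outer measure additively form a sigma algebra, and it
contains the open sets.\<close>

lemma TV_outer_measure_space:
  assumes f: "locally_integrable \<Omega> f" and O: "open \<Omega>"
  shows "measure_space \<Omega> (lambda_system \<Omega> (Pow \<Omega>) (TV_outer \<Omega> f)) (TV_outer \<Omega> f)"
    and "sets (restrict_space borel \<Omega>) \<subseteq> lambda_system \<Omega> (Pow \<Omega>) (TV_outer \<Omega> f)"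
proof -
  interpret P: sigma_algebra \<Omega> "Pow \<Omega>" by (rule sigma_algebra_Pow)
  have "outer_measure_space (Pow \<Omega>) (TV_outer \<Omega> f)"
    unfolding outer_measure_space_def
  proof (intro conjI)
    show "positive (Pow \<Omega>) (TV_outer \<Omega> f)" by (simp add: positive_def TV_outer_empty)
    show "increasing (Pow \<Omega>) (TV_outer \<Omega> f)" by (simp add: increasing_def TV_outer_mono)
    show "countably_subadditive (Pow \<Omega>) (TV_outer \<Omega> f)"
      unfolding countably_subadditive_def
      by (intro allI impI TV_outer_countably_subadditive[OF f O]) (auto simp: subset_eq)
  qed
  then show ms: "measure_space \<Omega> (lambda_system \<Omega> (Pow \<Omega>) (TV_outer \<Omega> f)) (TV_outer \<Omega> f)" by (rule P.caratheodory_lemma)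
  let ?L = "lambda_system \<Omega> (Pow \<Omega>) (TV_outer \<Omega> f)"
  have opL: "G \<inter> \<Omega> \<in> ?L" if G: "open G" for G
    unfolding P.lambda_system_eq
  proof (intro CollectI conjI ballI)
    show "G \<inter> \<Omega> \<in> Pow \<Omega>" by auto
    fix x assume x: "x \<in> Pow \<Omega>"
    have e: "x \<inter> (G \<inter> \<Omega>) = x \<inter> G" "x - (G \<inter> \<Omega>) = x - G" using x by auto
    show "TV_outer \<Omega> f (x \<inter> (G \<inter> \<Omega>)) + TV_outer \<Omega> f (x - G \<inter> \<Omega>) = TV_outer \<Omega> f x"
      unfolding e
    proof (rule antisym)
      show "TV_outer \<Omega> f (x \<inter> G) + TV_outer \<Omega> f (x - G) \<le> TV_outer \<Omega> f x"
        unfolding TV_outer_def[of \<Omega> f x]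
      proof (rule INF_greatest)
        fix U assume U: "U \<in> {U. open U \<and> x \<subseteq> U \<and> U \<subseteq> \<Omega>}"
        have "TV_outer \<Omega> f (x \<inter> G) + TV_outer \<Omega> f (x - G) \<le> TV_outer \<Omega> f (U \<inter> G) + TV_outer \<Omega> f (U - G)"
          by (intro add_mono TV_outer_mono) (use U in auto)
        also have "\<dots> \<le> TV f U" by (rule TV_outer_open_split[OF f _ _ G]) (use U in auto)
        finally show "TV_outer \<Omega> f (x \<inter> G) + TV_outer \<Omega> f (x - G) \<le> TV f U" .
      qed
      have "TV_outer \<Omega> f ((x \<inter> G) \<union> (x - G)) \<le> TV_outer \<Omega> f (x \<inter> G) + TV_outer \<Omega> f (x - G)"
        by (rule TV_outer_subadditive[OF f O]) (use x in auto)
      then show "TV_outer \<Omega> f x \<le> TV_outer \<Omega> f (x \<inter> G) + TV_outer \<Omega> f (x - G)" by (simp add: Int_Diff_Un)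
    qed
  qed
  interpret L: sigma_algebra \<Omega> ?L using ms by (simp add: measure_space_def)
  have "S \<inter> \<Omega> \<in> ?L" if "S \<in> sigma_sets UNIV {S. open S}" for S
    using that
  proof induction
    case (Basic a) then show ?case using opL by auto
  next
    case Empty then show ?case by simp
  next
    case (Compl a)
    have "(UNIV - a) \<inter> \<Omega> = \<Omega> - (a \<inter> \<Omega>)" by auto
    then show ?case using L.compl_sets[OF Compl.IH] by simp
  next
    case (Union a)
    have "(\<Union>i. a i) \<inter> \<Omega> = (\<Union>i. a i \<inter> \<Omega>)" by auto
    then show ?case using L.countable_UN[of "\<lambda>i. a i \<inter> \<Omega>" UNIV] Union.IH by auto
  qed
  moreover have "sets (borel :: 'a measure) = sigma_sets UNIV {S. open S}" by (simp add: borel_def)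
  ultimately show "sets (restrict_space borel \<Omega>) \<subseteq> ?L" by (auto simp: sets_restrict_space Int_commute)
qed

definition TV_measure :: "'a::euclidean_space set \<Rightarrow> ('a \<Rightarrow> real) \<Rightarrow> 'a measure" where
  "TV_measure \<Omega> f = measure_of \<Omega> (sets (restrict_space borel \<Omega>)) (TV_outer \<Omega> f)"

lemma sigma_algebra_restrict_borel: "sigma_algebra \<Omega> (sets (restrict_space borel (\<Omega> :: 'a::topological_space set)))"
  using sets.sigma_algebra_axioms[of "restrict_space borel \<Omega>"] by (simp add: space_restrict_space)

lemma space_TV_measure [simp]: "space (TV_measure \<Omega> f) = \<Omega>"
  and sets_TV_measure [measurable_cong, simp]: "sets (TV_measure \<Omega> f) = sets (restrict_space borel \<Omega>)"
proof -
  have "sets (restrict_space borel \<Omega>) \<subseteq> Pow \<Omega>" by (auto simp: sets_restrict_space)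
  then show "space (TV_measure \<Omega> f) = \<Omega>" "sets (TV_measure \<Omega> f) = sets (restrict_space borel \<Omega>)"
    unfolding TV_measure_def using sigma_algebra.sigma_sets_eq[OF sigma_algebra_restrict_borel[of \<Omega>]] by (auto simp: space_measure_of_conv)
qed

lemma open_sets_TV_measure: "open U \<Longrightarrow> U \<subseteq> \<Omega> \<Longrightarrow> U \<in> sets (TV_measure \<Omega> f)"
  unfolding sets_TV_measure sets_restrict_space by (intro image_eqI[of _ _ U]) auto

lemma emeasure_TV_measure:
  assumes f: "locally_integrable \<Omega> f" and O: "open \<Omega>" and A: "A \<in> sets (restrict_space borel \<Omega>)"
  shows "emeasure (TV_measure \<Omega> f) A = TV_outer \<Omega> f A"
  unfolding TV_measure_def
proof (rule emeasure_measure_of_sigma[OF sigma_algebra_restrict_borel _ _ A])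
  note ms = TV_outer_measure_space[OF f O]
  show "positive (sets (restrict_space borel \<Omega>)) (TV_outer \<Omega> f)" by (simp add: positive_def TV_outer_empty)
  show "countably_additive (sets (restrict_space borel \<Omega>)) (TV_outer \<Omega> f)"
    unfolding countably_additive_def
  proof (intro allI impI)
    fix A :: "nat \<Rightarrow> 'a set"
    assume A: "range A \<subseteq> sets (restrict_space borel \<Omega>)" "disjoint_family A" "(\<Union>i. A i) \<in> sets (restrict_space borel \<Omega>)"
    have "countably_additive (lambda_system \<Omega> (Pow \<Omega>) (TV_outer \<Omega> f)) (TV_outer \<Omega> f)"
      using ms(1) by (simp add: measure_space_def)
    moreover have "range A \<subseteq> lambda_system \<Omega> (Pow \<Omega>) (TV_outer \<Omega> f)" "(\<Union>i. A i) \<in> lambda_system \<Omega> (Pow \<Omega>) (TV_outer \<Omega> f)"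
      using A(1,3) ms(2) by auto
    ultimately show "(\<Sum>i. TV_outer \<Omega> f (A i)) = TV_outer \<Omega> f (\<Union>i. A i)"
      using A(2) by (simp add: countably_additive_def)
  qed
qed

lemma emeasure_TV_measure_open:
  assumes "locally_integrable \<Omega> f" "open \<Omega>" "open U" "U \<subseteq> \<Omega>"
  shows "emeasure (TV_measure \<Omega> f) U = TV f U"
  using emeasure_TV_measure[OF assms(1,2)] TV_outer_open[OF assms(3,4)] open_sets_TV_measure[OF assms(3,4), of f] by simp

lemma variation_measure_eq_TV_measure:
  fixes f g :: "'a::euclidean_space \<Rightarrow> real"
  assumes "open \<Omega>" "locally_integrable \<Omega> g" "AE x in lebesgue. x \<in> \<Omega> \<longrightarrow> f x = g x"
  shows "variation_measure \<Omega> f = TV_measure \<Omega> g"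
proof -
  have "(INF U\<in>{U. open U \<and> A \<subseteq> U \<and> U \<subseteq> \<Omega>}. total_variation U f) = TV_outer \<Omega> g A" for A
    unfolding TV_outer_def using total_variation_eq_Var[OF _ _ assms] by (intro INF_cong) auto
  then show ?thesis by (simp add: variation_measure_def TV_measure_def)
qed

section \<open>Fields and weights integrated against the variation measure\<close>

lemma clamp_explicit:
  fixes v :: "'b::euclidean_space"
  assumes "M \<ge> 0"
  shows "closest_point (cball 0 M) v = (if norm v \<le> M then v else (M / norm v) *\<^sub>R v)"
proof (cases "norm v \<le> M")
  case True then show ?thesis using clamp_to_ball(3)[OF assms True] by simp
next
  case False
  then have v: "norm v > 0" "M < norm v" using assms by linarith+
  have "(M / norm v) *\<^sub>R v = closest_point (cball 0 M) v"
  proof (rule closest_point_unique)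
    show "(M / norm v) *\<^sub>R v \<in> cball 0 M" using v assms by simp
    show "\<forall>z\<in>cball 0 M. dist v ((M / norm v) *\<^sub>R v) \<le> dist v z"
    proof
      fix z :: 'b assume z: "z \<in> cball 0 M"
      have "v - (M / norm v) *\<^sub>R v = (1 - M / norm v) *\<^sub>R v" by (simp add: scaleR_left_diff_distrib)
      then have "dist v ((M / norm v) *\<^sub>R v) = \<bar>1 - M / norm v\<bar> * norm v" by (simp add: dist_norm)
      also have "\<dots> = norm v - M" using v by (simp add: field_simps)
      also have "\<dots> \<le> dist v z" using norm_triangle_sub[of v z] z by (simp add: dist_norm)
      finally show "dist v ((M / norm v) *\<^sub>R v) \<le> dist v z" .
    qed
  qed auto
  then show ?thesis using False by simp
qed

text \<open>The part of a vector between two radii. It is bounded by the difference of the radii and vanishes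
on short vectors, which makes it a test field for a superlevel set of the norm.\<close>

lemma clamp_diff:
  fixes v :: "'b::euclidean_space"
  assumes "0 \<le> M" "M \<le> M'"
  shows "norm (closest_point (cball 0 M') v - closest_point (cball 0 M) v) \<le> M' - M"
    "norm v \<le> M \<Longrightarrow> closest_point (cball 0 M') v - closest_point (cball 0 M) v = 0"
proof -
  have M': "M' \<ge> 0" using assms by simp
  consider "norm v \<le> M" | "M < norm v" "norm v \<le> M'" | "M' < norm v" by linarith
  then show "norm (closest_point (cball 0 M') v - closest_point (cball 0 M) v) \<le> M' - M"
  proof cases
    case 1 then show ?thesis using assms by (simp add: clamp_explicit[OF assms(1)] clamp_explicit[OF M'])
  next
    case 2
    then have nv: "norm v > 0" using assms by linarith
    have "v - (M / norm v) *\<^sub>R v = (1 - M / norm v) *\<^sub>R v" by (simp add: scaleR_left_diff_distrib)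
    then have "norm (v - (M / norm v) *\<^sub>R v) = \<bar>1 - M / norm v\<bar> * norm v" by simp
    also have "\<dots> = norm v - M" using 2 nv by (simp add: field_simps)
    finally show ?thesis using 2 by (simp add: clamp_explicit[OF assms(1)] clamp_explicit[OF M'])
  next
    case 3
    then have v: "norm v > 0" "\<not> norm v \<le> M'" "\<not> norm v \<le> M" using assms by linarith+
    have "(M' / norm v) *\<^sub>R v - (M / norm v) *\<^sub>R v = ((M' - M) / norm v) *\<^sub>R v" by (simp add: scaleR_left_diff_distrib[symmetric] diff_divide_distrib)
    then have "norm ((M' / norm v) *\<^sub>R v - (M / norm v) *\<^sub>R v) = M' - M" using v assms by simp
    then show ?thesis using v by (simp add: clamp_explicit[OF assms(1)] clamp_explicit[OF M'])
  qed
  show "norm v \<le> M \<Longrightarrow> closest_point (cball 0 M') v - closest_point (cball 0 M) v = 0"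
    using assms by (simp add: clamp_explicit[OF assms(1)] clamp_explicit[OF M'])
qed

text \<open>This lemma and the next two estimate the lower step function of height \<open>\<delta>\<close> at \<open>s\<close>. The steps are counted only
where \<open>s\<close> exceeds their upper end, so that the sets involved are open.\<close>

lemma layer_sum_le:
  assumes "\<delta> > 0" "s \<ge> 0"
  shows "(\<Sum>i<n. if real (Suc i) * \<delta> < s then \<delta> else 0) \<le> min s (real n * \<delta>)"
proof (induction n)
  case (Suc n)
  then show ?case using assms by (auto simp: algebra_simps min_def split: if_splits)
qed (use assms in simp)

lemma layer_sum_full:
  assumes "\<delta> > 0" "real n * \<delta> < s"
  shows "(\<Sum>i<n. if real (Suc i) * \<delta> < s then \<delta> else 0) = real n * \<delta>"
proof -
  have "real (Suc i) * \<delta> < s" if "i < n" for i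
  proof -
    have "real (Suc i) * \<delta> \<le> real n * \<delta>" using that assms by (intro mult_right_mono) auto
    then show ?thesis using assms by linarith
  qed
  then have "(\<Sum>i<n. if real (Suc i) * \<delta> < s then \<delta> else 0) = (\<Sum>i<n. \<delta>)" by (intro sum.cong) auto
  then show ?thesis by simp
qed

lemma layer_sum_ge:
  assumes "\<delta> > 0"
  shows "min s (real n * \<delta>) - \<delta> \<le> (\<Sum>i<n. if real (Suc i) * \<delta> < s then \<delta> else 0)"
proof (induction n)
  case 0 then show ?case using assms by (simp add: min_def)
next
  case (Suc n)
  show ?case
  proof (cases "real n * \<delta> < s")
    case True
    have "(\<Sum>i<Suc n. if real (Suc i) * \<delta> < s then \<delta> else 0) \<ge> real n * \<delta>"
      using layer_sum_full[OF assms True] assms by simp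
    moreover have "real (Suc n) * \<delta> = real n * \<delta> + \<delta>" by (simp add: algebra_simps)
    moreover have "min s (real (Suc n) * \<delta>) \<le> real (Suc n) * \<delta>" by simp
    ultimately show ?thesis by linarith
  next
    case False
    then have "min s (real (Suc n) * \<delta>) = min s (real n * \<delta>)" using assms by (simp add: min_def algebra_simps)
    moreover have "(\<Sum>i<Suc n. if real (Suc i) * \<delta> < s then \<delta> else 0) \<ge> (\<Sum>i<n. if real (Suc i) * \<delta> < s then \<delta> else 0)"
      using assms by (subst sum.lessThan_Suc) auto
    ultimately show ?thesis using Suc by linarith
  qed
qed

lemma TV_upper_scaled:
  fixes f :: "'a::euclidean_space \<Rightarrow> real"
  assumes f: "locally_integrable \<Omega> f" and p: "lipc K \<phi>" "K \<subseteq> U" "\<And>x. norm (\<phi> x) \<le> c" and c: "c > 0"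
  shows "ennreal (pairing f \<phi>) \<le> ennreal c * TV f U"
proof -
  have l: "lipc K (\<lambda>x. (1 / c) *\<^sub>R \<phi> x)" by (rule lipc_cmult[OF p(1)])
  have "norm ((1 / c) *\<^sub>R \<phi> x) \<le> 1" for x using p(3)[of x] c by simp
  from TV_upper[OF l p(2) this, of f] have "ennreal (pairing f \<phi> / c) \<le> TV f U"
    by (simp add: pairing_cmult[OF f p(1), of "1 / c"])
  then have "ennreal c * ennreal (pairing f \<phi> / c) \<le> ennreal c * TV f U" by (rule mult_left_mono) simp
  then show ?thesis using c by (simp add: ennreal_mult'[symmetric])
qed

lemma TV_measure_measurable:
  assumes "h \<in> borel_measurable borel" shows "h \<in> borel_measurable (TV_measure \<Omega> f)"
proof -
  have "h \<in> borel_measurable (restrict_space borel \<Omega>)" by (rule measurable_restrict_space1[OF assms])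
  then show ?thesis by (simp cong: measurable_cong_sets)
qed

lemma ennreal_sum_le: "finite I \<Longrightarrow> ennreal (\<Sum>i\<in>I. a i) \<le> (\<Sum>i\<in>I. ennreal (a i))"
proof (induction I rule: finite_induct)
  case (insert i I)
  then show ?case using ennreal_add_le[of "a i" "sum a I"] by (auto intro: order_trans add_left_mono)
qed simp

text \<open>The inequality \<open>\<integral> f div \<psi> \<le> \<integral> |\<psi>| d|Df|\<close>. The
field is cut into layers of thickness \<open>\<delta>\<close> according to its norm; each layer is \<open>\<delta>\<close> times an admissible field
supported in a superlevel set of the norm, and the resulting sum is a lower sum for the integral.\<close>

lemma pairing_le_integral_norm:
  fixes f :: "'a::euclidean_space \<Rightarrow> real"
  assumes f: "locally_integrable \<Omega> f" and O: "open \<Omega>" and p: "lipc K \<psi>" "K \<subseteq> W" and W: "open W" "W \<subseteq> \<Omega>" "TV f W < \<infinity>"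
  shows "ennreal (pairing f \<psi>) \<le> (\<integral>\<^sup>+x. ennreal (norm (\<psi> x)) \<partial>TV_measure \<Omega> f)"
proof (rule ennreal_le_epsilon)
  fix e :: real assume e: "e > 0"
  have cK: "compact K" using p(1) by (simp add: lipc_def)
  have KO: "K \<subseteq> \<Omega>" using p W by auto
  have z: "\<psi> x = 0" if "x \<notin> K" for x using p(1) that by (simp add: lipc_def)
  have pc: "continuous_on UNIV \<psi>" using p(1) lipschitz_continuous by (auto simp: lipc_def)
  have pm[measurable]: "\<psi> \<in> borel_measurable borel" by (rule lipc_borel[OF p(1)])
  obtain T where T: "T \<ge> 0" "TV f W = ennreal T" using W(3) by (cases "TV f W") auto
  define \<delta> where "\<delta> = e / (2 * (T + 1))"
  have d: "\<delta> > 0" "2 * \<delta> * T \<le> e"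
    using e T by (auto simp: \<delta>_def field_simps)
  obtain B where B: "B > 0" "\<And>x. norm (\<psi> x) \<le> B" using lipc_bounded[OF p(1)] by metis
  obtain N where N: "B / \<delta> \<le> real N" using real_arch_simple by blast
  \<comment> \<open>The field truncated at height \<open>j * \<delta>\<close>; its consecutive differences are the layers.\<close>
  define c where "c j x = closest_point (cball 0 (real j * \<delta>)) (\<psi> x)" for j x
  define lay where "lay j x = c (Suc j) x - c j x" for j x
  have c0: "c 0 x = 0" for x using closest_point_in_set[of "cball (0::'a) 0" "\<psi> x"] by (simp add: c_def)
  have cN: "c (N + 2) x = \<psi> x" for x
  proof -
    have "norm (\<psi> x) \<le> real N * \<delta>" using N B(2)[of x] d(1) by (simp add: field_simps)
    also have "\<dots> \<le> real (N + 2) * \<delta>" using d by (intro mult_right_mono) auto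
    finally show ?thesis unfolding c_def using d by (intro clamp_to_ball(3)) auto
  qed
  have lc: "lipc K (c j)" for j unfolding c_def[abs_def] by (rule lipc_clamp[OF p(1)]) (use d in simp)
  have ld: "lipc K (lay j)" for j
    using lipc_diff[OF lc[of "Suc j"] lc[of j]] by (simp add: lay_def[abs_def])
  have nd: "norm (lay j x) \<le> \<delta>" for j x
    using clamp_diff(1)[of "real j * \<delta>" "real (Suc j) * \<delta>" "\<psi> x"] d
    by (simp add: lay_def c_def algebra_simps)
  have zd: "lay j x = 0" if "norm (\<psi> x) \<le> real j * \<delta>" for j x
    using clamp_diff(2)[of "real j * \<delta>" "real (Suc j) * \<delta>" "\<psi> x"] d that
    by (simp add: lay_def c_def algebra_simps)
  have "\<psi> x = (\<Sum>j<N+2. lay j x)" for x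
  proof -
    have "(\<Sum>j<N+2. lay j x) = c (N + 2) x - c 0 x" unfolding lay_def by (rule sum_lessThan_telescope)
    then show ?thesis by (simp only: cN c0 diff_zero)
  qed
  then have "\<psi> = (\<lambda>x. \<Sum>j<N+2. lay j x)" by (intro ext)
  then have "pairing f \<psi> = pairing f (\<lambda>x. \<Sum>j<N+2. lay j x)" by (simp only:)
  also have "\<dots> = (\<Sum>j<N+2. pairing f (lay j))" by (rule pairing_sum[OF f _ ld cK KO]) simp
  finally have eq: "pairing f \<psi> = (\<Sum>j<N+2. pairing f (lay j))" .
  have oV: "open {x. real (Suc i) * \<delta> < norm (\<psi> x)}" for i by (intro open_Collect_less continuous_intros pc)
  have sV: "{x. real (Suc i) * \<delta> < norm (\<psi> x)} \<subseteq> \<Omega>" for i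
  proof
    fix x assume "x \<in> {x. real (Suc i) * \<delta> < norm (\<psi> x)}"
    then have "real (Suc i) * \<delta> < norm (\<psi> x)" by (simp only: mem_Collect_eq)
    moreover have "0 \<le> real (Suc i) * \<delta>" using d by simp
    ultimately have "\<psi> x \<noteq> 0" by (metis norm_zero not_le)
    then show "x \<in> \<Omega>" using z KO by blast
  qed
  have "ennreal (pairing f \<psi>) \<le> (\<Sum>j<N+2. ennreal (pairing f (lay j)))"
    unfolding eq by (rule ennreal_sum_le) simp
  \<comment> \<open>Layer \<open>i + 2\<close> lives where the norm is at least \<open>(i + 2) * \<delta>\<close>, a compact part of the open set where it exceeds \<open>(i + 1) * \<delta>\<close>. The first two layers are estimated by the variation on \<open>W\<close>.\<close>
  also have "\<dots> = ennreal (pairing f (lay 0)) + (ennreal (pairing f (lay 1)) + (\<Sum>i<N. ennreal (pairing f (lay (Suc (Suc i))))))"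
    by (simp add: sum.lessThan_Suc_shift del: sum.lessThan_Suc)
  also have "\<dots> \<le> ennreal \<delta> * ennreal T + (ennreal \<delta> * ennreal T + (\<Sum>i<N. ennreal \<delta> * emeasure (TV_measure \<Omega> f) {x. real (Suc i) * \<delta> < norm (\<psi> x)}))"
  proof (intro add_mono sum_mono)
    have "ennreal (pairing f (lay j)) \<le> ennreal \<delta> * ennreal T" for j
      using TV_upper_scaled[OF f ld p(2) nd d(1)] T by simp
    then show "ennreal (pairing f (lay 0)) \<le> ennreal \<delta> * ennreal T" "ennreal (pairing f (lay 1)) \<le> ennreal \<delta> * ennreal T" by auto
    fix i
    let ?V = "{x. real (Suc i) * \<delta> < norm (\<psi> x)}" and ?K = "K \<inter> {x. real (Suc (Suc i)) * \<delta> \<le> norm (\<psi> x)}"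
    have "closed {x. real (Suc (Suc i)) * \<delta> \<le> norm (\<psi> x)}" by (intro closed_Collect_le continuous_intros pc)
    then have cK': "compact ?K" by (rule compact_Int_closed[OF cK])
    have l: "lipc ?K (lay (Suc (Suc i)))"
    proof -
      obtain L where L: "L-lipschitz_on UNIV (lay (Suc (Suc i)))" "\<And>x. x \<notin> K \<Longrightarrow> lay (Suc (Suc i)) x = 0"
        using ld[of "Suc (Suc i)"] by (auto simp: lipc_def)
      show ?thesis
      proof (rule lipcI[OF cK' L(1)])
        show "lay (Suc (Suc i)) x = 0" if "x \<notin> ?K" for x
          using L(2)[of x] zd[of x "Suc (Suc i)"] that by (cases "x \<in> K") auto
      qed
    qed
    have "?K \<subseteq> ?V"
    proof
      fix x assume "x \<in> ?K"
      moreover have "real (Suc i) * \<delta> < real (Suc (Suc i)) * \<delta>" using d by simp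
      ultimately show "x \<in> ?V" by auto
    qed
    then have "ennreal (pairing f (lay (Suc (Suc i)))) \<le> ennreal \<delta> * TV f ?V"
      by (rule TV_upper_scaled[OF f l _ nd d(1)])
    then show "ennreal (pairing f (lay (Suc (Suc i)))) \<le> ennreal \<delta> * emeasure (TV_measure \<Omega> f) ?V"
      by (simp only: emeasure_TV_measure_open[OF f O oV sV])
  qed
  also have "(\<Sum>i<N. ennreal \<delta> * emeasure (TV_measure \<Omega> f) {x. real (Suc i) * \<delta> < norm (\<psi> x)}) \<le> (\<integral>\<^sup>+x. ennreal (norm (\<psi> x)) \<partial>TV_measure \<Omega> f)"
  proof -
    have Vs: "{x. real (Suc i) * \<delta> < norm (\<psi> x)} \<in> sets (TV_measure \<Omega> f)" for i
      by (rule open_sets_TV_measure[OF oV sV])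
    have "(\<Sum>i<N. ennreal \<delta> * emeasure (TV_measure \<Omega> f) {x. real (Suc i) * \<delta> < norm (\<psi> x)})
      = (\<integral>\<^sup>+x. (\<Sum>i<N. ennreal \<delta> * indicator {x. real (Suc i) * \<delta> < norm (\<psi> x)} x) \<partial>TV_measure \<Omega> f)"
      using Vs by (subst nn_integral_sum) (auto simp: nn_integral_cmult_indicator)
    also have "\<dots> \<le> (\<integral>\<^sup>+x. ennreal (norm (\<psi> x)) \<partial>TV_measure \<Omega> f)"
    proof (rule nn_integral_mono)
      fix x
      have "(\<Sum>i<N. ennreal \<delta> * indicator {x. real (Suc i) * \<delta> < norm (\<psi> x)} x)
        = (\<Sum>i<N. ennreal (if real (Suc i) * \<delta> < norm (\<psi> x) then \<delta> else 0))"
        by (intro sum.cong) (auto simp: indicator_def)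
      also have "\<dots> = ennreal (\<Sum>i<N. if real (Suc i) * \<delta> < norm (\<psi> x) then \<delta> else 0)"
        using d by (intro sum_ennreal) auto
      also have "\<dots> \<le> ennreal (norm (\<psi> x))"
        using layer_sum_le[OF d(1), of "norm (\<psi> x)" N] by (intro ennreal_leI) auto
      finally show "(\<Sum>i<N. ennreal \<delta> * indicator {x. real (Suc i) * \<delta> < norm (\<psi> x)} x) \<le> ennreal (norm (\<psi> x))" .
    qed
    finally show ?thesis .
  qed
  also have "ennreal \<delta> * ennreal T + (ennreal \<delta> * ennreal T + (\<integral>\<^sup>+x. ennreal (norm (\<psi> x)) \<partial>TV_measure \<Omega> f))
    = ennreal (2 * \<delta> * T) + (\<integral>\<^sup>+x. ennreal (norm (\<psi> x)) \<partial>TV_measure \<Omega> f)"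
  proof -
    have "ennreal (2 * \<delta> * T) = ennreal (\<delta> * T + \<delta> * T)" by (simp add: algebra_simps)
    also have "\<dots> = ennreal (\<delta> * T) + ennreal (\<delta> * T)" using d T by (intro ennreal_plus) auto
    also have "\<dots> = ennreal \<delta> * ennreal T + ennreal \<delta> * ennreal T" using d T by (simp only: ennreal_mult less_imp_le)
    finally show ?thesis by (simp add: add.assoc)
  qed
  also have "\<dots> \<le> (\<integral>\<^sup>+x. ennreal (norm (\<psi> x)) \<partial>TV_measure \<Omega> f) + ennreal e"
    using d(2) by (subst add.commute) (intro add_left_mono ennreal_leI)
  finally show "ennreal (pairing f \<psi>) \<le> (\<integral>\<^sup>+x. ennreal (norm (\<psi> x)) \<partial>TV_measure \<Omega> f) + ennreal e"
    by (simp add: add_left_mono)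
qed

lemma TV_approx:
  fixes f :: "'a::euclidean_space \<Rightarrow> real"
  assumes "TV f U < \<infinity>" "e > 0"
  shows "\<exists>\<phi> K. lipc K \<phi> \<and> K \<subseteq> U \<and> (\<forall>x. norm (\<phi> x) \<le> 1) \<and> TV f U \<le> ennreal (pairing f \<phi>) + ennreal e"
proof (rule ccontr)
  assume n: "\<not> ?thesis"
  obtain T where T: "T \<ge> 0" "TV f U = ennreal T" using assms(1) by (cases "TV f U") auto
  have key: "\<not> ennreal T \<le> ennreal (pairing f \<phi>) + ennreal e"
    if "lipc K \<phi>" "K \<subseteq> U" "\<forall>x. norm (\<phi> x) \<le> 1" for \<phi> :: "'a \<Rightarrow> 'a" and K
    using n[unfolded T(2)] that by blast
  have "lipc {} (\<lambda>x::'a. 0 :: 'a)" by (rule lipc_zero) simp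
  then have "\<not> ennreal T \<le> ennreal (pairing f (\<lambda>x. 0)) + ennreal e" by (rule key) auto
  then have Te: "e < T" using assms(2) by (simp add: pairing_zero ennreal_le_iff not_le)
  have "TV f U \<le> ennreal (T - e)"
  proof (rule TV_least)
    fix \<phi> :: "'a \<Rightarrow> 'a" and K assume p: "lipc K \<phi>" "K \<subseteq> U" "\<And>x. norm (\<phi> x) \<le> 1"
    have "\<not> ennreal T \<le> ennreal (pairing f \<phi>) + ennreal e" by (rule key) (use p in auto)
    also have "ennreal (pairing f \<phi>) + ennreal e = ennreal (max 0 (pairing f \<phi>) + e)" using assms(2)
      by (subst ennreal_plus) (auto simp: max_def ennreal_neg)
    finally have "\<not> T \<le> max 0 (pairing f \<phi>) + e" using ennreal_leI[of T "max 0 (pairing f \<phi>) + e"] by blast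
    then show "ennreal (pairing f \<phi>) \<le> ennreal (T - e)" by (intro ennreal_leI) auto
  qed
  then show False using T Te assms(2) by (simp add: ennreal_le_iff)
qed

text \<open>If a step function built from open sets lies below the weight, then near optimal fields for the individual sets add up
to a field that is admissible for the weight.\<close>

lemma layer_sum_le_Var:
  fixes f :: "'a::euclidean_space \<Rightarrow> real" and U :: "nat \<Rightarrow> 'a set"
  assumes f: "locally_integrable \<Omega> f" and U: "\<And>i. i < n \<Longrightarrow> U i \<subseteq> \<Omega>" and d: "\<delta> > 0"
    and w: "\<And>x. x \<in> \<Omega> \<Longrightarrow> (\<Sum>i<n. ennreal \<delta> * indicator (U i) x) \<le> w x" and V: "Var f \<Omega> w < \<infinity>"
  shows "(\<Sum>i<n. ennreal \<delta> * TV f (U i)) \<le> Var f \<Omega> w"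
proof -
  have fin: "TV f (U i) < \<infinity>" if i: "i < n" for i
  proof -
    have "TV f (U i) \<le> Var f \<Omega> w / ennreal \<delta>"
    proof (rule TV_least)
      fix \<phi> :: "'a \<Rightarrow> 'a" and K assume p: "lipc K \<phi>" "K \<subseteq> U i" "\<And>x. norm (\<phi> x) \<le> 1"
      have "ennreal (pairing f (\<lambda>x. \<delta> *\<^sub>R \<phi> x)) \<le> Var f \<Omega> w"
      proof (rule Var_upper[OF lipc_cmult[OF p(1)]])
        show "K \<subseteq> \<Omega>" using p(2) U[OF i] by auto
        fix x assume x: "x \<in> \<Omega>"
        have "ennreal (norm (\<delta> *\<^sub>R \<phi> x)) \<le> ennreal \<delta> * indicator (U i) x"
        proof (cases "x \<in> U i")
          case True
          have "\<delta> * norm (\<phi> x) \<le> \<delta> * 1" using p(3) d by (intro mult_left_mono) auto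
          then show ?thesis using True d by (simp add: ennreal_leI)
        next
          case False
          then have "\<phi> x = 0" using p by (auto simp: lipc_def)
          then show ?thesis by simp
        qed
        also have "\<dots> \<le> (\<Sum>i<n. ennreal \<delta> * indicator (U i) x)" using i by (intro member_le_sum) auto
        also have "\<dots> \<le> w x" by (rule w[OF x])
        finally show "ennreal (norm (\<delta> *\<^sub>R \<phi> x)) \<le> w x" .
      qed
      then have "ennreal \<delta> * ennreal (pairing f \<phi>) \<le> Var f \<Omega> w" using d by (simp add: pairing_cmult[OF f p(1)] ennreal_mult')
      then have "ennreal \<delta> * ennreal (pairing f \<phi>) / ennreal \<delta> \<le> Var f \<Omega> w / ennreal \<delta>" by (rule divide_right_mono_ennreal)
      then show "ennreal (pairing f \<phi>) \<le> Var f \<Omega> w / ennreal \<delta>"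
        using d mult_divide_eq_ennreal[of "ennreal \<delta>" "ennreal (pairing f \<phi>)"] by (simp add: mult.commute)
    qed
    also have "\<dots> < \<infinity>" 
    proof -
      have "Var f \<Omega> w / ennreal \<delta> \<noteq> top" using V d by (auto simp: ennreal_divide_eq_top_iff)
      then show ?thesis by (simp add: less_top)
    qed
    finally show ?thesis .
  qed
  show ?thesis
  proof (rule ennreal_le_epsilon)
    fix e :: real assume e: "e > 0"
    define e' where "e' = e / (real n + 1) / \<delta>"
    have de: "\<delta> * e' = e / (real n + 1)" using d by (simp add: e'_def)
    have e': "e' > 0" using e d by (simp add: e'_def add_nonneg_pos)
    have ne: "real n * (\<delta> * e') \<le> e"
    proof -
      have "real n * e \<le> e * (real n + 1)" using e by (simp add: algebra_simps)
      then show ?thesis unfolding de by (simp add: pos_divide_le_eq)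
    qed
    have "\<forall>i. \<exists>\<phi> K. i < n \<longrightarrow> lipc K \<phi> \<and> K \<subseteq> U i \<and> (\<forall>x. norm (\<phi> x) \<le> 1) \<and> 0 \<le> pairing f \<phi> \<and> TV f (U i) \<le> ennreal (pairing f \<phi>) + ennreal e'"
    proof
      fix i
      show "\<exists>\<phi> K. i < n \<longrightarrow> lipc K \<phi> \<and> K \<subseteq> U i \<and> (\<forall>x. norm (\<phi> x) \<le> 1) \<and> 0 \<le> pairing f \<phi> \<and> TV f (U i) \<le> ennreal (pairing f \<phi>) + ennreal e'"
      proof (cases "i < n")
        case True
        obtain \<phi> K where p: "lipc K \<phi>" "K \<subseteq> U i" "\<forall>x. norm (\<phi> x) \<le> 1" "TV f (U i) \<le> ennreal (pairing f \<phi>) + ennreal e'"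
          using TV_approx[OF fin[OF True] e'] by blast
        show ?thesis
        proof (cases "0 \<le> pairing f \<phi>")
          case True then show ?thesis using p by blast
        next
          case False
          then have "TV f (U i) \<le> ennreal (pairing f (\<lambda>x. 0)) + ennreal e'" using p(4) by (simp add: ennreal_neg pairing_zero)
          then show ?thesis using lipc_zero[of "{}::'a set"] pairing_zero[of f]
            by (intro exI[of _ "\<lambda>x. 0"] exI[of _ "{}"]) auto
        qed
      qed auto
    qed
    then obtain \<phi> K where p: "\<And>i. i < n \<Longrightarrow> lipc (K i) (\<phi> i)" "\<And>i. i < n \<Longrightarrow> K i \<subseteq> U i"
      "\<And>i x. i < n \<Longrightarrow> norm (\<phi> i x) \<le> 1" "\<And>i. i < n \<Longrightarrow> 0 \<le> pairing f (\<phi> i)"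
      "\<And>i. i < n \<Longrightarrow> TV f (U i) \<le> ennreal (pairing f (\<phi> i)) + ennreal e'" by metis
    define KK where "KK = (\<Union>i<n. K i)"
    have cKK: "compact KK" unfolding KK_def using p(1) by (intro compact_UN) (auto simp: lipc_def)
    have KKO: "KK \<subseteq> \<Omega>" unfolding KK_def using p(2) U by fastforce
    have l: "lipc KK (\<phi> i)" if "i < n" for i
      by (rule lipc_mono[OF p(1)[OF that] _ cKK]) (use that in \<open>auto simp: KK_def\<close>)
    have l': "lipc KK (\<lambda>x. \<delta> *\<^sub>R \<phi> i x)" if "i < n" for i by (rule lipc_cmult[OF l[OF that]])
    have ls: "lipc KK (\<lambda>x. \<Sum>i<n. \<delta> *\<^sub>R \<phi> i x)" by (rule lipc_sum[OF _ l' cKK]) auto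
    have "pairing f (\<lambda>x. \<Sum>i<n. \<delta> *\<^sub>R \<phi> i x) = (\<Sum>i<n. pairing f (\<lambda>x. \<delta> *\<^sub>R \<phi> i x))"
      by (rule pairing_sum[OF f _ l' cKK KKO]) auto
    also have "\<dots> = (\<Sum>i<n. \<delta> * pairing f (\<phi> i))" by (intro sum.cong refl pairing_cmult[OF f l]) auto
    finally have ps: "pairing f (\<lambda>x. \<Sum>i<n. \<delta> *\<^sub>R \<phi> i x) = (\<Sum>i<n. \<delta> * pairing f (\<phi> i))" .
    have "ennreal (pairing f (\<lambda>x. \<Sum>i<n. \<delta> *\<^sub>R \<phi> i x)) \<le> Var f \<Omega> w"
    proof (rule Var_upper[OF ls KKO])
      fix x assume x: "x \<in> \<Omega>"
      have "norm (\<Sum>i<n. \<delta> *\<^sub>R \<phi> i x) \<le> (\<Sum>i<n. norm (\<delta> *\<^sub>R \<phi> i x))" by (rule norm_sum)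
      also have "\<dots> \<le> (\<Sum>i<n. \<delta> * indicator (U i) x)"
      proof (rule sum_mono)
        fix i assume "i \<in> {..<n}"
        then have i: "i < n" by simp
        show "norm (\<delta> *\<^sub>R \<phi> i x) \<le> \<delta> * indicator (U i) x"
        proof (cases "x \<in> U i")
          case True
          have "\<delta> * norm (\<phi> i x) \<le> \<delta> * 1" using p(3)[OF i] d by (intro mult_left_mono) auto
          then show ?thesis using True d by simp
        next
          case False
          then have "\<phi> i x = 0" using p(1,2)[OF i] by (auto simp: lipc_def)
          then show ?thesis using False by simp
        qed
      qed
      finally have "ennreal (norm (\<Sum>i<n. \<delta> *\<^sub>R \<phi> i x)) \<le> ennreal (\<Sum>i<n. \<delta> * indicator (U i) x)" by (rule ennreal_leI)
      also have "\<dots> = (\<Sum>i<n. ennreal (\<delta> * indicator (U i) x))" using d by (intro sum_ennreal[symmetric]) auto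
      also have "\<dots> = (\<Sum>i<n. ennreal \<delta> * indicator (U i) x)" by (intro sum.cong) (auto simp: indicator_def)
      also have "\<dots> \<le> w x" by (rule w[OF x])
      finally show "ennreal (norm (\<Sum>i<n. \<delta> *\<^sub>R \<phi> i x)) \<le> w x" .
    qed
    then have 1: "ennreal (\<Sum>i<n. \<delta> * pairing f (\<phi> i)) \<le> Var f \<Omega> w" by (simp only: ps)
    have "(\<Sum>i<n. ennreal \<delta> * TV f (U i)) \<le> (\<Sum>i<n. ennreal (\<delta> * pairing f (\<phi> i)) + ennreal (\<delta> * e'))"
    proof (rule sum_mono)
      fix i assume "i \<in> {..<n}"
      then have i: "i < n" by simp
      have "ennreal \<delta> * TV f (U i) \<le> ennreal \<delta> * (ennreal (pairing f (\<phi> i)) + ennreal e')" by (intro mult_left_mono p(5)[OF i]) simp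
      then show "ennreal \<delta> * TV f (U i) \<le> ennreal (\<delta> * pairing f (\<phi> i)) + ennreal (\<delta> * e')"
        using d e' p(4)[OF i] by (simp add: distrib_left ennreal_mult)
    qed
    also have "\<dots> = ennreal (\<Sum>i<n. \<delta> * pairing f (\<phi> i)) + ennreal (real n * (\<delta> * e'))"
    proof -
      have "(\<Sum>i<n. ennreal (\<delta> * pairing f (\<phi> i))) = ennreal (\<Sum>i<n. \<delta> * pairing f (\<phi> i))"
        using d p(4) by (intro sum_ennreal) auto
      moreover have "(\<Sum>i<n. ennreal (\<delta> * e')) = ennreal (\<Sum>i<n. \<delta> * e')"
        using d e' by (intro sum_ennreal) auto
      ultimately show ?thesis by (simp add: sum.distrib)
    qed
    also have "\<dots> \<le> Var f \<Omega> w + ennreal e" by (intro add_mono 1 ennreal_leI ne)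
    finally show "(\<Sum>i<n. ennreal \<delta> * TV f (U i)) \<le> Var f \<Omega> w + ennreal e" .
  qed
qed

text \<open>The inequality \<open>\<integral> w d|Df| \<le> \<parallel>Df\<parallel>\<^sub>w\<close>. Lower semicontinuity makes the superlevel sets of \<open>w\<close>
open, so that \<open>w\<close> is the limit of step functions as in the previous lemma, and Fatou's lemma concludes.\<close>

lemma integral_weight_le_Var:
  fixes f :: "'a::euclidean_space \<Rightarrow> real"
  assumes f: "locally_integrable \<Omega> f" and O: "open \<Omega>" and w: "\<And>t. open {x. t < w x}" and wm: "w \<in> borel_measurable borel" and V: "Var f \<Omega> w < \<infinity>"
  shows "(\<integral>\<^sup>+x. w x \<partial>TV_measure \<Omega> f) \<le> Var f \<Omega> w"
proof -
  define \<delta> where "\<delta> k = (1 / 2 :: real) ^ k" for k :: nat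
  \<comment> \<open>At stage \<open>k\<close> there are \<open>4 ^ k\<close> steps of height \<open>1 / 2 ^ k\<close>: the mesh tends to \<open>0\<close> and the total height \<open>2 ^ k\<close> to infinity, as is necessary where \<open>w\<close> is infinite.\<close>
  define U where "U k i = {x \<in> \<Omega>. ennreal (real (Suc i) * \<delta> k) < w x}" for k i :: nat
  define s where "s k x = (\<Sum>i<(4::nat)^k. ennreal (\<delta> k) * indicator (U k i) x)" for k :: nat and x
  have d: "\<delta> k > 0" for k by (simp add: \<delta>_def)
  have oU: "open (U k i)" for k i
  proof -
    have "U k i = \<Omega> \<inter> {x. ennreal (real (Suc i) * \<delta> k) < w x}" by (auto simp: U_def)
    then show ?thesis using O w by auto
  qed
  have sU: "U k i \<subseteq> \<Omega>" for k i by (auto simp: U_def)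
  have mU: "U k i \<in> sets (TV_measure \<Omega> f)" for k i by (rule open_sets_TV_measure[OF oU sU])
  have sv: "s k x = ennreal (\<Sum>i<(4::nat)^k. if real (Suc i) * \<delta> k < v then \<delta> k else 0)"
    if "x \<in> \<Omega>" "w x = ennreal v" "v \<ge> 0" for k x v
  proof -
    have "s k x = (\<Sum>i<(4::nat)^k. ennreal (if real (Suc i) * \<delta> k < v then \<delta> k else 0))"
      unfolding s_def using that d[of k] by (intro sum.cong) (auto simp: U_def indicator_def ennreal_less_iff simp del: of_nat_Suc)
    also have "\<dots> = ennreal (\<Sum>i<(4::nat)^k. if real (Suc i) * \<delta> k < v then \<delta> k else 0)"
      using less_imp_le[OF d[of k]] by (intro sum_ennreal) auto
    finally show ?thesis .
  qed
  have st: "s k x = ennreal (4^k * \<delta> k)" if "x \<in> \<Omega>" "w x = \<infinity>" for k x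
  proof -
    have "s k x = (\<Sum>i<(4::nat)^k. ennreal (\<delta> k))"
      unfolding s_def using that by (intro sum.cong) (auto simp: U_def indicator_def)
    also have "\<dots> = ennreal (\<Sum>i<(4::nat)^k. \<delta> k)" using less_imp_le[OF d[of k]] by (intro sum_ennreal) auto
    finally show ?thesis by simp
  qed
  have dk: "4 ^ k * \<delta> k = 2 ^ k" for k
    by (simp add: \<delta>_def power_mult_distrib[symmetric] flip: power_mult_distrib)
  have le: "s k x \<le> w x" if x: "x \<in> \<Omega>" for k x
  proof (cases "w x")
    case (real v)
    have "(\<Sum>i<(4::nat)^k. if real (Suc i) * \<delta> k < v then \<delta> k else 0) \<le> v"
      using layer_sum_le[OF d[of k] real(1), of "4^k"] by simp
    then show ?thesis using sv[OF x real(2,1), of k] real by (simp add: ennreal_leI)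
  qed simp
  have int: "(\<integral>\<^sup>+x. s k x \<partial>TV_measure \<Omega> f) \<le> Var f \<Omega> w" for k
  proof -
    have "(\<integral>\<^sup>+x. s k x \<partial>TV_measure \<Omega> f) = (\<Sum>i<(4::nat)^k. ennreal (\<delta> k) * emeasure (TV_measure \<Omega> f) (U k i))"
      unfolding s_def using mU by (subst nn_integral_sum) (auto simp: nn_integral_cmult_indicator)
    also have "\<dots> = (\<Sum>i<(4::nat)^k. ennreal (\<delta> k) * TV f (U k i))"
      by (simp add: emeasure_TV_measure_open[OF f O oU sU])
    also have "\<dots> \<le> Var f \<Omega> w"
      by (rule layer_sum_le_Var[OF f sU d _ V]) (use le in \<open>simp add: s_def\<close>)
    finally show ?thesis .
  qed
  have lim: "w x \<le> liminf (\<lambda>k. s k x)" if x: "x \<in> \<Omega>" for x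
  proof (cases "w x")
    case (real v)
    have "(\<lambda>k. ennreal (min v (2 ^ k) - \<delta> k)) \<longlonglongrightarrow> ennreal v"
    proof (rule tendsto_ennrealI)
      obtain N where N: "v < 2 ^ N" using real_arch_pow[of 2 v] by auto
      have "\<forall>\<^sub>F k in sequentially. v - \<delta> k = min v (2 ^ k) - \<delta> k"
        using eventually_ge_at_top[of N]
      proof eventually_elim
        fix k assume "N \<le> k"
        then have "(2::real) ^ N \<le> 2 ^ k" by (intro power_increasing) auto
        then have "v \<le> 2 ^ k" using N by linarith
        then show "v - \<delta> k = min v (2 ^ k) - \<delta> k" by (simp add: min_absorb1)
      qed
      moreover have "(\<lambda>k. v - \<delta> k) \<longlonglongrightarrow> v - 0"
        unfolding \<delta>_def by (intro tendsto_intros LIMSEQ_power_zero) auto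
      ultimately show "(\<lambda>k. min v (2 ^ k) - \<delta> k) \<longlonglongrightarrow> v" by (auto intro: Lim_transform_eventually)
    qed
    then have "ennreal v = liminf (\<lambda>k. ennreal (min v (2 ^ k) - \<delta> k))" by (intro lim_imp_Liminf[symmetric]) auto
    also have "\<dots> \<le> liminf (\<lambda>k. s k x)"
    proof (intro Liminf_mono always_eventually allI)
      fix k
      have "min v (2 ^ k) - \<delta> k \<le> (\<Sum>i<(4::nat)^k. if real (Suc i) * \<delta> k < v then \<delta> k else 0)"
        using layer_sum_ge[OF d[of k], of v "4^k"] dk[of k] by simp
      then show "ennreal (min v (2 ^ k) - \<delta> k) \<le> s k x" unfolding sv[OF x real(2,1)] by (rule ennreal_leI)
    qed
    finally show ?thesis using real by simp
  next
    case top
    have "liminf (\<lambda>k. of_nat k :: ennreal) = top"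
      by (intro lim_imp_Liminf of_nat_tendsto_top_ennreal) simp
    moreover have "liminf (\<lambda>k. of_nat k :: ennreal) \<le> liminf (\<lambda>k. s k x)"
    proof (intro Liminf_mono always_eventually allI)
      fix k :: nat
      have "real k \<le> 2 ^ k" by (simp add: of_nat_less_two_power less_imp_le)
      then have "ennreal (real k) \<le> s k x" using st[OF x, of k] top dk[of k] by (simp add: ennreal_leI)
      then show "of_nat k \<le> s k x" by (simp add: ennreal_of_nat_eq_real_of_nat)
    qed
    ultimately show ?thesis by (simp add: top_unique)
  qed
  have "(\<integral>\<^sup>+x. w x \<partial>TV_measure \<Omega> f) \<le> (\<integral>\<^sup>+x. liminf (\<lambda>k. s k x) \<partial>TV_measure \<Omega> f)"
    by (intro nn_integral_mono lim) simp
  also have "\<dots> \<le> liminf (\<lambda>k. \<integral>\<^sup>+x. s k x \<partial>TV_measure \<Omega> f)"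
    by (rule nn_integral_liminf) (use mU in \<open>auto simp: s_def[abs_def] simp del: sets_TV_measure\<close>)
  also have "\<dots> \<le> Var f \<Omega> w"
    using int by (intro Liminf_le) auto
  finally show ?thesis .
qed

section \<open>Local smoothness and a partition of unity in shells\<close>

text \<open>The induction on the order of differentiability runs over all families of kernels at once, because the derivatives of
the summands are convolutions with different kernels.\<close>

lemma sum_conv_Ck:
  fixes g :: "nat \<Rightarrow> 'a::euclidean_space \<Rightarrow> 'b::euclidean_space"
  assumes "\<And>i. i < n \<Longrightarrow> a i \<in> kernels (r i)" "\<And>i. i < n \<Longrightarrow> r i > 0" "\<And>i. i < n \<Longrightarrow> integrable lborel (g i)"
  shows "Ck_on k S (\<lambda>x. \<Sum>i<n. conv (a i) (g i) x)"
  using assms(1)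
proof (induction k arbitrary: a)
  case 0
  have "continuous_on S (conv (a i) (g i))" if "i < n" for i
    using conv_Ck[OF 0[OF that] assms(2)[OF that] assms(3)[OF that], of 0 S] by simp
  then show ?case by (auto intro!: continuous_on_sum)
next
  case (Suc k)
  define P where "P i D \<longleftrightarrow> (\<forall>x. (conv (a i) (g i) has_derivative (\<lambda>v. conv (\<lambda>z. D z v) (g i) x)) (at x))
      \<and> (\<forall>v. (\<lambda>x. D x v) \<in> kernels (r i))" for i D
  define D where "D i = (SOME D. P i D)" for i
  have P: "P i (D i)" if i: "i < n" for i
  proof (rule conv_kernel_has_derivative[OF Suc.prems[OF i] assms(2)[OF i] assms(3)[OF i]])
    fix D' :: "'a \<Rightarrow> 'a \<Rightarrow> real"
    assume "\<And>x. (conv (a i) (g i) has_derivative (\<lambda>v. conv (\<lambda>z. D' z v) (g i) x)) (at x)" "\<And>v. (\<lambda>x. D' x v) \<in> kernels (r i)"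
    then have "P i D'" by (simp add: P_def)
    then show ?thesis unfolding D_def by (rule someI[of "P i"])
  qed
  have D: "\<And>i x. i < n \<Longrightarrow> (conv (a i) (g i) has_derivative (\<lambda>v. conv (\<lambda>z. D i z v) (g i) x)) (at x)"
    "\<And>i v. i < n \<Longrightarrow> (\<lambda>x. D i x v) \<in> kernels (r i)" using P by (simp_all add: P_def)
  have hd: "((\<lambda>x. \<Sum>i<n. conv (a i) (g i) x) has_derivative (\<lambda>v. \<Sum>i<n. conv (\<lambda>z. D i z v) (g i) x)) (at x)" for x
    by (intro has_derivative_sum D(1)) simp
  have fd: "frechet_derivative (\<lambda>x. \<Sum>i<n. conv (a i) (g i) x) (at x) = (\<lambda>v. \<Sum>i<n. conv (\<lambda>z. D i z v) (g i) x)" for x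
    by (rule frechet_derivative_at[OF hd, symmetric])
  have "Ck_on k S (\<lambda>x. \<Sum>i<n. conv (\<lambda>z. D i z v) (g i) x)" for v
    by (rule Suc.IH) (rule D(2))
  moreover have "(\<lambda>x. \<Sum>i<n. conv (a i) (g i) x) differentiable (at x)" for x
    unfolding differentiable_def by (rule exI) (rule hd)
  ultimately show ?case by (simp add: fd)
qed

text \<open>Smoothness is local. The Frechet derivative is determined by the germ of the function, so the
local models of \<open>F\<close> yield local models of its derivatives.\<close>

lemma Ck_on_local:
  fixes F :: "'a::euclidean_space \<Rightarrow> 'b::real_normed_vector"
  assumes "\<And>x. x \<in> S \<Longrightarrow> \<exists>U G. open U \<and> x \<in> U \<and> (\<forall>y\<in>U. F y = G y) \<and> Ck_on k UNIV G"
  shows "Ck_on k S F"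
  using assms
proof (induction k arbitrary: F)
  case 0
  show ?case unfolding Ck_on.simps
  proof (rule continuous_at_imp_continuous_on, rule ballI)
    fix x assume xS: "x \<in> S"
    from 0[OF xS] obtain U and G :: "'a \<Rightarrow> 'b" where U: "open U" "x \<in> U" "\<forall>y\<in>U. F y = G y" "Ck_on 0 UNIV G" by (elim exE conjE)
    have "continuous_on U G" using U(4) continuous_on_subset[of UNIV G U] by simp
    then have "continuous_on U F" using U(3) by (subst continuous_on_cong[of U U F G]) auto
    then show "isCont F x" using U(1,2) by (simp add: continuous_on_eq_continuous_at)
  qed
next
  case (Suc k)
  have d: "F differentiable (at x)" if "x \<in> S" for x
  proof -
    from Suc.prems[OF \<open>x \<in> S\<close>] obtain U and G :: "'a \<Rightarrow> 'b" where U: "open U" "x \<in> U" "\<forall>y\<in>U. F y = G y" "Ck_on (Suc k) UNIV G"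
      by (elim exE conjE)
    then have "G differentiable (at x)" by simp
    then obtain D where "(G has_derivative D) (at x)" unfolding differentiable_def by (elim exE)
    then have "(F has_derivative D) (at x)" by (rule has_derivative_transform_within_open[OF _ U(1,2)]) (use U in auto)
    then show ?thesis by (auto simp: differentiable_def)
  qed
  have "Ck_on k S (\<lambda>x. frechet_derivative F (at x) v)" for v
  proof (rule Suc.IH)
    fix x assume "x \<in> S"
    from Suc.prems[OF \<open>x \<in> S\<close>] obtain U and G :: "'a \<Rightarrow> 'b" where U: "open U" "x \<in> U" "\<forall>y\<in>U. F y = G y" "Ck_on (Suc k) UNIV G"
      by (elim exE conjE)
    have "frechet_derivative F (at y) v = frechet_derivative G (at y) v" if "y \<in> U" for y
      using frechet_derivative_local[OF U(1) that, of F G] U(3) by simp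
    then show "\<exists>U G. open U \<and> x \<in> U \<and> (\<forall>y\<in>U. frechet_derivative F (at y) v = G y) \<and> Ck_on k UNIV G"
      using U by (intro exI[of _ U] exI[of _ "\<lambda>y. frechet_derivative G (at y) v"]) auto
  qed
  then show ?case using d by simp
qed

text \<open>A Lipschitz exhaustion function: positive exactly on \<open>\<Omega>\<close>, with compact superlevel sets. The second term bounds these sets;
the case \<open>\<Omega> = UNIV\<close> is separate because the distance to the empty set is \<open>0\<close>.\<close>

definition depth :: "'a::euclidean_space set \<Rightarrow> 'a \<Rightarrow> real" where
  "depth \<Omega> x = (if \<Omega> = UNIV then 1 / (1 + norm x) else min (infdist x (- \<Omega>)) (1 / (1 + norm x)))"

lemma depth_lipschitz: "1-lipschitz_on UNIV (depth \<Omega>)"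
proof (rule lipschitz_onI)
  fix x y :: 'a
  have a: "\<bar>1 / (1 + norm x) - 1 / (1 + norm y)\<bar> \<le> dist x y"
  proof -
    have p: "1 + norm x > 0" "1 + norm y > 0" by (simp_all add: add_pos_nonneg)
    have "1 / (1 + norm x) - 1 / (1 + norm y) = (norm y - norm x) / ((1 + norm x) * (1 + norm y))"
      using p by (simp add: field_simps)
    then have "\<bar>1 / (1 + norm x) - 1 / (1 + norm y)\<bar> = \<bar>norm y - norm x\<bar> / ((1 + norm x) * (1 + norm y))"
      using p by (simp add: abs_divide abs_mult)
    also have "\<dots> \<le> \<bar>norm y - norm x\<bar> / 1"
    proof (rule divide_left_mono)
      have "1 * 1 \<le> (1 + norm x) * (1 + norm y)" by (intro mult_mono) auto
      then show "1 \<le> (1 + norm x) * (1 + norm y)" by simp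
    qed (use p in auto)
    also have "\<dots> \<le> dist x y" using norm_triangle_ineq3[of y x] by (simp add: dist_norm norm_minus_commute)
    finally show ?thesis .
  qed
  have b: "\<bar>infdist x (- \<Omega>) - infdist y (- \<Omega>)\<bar> \<le> dist x y" by (rule infdist_triangle_abs)
  show "dist (depth \<Omega> x) (depth \<Omega> y) \<le> 1 * dist x y"
    using a b by (auto simp: depth_def dist_real_def min_def)
qed simp

lemma depth_le1: "depth \<Omega> x \<le> 1"
proof -
  have "1 / (1 + norm x) \<le> 1" by (simp add: pos_divide_le_eq add_pos_nonneg)
  then show ?thesis by (auto simp: depth_def min_def)
qed

lemma depth_nonneg: "0 \<le> depth \<Omega> x"
  by (auto simp: depth_def infdist_nonneg)

lemma depth_pos_iff:
  assumes "open \<Omega>" shows "depth \<Omega> x > 0 \<longleftrightarrow> x \<in> \<Omega>"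
proof -
  have p: "1 / (1 + norm x) > 0" by (simp add: add_pos_nonneg)
  show ?thesis
  proof (cases "\<Omega> = UNIV")
    case True then show ?thesis using p by (simp add: depth_def)
  next
    case False
    then have ne: "- \<Omega> \<noteq> {}" by auto
    have "infdist x (- \<Omega>) > 0 \<longleftrightarrow> x \<in> \<Omega>"
      using in_closed_iff_infdist_zero[OF closed_Compl[OF assms] ne, of x] infdist_nonneg[of x "- \<Omega>"] by (auto simp: less_le)
    then show ?thesis using False p by (simp add: depth_def)
  qed
qed

lemma depth_continuous: "continuous_on UNIV (depth \<Omega>)"
  by (rule lipschitz_continuous[OF depth_lipschitz])

lemma depth_compact:
  assumes "open \<Omega>" "a > 0"
  shows "compact {x. a \<le> depth \<Omega> x}" "{x. a \<le> depth \<Omega> x} \<subseteq> \<Omega>"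
proof -
  have "closed {x. a \<le> depth \<Omega> x}" by (intro closed_Collect_le continuous_intros depth_continuous)
  moreover have "{x. a \<le> depth \<Omega> x} \<subseteq> cball 0 (1 / a)"
  proof
    fix x assume "x \<in> {x. a \<le> depth \<Omega> x}"
    then have "a \<le> 1 / (1 + norm x)" by (auto simp: depth_def split: if_splits)
    then have "a * (1 + norm x) \<le> 1" by (subst (asm) pos_le_divide_eq) (auto simp: add_pos_nonneg)
    then have "1 + norm x \<le> 1 / a" using assms(2) by (simp add: field_simps)
    then show "x \<in> cball 0 (1 / a)" by simp
  qed
  ultimately show "compact {x. a \<le> depth \<Omega> x}" using bounded_subset[OF bounded_cball] compact_eq_bounded_closed by blast
  show "{x. a \<le> depth \<Omega> x} \<subseteq> \<Omega>" using depth_pos_iff[OF assms(1)] assms(2) by force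
qed

text \<open>Vanishes where the depth is at most \<open>1 / 2 ^ i\<close> and is \<open>1\<close> where it is at least \<open>2 / 2 ^ i\<close>.\<close>

definition shell_cut :: "'a::euclidean_space set \<Rightarrow> nat \<Rightarrow> 'a \<Rightarrow> real" where
  "shell_cut \<Omega> i x = max 0 (min 1 (2 ^ i * depth \<Omega> x - 1))"

text \<open>A Lipschitz partition of unity on \<open>\<Omega>\<close>; being differences of consecutive cutoffs, the functions telescope. The
\<open>i\<close>-th one lives at depth between \<open>1 / 2 ^ (i + 1)\<close> and \<open>2 / 2 ^ i\<close>.\<close>

definition shell :: "'a::euclidean_space set \<Rightarrow> nat \<Rightarrow> 'a \<Rightarrow> real" where
  "shell \<Omega> i x = shell_cut \<Omega> (Suc i) x - shell_cut \<Omega> i x"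

lemma shell_cut_lipschitz: "(2 ^ i)-lipschitz_on UNIV (shell_cut \<Omega> i)"
  unfolding shell_cut_def[abs_def]
proof (rule clamp01_lipschitz, rule lipschitz_onI)
  fix x y :: 'a
  have "dist (2 ^ i * depth \<Omega> x - 1) (2 ^ i * depth \<Omega> y - 1) = 2 ^ i * dist (depth \<Omega> x) (depth \<Omega> y)"
    by (simp add: dist_real_def abs_mult flip: right_diff_distrib)
  also have "\<dots> \<le> 2 ^ i * dist x y" using depth_lipschitz[of \<Omega>] by (intro mult_left_mono) (auto simp: lipschitz_on_def)
  finally show "dist (2 ^ i * depth \<Omega> x - 1) (2 ^ i * depth \<Omega> y - 1) \<le> 2 ^ i * dist x y" .
qed simp

lemma shell_lipschitz: "(2 ^ Suc i + 2 ^ i)-lipschitz_on UNIV (shell \<Omega> i)"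
proof (rule lipschitz_onI)
  fix x y :: 'a
  have "dist (shell \<Omega> i x) (shell \<Omega> i y) \<le> dist (shell_cut \<Omega> (Suc i) x) (shell_cut \<Omega> (Suc i) y) + dist (shell_cut \<Omega> i x) (shell_cut \<Omega> i y)"
    by (simp add: shell_def dist_real_def)
  also have "\<dots> \<le> 2 ^ Suc i * dist x y + 2 ^ i * dist x y"
    using shell_cut_lipschitz[of "Suc i" \<Omega>] shell_cut_lipschitz[of i \<Omega>] by (intro add_mono) (auto simp: lipschitz_on_def)
  finally show "dist (shell \<Omega> i x) (shell \<Omega> i y) \<le> (2 ^ Suc i + 2 ^ i) * dist x y" by (simp add: algebra_simps)
qed simp

lemma shell_bounds: "0 \<le> shell \<Omega> i x" "shell \<Omega> i x \<le> 1"
proof -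
  have "2 ^ i * depth \<Omega> x \<le> 2 ^ Suc i * depth \<Omega> x" using depth_nonneg[of \<Omega> x] by (intro mult_right_mono) auto
  then have "shell_cut \<Omega> i x \<le> shell_cut \<Omega> (Suc i) x"
    unfolding shell_cut_def by (intro max.mono min.mono) auto
  moreover have "0 \<le> shell_cut \<Omega> i x" "shell_cut \<Omega> (Suc i) x \<le> 1" by (simp_all add: shell_cut_def)
  ultimately show "0 \<le> shell \<Omega> i x" "shell \<Omega> i x \<le> 1" unfolding shell_def by linarith+
qed

lemma shell_support:
  "depth \<Omega> x < 1 / 2 ^ Suc i \<Longrightarrow> shell \<Omega> i x = 0"
  "2 / 2 ^ i \<le> depth \<Omega> x \<Longrightarrow> shell \<Omega> i x = 0"
proof -
  assume "depth \<Omega> x < 1 / 2 ^ Suc i"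
  then have a: "2 ^ Suc i * depth \<Omega> x < 1" by (simp add: field_simps)
  moreover have "2 ^ i * depth \<Omega> x \<le> 2 ^ Suc i * depth \<Omega> x" using depth_nonneg[of \<Omega> x] by (intro mult_right_mono) auto
  ultimately show "shell \<Omega> i x = 0" by (simp add: shell_def shell_cut_def max_def min_def)
next
  assume "2 / 2 ^ i \<le> depth \<Omega> x"
  then have a: "2 \<le> 2 ^ i * depth \<Omega> x" by (simp add: field_simps)
  moreover have "2 ^ i * depth \<Omega> x \<le> 2 ^ Suc i * depth \<Omega> x" using depth_nonneg[of \<Omega> x] by (intro mult_right_mono) auto
  ultimately show "shell \<Omega> i x = 0" by (simp add: shell_def shell_cut_def max_def min_def)
qed

lemma sum_shell: "(\<Sum>i<n. shell \<Omega> i x) = shell_cut \<Omega> n x"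
proof -
  have "(\<Sum>i<n. shell \<Omega> i x) = shell_cut \<Omega> n x - shell_cut \<Omega> 0 x"
    unfolding shell_def by (rule sum_lessThan_telescope)
  moreover have "shell_cut \<Omega> 0 x = 0" using depth_le1[of \<Omega> x] by (simp add: shell_cut_def max_def min_def)
  ultimately show ?thesis by simp
qed

lemma shell_cut_one: "2 / 2 ^ n \<le> depth \<Omega> x \<Longrightarrow> shell_cut \<Omega> n x = 1"
  by (simp add: shell_cut_def field_simps)

lemma sum_shell_le: "(\<Sum>i<n. shell \<Omega> i x) \<le> 1"
  unfolding sum_shell by (simp add: shell_cut_def)

lemma shell_measurable[measurable]: "shell \<Omega> i \<in> borel_measurable borel"
  by (rule lipschitz_borel[OF shell_lipschitz])

text \<open>Together with the next lemma: mollification with radius at most \<open>1 / 2 ^ (i + 2)\<close> moves the \<open>i\<close>-th shell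
so little that the mollified pieces remain locally finite and do not reach the boundary.\<close>

lemma shell_far:
  assumes "1 / 2 ^ m \<le> depth \<Omega> x" "m + 3 \<le> i" "dist x y < 1 / 2 ^ (i + 2)"
  shows "shell \<Omega> i y = 0"
proof (rule shell_support(2))
  have d: "depth \<Omega> x - depth \<Omega> y \<le> dist x y"
    using lipschitz_onD[OF depth_lipschitz, of x y \<Omega>] by (simp add: dist_real_def)
  have "(1::real) / 2 ^ i \<le> 1 / 2 ^ (m + 3)" using assms(2) by (intro divide_left_mono power_increasing) auto
  also have "(1::real) / 2 ^ (m + 3) = (1 / 2 ^ m) / 8" by (simp add: power_add)
  finally have 1: "(1::real) / 2 ^ i \<le> (1 / 2 ^ m) / 8" .
  have 2: "(1::real) / 2 ^ (i + 2) = (1 / 2 ^ i) / 4" "(2::real) / 2 ^ i = 2 * (1 / 2 ^ i)" by (simp_all add: power_add)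
  define p q where "p = (1::real) / 2 ^ m" and "q = (1::real) / 2 ^ i"
  have "p > 0" "q > 0" by (simp_all add: p_def q_def)
  then show "2 / 2 ^ i \<le> depth \<Omega> y"
    using assms(1,3) d 1 unfolding 2 p_def[symmetric] q_def[symmetric] by linarith
qed

lemma shell_near:
  assumes "shell \<Omega> i y \<noteq> 0" "dist x y < 1 / 2 ^ (i + 2)"
  shows "1 / 2 ^ (i + 2) \<le> depth \<Omega> x"
proof -
  have "depth \<Omega> y - depth \<Omega> x \<le> dist x y"
    using lipschitz_onD[OF depth_lipschitz, of x y \<Omega>] by (simp add: dist_real_def)
  moreover have "1 / 2 ^ Suc i \<le> depth \<Omega> y" using shell_support(1)[of \<Omega> y i] assms(1) by linarith
  moreover have "(1::real) / 2 ^ Suc i = 2 * (1 / 2 ^ (i + 2))" by (simp add: power_add)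
  ultimately show ?thesis using assms(2) by linarith
qed

lemma depth_exhaust:
  assumes "compact K" "K \<subseteq> \<Omega>" "open \<Omega>"
  obtains m where "\<And>x. x \<in> K \<Longrightarrow> 1 / 2 ^ m \<le> depth \<Omega> x"
proof (cases "K = {}")
  case False
  obtain x0 where x0: "x0 \<in> K" "\<And>x. x \<in> K \<Longrightarrow> depth \<Omega> x0 \<le> depth \<Omega> x"
    using continuous_attains_inf[OF assms(1) False continuous_on_subset[OF depth_continuous]] by blast
  have "depth \<Omega> x0 > 0" using depth_pos_iff[OF assms(3)] x0 assms(2) by blast
  then obtain m where "(1/2::real) ^ m < depth \<Omega> x0" using real_arch_pow_inv[of "depth \<Omega> x0" "1/2"] by auto
  then show ?thesis using x0 by (intro that[of m]) (force simp: power_divide)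
qed (use that in blast)

section \<open>The product rule and duality for pieces\<close>

lemma conv_inner:
  fixes g :: "'a::euclidean_space \<Rightarrow> 'b::euclidean_space"
  assumes "r > 0" "integrable lborel g"
  shows "conv (mol r) (\<lambda>y. g y \<bullet> b) x = conv (mol r) g x \<bullet> b"
  unfolding conv_def using conv_mol_integrable[OF assms, of x] by (simp flip: integral_inner_left)

lemma integrable_bounded_mult:
  fixes g h :: "'a \<Rightarrow> real"
  assumes "integrable M g" "h \<in> borel_measurable M" "\<And>x. \<bar>h x\<bar> \<le> B"
  shows "integrable M (\<lambda>x. g x * h x)"
  using integrable_bounded_scaleR[OF assms] by (simp add: mult.commute)

lemma conv_duality_vec:
  fixes G \<phi> :: "'a::euclidean_space \<Rightarrow> 'b::euclidean_space"
  assumes G: "integrable lborel G" and p: "lipc K \<phi>" and r: "r > 0"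
    and cG: "integrable lborel (conv (mol r) G)"
  shows "(\<integral>x. G x \<bullet> conv (mol r) \<phi> x \<partial>lborel) = (\<integral>x. conv (mol r) G x \<bullet> \<phi> x \<partial>lborel)"
proof -
  obtain B where B: "B > 0" "\<And>x. norm (\<phi> x) \<le> B" using lipc_bounded[OF p] by metis
  have [measurable]: "\<phi> \<in> borel_measurable borel" "G \<in> borel_measurable borel" using lipc_borel[OF p] G by auto
  obtain L where L: "compact K" "L-lipschitz_on UNIV \<phi>" "\<And>x. x \<notin> K \<Longrightarrow> \<phi> x = 0" using lipcE[OF p] by metis
  have ip: "integrable lborel \<phi>" by (rule integrable_lipschitz[OF L(2,1,3)])
  have cB: "norm (conv (mol r) \<phi> x) \<le> B" for x
    using conv_mol_approx_pointwise[OF r ip, of x 0 B] B by simp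
  have b1: "\<bar>conv (mol r) \<phi> x \<bullet> b\<bar> \<le> B" "\<bar>\<phi> x \<bullet> b\<bar> \<le> B" if "b \<in> Basis" for x b
    using Basis_le_norm[OF that, of "conv (mol r) \<phi> x"] Basis_le_norm[OF that, of "\<phi> x"] cB[of x] B(2)[of x] by linarith+
  have i1: "integrable lborel (\<lambda>x. (G x \<bullet> b) * (conv (mol r) \<phi> x \<bullet> b))" if "b \<in> Basis" for b
    by (rule integrable_bounded_mult[where B=B]) (use G b1(1)[OF that] in auto)
  have i2: "integrable lborel (\<lambda>x. (conv (mol r) G x \<bullet> b) * (\<phi> x \<bullet> b))" if "b \<in> Basis" for b
    by (rule integrable_bounded_mult[where B=B]) (use cG b1(2)[OF that] in auto)
  have "(\<integral>x. G x \<bullet> conv (mol r) \<phi> x \<partial>lborel) = (\<Sum>b\<in>Basis. \<integral>x. (G x \<bullet> b) * (conv (mol r) \<phi> x \<bullet> b) \<partial>lborel)"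
    by (subst euclidean_inner) (rule Bochner_Integration.integral_sum[OF i1])
  also have "\<dots> = (\<Sum>b\<in>Basis. \<integral>x. (conv (mol r) G x \<bullet> b) * (\<phi> x \<bullet> b) \<partial>lborel)"
  proof (rule sum.cong[OF refl])
    fix b :: 'b assume b: "b \<in> Basis"
    have "(\<integral>x. (G x \<bullet> b) * conv (mol r) (\<lambda>y. \<phi> y \<bullet> b) x \<partial>lborel) = (\<integral>x. conv (mol r) (\<lambda>y. G y \<bullet> b) x * (\<phi> x \<bullet> b) \<partial>lborel)"
      by (rule conv_duality[where B=B, OF _ _ _ r]) (use G b1(2)[OF b] in auto)
    then show "(\<integral>x. (G x \<bullet> b) * (conv (mol r) \<phi> x \<bullet> b) \<partial>lborel) = (\<integral>x. (conv (mol r) G x \<bullet> b) * (\<phi> x \<bullet> b) \<partial>lborel)"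
      by (simp add: conv_inner[OF r ip] conv_inner[OF r G])
  qed
  also have "\<dots> = (\<integral>x. conv (mol r) G x \<bullet> \<phi> x \<partial>lborel)"
    by (subst (2) euclidean_inner) (rule Bochner_Integration.integral_sum[OF i2, symmetric])
  finally show ?thesis .
qed

lemma conv_integrable:
  fixes g :: "'a::euclidean_space \<Rightarrow> 'b::euclidean_space"
  assumes "integrable lborel g" "r > 0"
  shows "integrable lborel (conv (mol r) g)"
proof (rule integrableI_bounded)
  have [measurable]: "g \<in> borel_measurable borel" using assms by auto
  show "conv (mol r) g \<in> borel_measurable lborel" by simp
  have "(\<integral>\<^sup>+x. ennreal (norm (conv (mol r) g x)) * 1 \<partial>lborel) \<le> (\<integral>\<^sup>+y. ennreal (norm (g y)) * wmol r (\<lambda>_. 1) y \<partial>lborel)"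
    by (rule nn_integral_conv_le) auto
  also have "\<dots> = (\<integral>\<^sup>+y. ennreal (norm (g y)) \<partial>lborel)"
    by (simp add: wmol_def nn_integral_mol'[OF assms(2)])
  also have "\<dots> < \<infinity>" using assms(1) by (simp add: integrable_iff_bounded)
  finally show "(\<integral>\<^sup>+x. ennreal (norm (conv (mol r) g x)) \<partial>lborel) < \<infinity>" by simp
qed

text \<open>The product rule for the divergence, integrated against \<open>f\<close>. The statements about \<open>\<zeta>\<close> and its gradient
are collected here since all of them are needed for each piece of the partition.\<close>

lemma pairing_product:
  fixes f :: "'a::euclidean_space \<Rightarrow> real"
  assumes f: "locally_integrable \<Omega> f" and z: "M-lipschitz_on UNIV \<zeta>" "\<And>x. \<bar>\<zeta> x\<bar> \<le> 1" and K: "compact K" "K \<subseteq> \<Omega>" "\<And>x. x \<notin> K \<Longrightarrow> \<zeta> x = 0"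
    and p: "lipc K' \<Phi>"
  shows "lipc K (\<lambda>x. \<zeta> x *\<^sub>R \<Phi> x)"
    and "integrable lborel (\<lambda>x. (f x *\<^sub>R grad \<zeta> x) \<bullet> \<Phi> x)"
    and "pairing (\<lambda>x. \<zeta> x * f x) \<Phi> = pairing f (\<lambda>x. \<zeta> x *\<^sub>R \<Phi> x) - (\<integral>x. (f x *\<^sub>R grad \<zeta> x) \<bullet> \<Phi> x \<partial>lborel)"
    and "integrable lborel (\<lambda>x. f x *\<^sub>R grad \<zeta> x)"
    and "integrable lborel (\<lambda>x. \<zeta> x * f x)"
    and "\<exists>B\<ge>0. AE x in lborel. norm (grad \<zeta> x) \<le> B"
    and "\<And>x. x \<notin> K \<Longrightarrow> grad \<zeta> x = 0"
proof -
  have [measurable]: "f \<in> borel_measurable borel" "\<zeta> \<in> borel_measurable borel" "\<Phi> \<in> borel_measurable borel"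
    using locally_integrable_borel[OF f] lipschitz_borel[OF z(1)] lipc_borel[OF p] by auto
  show l: "lipc K (\<lambda>x. \<zeta> x *\<^sub>R \<Phi> x)"
    by (rule lipc_mult[OF z p K(1)]) (use K(3) in blast)
  show gz: "grad \<zeta> x = 0" if "x \<notin> K" for x
    unfolding grad_def using dir_deriv_zero_outside[OF compact_imp_closed[OF K(1)] K(3) that] by simp
  have M0: "M \<ge> 0" using z(1) by (simp add: lipschitz_on_def)
  have gb: "AE x in lborel. norm (grad \<zeta> x) \<le> (\<Sum>b\<in>(Basis::'a set). M)"
  proof -
    have "AE x in lborel. \<forall>b\<in>(Basis::'a set). \<bar>dir_deriv b \<zeta> x\<bar> \<le> M * norm b"
      by (rule AE_finite_allI[OF finite_Basis]) (rule AE_dir_deriv_bound[OF z(1)])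
    then show ?thesis
    proof eventually_elim
      fix x assume a: "\<forall>b\<in>(Basis::'a set). \<bar>dir_deriv b \<zeta> x\<bar> \<le> M * norm b"
      have "norm (grad \<zeta> x) \<le> (\<Sum>b\<in>(Basis::'a set). norm (dir_deriv b \<zeta> x *\<^sub>R b))" unfolding grad_def by (rule norm_sum)
      also have "\<dots> \<le> (\<Sum>b\<in>(Basis::'a set). M)" using a by (intro sum_mono) simp
      finally show "norm (grad \<zeta> x) \<le> (\<Sum>b\<in>(Basis::'a set). M)" .
    qed
  qed
  have S0: "(\<Sum>b\<in>(Basis::'a set). M) \<ge> 0" using M0 by (intro sum_nonneg) auto
  then show "\<exists>B\<ge>0. AE x in lborel. norm (grad \<zeta> x) \<le> B" using gb by blast
  show iG: "integrable lborel (\<lambda>x. f x *\<^sub>R grad \<zeta> x)"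
    by (rule integrable_locally_integrable_bounded[OF f K(1,2) _ gb gz]) simp
  have "integrable lborel (\<lambda>x. f x *\<^sub>R \<zeta> x)"
    by (rule integrable_locally_integrable_bounded[OF f K(1,2), where B=1]) (use z(2) K(3) in auto)
  then show iz: "integrable lborel (\<lambda>x. \<zeta> x * f x)" by (simp add: mult.commute)
  obtain A where A: "A > 0" "\<And>x. norm (\<Phi> x) \<le> A" using lipc_bounded[OF p] by metis
  have "integrable lborel (\<lambda>x. f x *\<^sub>R (grad \<zeta> x \<bullet> \<Phi> x))"
  proof (rule integrable_locally_integrable_bounded[OF f K(1,2), where B="(\<Sum>b\<in>(Basis::'a set). M) * A"])
    show "AE x in lborel. norm (grad \<zeta> x \<bullet> \<Phi> x) \<le> (\<Sum>b\<in>(Basis::'a set). M) * A"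
      using gb
    proof eventually_elim
      fix x assume "norm (grad \<zeta> x) \<le> (\<Sum>b\<in>(Basis::'a set). M)"
      then have "norm (grad \<zeta> x) * norm (\<Phi> x) \<le> (\<Sum>b\<in>(Basis::'a set). M) * A"
        using A S0 by (intro mult_mono) auto
      then show "norm (grad \<zeta> x \<bullet> \<Phi> x) \<le> (\<Sum>b\<in>(Basis::'a set). M) * A"
        using Cauchy_Schwarz_ineq2[of "grad \<zeta> x" "\<Phi> x"] by simp
    qed
  qed (use gz in auto)
  then show i1: "integrable lborel (\<lambda>x. (f x *\<^sub>R grad \<zeta> x) \<bullet> \<Phi> x)" by simp
  have i2: "integrable lborel (\<lambda>x. f x * borel_div (\<lambda>x. \<zeta> x *\<^sub>R \<Phi> x) x)" by (rule integrable_pairing[OF f l K(2)])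
  obtain L where L: "L-lipschitz_on UNIV \<Phi>" using p by (auto simp: lipc_def)
  have "pairing (\<lambda>x. \<zeta> x * f x) \<Phi> = (\<integral>x. f x * borel_div (\<lambda>x. \<zeta> x *\<^sub>R \<Phi> x) x - (f x *\<^sub>R grad \<zeta> x) \<bullet> \<Phi> x \<partial>lborel)"
    unfolding pairing_def
  proof (rule integral_cong_AE)
    show "AE x in lborel. \<zeta> x * f x * borel_div \<Phi> x = f x * borel_div (\<lambda>x. \<zeta> x *\<^sub>R \<Phi> x) x - (f x *\<^sub>R grad \<zeta> x) \<bullet> \<Phi> x"
      using AE_borel_div_mult[OF z(1) L] by eventually_elim (simp add: algebra_simps)
  qed measurable
  also have "\<dots> = pairing f (\<lambda>x. \<zeta> x *\<^sub>R \<Phi> x) - (\<integral>x. (f x *\<^sub>R grad \<zeta> x) \<bullet> \<Phi> x \<partial>lborel)"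
    unfolding pairing_def by (rule Bochner_Integration.integral_diff[OF i2 i1])
  finally show "pairing (\<lambda>x. \<zeta> x * f x) \<Phi> = pairing f (\<lambda>x. \<zeta> x *\<^sub>R \<Phi> x) - (\<integral>x. (f x *\<^sub>R grad \<zeta> x) \<bullet> \<Phi> x \<partial>lborel)" .
qed

section \<open>Meyers--Serrin smoothing\<close>

text \<open>The setting after the passage to Borel representatives. The \<open>A\<^sub>1\<close> condition enters through its consequences:
the bound for mollified weights, local integrability and local positivity.\<close>

locale weighted_BV =
  fixes \<Omega> :: "'a::euclidean_space set" and w :: "'a \<Rightarrow> ennreal" and f :: "'a \<Rightarrow> real" and C :: real
  assumes open_dom: "open \<Omega>"
    and weight_borel [measurable]: "w \<in> borel_measurable borel"
    and C_pos: "C > 0"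
    and wmol_bound: "\<And>r x. r > 0 \<Longrightarrow> wmol r w x \<le> ennreal C * w x"
    and weight_loc: "\<And>K. compact K \<Longrightarrow> (\<integral>\<^sup>+y\<in>K. w y \<partial>lborel) < \<infinity>"
    and weight_low: "\<And>K. compact K \<Longrightarrow> \<exists>c>0. \<forall>x\<in>K. ennreal c \<le> w x"
    and weight_lsc: "\<And>t. open {x. t < w x}"
    and f_borel [measurable]: "f \<in> borel_measurable borel"
    and f_outside: "\<And>x. x \<notin> \<Omega> \<Longrightarrow> f x = 0"
    and f_L1: "(\<integral>\<^sup>+x. ennreal \<bar>f x\<bar> * w x \<partial>lborel) < \<infinity>"
    and f_Var: "Var f \<Omega> w < \<infinity>"
begin

lemma L1_weight_imp_locally_integrable:
  assumes [measurable]: "g \<in> borel_measurable borel" and "(\<integral>\<^sup>+x. ennreal \<bar>g x\<bar> * w x \<partial>lborel) < \<infinity>" and K: "compact K"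
  shows "integrable lborel (\<lambda>x. indicator K x * g x)"
proof (rule integrableI_bounded)
  have [measurable]: "K \<in> sets borel" using compact_imp_closed[OF K] by simp
  obtain c where c: "c > 0" "\<forall>x\<in>K. ennreal c \<le> w x" using weight_low[OF K] by blast
  show "(\<lambda>x. indicator K x * g x) \<in> borel_measurable lborel" by simp
  have "(\<integral>\<^sup>+x. ennreal (norm (indicator K x * g x)) \<partial>lborel) \<le> (\<integral>\<^sup>+x. ennreal (1 / c) * (ennreal \<bar>g x\<bar> * w x) \<partial>lborel)"
  proof (rule nn_integral_mono)
    fix x
    show "ennreal (norm (indicator K x * g x)) \<le> ennreal (1 / c) * (ennreal \<bar>g x\<bar> * w x)"
    proof (cases "x \<in> K")
      case True
      have "ennreal (norm (indicator K x * g x)) = ennreal (1 / c) * (ennreal \<bar>g x\<bar> * ennreal c)"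
        using True c(1) by (simp add: ennreal_mult[symmetric])
      also have "\<dots> \<le> ennreal (1 / c) * (ennreal \<bar>g x\<bar> * w x)" using c(2) True by (intro mult_left_mono) auto
      finally show ?thesis .
    qed simp
  qed
  also have "\<dots> = ennreal (1 / c) * (\<integral>\<^sup>+x. ennreal \<bar>g x\<bar> * w x \<partial>lborel)" by (rule nn_integral_cmult) simp
  also have "\<dots> < \<infinity>" using assms(2) by (simp add: ennreal_mult_less_top)
  finally show "(\<integral>\<^sup>+x. ennreal (norm (indicator K x * g x)) \<partial>lborel) < \<infinity>" .
qed

lemma f_locally_integrable: "locally_integrable \<Omega> f"
  unfolding locally_integrable_def using f_outside L1_weight_imp_locally_integrable[OF f_borel f_L1] by simp

definition piece :: "nat \<Rightarrow> 'a \<Rightarrow> real" where "piece i x = shell \<Omega> i x * f x"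
definition grad_piece :: "nat \<Rightarrow> 'a \<Rightarrow> 'a" where "grad_piece i x = f x *\<^sub>R grad (shell \<Omega> i) x"
definition shellK :: "nat \<Rightarrow> 'a set" where "shellK i = {x. 1 / 2 ^ Suc i \<le> depth \<Omega> x}"

lemma shellK: "compact (shellK i)" "shellK i \<subseteq> \<Omega>" "\<And>x. x \<notin> shellK i \<Longrightarrow> shell \<Omega> i x = 0"
  unfolding shellK_def using depth_compact[OF open_dom, of "1 / 2 ^ Suc i"] shell_support(1)[of \<Omega> _ i] by (auto simp: not_le)

lemma abs_shell: "\<bar>shell \<Omega> i x\<bar> \<le> 1"
  using shell_bounds[of \<Omega> i x] by simp

lemma piece_product:
  assumes p: "lipc K' \<Phi>"
  shows "lipc (shellK i) (\<lambda>x. shell \<Omega> i x *\<^sub>R \<Phi> x)"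
    and "integrable lborel (\<lambda>x. (f x *\<^sub>R grad (shell \<Omega> i) x) \<bullet> \<Phi> x)"
    and "pairing (\<lambda>x. shell \<Omega> i x * f x) \<Phi> = pairing f (\<lambda>x. shell \<Omega> i x *\<^sub>R \<Phi> x) - (\<integral>x. (f x *\<^sub>R grad (shell \<Omega> i) x) \<bullet> \<Phi> x \<partial>lborel)"
    and "integrable lborel (\<lambda>x. f x *\<^sub>R grad (shell \<Omega> i) x)"
    and "integrable lborel (\<lambda>x. shell \<Omega> i x * f x)"
    and "\<exists>B\<ge>0. AE x in lborel. norm (grad (shell \<Omega> i) x) \<le> B"
    and "\<And>x. x \<notin> shellK i \<Longrightarrow> grad (shell \<Omega> i) x = 0"
proof -
  note P = pairing_product[OF f_locally_integrable shell_lipschitz[of i \<Omega>] abs_shell shellK(1,2)[of i] _ p]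
  show "lipc (shellK i) (\<lambda>x. shell \<Omega> i x *\<^sub>R \<Phi> x)" by (rule P(1)) (rule shellK(3))
  show "integrable lborel (\<lambda>x. (f x *\<^sub>R grad (shell \<Omega> i) x) \<bullet> \<Phi> x)" by (rule P(2)) (rule shellK(3))
  show "pairing (\<lambda>x. shell \<Omega> i x * f x) \<Phi> = pairing f (\<lambda>x. shell \<Omega> i x *\<^sub>R \<Phi> x) - (\<integral>x. (f x *\<^sub>R grad (shell \<Omega> i) x) \<bullet> \<Phi> x \<partial>lborel)"
    by (rule P(3)) (rule shellK(3))
  show "integrable lborel (\<lambda>x. f x *\<^sub>R grad (shell \<Omega> i) x)" by (rule P(4)) (rule shellK(3))
  show "integrable lborel (\<lambda>x. shell \<Omega> i x * f x)" by (rule P(5)) (rule shellK(3))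
  show "\<exists>B\<ge>0. AE x in lborel. norm (grad (shell \<Omega> i) x) \<le> B" by (rule P(6)) (rule shellK(3))
  show "grad (shell \<Omega> i) x = 0" if "x \<notin> shellK i" for x by (rule P(7)[OF _ that]) (rule shellK(3))
qed

lemma piece_integrable: "integrable lborel (piece i)" "integrable lborel (grad_piece i)"
  using piece_product(5,4)[OF lipc_zero[OF compact_empty], of i] by (simp_all add: piece_def[abs_def] grad_piece_def[abs_def])

lemma piece_outside: "x \<notin> shellK i \<Longrightarrow> piece i x = 0" "x \<notin> shellK i \<Longrightarrow> grad_piece i x = 0"
  using shellK(3)[of x i] piece_product(7)[OF lipc_zero[OF compact_empty], of x i] by (simp_all add: piece_def grad_piece_def)

lemma piece_borel [measurable]: "piece i \<in> borel_measurable borel" "grad_piece i \<in> borel_measurable borel"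
  using piece_integrable[of i] by auto

lemma piece_L1:
  "(\<integral>\<^sup>+y. ennreal (norm (piece i y)) * w y \<partial>lborel) < \<infinity>"
  "(\<integral>\<^sup>+y. ennreal (norm (grad_piece i y)) * w y \<partial>lborel) < \<infinity>"
proof -
  have "(\<integral>\<^sup>+y. ennreal (norm (piece i y)) * w y \<partial>lborel) \<le> (\<integral>\<^sup>+x. ennreal \<bar>f x\<bar> * w x \<partial>lborel)"
  proof (rule nn_integral_mono, rule mult_right_mono, rule ennreal_leI)
    fix x
    have "\<bar>shell \<Omega> i x\<bar> * \<bar>f x\<bar> \<le> 1 * \<bar>f x\<bar>" by (intro mult_right_mono abs_shell) simp
    then show "norm (piece i x) \<le> \<bar>f x\<bar>" by (simp add: piece_def abs_mult)
  qed simp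
  then show "(\<integral>\<^sup>+y. ennreal (norm (piece i y)) * w y \<partial>lborel) < \<infinity>" using f_L1 by (rule le_less_trans)
  obtain B where B: "B \<ge> 0" "AE x in lborel. norm (grad (shell \<Omega> i) x) \<le> B"
    using piece_product(6)[OF lipc_zero[OF compact_empty], of i] by auto
  have "(\<integral>\<^sup>+y. ennreal (norm (grad_piece i y)) * w y \<partial>lborel) \<le> (\<integral>\<^sup>+x. ennreal B * (ennreal \<bar>f x\<bar> * w x) \<partial>lborel)"
  proof (rule nn_integral_mono_AE)
    show "AE x in lborel. ennreal (norm (grad_piece i x)) * w x \<le> ennreal B * (ennreal \<bar>f x\<bar> * w x)"
      using B(2)
    proof eventually_elim
      fix x assume b: "norm (grad (shell \<Omega> i) x) \<le> B"
      have "\<bar>f x\<bar> * norm (grad (shell \<Omega> i) x) \<le> B * \<bar>f x\<bar>"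
        using mult_left_mono[OF b abs_ge_zero[of "f x"]] by (simp add: mult.commute)
      then have "ennreal (norm (grad_piece i x)) \<le> ennreal B * ennreal \<bar>f x\<bar>"
        using B(1) by (simp add: grad_piece_def ennreal_mult[symmetric] ennreal_leI)
      then show "ennreal (norm (grad_piece i x)) * w x \<le> ennreal B * (ennreal \<bar>f x\<bar> * w x)"
        unfolding mult.assoc[symmetric] by (rule mult_right_mono) simp
    qed
  qed
  also have "\<dots> = ennreal B * (\<integral>\<^sup>+x. ennreal \<bar>f x\<bar> * w x \<partial>lborel)" by (rule nn_integral_cmult) simp
  also have "\<dots> < \<infinity>" using f_L1 by (simp add: ennreal_mult_less_top)
  finally show "(\<integral>\<^sup>+y. ennreal (norm (grad_piece i y)) * w y \<partial>lborel) < \<infinity>" .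
qed

lemma piece_mollify:
  "((\<lambda>r. \<integral>\<^sup>+x. ennreal (norm (conv (mol r) (piece i) x - piece i x)) * w x \<partial>lborel) \<longlongrightarrow> 0) (at_right 0)"
  "((\<lambda>r. \<integral>\<^sup>+x. ennreal (norm (conv (mol r) (grad_piece i) x - grad_piece i x)) * w x \<partial>lborel) \<longlongrightarrow> 0) (at_right 0)"
  using mollify_L1[OF weight_borel weight_loc less_imp_le[OF C_pos] wmol_bound piece_integrable(1) piece_L1(1) shellK(1) piece_outside(1)]
    mollify_L1[OF weight_borel weight_loc less_imp_le[OF C_pos] wmol_bound piece_integrable(2) piece_L1(2) shellK(1) piece_outside(2)]
  by auto

text \<open>Radii for the mollification of the pieces: small compared with the width of the shell, and such that
both the piece and the error term from the gradient of the partition function are approximated in weighted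
\<open>L\<^sup>1\<close>, with errors that sum to \<open>e\<close>.\<close>

definition good :: "(nat \<Rightarrow> real) \<Rightarrow> real \<Rightarrow> bool" where
  "good r e \<longleftrightarrow> e > 0 \<and> (\<forall>i. 0 < r i \<and> r i \<le> 1 / 2 ^ (i + 2)
     \<and> (\<integral>\<^sup>+x. ennreal (norm (conv (mol (r i)) (piece i) x - piece i x)) * w x \<partial>lborel) \<le> ennreal (e * (1/2) ^ Suc i)
     \<and> (\<integral>\<^sup>+x. ennreal (norm (conv (mol (r i)) (grad_piece i) x - grad_piece i x)) * w x \<partial>lborel) \<le> ennreal (e * (1/2) ^ Suc i))"

text \<open>The Meyers--Serrin approximation; the sum is locally finite on \<open>\<Omega>\<close>.\<close>

definition smoothing :: "(nat \<Rightarrow> real) \<Rightarrow> 'a \<Rightarrow> real" where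
  "smoothing r x = (\<Sum>i. conv (mol (r i)) (piece i) x)"

lemma conv_piece_outside:
  assumes "0 < r" "r \<le> 1 / 2 ^ (i + 2)" "depth \<Omega> x < 1 / 2 ^ (i + 2)"
  shows "conv (mol r) (piece i) x = 0"
proof (rule conv_zero[OF assms(1)])
  fix y assume "dist x y < r"
  then have "shell \<Omega> i y = 0" using shell_near[of \<Omega> i y x] assms by force
  then show "piece i y = 0" by (simp add: piece_def)
qed

lemma pieces_far:
  assumes "0 < r" "r \<le> 1 / 2 ^ (i + 2)" "1 / 2 ^ m \<le> depth \<Omega> x" "m + 3 \<le> i"
  shows "conv (mol r) (piece i) x = 0" "piece i x = 0"
proof -
  have z: "shell \<Omega> i y = 0" if "dist x y < r" for y
    by (rule shell_far[OF assms(3,4)]) (use that assms in linarith)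
  then show "conv (mol r) (piece i) x = 0" by (intro conv_zero[OF assms(1)]) (simp add: piece_def)
  show "piece i x = 0" using z[of x] assms(1) by (simp add: piece_def)
qed

context
  fixes r :: "nat \<Rightarrow> real" and e :: real
  assumes r: "good r e"
begin

lemma r_pos: "0 < r i" and r_small: "r i \<le> 1 / 2 ^ (i + 2)" and e_pos: "0 < e"
  using r by (auto simp: good_def)

lemma smoothing_finite:
  assumes "1 / 2 ^ m \<le> depth \<Omega> x"
  shows "smoothing r x = (\<Sum>i<m+3. conv (mol (r i)) (piece i) x)"
  unfolding smoothing_def
  by (rule suminf_finite) (use pieces_far(1)[OF r_pos r_small assms] in auto)

lemma f_finite:
  assumes "1 / 2 ^ m \<le> depth \<Omega> x"
  shows "f x = (\<Sum>i<m+3. piece i x)"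
proof -
  have "2 / 2 ^ (m + 3) \<le> depth \<Omega> x"
  proof -
    have "(2::real) / 2 ^ (m + 3) \<le> 1 / 2 ^ m" by (simp add: power_add field_simps)
    then show ?thesis using assms by linarith
  qed
  then have "(\<Sum>i<m+3. shell \<Omega> i x) = 1" unfolding sum_shell by (rule shell_cut_one)
  then show ?thesis by (simp add: piece_def sum_distrib_right[symmetric] del: sum.lessThan_Suc)
qed

lemma depth_level: "x \<in> \<Omega> \<Longrightarrow> \<exists>m. 1 / 2 ^ m < depth \<Omega> x"
proof -
  assume "x \<in> \<Omega>"
  then have "depth \<Omega> x > 0" using depth_pos_iff[OF open_dom] by blast
  then obtain m where "(1/2::real) ^ m < depth \<Omega> x" using real_arch_pow_inv[of "depth \<Omega> x" "1/2"] by auto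
  then show ?thesis by (auto simp: power_divide)
qed

lemma smoothing_outside: "x \<notin> \<Omega> \<Longrightarrow> smoothing r x = 0"
proof -
  assume "x \<notin> \<Omega>"
  then have "depth \<Omega> x \<le> 0" using depth_pos_iff[OF open_dom, of x] by linarith
  then have "depth \<Omega> x < 1 / 2 ^ (i + 2)" for i by (rule le_less_trans) simp
  then have "conv (mol (r i)) (piece i) x = 0" for i by (rule conv_piece_outside[OF r_pos r_small])
  then show ?thesis by (simp add: smoothing_def)
qed

lemma smoothing_Cinf: "Cinf_on \<Omega> (smoothing r)"
  unfolding Cinf_on_def
proof
  fix k
  show "Ck_on k \<Omega> (smoothing r)"
  proof (rule Ck_on_local)
    fix x assume "x \<in> \<Omega>"
    then obtain m where m: "1 / 2 ^ m < depth \<Omega> x" using depth_level by blast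
    show "\<exists>U G. open U \<and> x \<in> U \<and> (\<forall>y\<in>U. smoothing r y = G y) \<and> Ck_on k UNIV G"
    proof (intro exI conjI ballI)
      show "open {x. 1 / 2 ^ m < depth \<Omega> x}" by (intro open_Collect_less continuous_intros depth_continuous)
      show "x \<in> {x. 1 / 2 ^ m < depth \<Omega> x}" using m by simp
      show "Ck_on k UNIV (\<lambda>x. \<Sum>i<m+3. conv (mol (r i)) (piece i) x)"
        by (rule sum_conv_Ck[where r=r]) (auto intro: mol_kernel r_pos piece_integrable)
      show "smoothing r y = (\<Sum>i<m+3. conv (mol (r i)) (piece i) y)" if "y \<in> {x. 1 / 2 ^ m < depth \<Omega> x}" for y
        using that by (intro smoothing_finite) auto
    qed
  qed
qed

lemma smoothing_borel [measurable]: "smoothing r \<in> borel_measurable borel"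
  unfolding smoothing_def[abs_def] by measurable

lemma smoothing_locally_integrable: "locally_integrable \<Omega> (smoothing r)"
  unfolding locally_integrable_def
proof (intro conjI allI impI)
  fix K assume K: "compact K \<and> K \<subseteq> \<Omega>"
  have "Ck_on 0 \<Omega> (smoothing r)" using smoothing_Cinf unfolding Cinf_on_def by blast
  then have "continuous_on K (smoothing r)" using K continuous_on_subset[of \<Omega> _ K] by simp
  then have "integrable lborel (\<lambda>x. indicator K x *\<^sub>R smoothing r x)" using K by (intro borel_integrable_compact) auto
  then show "integrable lborel (\<lambda>x. indicator K x * smoothing r x)" by simp
qed (auto simp: smoothing_outside)

lemma finite_geometric_sum: "(\<Sum>i<n. ennreal (e * (1/2) ^ Suc i)) \<le> ennreal e"
  unfolding suminf_geometric_ennreal[OF e_pos, symmetric] by (rule sum_le_suminf) auto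

lemma smoothing_L1: "(\<integral>\<^sup>+x. ennreal \<bar>smoothing r x - f x\<bar> * w x \<partial>lborel) \<le> ennreal e"
proof -
  have "(\<integral>\<^sup>+x. ennreal \<bar>smoothing r x - f x\<bar> * w x \<partial>lborel)
     \<le> (\<integral>\<^sup>+x. (\<Sum>i. ennreal (norm (conv (mol (r i)) (piece i) x - piece i x)) * w x) \<partial>lborel)"
  proof (rule nn_integral_mono)
    fix x
    show "ennreal \<bar>smoothing r x - f x\<bar> * w x \<le> (\<Sum>i. ennreal (norm (conv (mol (r i)) (piece i) x - piece i x)) * w x)"
    proof (cases "x \<in> \<Omega>")
      case True
      then obtain m where m: "1 / 2 ^ m \<le> depth \<Omega> x" using depth_level less_imp_le by blast
      have "smoothing r x - f x = (\<Sum>i<m+3. conv (mol (r i)) (piece i) x - piece i x)"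
        unfolding smoothing_finite[OF m] f_finite[OF m] by (rule sum_subtractf[symmetric])
      then have "\<bar>smoothing r x - f x\<bar> \<le> (\<Sum>i<m+3. norm (conv (mol (r i)) (piece i) x - piece i x))"
        by (simp only: real_norm_def sum_abs)
      then have "ennreal \<bar>smoothing r x - f x\<bar> \<le> (\<Sum>i<m+3. ennreal (norm (conv (mol (r i)) (piece i) x - piece i x)))"
        by (subst sum_ennreal) (auto intro: ennreal_leI)
      then have "ennreal \<bar>smoothing r x - f x\<bar> * w x \<le> (\<Sum>i<m+3. ennreal (norm (conv (mol (r i)) (piece i) x - piece i x))) * w x"
        by (rule mult_right_mono) simp
      also have "\<dots> = (\<Sum>i<m+3. ennreal (norm (conv (mol (r i)) (piece i) x - piece i x)) * w x)" by (rule sum_distrib_right)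
      also have "\<dots> \<le> (\<Sum>i. ennreal (norm (conv (mol (r i)) (piece i) x - piece i x)) * w x)" by (rule sum_le_suminf) auto
      finally show ?thesis .
    qed (simp add: smoothing_outside f_outside)
  qed
  also have "\<dots> = (\<Sum>i. \<integral>\<^sup>+x. ennreal (norm (conv (mol (r i)) (piece i) x - piece i x)) * w x \<partial>lborel)"
    by (rule nn_integral_suminf) measurable
  also have "\<dots> \<le> (\<Sum>i. ennreal (e * (1/2) ^ Suc i))" using r by (intro suminf_le) (auto simp: good_def)
  also have "\<dots> = ennreal e" by (rule suminf_geometric_ennreal[OF e_pos])
  finally show ?thesis .
qed

text \<open>The heart of the construction. Moving the mollifications and the partition functions from \<open>f\<close> to the test field turns \<open>\<phi>\<close>
into \<open>\<psi> = (\<Sum>i<n. \<zeta>\<^sub>i *\<^sub>R (\<rho>\<^sub>i * \<phi>))\<close>, with \<open>\<zeta>\<^sub>i\<close> the shells and \<open>\<rho>\<^sub>i\<close> the mollifiers. The error consists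
of the terms \<open>\<integral> (\<rho>\<^sub>i * (f \<nabla>\<zeta>\<^sub>i)) \<bullet> \<phi>\<close>. Without mollification these would sum to zero, because the
\<open>\<zeta>\<^sub>i\<close> sum to \<open>1\<close> on the support of \<open>\<phi>\<close>, and \<open>good\<close> controls the effect of the mollification
since \<open>norm (\<phi> x) \<le> w x\<close>. The last bound is pointwise and keeps track of the individual
radii; it is used in two different ways below.\<close>

lemma smoothing_test_field:
  assumes p: "lipc K \<phi>" "K \<subseteq> \<Omega>" and pw: "\<And>x. x \<in> \<Omega> \<Longrightarrow> ennreal (norm (\<phi> x)) \<le> w x"
  shows "\<exists>\<psi> n. lipc (shellK n) \<psi> \<and> pairing (smoothing r) \<phi> \<le> pairing f \<psi> + e
    \<and> (\<forall>x. ennreal (norm (\<psi> x)) \<le> (\<Sum>i<n. ennreal (shell \<Omega> i x) * wmol (r i) w x))"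
proof -
  obtain L where L: "compact K" "L-lipschitz_on UNIV \<phi>" "\<And>x. x \<notin> K \<Longrightarrow> \<phi> x = 0" using lipcE[OF p(1)] by metis
  have [measurable]: "\<phi> \<in> borel_measurable borel" by (rule lipc_borel[OF p(1)])
  have pw': "ennreal (norm (\<phi> x)) \<le> w x" for x
    using pw[of x] L(3)[of x] subsetD[OF p(2), of x] by (cases "x \<in> K") auto
  obtain m where m: "\<And>x. x \<in> K \<Longrightarrow> 1 / 2 ^ m \<le> depth \<Omega> x" using depth_exhaust[OF L(1) p(2) open_dom] by metis
  \<comment> \<open>On the support of \<open>\<phi>\<close> all mollified pieces from this index on vanish and the first \<open>n\<close> shells sum to \<open>1\<close>.\<close>
  define n where "n = m + 3"
  obtain R where R: "\<And>x. x \<in> K \<Longrightarrow> norm x \<le> R" using compact_imp_bounded[OF L(1)] by (auto simp: bounded_iff)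
  define \<Phi> where "\<Phi> i = conv (mol (r i)) \<phi>" for i
  have lP: "lipc (cball 0 (R + 1)) (\<Phi> i)" for i
    unfolding \<Phi>_def
  proof (rule lipc_conv[OF p(1) r_pos compact_cball])
    fix x y assume y: "y \<in> K" "dist x y < r i"
    have "(1::real) \<le> 2 ^ (i + 2)" by (rule one_le_power) simp
    then have "(1::real) / 2 ^ (i + 2) \<le> 1" by (simp add: divide_le_eq)
    then have "dist x y < 1" using y(2) r_small[of i] by linarith
    moreover have "norm x \<le> norm y + dist x y" by (metis dist_norm norm_triangle_sub)
    ultimately show "x \<in> cball 0 (R + 1)" using R[OF y(1)] by simp
  qed
  have sub: "shellK i \<subseteq> shellK n" if "i < n" for i
  proof -
    have "(1::real) / 2 ^ Suc n \<le> 1 / 2 ^ Suc i" using that by (intro divide_left_mono power_increasing) auto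
    then show ?thesis by (auto simp: shellK_def)
  qed
  have lz: "lipc (shellK n) (\<lambda>x. shell \<Omega> i x *\<^sub>R \<Phi> i x)" if "i < n" for i
    by (rule lipc_mono[OF piece_product(1)[OF lP] sub[OF that] shellK(1)])
  have lzp: "lipc (shellK n) (\<lambda>x. shell \<Omega> i x *\<^sub>R \<phi> x)" if "i < n" for i
    by (rule lipc_mono[OF piece_product(1)[OF p(1)] sub[OF that] shellK(1)])
  define \<psi> where "\<psi> x = (\<Sum>i<n. shell \<Omega> i x *\<^sub>R \<Phi> i x)" for x
  have lpsi: "lipc (shellK n) \<psi>" unfolding \<psi>_def[abs_def] by (rule lipc_sum[OF _ lz shellK(1)]) auto
  have ppsi: "pairing f \<psi> = (\<Sum>i<n. pairing f (\<lambda>x. shell \<Omega> i x *\<^sub>R \<Phi> i x))"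
    unfolding \<psi>_def[abs_def] by (rule pairing_sum[OF f_locally_integrable _ lz shellK(1,2)]) auto
  have ci: "integrable lborel (conv (mol (r i)) (piece i))" "integrable lborel (conv (mol (r i)) (grad_piece i))" for i
    by (intro conv_integrable piece_integrable r_pos)+
  note ib = integrable_mult_borel_div[OF p(1)]
  have step1: "pairing (smoothing r) \<phi> = (\<Sum>i<n. pairing (piece i) (\<Phi> i))"
  proof -
    have "pairing (smoothing r) \<phi> = (\<integral>x. (\<Sum>i<n. conv (mol (r i)) (piece i) x * borel_div \<phi> x) \<partial>lborel)"
      unfolding pairing_def
    proof (rule Bochner_Integration.integral_cong[OF refl])
      fix x
      show "smoothing r x * borel_div \<phi> x = (\<Sum>i<n. conv (mol (r i)) (piece i) x * borel_div \<phi> x)"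
      proof (cases "x \<in> K")
        case True
        show ?thesis unfolding n_def smoothing_finite[OF m[OF True]] by (rule sum_distrib_right)
      next
        case False then show ?thesis using borel_div_zero_outside[OF p(1)] by simp
      qed
    qed
    also have "\<dots> = (\<Sum>i<n. \<integral>x. conv (mol (r i)) (piece i) x * borel_div \<phi> x \<partial>lborel)"
      by (rule Bochner_Integration.integral_sum) (intro ib ci)
    also have "\<dots> = (\<Sum>i<n. pairing (piece i) (\<Phi> i))"
      unfolding \<Phi>_def pairing_conv[OF piece_integrable(1) p(1) r_pos] ..
    finally show ?thesis .
  qed
  have step2: "pairing (piece i) (\<Phi> i) = pairing f (\<lambda>x. shell \<Omega> i x *\<^sub>R \<Phi> i x) - (\<integral>x. conv (mol (r i)) (grad_piece i) x \<bullet> \<phi> x \<partial>lborel)" for i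
    using piece_product(3)[OF lP, of i] conv_duality_vec[OF piece_integrable(2) p(1) r_pos ci(2), of i]
    by (simp add: piece_def[abs_def] grad_piece_def[abs_def] \<Phi>_def)
  \<comment> \<open>Comparing the product rule for \<open>\<zeta>\<^sub>i *\<^sub>R \<phi>\<close>, summed over \<open>i\<close>, with the pairing of \<open>f\<close> and \<open>\<phi>\<close> itself.\<close>
  have step3: "(\<Sum>i<n. \<integral>x. grad_piece i x \<bullet> \<phi> x \<partial>lborel) = 0"
  proof -
    have one: "(\<Sum>i<n. shell \<Omega> i x) = 1" if "x \<in> K" for x
    proof -
      have "(2::real) / 2 ^ (m + 3) \<le> 1 / 2 ^ m" by (simp add: power_add field_simps)
      then have "2 / 2 ^ n \<le> depth \<Omega> x" using m[OF that] unfolding n_def by linarith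
      then show ?thesis unfolding sum_shell by (rule shell_cut_one)
    qed
    have "(\<Sum>i<n. pairing (piece i) \<phi>) = (\<integral>x. (\<Sum>i<n. piece i x * borel_div \<phi> x) \<partial>lborel)"
      unfolding pairing_def by (rule Bochner_Integration.integral_sum[symmetric]) (intro ib piece_integrable)
    also have "\<dots> = pairing f \<phi>"
      unfolding pairing_def
    proof (rule Bochner_Integration.integral_cong[OF refl])
      fix x
      show "(\<Sum>i<n. piece i x * borel_div \<phi> x) = f x * borel_div \<phi> x"
      proof (cases "x \<in> K")
        case True then show ?thesis by (simp add: piece_def sum_distrib_right[symmetric] one)
      next
        case False then show ?thesis using borel_div_zero_outside[OF p(1)] by simp
      qed
    qed
    finally have 1: "(\<Sum>i<n. pairing (piece i) \<phi>) = pairing f \<phi>" .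
    have "(\<lambda>x. \<Sum>i<n. shell \<Omega> i x *\<^sub>R \<phi> x) = \<phi>"
    proof
      fix x show "(\<Sum>i<n. shell \<Omega> i x *\<^sub>R \<phi> x) = \<phi> x"
        using one[of x] L(3)[of x] by (cases "x \<in> K") (simp_all flip: scaleR_left.sum)
    qed
    then have 2: "(\<Sum>i<n. pairing f (\<lambda>x. shell \<Omega> i x *\<^sub>R \<phi> x)) = pairing f \<phi>"
      using pairing_sum[of \<Omega> f "{..<n}" "shellK n" "\<lambda>i x. shell \<Omega> i x *\<^sub>R \<phi> x", OF f_locally_integrable finite_lessThan _ shellK(1,2)] lzp by simp
    have "pairing (piece i) \<phi> = pairing f (\<lambda>x. shell \<Omega> i x *\<^sub>R \<phi> x) - (\<integral>x. grad_piece i x \<bullet> \<phi> x \<partial>lborel)" for i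
      using piece_product(3)[OF p(1), of i] by (simp add: piece_def[abs_def] grad_piece_def[abs_def])
    then have "(\<Sum>i<n. pairing (piece i) \<phi>) = (\<Sum>i<n. pairing f (\<lambda>x. shell \<Omega> i x *\<^sub>R \<phi> x)) - (\<Sum>i<n. \<integral>x. grad_piece i x \<bullet> \<phi> x \<partial>lborel)"
      by (simp add: sum_subtractf)
    then show ?thesis using 1 2 by simp
  qed
  have step4: "\<bar>(\<integral>x. conv (mol (r i)) (grad_piece i) x \<bullet> \<phi> x \<partial>lborel) - (\<integral>x. grad_piece i x \<bullet> \<phi> x \<partial>lborel)\<bar> \<le> e * (1/2) ^ Suc i" for i
  proof -
    have iG: "integrable lborel (\<lambda>x. grad_piece i x \<bullet> \<phi> x)"
      using piece_product(2)[OF p(1), of i] by (simp add: grad_piece_def[abs_def])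
    obtain B where B: "B > 0" "\<And>x. norm (\<phi> x) \<le> B" using lipc_bounded[OF p(1)] by metis
    have iC: "integrable lborel (\<lambda>x. conv (mol (r i)) (grad_piece i) x \<bullet> \<phi> x)"
    proof (rule Bochner_Integration.integrable_bound)
      show "integrable lborel (\<lambda>x. B * norm (conv (mol (r i)) (grad_piece i) x))" using ci(2) by auto
      show "AE x in lborel. norm (conv (mol (r i)) (grad_piece i) x \<bullet> \<phi> x) \<le> norm (B * norm (conv (mol (r i)) (grad_piece i) x))"
      proof (rule AE_I2)
        fix x
        have "norm (conv (mol (r i)) (grad_piece i) x) * norm (\<phi> x) \<le> norm (conv (mol (r i)) (grad_piece i) x) * B"
          using B by (intro mult_left_mono) auto
        then show "norm (conv (mol (r i)) (grad_piece i) x \<bullet> \<phi> x) \<le> norm (B * norm (conv (mol (r i)) (grad_piece i) x))"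
          using Cauchy_Schwarz_ineq2[of "conv (mol (r i)) (grad_piece i) x" "\<phi> x"] B(1) by (simp add: mult.commute)
      qed
    qed simp
    have id: "integrable lborel (\<lambda>x. (conv (mol (r i)) (grad_piece i) x - grad_piece i x) \<bullet> \<phi> x)"
      using Bochner_Integration.integrable_diff[OF iC iG] by (simp add: inner_diff_left)
    have eq: "(\<integral>x. conv (mol (r i)) (grad_piece i) x \<bullet> \<phi> x \<partial>lborel) - (\<integral>x. grad_piece i x \<bullet> \<phi> x \<partial>lborel)
       = (\<integral>x. (conv (mol (r i)) (grad_piece i) x - grad_piece i x) \<bullet> \<phi> x \<partial>lborel)"
      using Bochner_Integration.integral_diff[OF iC iG] by (simp add: inner_diff_left)
    have "ennreal \<bar>\<integral>x. (conv (mol (r i)) (grad_piece i) x - grad_piece i x) \<bullet> \<phi> x \<partial>lborel\<bar>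
       \<le> (\<integral>\<^sup>+x. ennreal (norm ((conv (mol (r i)) (grad_piece i) x - grad_piece i x) \<bullet> \<phi> x)) \<partial>lborel)"
      using integral_norm_bound_ennreal[OF id] by simp
    also have "\<dots> \<le> (\<integral>\<^sup>+x. ennreal (norm (conv (mol (r i)) (grad_piece i) x - grad_piece i x)) * w x \<partial>lborel)"
    proof (rule nn_integral_mono)
      fix x
      have "ennreal (norm ((conv (mol (r i)) (grad_piece i) x - grad_piece i x) \<bullet> \<phi> x))
         \<le> ennreal (norm (conv (mol (r i)) (grad_piece i) x - grad_piece i x) * norm (\<phi> x))"
        by (intro ennreal_leI) (simp add: Cauchy_Schwarz_ineq2)
      also have "\<dots> = ennreal (norm (conv (mol (r i)) (grad_piece i) x - grad_piece i x)) * ennreal (norm (\<phi> x))"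
        by (rule ennreal_mult) auto
      also have "\<dots> \<le> ennreal (norm (conv (mol (r i)) (grad_piece i) x - grad_piece i x)) * w x" by (intro mult_left_mono pw') simp
      finally show "ennreal (norm ((conv (mol (r i)) (grad_piece i) x - grad_piece i x) \<bullet> \<phi> x)) \<le> ennreal (norm (conv (mol (r i)) (grad_piece i) x - grad_piece i x)) * w x" .
    qed
    also have "\<dots> \<le> ennreal (e * (1/2) ^ Suc i)" using r by (simp add: good_def)
    finally show ?thesis unfolding eq using e_pos by (simp add: ennreal_le_iff)
  qed
  have "pairing (smoothing r) \<phi> = pairing f \<psi> - (\<Sum>i<n. (\<integral>x. conv (mol (r i)) (grad_piece i) x \<bullet> \<phi> x \<partial>lborel) - (\<integral>x. grad_piece i x \<bullet> \<phi> x \<partial>lborel))"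
    unfolding step1 step2 ppsi sum_subtractf step3 by simp
  also have "\<dots> \<le> pairing f \<psi> + (\<Sum>i<n. e * (1/2) ^ Suc i)"
  proof -
    have "- (\<Sum>i<n. (\<integral>x. conv (mol (r i)) (grad_piece i) x \<bullet> \<phi> x \<partial>lborel) - (\<integral>x. grad_piece i x \<bullet> \<phi> x \<partial>lborel)) \<le> (\<Sum>i<n. e * (1/2) ^ Suc i)"
      unfolding sum_negf[symmetric]
    proof (rule sum_mono)
      fix i
      show "- ((\<integral>x. conv (mol (r i)) (grad_piece i) x \<bullet> \<phi> x \<partial>lborel) - (\<integral>x. grad_piece i x \<bullet> \<phi> x \<partial>lborel)) \<le> e * (1/2) ^ Suc i"
        using step4[of i] by linarith
    qed
    then show ?thesis by linarith
  qed
  also have "\<dots> \<le> pairing f \<psi> + e"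
  proof -
    have "ennreal (\<Sum>i<n. e * (1/2) ^ Suc i) = (\<Sum>i<n. ennreal (e * (1/2) ^ Suc i))" using e_pos by (intro sum_ennreal[symmetric]) auto
    also have "\<dots> \<le> ennreal e" by (rule finite_geometric_sum)
    finally show ?thesis using e_pos by (simp add: ennreal_le_iff)
  qed
  finally have fin: "pairing (smoothing r) \<phi> \<le> pairing f \<psi> + e" .
  have "ennreal (norm (\<psi> x)) \<le> (\<Sum>i<n. ennreal (shell \<Omega> i x) * wmol (r i) w x)" for x
  proof -
    have "norm (\<psi> x) \<le> (\<Sum>i<n. norm (shell \<Omega> i x *\<^sub>R \<Phi> i x))" unfolding \<psi>_def by (rule norm_sum)
    then have "ennreal (norm (\<psi> x)) \<le> (\<Sum>i<n. ennreal (norm (shell \<Omega> i x *\<^sub>R \<Phi> i x)))"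
      by (subst sum_ennreal) (auto intro: ennreal_leI)
    also have "\<dots> \<le> (\<Sum>i<n. ennreal (shell \<Omega> i x) * wmol (r i) w x)"
    proof (rule sum_mono)
      fix i
      have "ennreal (norm (shell \<Omega> i x *\<^sub>R \<Phi> i x)) = ennreal (shell \<Omega> i x) * ennreal (norm (\<Phi> i x))"
        using shell_bounds(1)[of \<Omega> i x] by (simp add: ennreal_mult)
      also have "\<dots> \<le> ennreal (shell \<Omega> i x) * wmol (r i) w x"
        unfolding \<Phi>_def by (intro mult_left_mono norm_conv_le_wmol pw') simp_all
      finally show "ennreal (norm (shell \<Omega> i x *\<^sub>R \<Phi> i x)) \<le> ennreal (shell \<Omega> i x) * wmol (r i) w x" .
    qed
    finally show ?thesis .
  qed
  then show ?thesis using lpsi fin by blast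
qed

end

end

section \<open>Variation of the smoothing\<close>

text \<open>At a point where the weight is approximable, its mollifications are asymptotically at most its value. This is how
approximability enters.\<close>

lemma wmol_le_average:
  fixes w :: "'a::euclidean_space \<Rightarrow> ennreal"
  assumes [measurable]: "w \<in> borel_measurable borel" and r: "r > 0"
  shows "wmol r w x \<le> w x + ennreal (flat_exp 0 1 * 2 ^ DIM('a) / flat_exp 0 (3/4)) * ball_average x r (\<lambda>y. ennreal_absdiff (w y) (w x))"
proof -
  define A where "A = flat_exp 0 1 * 2 ^ DIM('a) / flat_exp 0 (3/4)"
  define m where "m = measure lborel (ball (0::'a) r)"
  have m: "m > 0" unfolding m_def by (rule measure_ball_pos[OF r])
  have A: "A \<ge> 0" unfolding A_def by (intro divide_nonneg_nonneg mult_nonneg_nonneg flat_exp_nonneg) auto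
  have me: "emeasure lborel (ball x r) = ennreal m"
  proof -
    have "measure lborel (ball x r) = m"
      unfolding m_def using content_ball_conv_unit_ball[of r x] content_ball_conv_unit_ball[of r "0::'a"] r by simp
    moreover have "emeasure lborel (ball x r) \<noteq> \<infinity>" using emeasure_bounded_finite[OF bounded_ball[of x r]] by simp
    ultimately show ?thesis by (simp add: emeasure_eq_ennreal_measure)
  qed
  define d where "d y = ennreal_absdiff (w y) (w x)" for y
  have dm[measurable]: "d \<in> borel_measurable borel" unfolding d_def[abs_def] ennreal_absdiff_def by measurable
  have wd: "w y \<le> w x + d y" for y
  proof (cases "w x \<le> w y")
    case True
    have "w y = w x + (w y - w x)" using True by (simp add: add_diff_inverse_ennreal)
    also have "\<dots> \<le> w x + d y" unfolding d_def ennreal_absdiff_def by (intro add_left_mono) simp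
    finally show ?thesis .
  next
    case False
    then have "w y \<le> w x + 0" by simp
    also have "\<dots> \<le> w x + d y" by (intro add_left_mono) simp
    finally show ?thesis .
  qed
  have "wmol r w x \<le> (\<integral>\<^sup>+y. ennreal (mol r (x - y)) * w x + ennreal (mol r (x - y)) * d y \<partial>lborel)"
    unfolding wmol_def distrib_left[symmetric] by (intro nn_integral_mono mult_left_mono wd) simp
  also have "\<dots> = (\<integral>\<^sup>+y. ennreal (mol r (x - y)) * w x \<partial>lborel) + (\<integral>\<^sup>+y. ennreal (mol r (x - y)) * d y \<partial>lborel)"
    by (rule nn_integral_add) measurable
  also have "(\<integral>\<^sup>+y. ennreal (mol r (x - y)) * w x \<partial>lborel) = w x"
    using nn_integral_mol'[OF r, of x] by (simp add: nn_integral_multc)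
  also have "(\<integral>\<^sup>+y. ennreal (mol r (x - y)) * d y \<partial>lborel) \<le> (\<integral>\<^sup>+y. ennreal (A / m) * (d y * indicator (ball x r) y) \<partial>lborel)"
  proof (rule nn_integral_mono)
    fix y
    show "ennreal (mol r (x - y)) * d y \<le> ennreal (A / m) * (d y * indicator (ball x r) y)"
    proof (cases "y \<in> ball x r")
      case True
      have "ennreal (mol r (x - y)) \<le> ennreal (A / m)"
        unfolding A_def m_def by (rule ennreal_leI[OF mol_upper[OF r]])
      then show ?thesis using True by (simp add: mult_right_mono)
    next
      case False
      then have "mol r (x - y) = 0" by (intro mol_support[OF r]) (simp add: dist_norm)
      then show ?thesis by simp
    qed
  qed
  also have "(\<integral>\<^sup>+y. ennreal (A / m) * (d y * indicator (ball x r) y) \<partial>lborel) = ennreal (A / m) * (\<integral>\<^sup>+y\<in>ball x r. d y \<partial>lborel)"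
    by (rule nn_integral_cmult) (simp add: weight_indicator_measurable)
  also have "\<dots> = ennreal A * ((\<integral>\<^sup>+y\<in>ball x r. d y \<partial>lborel) / ennreal m)"
    using A m by (simp add: divide_ennreal[symmetric] ennreal_times_divide ennreal_divide_times)
  also have "(\<integral>\<^sup>+y\<in>ball x r. d y \<partial>lborel) / ennreal m = ball_average x r d"
    unfolding ball_average_def by (simp add: nn_integral_completion me)
  finally show ?thesis unfolding A_def d_def by (simp add: add_left_mono)
qed

context weighted_BV
begin

lemma integral_weight_le: "(\<integral>\<^sup>+x. w x \<partial>TV_measure \<Omega> f) \<le> Var f \<Omega> w"
  by (rule integral_weight_le_Var[OF f_locally_integrable open_dom weight_lsc weight_borel f_Var])

text \<open>On compact sets the weight has a positive lower bound, so finite weighted variation gives locally finite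
classical variation.\<close>

lemma TV_finite:
  assumes "compact K" "U \<subseteq> K" "U \<subseteq> \<Omega>"
  shows "TV f U < \<infinity>"
proof -
  obtain c where c: "c > 0" "\<forall>x\<in>K. ennreal c \<le> w x" using weight_low[OF assms(1)] by blast
  have "(\<Sum>i<(1::nat). ennreal c * TV f U) \<le> Var f \<Omega> w"
    by (rule layer_sum_le_Var[OF f_locally_integrable _ c(1) _ f_Var]) (use assms c in \<open>auto simp: indicator_def\<close>)
  then have "ennreal c * TV f U < \<infinity>" using f_Var by (simp add: le_less_trans)
  then show ?thesis using c(1) by (auto simp: ennreal_mult_less_top)
qed

text \<open>Here the radii are discarded: each \<open>wmol (r i) w\<close> is at most \<open>C\<close> times \<open>w\<close>, so the field \<open>\<psi>\<close> divided by
\<open>C\<close> is admissible for \<open>f\<close>.\<close>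

lemma Var_smoothing_le_C:
  assumes r: "good r e"
  shows "Var (smoothing r) \<Omega> w \<le> ennreal C * Var f \<Omega> w + ennreal e"
proof (rule Var_least)
  fix \<phi> :: "'a \<Rightarrow> 'a" and K assume p: "lipc K \<phi>" "K \<subseteq> \<Omega>" "\<And>x. x \<in> \<Omega> \<Longrightarrow> ennreal (norm (\<phi> x)) \<le> w x"
  obtain \<psi> n where q: "lipc (shellK n) \<psi>" "pairing (smoothing r) \<phi> \<le> pairing f \<psi> + e"
    "\<forall>x. ennreal (norm (\<psi> x)) \<le> (\<Sum>i<n. ennreal (shell \<Omega> i x) * wmol (r i) w x)"
    using smoothing_test_field[OF r p] by blast
  have rp: "r i > 0" for i using r by (simp add: good_def)
  have nb: "ennreal (norm (\<psi> x)) \<le> ennreal C * w x" for x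
  proof -
    have "ennreal (norm (\<psi> x)) \<le> (\<Sum>i<n. ennreal (shell \<Omega> i x) * wmol (r i) w x)" using q(3) by blast
    also have "\<dots> \<le> (\<Sum>i<n. ennreal (shell \<Omega> i x) * (ennreal C * w x))" by (intro sum_mono mult_left_mono wmol_bound rp) simp
    also have "\<dots> = (\<Sum>i<n. ennreal (shell \<Omega> i x)) * (ennreal C * w x)" by (rule sum_distrib_right[symmetric])
    also have "(\<Sum>i<n. ennreal (shell \<Omega> i x)) = ennreal (\<Sum>i<n. shell \<Omega> i x)" by (rule sum_ennreal) (rule shell_bounds)
    also have "ennreal (\<Sum>i<n. shell \<Omega> i x) * (ennreal C * w x) \<le> 1 * (ennreal C * w x)"
      by (intro mult_right_mono) (simp_all add: ennreal_le_1 sum_shell_le)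
    finally show ?thesis by simp
  qed
  have "ennreal (pairing f (\<lambda>x. (1 / C) *\<^sub>R \<psi> x)) \<le> Var f \<Omega> w"
  proof (rule Var_upper[OF lipc_cmult[OF q(1)] shellK(2)])
    fix x
    have "ennreal (norm ((1 / C) *\<^sub>R \<psi> x)) = ennreal (1 / C) * ennreal (norm (\<psi> x))"
      using C_pos by (simp add: ennreal_mult[symmetric])
    also have "\<dots> \<le> ennreal (1 / C) * (ennreal C * w x)" by (intro mult_left_mono nb) simp
    also have "\<dots> = w x" using C_pos by (simp add: mult.assoc[symmetric] ennreal_mult[symmetric])
    finally show "ennreal (norm ((1 / C) *\<^sub>R \<psi> x)) \<le> w x" .
  qed
  then have "ennreal C * ennreal ((1 / C) * pairing f \<psi>) \<le> ennreal C * Var f \<Omega> w"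
    unfolding pairing_cmult[OF f_locally_integrable q(1)] by (rule mult_left_mono) simp
  then have 1: "ennreal (pairing f \<psi>) \<le> ennreal C * Var f \<Omega> w" using C_pos by (simp add: ennreal_mult'[symmetric])
  have "ennreal (pairing (smoothing r) \<phi>) \<le> ennreal (pairing f \<psi> + e)" by (rule ennreal_leI[OF q(2)])
  also have "\<dots> \<le> ennreal (pairing f \<psi>) + ennreal e" by (rule ennreal_add_le)
  also have "\<dots> \<le> ennreal C * Var f \<Omega> w + ennreal e" by (intro add_right_mono 1)
  finally show "ennreal (pairing (smoothing r) \<phi>) \<le> ennreal C * Var f \<Omega> w + ennreal e" .
qed

text \<open>Here \<open>\<psi>\<close> is not compared with the weight pointwise but integrated against the variation measure. It suffices
that the mollified weights do not exceed the weight by much in the mean, separately on each shell.\<close>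

lemma Var_smoothing_le_approximable:
  assumes r: "good r e" and a: "\<And>i. (\<integral>\<^sup>+x. ennreal (shell \<Omega> i x) * wmol (r i) w x \<partial>TV_measure \<Omega> f)
      \<le> (\<integral>\<^sup>+x. ennreal (shell \<Omega> i x) * w x \<partial>TV_measure \<Omega> f) + ennreal (e * (1/2) ^ Suc i)"
  shows "Var (smoothing r) \<Omega> w \<le> Var f \<Omega> w + ennreal e + ennreal e"
proof (rule Var_least)
  fix \<phi> :: "'a \<Rightarrow> 'a" and K assume p: "lipc K \<phi>" "K \<subseteq> \<Omega>" "\<And>x. x \<in> \<Omega> \<Longrightarrow> ennreal (norm (\<phi> x)) \<le> w x"
  obtain \<psi> n where q: "lipc (shellK n) \<psi>" "pairing (smoothing r) \<phi> \<le> pairing f \<psi> + e"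
    "\<forall>x. ennreal (norm (\<psi> x)) \<le> (\<Sum>i<n. ennreal (shell \<Omega> i x) * wmol (r i) w x)"
    using smoothing_test_field[OF r p] by blast
  \<comment> \<open>An open neighbourhood of the support on which the classical variation is finite.\<close>
  define W where "W = {x. 1 / 2 ^ (n + 2) < depth \<Omega> x}"
  have W: "open W" "W \<subseteq> {x. 1 / 2 ^ (n + 2) \<le> depth \<Omega> x}" "shellK n \<subseteq> W"
  proof -
    show "open W" unfolding W_def by (intro open_Collect_less continuous_intros depth_continuous)
    have "(1::real) / 2 ^ (n + 2) < 1 / 2 ^ Suc n" by (simp add: power_add field_simps)
    then show "shellK n \<subseteq> W" by (auto simp: W_def shellK_def)
  qed (auto simp: W_def)
  have WO: "W \<subseteq> \<Omega>" using W(2) depth_compact(2)[OF open_dom, of "1 / 2 ^ (n + 2)"] by auto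
  have Wf: "TV f W < \<infinity>" by (rule TV_finite[OF depth_compact(1)[OF open_dom] W(2) WO]) simp
  have m1: "(\<lambda>x. ennreal (shell \<Omega> i x) * wmol (r i) w x) \<in> borel_measurable (TV_measure \<Omega> f)" for i
    by (rule TV_measure_measurable) measurable
  have m2: "(\<lambda>x. ennreal (shell \<Omega> i x) * w x) \<in> borel_measurable (TV_measure \<Omega> f)" for i
    by (rule TV_measure_measurable) measurable
  have "ennreal (pairing f \<psi>) \<le> (\<integral>\<^sup>+x. ennreal (norm (\<psi> x)) \<partial>TV_measure \<Omega> f)"
    by (rule pairing_le_integral_norm[OF f_locally_integrable open_dom q(1) W(3,1) WO Wf])
  also have "\<dots> \<le> (\<integral>\<^sup>+x. (\<Sum>i<n. ennreal (shell \<Omega> i x) * wmol (r i) w x) \<partial>TV_measure \<Omega> f)"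
    by (intro nn_integral_mono) (use q(3) in blast)
  also have "\<dots> = (\<Sum>i<n. \<integral>\<^sup>+x. ennreal (shell \<Omega> i x) * wmol (r i) w x \<partial>TV_measure \<Omega> f)"
    by (rule nn_integral_sum) (rule m1)
  also have "\<dots> \<le> (\<Sum>i<n. (\<integral>\<^sup>+x. ennreal (shell \<Omega> i x) * w x \<partial>TV_measure \<Omega> f) + ennreal (e * (1/2) ^ Suc i))"
    by (rule sum_mono) (rule a)
  also have "\<dots> = (\<integral>\<^sup>+x. (\<Sum>i<n. ennreal (shell \<Omega> i x) * w x) \<partial>TV_measure \<Omega> f) + (\<Sum>i<n. ennreal (e * (1/2) ^ Suc i))"
    unfolding sum.distrib by (subst nn_integral_sum) (auto intro: m2)
  also have "\<dots> \<le> (\<integral>\<^sup>+x. w x \<partial>TV_measure \<Omega> f) + ennreal e"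
  proof (rule add_mono)
    show "(\<integral>\<^sup>+x. (\<Sum>i<n. ennreal (shell \<Omega> i x) * w x) \<partial>TV_measure \<Omega> f) \<le> (\<integral>\<^sup>+x. w x \<partial>TV_measure \<Omega> f)"
    proof (rule nn_integral_mono)
      fix x
      have "(\<Sum>i<n. ennreal (shell \<Omega> i x) * w x) = (\<Sum>i<n. ennreal (shell \<Omega> i x)) * w x" by (rule sum_distrib_right[symmetric])
      also have "(\<Sum>i<n. ennreal (shell \<Omega> i x)) = ennreal (\<Sum>i<n. shell \<Omega> i x)" by (rule sum_ennreal) (rule shell_bounds)
      also have "ennreal (\<Sum>i<n. shell \<Omega> i x) * w x \<le> 1 * w x"
        by (intro mult_right_mono) (simp_all add: ennreal_le_1 sum_shell_le)
      finally show "(\<Sum>i<n. ennreal (shell \<Omega> i x) * w x) \<le> w x" by simp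
    qed
    show "(\<Sum>i<n. ennreal (e * (1/2) ^ Suc i)) \<le> ennreal e" by (rule finite_geometric_sum[OF r])
  qed
  also have "\<dots> \<le> Var f \<Omega> w + ennreal e" by (intro add_right_mono integral_weight_le)
  finally have 1: "ennreal (pairing f \<psi>) \<le> Var f \<Omega> w + ennreal e" .
  have "ennreal (pairing (smoothing r) \<phi>) \<le> ennreal (pairing f \<psi> + e)" by (rule ennreal_leI[OF q(2)])
  also have "\<dots> \<le> ennreal (pairing f \<psi>) + ennreal e" by (rule ennreal_add_le)
  also have "\<dots> \<le> Var f \<Omega> w + ennreal e + ennreal e" by (intro add_right_mono 1)
  finally show "ennreal (pairing (smoothing r) \<phi>) \<le> Var f \<Omega> w + ennreal e + ennreal e" .
qed

lemma good_radius:
  assumes e: "e > 0"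
  shows "\<forall>\<^sub>F n in sequentially. 0 < 1 / real (Suc n) \<and> 1 / real (Suc n) \<le> 1 / 2 ^ (i + 2)
     \<and> (\<integral>\<^sup>+x. ennreal (norm (conv (mol (1 / real (Suc n))) (piece i) x - piece i x)) * w x \<partial>lborel) \<le> ennreal (e * (1/2) ^ Suc i)
     \<and> (\<integral>\<^sup>+x. ennreal (norm (conv (mol (1 / real (Suc n))) (grad_piece i) x - grad_piece i x)) * w x \<partial>lborel) \<le> ennreal (e * (1/2) ^ Suc i)"
proof -
  have p: "0 < ennreal (e * (1/2) ^ Suc i)" using e by simp
  note lim = filterlim_compose[OF piece_mollify(1) inverse_Suc_at_right, of i] filterlim_compose[OF piece_mollify(2) inverse_Suc_at_right, of i]
  have "(\<lambda>n. 1 / real (Suc n)) \<longlonglongrightarrow> 0" using LIMSEQ_inverse_real_of_nat by (simp add: inverse_eq_divide)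
  then have "\<forall>\<^sub>F n in sequentially. 1 / real (Suc n) < 1 / 2 ^ (i + 2)" by (rule order_tendstoD) simp
  then show ?thesis using order_tendstoD(2)[OF lim(1) p] order_tendstoD(2)[OF lim(2) p]
    by eventually_elim (auto intro: less_imp_le simp del: of_nat_Suc power_Suc)
qed

text \<open>Every requirement on the radius of a single shell holds eventually, so all of them can be met, shell by shell.\<close>

lemma good_sequence:
  assumes e: "e > 0" and Q: "\<And>i. \<forall>\<^sub>F n in sequentially. Q i (1 / real (Suc n))"
  shows "\<exists>r. good r e \<and> (\<forall>i. Q i (r i))"
proof -
  define P where "P i \<rho> \<longleftrightarrow> 0 < \<rho> \<and> \<rho> \<le> 1 / 2 ^ (i + 2)
     \<and> (\<integral>\<^sup>+x. ennreal (norm (conv (mol \<rho>) (piece i) x - piece i x)) * w x \<partial>lborel) \<le> ennreal (e * (1/2) ^ Suc i)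
     \<and> (\<integral>\<^sup>+x. ennreal (norm (conv (mol \<rho>) (grad_piece i) x - grad_piece i x)) * w x \<partial>lborel) \<le> ennreal (e * (1/2) ^ Suc i)" for i \<rho>
  have "\<exists>n. P i (1 / real (Suc n)) \<and> Q i (1 / real (Suc n))" for i
  proof (rule eventually_happens'[OF sequentially_bot])
    show "\<forall>\<^sub>F n in sequentially. P i (1 / real (Suc n)) \<and> Q i (1 / real (Suc n))"
      unfolding P_def by (rule eventually_conj[OF good_radius[OF e] Q])
  qed
  then have "\<forall>i. \<exists>\<rho>. P i \<rho> \<and> Q i \<rho>" by (intro allI) (erule meta_allE, erule exE, rule exI)
  from choice[OF this] obtain r where r: "\<forall>i. P i (r i) \<and> Q i (r i)" ..
  show ?thesis
  proof (intro exI conjI allI)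
    show "good r e" unfolding good_def using e r by (simp only: P_def) simp
    show "Q i (r i)" for i using r by simp
  qed
qed

text \<open>The reverse Fatou lemma with the dominating function \<open>C * w\<close>, which is integrable with respect to the variation measure
since the weighted variation is finite.\<close>

lemma limsup_wmol_integral:
  assumes ap: "AE x in TV_measure \<Omega> f. ((\<lambda>\<epsilon>. ball_average x \<epsilon> (\<lambda>y. ennreal_absdiff (w y) (w x))) \<longlongrightarrow> 0) (at_right 0)"
  shows "limsup (\<lambda>n. \<integral>\<^sup>+x. ennreal (shell \<Omega> i x) * wmol (1 / real (Suc n)) w x \<partial>TV_measure \<Omega> f) \<le> (\<integral>\<^sup>+x. ennreal (shell \<Omega> i x) * w x \<partial>TV_measure \<Omega> f)"
proof -
  have fin: "(\<integral>\<^sup>+x. w x \<partial>TV_measure \<Omega> f) < \<infinity>" using integral_weight_le f_Var by (rule le_less_trans)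
  have "limsup (\<lambda>n. \<integral>\<^sup>+x. ennreal (shell \<Omega> i x) * wmol (1 / real (Suc n)) w x \<partial>TV_measure \<Omega> f)
     \<le> (\<integral>\<^sup>+x. limsup (\<lambda>n. ennreal (shell \<Omega> i x) * wmol (1 / real (Suc n)) w x) \<partial>TV_measure \<Omega> f)"
  proof (rule nn_integral_limsup)
    show "(\<lambda>x. ennreal (shell \<Omega> i x) * wmol (1 / real (Suc n)) w x) \<in> borel_measurable (TV_measure \<Omega> f)" for n
      by (rule TV_measure_measurable) measurable
    show "(\<lambda>x. ennreal C * w x) \<in> borel_measurable (TV_measure \<Omega> f)" by (rule TV_measure_measurable) measurable
    show "AE x in TV_measure \<Omega> f. ennreal (shell \<Omega> i x) * wmol (1 / real (Suc n)) w x \<le> ennreal C * w x" for n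
    proof (rule AE_I2)
      fix x
      have "ennreal (shell \<Omega> i x) * wmol (1 / real (Suc n)) w x \<le> 1 * (ennreal C * w x)"
        by (intro mult_mono wmol_bound) (simp_all add: ennreal_le_1 shell_bounds)
      then show "ennreal (shell \<Omega> i x) * wmol (1 / real (Suc n)) w x \<le> ennreal C * w x" by simp
    qed
    have "(\<integral>\<^sup>+x. ennreal C * w x \<partial>TV_measure \<Omega> f) = ennreal C * (\<integral>\<^sup>+x. w x \<partial>TV_measure \<Omega> f)"
      by (rule nn_integral_cmult) (rule TV_measure_measurable[OF weight_borel])
    then show "(\<integral>\<^sup>+x. ennreal C * w x \<partial>TV_measure \<Omega> f) < \<infinity>" using fin by (simp add: ennreal_mult_less_top)
  qed
  also have "\<dots> \<le> (\<integral>\<^sup>+x. ennreal (shell \<Omega> i x) * w x \<partial>TV_measure \<Omega> f)"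
  proof (rule nn_integral_mono_AE)
    show "AE x in TV_measure \<Omega> f. limsup (\<lambda>n. ennreal (shell \<Omega> i x) * wmol (1 / real (Suc n)) w x) \<le> ennreal (shell \<Omega> i x) * w x"
      using ap
    proof eventually_elim
      fix x assume lim: "((\<lambda>\<epsilon>. ball_average x \<epsilon> (\<lambda>y. ennreal_absdiff (w y) (w x))) \<longlongrightarrow> 0) (at_right 0)"
      let ?A = "ennreal (flat_exp 0 1 * 2 ^ DIM('a) / flat_exp 0 (3/4))"
      let ?b = "\<lambda>n. ball_average x (1 / real (Suc n)) (\<lambda>y. ennreal_absdiff (w y) (w x))"
      have "(\<lambda>n. ?A * ?b n) \<longlonglongrightarrow> ?A * 0"
        by (intro ennreal_tendsto_cmult filterlim_compose[OF lim inverse_Suc_at_right]) simp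
      then have "(\<lambda>n. w x + ?A * ?b n) \<longlonglongrightarrow> w x + ?A * 0" by (intro tendsto_add tendsto_const)
      then have "(\<lambda>n. ennreal (shell \<Omega> i x) * (w x + ?A * ?b n)) \<longlonglongrightarrow> ennreal (shell \<Omega> i x) * (w x + ?A * 0)"
        by (intro ennreal_tendsto_cmult) simp_all
      then have "limsup (\<lambda>n. ennreal (shell \<Omega> i x) * (w x + ?A * ?b n)) = ennreal (shell \<Omega> i x) * w x"
        by (intro lim_imp_Limsup) simp_all
      moreover have "limsup (\<lambda>n. ennreal (shell \<Omega> i x) * wmol (1 / real (Suc n)) w x) \<le> limsup (\<lambda>n. ennreal (shell \<Omega> i x) * (w x + ?A * ?b n))"
        by (intro Limsup_mono always_eventually allI mult_left_mono wmol_le_average weight_borel) simp_all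
      ultimately show "limsup (\<lambda>n. ennreal (shell \<Omega> i x) * wmol (1 / real (Suc n)) w x) \<le> ennreal (shell \<Omega> i x) * w x" by simp
    qed
  qed
  finally show ?thesis .
qed

lemma smooth_approximation_C:
  assumes "e > 0"
  shows "\<exists>F. Cinf_on \<Omega> F \<and> locally_integrable \<Omega> F \<and> (\<integral>\<^sup>+x. ennreal \<bar>F x - f x\<bar> * w x \<partial>lborel) \<le> ennreal e
    \<and> Var F \<Omega> w \<le> ennreal C * Var f \<Omega> w + ennreal e"
proof -
  obtain r where r: "good r e" using good_sequence[OF assms, of "\<lambda>_ _. True"] by auto
  show ?thesis
    by (intro exI[of _ "smoothing r"] conjI smoothing_Cinf[OF r] smoothing_locally_integrable[OF r] smoothing_L1[OF r] Var_smoothing_le_C[OF r])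
qed

lemma smooth_approximation_approximable:
  assumes "e > 0"
    and ap: "AE x in TV_measure \<Omega> f. ((\<lambda>\<epsilon>. ball_average x \<epsilon> (\<lambda>y. ennreal_absdiff (w y) (w x))) \<longlongrightarrow> 0) (at_right 0)"
  shows "\<exists>F. Cinf_on \<Omega> F \<and> locally_integrable \<Omega> F \<and> (\<integral>\<^sup>+x. ennreal \<bar>F x - f x\<bar> * w x \<partial>lborel) \<le> ennreal e
    \<and> Var F \<Omega> w \<le> Var f \<Omega> w + ennreal e + ennreal e"
proof -
  let ?Q = "\<lambda>i \<rho>. (\<integral>\<^sup>+x. ennreal (shell \<Omega> i x) * wmol \<rho> w x \<partial>TV_measure \<Omega> f)
      \<le> (\<integral>\<^sup>+x. ennreal (shell \<Omega> i x) * w x \<partial>TV_measure \<Omega> f) + ennreal (e * (1/2) ^ Suc i)"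
  have "\<forall>\<^sub>F n in sequentially. ?Q i (1 / real (Suc n))" for i
  proof -
    let ?I = "\<integral>\<^sup>+x. ennreal (shell \<Omega> i x) * w x \<partial>TV_measure \<Omega> f"
    have "?I \<le> (\<integral>\<^sup>+x. 1 * w x \<partial>TV_measure \<Omega> f)"
      by (intro nn_integral_mono mult_right_mono) (simp_all add: ennreal_le_1 shell_bounds)
    then have "?I < \<infinity>" using integral_weight_le f_Var by (auto intro: le_less_trans order_trans)
    then have "?I < ?I + ennreal (e * (1/2) ^ Suc i)"
      using assms(1) by (cases ?I) (auto simp: ennreal_less_iff simp flip: ennreal_plus)
    with limsup_wmol_integral[OF ap, of i]
    have "limsup (\<lambda>n. \<integral>\<^sup>+x. ennreal (shell \<Omega> i x) * wmol (1 / real (Suc n)) w x \<partial>TV_measure \<Omega> f) < ?I + ennreal (e * (1/2) ^ Suc i)"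
      by (rule le_less_trans)
    from Limsup_lessD[OF this] show ?thesis by (rule eventually_mono) (rule less_imp_le)
  qed
  then obtain r where r: "good r e" "\<And>i. ?Q i (r i)" using good_sequence[OF assms(1), of ?Q] by blast
  show ?thesis
    by (intro exI[of _ "smoothing r"] conjI smoothing_Cinf[OF r(1)] smoothing_locally_integrable[OF r(1)] smoothing_L1[OF r(1)]
        Var_smoothing_le_approximable[OF r])
qed

text \<open>Each pairing with a fixed field is continuous under convergence in weighted \<open>L\<^sup>1\<close>, because the weight is bounded
below on the support of the field; the variation is a supremum of such pairings.\<close>

lemma Var_lower_semicontinuous:
  assumes F: "\<And>k. locally_integrable \<Omega> (F k)" and lim: "(\<lambda>k. \<integral>\<^sup>+x. ennreal \<bar>F k x - f x\<bar> * w x \<partial>lborel) \<longlonglongrightarrow> 0"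
  shows "Var f \<Omega> w \<le> liminf (\<lambda>k. Var (F k) \<Omega> w)"
proof (rule Var_least)
  fix \<phi> :: "'a \<Rightarrow> 'a" and K assume p: "lipc K \<phi>" "K \<subseteq> \<Omega>" "\<And>x. x \<in> \<Omega> \<Longrightarrow> ennreal (norm (\<phi> x)) \<le> w x"
  have cK: "compact K" using p(1) by (simp add: lipc_def)
  have [measurable]: "F k \<in> borel_measurable borel" for k using locally_integrable_borel[OF F] .
  obtain B where B: "B > 0" "AE x in lborel. \<bar>borel_div \<phi> x\<bar> \<le> B" using borel_div_bounded[OF p(1)] by metis
  obtain c where c: "c > 0" "\<forall>x\<in>K. ennreal c \<le> w x" using weight_low[OF cK] by blast
  have bound: "ennreal \<bar>pairing (F k) \<phi> - pairing f \<phi>\<bar> \<le> ennreal (B / c) * (\<integral>\<^sup>+x. ennreal \<bar>F k x - f x\<bar> * w x \<partial>lborel)" for k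
  proof -
    note i = integrable_pairing[OF F p(1,2), of k] integrable_pairing[OF f_locally_integrable p(1,2)]
    have id: "integrable lborel (\<lambda>x. (F k x - f x) * borel_div \<phi> x)"
      using Bochner_Integration.integrable_diff[OF i] by (simp add: left_diff_distrib)
    have "pairing (F k) \<phi> - pairing f \<phi> = (\<integral>x. (F k x - f x) * borel_div \<phi> x \<partial>lborel)"
      unfolding pairing_def using Bochner_Integration.integral_diff[OF i] by (simp add: left_diff_distrib)
    then have "ennreal \<bar>pairing (F k) \<phi> - pairing f \<phi>\<bar> \<le> (\<integral>\<^sup>+x. ennreal (norm ((F k x - f x) * borel_div \<phi> x)) \<partial>lborel)"
      using integral_norm_bound_ennreal[OF id] by simp
    also have "\<dots> \<le> (\<integral>\<^sup>+x. ennreal (B / c) * (ennreal \<bar>F k x - f x\<bar> * w x) \<partial>lborel)"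
    proof (rule nn_integral_mono_AE)
      show "AE x in lborel. ennreal (norm ((F k x - f x) * borel_div \<phi> x)) \<le> ennreal (B / c) * (ennreal \<bar>F k x - f x\<bar> * w x)"
        using B(2)
      proof eventually_elim
        fix x assume b: "\<bar>borel_div \<phi> x\<bar> \<le> B"
        show "ennreal (norm ((F k x - f x) * borel_div \<phi> x)) \<le> ennreal (B / c) * (ennreal \<bar>F k x - f x\<bar> * w x)"
        proof (cases "x \<in> K")
          case True
          have "\<bar>F k x - f x\<bar> * \<bar>borel_div \<phi> x\<bar> \<le> \<bar>F k x - f x\<bar> * B" using b by (intro mult_left_mono) auto
          also have "\<dots> = B / c * (\<bar>F k x - f x\<bar> * c)" using c(1) by simp
          finally have "ennreal (norm ((F k x - f x) * borel_div \<phi> x)) \<le> ennreal (B / c * (\<bar>F k x - f x\<bar> * c))"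
            by (intro ennreal_leI) (simp only: real_norm_def abs_mult)
          also have "\<dots> = ennreal (B / c) * (ennreal \<bar>F k x - f x\<bar> * ennreal c)"
            using B(1) c(1) by (simp only: ennreal_mult less_imp_le divide_nonneg_nonneg mult_nonneg_nonneg abs_ge_zero)
          also have "\<dots> \<le> ennreal (B / c) * (ennreal \<bar>F k x - f x\<bar> * w x)" using c(2) True by (intro mult_left_mono) auto
          finally show ?thesis .
        next
          case False
          then show ?thesis using borel_div_zero_outside[OF p(1)] by simp
        qed
      qed
    qed
    also have "\<dots> = ennreal (B / c) * (\<integral>\<^sup>+x. ennreal \<bar>F k x - f x\<bar> * w x \<partial>lborel)" by (rule nn_integral_cmult) measurable
    finally show ?thesis .
  qed
  have "(\<lambda>k. ennreal (B / c) * (\<integral>\<^sup>+x. ennreal \<bar>F k x - f x\<bar> * w x \<partial>lborel)) \<longlonglongrightarrow> ennreal (B / c) * 0"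
    by (intro ennreal_tendsto_cmult lim) simp
  then have z: "(\<lambda>k. ennreal (B / c) * (\<integral>\<^sup>+x. ennreal \<bar>F k x - f x\<bar> * w x \<partial>lborel)) \<longlonglongrightarrow> 0" by simp
  have "(\<lambda>k. pairing (F k) \<phi>) \<longlonglongrightarrow> pairing f \<phi>"
  proof (rule tendstoI)
    fix e :: real assume e: "e > 0"
    have "\<forall>\<^sub>F k in sequentially. ennreal (B / c) * (\<integral>\<^sup>+x. ennreal \<bar>F k x - f x\<bar> * w x \<partial>lborel) < ennreal e"
      using order_tendstoD(2)[OF z, of "ennreal e"] e by simp
    then show "\<forall>\<^sub>F k in sequentially. dist (pairing (F k) \<phi>) (pairing f \<phi>) < e"
    proof eventually_elim
      fix k assume "ennreal (B / c) * (\<integral>\<^sup>+x. ennreal \<bar>F k x - f x\<bar> * w x \<partial>lborel) < ennreal e"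
      with bound[of k] have "ennreal \<bar>pairing (F k) \<phi> - pairing f \<phi>\<bar> < ennreal e" by (rule le_less_trans)
      then show "dist (pairing (F k) \<phi>) (pairing f \<phi>) < e" using e by (simp add: dist_real_def ennreal_less_iff)
    qed
  qed
  then have "(\<lambda>k. ennreal (pairing (F k) \<phi>)) \<longlonglongrightarrow> ennreal (pairing f \<phi>)" by (rule tendsto_ennrealI)
  then have "ennreal (pairing f \<phi>) = liminf (\<lambda>k. ennreal (pairing (F k) \<phi>))" by (intro lim_imp_Liminf[symmetric]) simp_all
  also have "\<dots> \<le> liminf (\<lambda>k. Var (F k) \<Omega> w)"
    by (intro Liminf_mono always_eventually allI Var_upper[OF p])
  finally show "ennreal (pairing f \<phi>) \<le> liminf (\<lambda>k. Var (F k) \<Omega> w)" .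
qed

end

section \<open>Approximation by smooth functions\<close>

lemma Ck_on_empty: "Ck_on k {} F"
  by (induction k arbitrary: F) auto

lemma L1_norm_eq:
  fixes u v :: "'a::euclidean_space \<Rightarrow> real"
  assumes "AE x in lebesgue. x \<in> \<Omega> \<longrightarrow> u x = v x" "\<And>x. x \<notin> \<Omega> \<Longrightarrow> v x = 0"
  shows "L1_norm \<Omega> w u = (\<integral>\<^sup>+x. ennreal \<bar>v x\<bar> * w x \<partial>lborel)"
proof -
  have "L1_norm \<Omega> w u = (\<integral>\<^sup>+x. ennreal \<bar>v x\<bar> * w x \<partial>lebesgue)"
    unfolding L1_norm_def
  proof (rule nn_integral_cong_AE)
    show "AE x in lebesgue. ennreal \<bar>u x\<bar> * w x * indicator \<Omega> x = ennreal \<bar>v x\<bar> * w x"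
      using assms(1) by eventually_elim (use assms(2) in \<open>auto simp: indicator_def\<close>)
  qed
  then show ?thesis by (simp add: nn_integral_completion)
qed

lemma inverse_Suc_ennreal_tendsto: "(\<lambda>k. ennreal (1 / real (Suc k))) \<longlonglongrightarrow> 0"
proof -
  have "(\<lambda>k. 1 / real (Suc k)) \<longlonglongrightarrow> 0" using LIMSEQ_inverse_real_of_nat by (simp add: inverse_eq_divide)
  from tendsto_ennrealI[OF this] show ?thesis by simp
qed

theorem theorem1p2:
  fixes \<Omega> :: "'a::euclidean_space set"
    and w :: "'a \<Rightarrow> ennreal"
    and f :: "'a \<Rightarrow> real"
  assumes "open \<Omega>"
    and "A1_star \<Omega> w"
    and "f \<in> BV_weighted \<Omega> w"
  shows "(approximable \<Omega> w f \<longrightarrow>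
            (\<exists>F :: nat \<Rightarrow> 'a \<Rightarrow> real.
               (\<forall>k. Cinf_on \<Omega> (F k) \<and> F k \<in> BV_weighted \<Omega> w) \<and>
               (\<lambda>k. L1_norm \<Omega> w (\<lambda>x. F k x - f x)) \<longlonglongrightarrow> 0 \<and>
               (\<lambda>k. weighted_variation \<Omega> w (F k)) \<longlonglongrightarrow> weighted_variation \<Omega> w f)) \<and>
         (\<not> approximable \<Omega> w f \<longrightarrow>
            (\<exists>(F :: nat \<Rightarrow> 'a \<Rightarrow> real) L.
               (\<forall>k. Cinf_on \<Omega> (F k) \<and> F k \<in> BV_weighted \<Omega> w) \<and>
               (\<lambda>k. L1_norm \<Omega> w (\<lambda>x. F k x - f x)) \<longlonglongrightarrow> 0 \<and>
               (\<lambda>k. weighted_variation \<Omega> w (F k)) \<longlonglongrightarrow> L \<and>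
               weighted_variation \<Omega> w f \<le> L \<and>
               L \<le> ennreal (A1_const w) * weighted_variation \<Omega> w f))"
proof (cases "\<Omega> = {}")
  case True
  \<comment> \<open>On the empty set all quantities vanish; the facts about the weight used below require a point of \<open>\<Omega>\<close>.\<close>
  have v: "weighted_variation \<Omega> w g = 0" for g
  proof -
    have "weighted_variation \<Omega> w g \<le> 0"
      unfolding weighted_variation_def True by (rule SUP_least) (simp add: set_lebesgue_integral_def)
    then show ?thesis by simp
  qed
  have c: "Cinf_on \<Omega> f" by (simp add: Cinf_on_def True Ck_on_empty)
  have n: "L1_norm \<Omega> w g = 0" for g by (simp add: L1_norm_def True)
  show ?thesis using assms(3) by (intro conjI impI exI[of _ "\<lambda>_. f"] exI[of _ 0]) (simp_all add: v c n)
next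
  case False
  note A = A1_star_facts[OF assms(2,1) False]
  define C where "C = A1_const w"
  have [measurable]: "w \<in> borel_measurable borel" by (rule A(1))
  have fm: "f \<in> borel_measurable (lebesgue_on \<Omega>)" and fL: "L1_norm \<Omega> w f < \<infinity>" and fV: "weighted_variation \<Omega> w f < \<infinity>"
    using assms(3) by (auto simp: BV_weighted_def L1_weighted_def)
  have Os: "\<Omega> \<in> sets lebesgue" "\<Omega> \<in> sets borel" using assms(1) by auto
  have "(\<lambda>x. if x \<in> \<Omega> then f x else 0) \<in> borel_measurable lebesgue"
    using borel_measurable_if[OF Os(1), of f] fm by simp
  then obtain h where h: "h \<in> borel_measurable lborel" "AE x in lborel. (if x \<in> \<Omega> then f x else 0) = h x"
    using completion_ex_borel_measurable_real by blast
  \<comment> \<open>A Borel representative of \<open>f\<close> that vanishes outside \<open>\<Omega>\<close>.\<close>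
  define g where "g x = (if x \<in> \<Omega> then h x else 0)" for x
  have gm[measurable]: "g \<in> borel_measurable borel"
    unfolding g_def[abs_def] using h(1) Os(2) by measurable
  have g0: "g x = 0" if "x \<notin> \<Omega>" for x using that by (simp add: g_def)
  have fg: "AE x in lebesgue. x \<in> \<Omega> \<longrightarrow> f x = g x"
    using AE_completion[OF h(2)] by eventually_elim (simp add: g_def split: if_splits)
  have Vf: "weighted_variation \<Omega> w f = Var g \<Omega> w" by (rule weighted_variation_eq_Var[OF assms(1) gm fg])
  have Lf: "L1_norm \<Omega> w f = (\<integral>\<^sup>+x. ennreal \<bar>g x\<bar> * w x \<partial>lborel)" by (rule L1_norm_eq[OF fg g0])
  interpret weighted_BV \<Omega> w g C
  proof
    show "open \<Omega>" by fact
    show "C > 0" unfolding C_def by (rule A(2))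
    show "wmol r w x \<le> ennreal C * w x" if "r > 0" for r x
      unfolding C_def by (rule wmol_le[OF A(1) that A(3)])
    show "open {x. t < w x}" for t using assms(2) by (simp add: A1_star_def lower_semicontinuous_def)
  qed (use A g0 fL fV in \<open>simp_all add: Vf Lf\<close>)
  have transfer: "F \<in> BV_weighted \<Omega> w \<and> weighted_variation \<Omega> w F = Var F \<Omega> w
      \<and> L1_norm \<Omega> w (\<lambda>x. F x - f x) = (\<integral>\<^sup>+x. ennreal \<bar>F x - g x\<bar> * w x \<partial>lborel)"
    if F: "locally_integrable \<Omega> F" "(\<integral>\<^sup>+x. ennreal \<bar>F x - g x\<bar> * w x \<partial>lborel) \<le> ennreal e" "Var F \<Omega> w < \<infinity>" for F e
  proof -
    have Fm[measurable]: "F \<in> borel_measurable borel" by (rule locally_integrable_borel[OF F(1)])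
    have F0: "F x = 0" if "x \<notin> \<Omega>" for x using F(1) that by (simp add: locally_integrable_def)
    have v: "weighted_variation \<Omega> w F = Var F \<Omega> w" by (rule weighted_variation_eq_Var[OF assms(1) Fm]) simp
    have d: "L1_norm \<Omega> w (\<lambda>x. F x - f x) = (\<integral>\<^sup>+x. ennreal \<bar>F x - g x\<bar> * w x \<partial>lborel)"
    proof (rule L1_norm_eq)
      show "AE x in lebesgue. x \<in> \<Omega> \<longrightarrow> F x - f x = F x - g x" using fg by eventually_elim simp
    qed (simp add: F0 g0)
    have "L1_norm \<Omega> w F = (\<integral>\<^sup>+x. ennreal \<bar>F x\<bar> * w x \<partial>lborel)" by (rule L1_norm_eq) (simp_all add: F0)
    also have "\<dots> \<le> (\<integral>\<^sup>+x. ennreal \<bar>F x - g x\<bar> * w x + ennreal \<bar>g x\<bar> * w x \<partial>lborel)"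
    proof (rule nn_integral_mono)
      fix x
      have "ennreal \<bar>F x\<bar> \<le> ennreal (\<bar>F x - g x\<bar> + \<bar>g x\<bar>)" by (intro ennreal_leI) simp
      also have "\<dots> = ennreal \<bar>F x - g x\<bar> + ennreal \<bar>g x\<bar>" by simp
      finally show "ennreal \<bar>F x\<bar> * w x \<le> ennreal \<bar>F x - g x\<bar> * w x + ennreal \<bar>g x\<bar> * w x"
        unfolding distrib_right[symmetric] by (rule mult_right_mono) simp
    qed
    also have "\<dots> = (\<integral>\<^sup>+x. ennreal \<bar>F x - g x\<bar> * w x \<partial>lborel) + (\<integral>\<^sup>+x. ennreal \<bar>g x\<bar> * w x \<partial>lborel)"
      by (rule nn_integral_add) measurable
    also have "\<dots> < \<infinity>" using F(2) f_L1 by (auto simp: less_top[symmetric] top_unique)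
    finally have "L1_norm \<Omega> w F < \<infinity>" .
    moreover have "F \<in> borel_measurable (lebesgue_on \<Omega>)"
      by (rule measurable_restrict_space1) (rule measurable_completion, simp)
    ultimately show ?thesis using v d F(3) by (simp add: BV_weighted_def L1_weighted_def)
  qed
  have Cfin: "ennreal C * Var g \<Omega> w + ennreal e < \<infinity>" "Var g \<Omega> w + ennreal e + ennreal e < \<infinity>" for e
    using f_Var by (simp_all add: ennreal_mult_less_top)
  show ?thesis
  proof (intro conjI impI)
    assume "approximable \<Omega> w f"
    then have ap: "AE x in TV_measure \<Omega> g. ((\<lambda>\<epsilon>. ball_average x \<epsilon> (\<lambda>y. ennreal_absdiff (w y) (w x))) \<longlongrightarrow> 0) (at_right 0)"
      unfolding approximable_def variation_measure_eq_TV_measure[OF assms(1) f_locally_integrable fg] .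
    have "\<exists>F. Cinf_on \<Omega> F \<and> locally_integrable \<Omega> F \<and> (\<integral>\<^sup>+x. ennreal \<bar>F x - g x\<bar> * w x \<partial>lborel) \<le> ennreal (1 / real (Suc k))
      \<and> Var F \<Omega> w \<le> Var g \<Omega> w + ennreal (1 / real (Suc k)) + ennreal (1 / real (Suc k))" for k
      by (rule smooth_approximation_approximable[OF _ ap]) simp
    from choice[OF allI[OF this]] obtain F where FF: "\<forall>k. Cinf_on \<Omega> (F k) \<and> locally_integrable \<Omega> (F k)
      \<and> (\<integral>\<^sup>+x. ennreal \<bar>F k x - g x\<bar> * w x \<partial>lborel) \<le> ennreal (1 / real (Suc k))
      \<and> Var (F k) \<Omega> w \<le> Var g \<Omega> w + ennreal (1 / real (Suc k)) + ennreal (1 / real (Suc k))" ..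
    have F: "Cinf_on \<Omega> (F k)" "locally_integrable \<Omega> (F k)"
      "(\<integral>\<^sup>+x. ennreal \<bar>F k x - g x\<bar> * w x \<partial>lborel) \<le> ennreal (1 / real (Suc k))"
      "Var (F k) \<Omega> w \<le> Var g \<Omega> w + ennreal (1 / real (Suc k)) + ennreal (1 / real (Suc k))" for k
      using FF by simp_all
    note T = transfer[OF F(2,3) le_less_trans[OF F(4) Cfin(2)]]
    have lim0: "(\<lambda>k. \<integral>\<^sup>+x. ennreal \<bar>F k x - g x\<bar> * w x \<partial>lborel) \<longlonglongrightarrow> 0"
      by (rule tendsto_sandwich[OF _ _ tendsto_const inverse_Suc_ennreal_tendsto]) (use F(3) in auto)
    have low: "Var g \<Omega> w \<le> liminf (\<lambda>k. Var (F k) \<Omega> w)" by (rule Var_lower_semicontinuous[OF F(2) lim0])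
    have "(\<lambda>k. Var g \<Omega> w + ennreal (1 / real (Suc k)) + ennreal (1 / real (Suc k))) \<longlonglongrightarrow> Var g \<Omega> w + 0 + 0"
      by (intro tendsto_add tendsto_const inverse_Suc_ennreal_tendsto)
    then have "limsup (\<lambda>k. Var g \<Omega> w + ennreal (1 / real (Suc k)) + ennreal (1 / real (Suc k))) = Var g \<Omega> w"
      by (intro lim_imp_Limsup) simp_all
    moreover have "limsup (\<lambda>k. Var (F k) \<Omega> w) \<le> limsup (\<lambda>k. Var g \<Omega> w + ennreal (1 / real (Suc k)) + ennreal (1 / real (Suc k)))"
      by (intro Limsup_mono always_eventually allI F(4))
    ultimately have up: "limsup (\<lambda>k. Var (F k) \<Omega> w) \<le> Var g \<Omega> w" by simp
    have "liminf (\<lambda>k. Var (F k) \<Omega> w) \<le> limsup (\<lambda>k. Var (F k) \<Omega> w)" by (rule Liminf_le_Limsup) simp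
    then have "(\<lambda>k. Var (F k) \<Omega> w) \<longlonglongrightarrow> Var g \<Omega> w"
      using low up by (subst tendsto_iff_Liminf_eq_Limsup) auto
    then show "\<exists>F :: nat \<Rightarrow> 'a \<Rightarrow> real.
               (\<forall>k. Cinf_on \<Omega> (F k) \<and> F k \<in> BV_weighted \<Omega> w) \<and>
               (\<lambda>k. L1_norm \<Omega> w (\<lambda>x. F k x - f x)) \<longlonglongrightarrow> 0 \<and>
               (\<lambda>k. weighted_variation \<Omega> w (F k)) \<longlonglongrightarrow> weighted_variation \<Omega> w f"
      using T F(1) lim0 by (intro exI[of _ F]) (simp add: Vf)
  next
    have "\<exists>F. Cinf_on \<Omega> F \<and> locally_integrable \<Omega> F \<and> (\<integral>\<^sup>+x. ennreal \<bar>F x - g x\<bar> * w x \<partial>lborel) \<le> ennreal (1 / real (Suc k))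
      \<and> Var F \<Omega> w \<le> ennreal C * Var g \<Omega> w + ennreal (1 / real (Suc k))" for k
      by (rule smooth_approximation_C) simp
    from choice[OF allI[OF this]] obtain F where FF: "\<forall>k. Cinf_on \<Omega> (F k) \<and> locally_integrable \<Omega> (F k)
      \<and> (\<integral>\<^sup>+x. ennreal \<bar>F k x - g x\<bar> * w x \<partial>lborel) \<le> ennreal (1 / real (Suc k))
      \<and> Var (F k) \<Omega> w \<le> ennreal C * Var g \<Omega> w + ennreal (1 / real (Suc k))" ..
    have F: "Cinf_on \<Omega> (F k)" "locally_integrable \<Omega> (F k)"
      "(\<integral>\<^sup>+x. ennreal \<bar>F k x - g x\<bar> * w x \<partial>lborel) \<le> ennreal (1 / real (Suc k))"
      "Var (F k) \<Omega> w \<le> ennreal C * Var g \<Omega> w + ennreal (1 / real (Suc k))" for k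
      using FF by simp_all
    note T = transfer[OF F(2,3) le_less_trans[OF F(4) Cfin(1)]]
    have lim0: "(\<lambda>k. \<integral>\<^sup>+x. ennreal \<bar>F k x - g x\<bar> * w x \<partial>lborel) \<longlonglongrightarrow> 0"
      by (rule tendsto_sandwich[OF _ _ tendsto_const inverse_Suc_ennreal_tendsto]) (use F(3) in auto)
    have low: "Var g \<Omega> w \<le> liminf (\<lambda>k. Var (F k) \<Omega> w)" by (rule Var_lower_semicontinuous[OF F(2) lim0])
    define u where "u k = Var (F k) \<Omega> w" for k
    \<comment> \<open>The variations are only known to be asymptotically between the two bounds, so convergence requires a subsequence.\<close>
    obtain s where s: "strict_mono s" "(u \<circ> s) \<longlonglongrightarrow> limsup u" using limsup_subseq_lim[of u] by blast
    have lu: "Var g \<Omega> w \<le> limsup u"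
    proof -
      have "liminf u \<le> limsup u" by (rule Liminf_le_Limsup) simp
      with low show ?thesis unfolding u_def[abs_def] by (rule order_trans)
    qed
    have "(\<lambda>k. ennreal C * Var g \<Omega> w + ennreal (1 / real (Suc k))) \<longlonglongrightarrow> ennreal C * Var g \<Omega> w + 0"
      by (intro tendsto_add tendsto_const inverse_Suc_ennreal_tendsto)
    then have "limsup (\<lambda>k. ennreal C * Var g \<Omega> w + ennreal (1 / real (Suc k))) = ennreal C * Var g \<Omega> w"
      by (intro lim_imp_Limsup) simp_all
    moreover have "limsup u \<le> limsup (\<lambda>k. ennreal C * Var g \<Omega> w + ennreal (1 / real (Suc k)))"
      unfolding u_def by (intro Limsup_mono always_eventually allI F(4))
    ultimately have up: "limsup u \<le> ennreal C * Var g \<Omega> w" by simp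
    have lims: "(\<lambda>k. \<integral>\<^sup>+x. ennreal \<bar>F (s k) x - g x\<bar> * w x \<partial>lborel) \<longlonglongrightarrow> 0"
      using LIMSEQ_subseq_LIMSEQ[OF lim0 s(1)] by (simp add: o_def)
    show "\<exists>(F :: nat \<Rightarrow> 'a \<Rightarrow> real) L.
               (\<forall>k. Cinf_on \<Omega> (F k) \<and> F k \<in> BV_weighted \<Omega> w) \<and>
               (\<lambda>k. L1_norm \<Omega> w (\<lambda>x. F k x - f x)) \<longlonglongrightarrow> 0 \<and>
               (\<lambda>k. weighted_variation \<Omega> w (F k)) \<longlonglongrightarrow> L \<and>
               weighted_variation \<Omega> w f \<le> L \<and>
               L \<le> ennreal (A1_const w) * weighted_variation \<Omega> w f"
      using T F(1) lims s(2) lu up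
      by (intro exI[of _ "\<lambda>k. F (s k)"] exI[of _ "limsup u"]) (simp add: Vf u_def[abs_def] o_def C_def)
  qed
qed

end
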